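(* Consider the family of elliptic curves $\mathcal L(x)$: $v^2=u(u-1)(u-x)$ parametrized by $x\in\mathbb C\setminus\{0,1\}$, and let $c_1,c_2\in\mathbb C$ be constants (independent of $x$) such that $(c_1,c_2)\notin(\frac12\mathbb Z)^2$. Define a point $Q_0=Q_0(x)\in\mathcal L(x)$ by $$\int_{P_\infty}^{Q_0}\omega=c_1+c_2\mu ,$$ where $\mu=\mu(x)$ is the period of $\mathcal L(x)$, and let $$\Omega=\Omega_{Q_0,Q_0^*}-4\pi \mathrm{i}\, c_2\,\omega .$$ Then the zeros $P_y$ and $P_y^*$ of $\Omega$ project to the same point of the $u$-sphere, and the function $y(x)=u(P_y)=u(P_y^* )$ satisfies the Painlevé VI equation $$\frac{d^2 y}{dx^2} = \frac{1}{2} \left( \frac{1}{y} + \frac{1}{y-1}+ \frac{1}{y-x} \right) \left( \frac{dy}{dx} \right)^2 - \left( \frac{1}{x} + \frac{1}{x-1} + \frac{1}{y-x} \right) \frac{dy}{dx} + \frac{y(y-1)(y-x)}{x^2(x-1)^2}\left( \alpha +\beta\frac{x}{y^2} + \gamma\frac{x-1}{(y-1)^2} + \delta\frac{x(x-1)}{(y-x)^2} \right)$$ with parameters $\alpha=\frac18$, $\beta=-\frac18$, $\gamma=\frac18$, $\delta=\frac38$.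
   Context: $\mathcal L(x)$ denotes the compact Riemann surface of genus one of the curve $v^2=u(u-1)(u-x)$, viewed as a double covering of the $u$-sphere; $P_\infty$ is the ramification point over $u=\infty$, and $*$ is the involution $(u,v)^*=(u,-v)$. A canonical homology basis $a,b$ (intersection index $a\circ b=1$) is chosen and continued locally constantly as $x$ varies; the statement is local in $x$. $\omega$ is the holomorphic differential with $\oint_a\omega=1$, and $\mu=\oint_b\omega$. $\Omega_{Q_0,Q_0^*}$ is the differential of the third kind with simple poles only at $Q_0$ and $Q_0^*$, with residues $+1$ and $-1$ respectively, normalized to have vanishing $a$-period. Equivalently $\Omega_{Q_0,Q_0^*}(P)=\int_{Q_0^*}^{Q_0}W(P,R)$ (integration in $R$), where $W(P,R)$ is the unique symmetric bidifferential on $\mathcal L(x)$ whose only singularity is a double pole on the diagonal with biresidue $1$ and which satisfies $\oint_a W(P,\cdot)=0$. Path convention: if $\Gamma$ is a path from $P_\infty$ to $Q_0$ with $\int_\Gamma\omega=c_1+c_2\mu$, then the path from $Q_0^*$ to $Q_0$ is the reverse of $\Gamma^*$ followed by $\Gamma$. With this convention $\Omega$ has $a$-period $-4\pi \mathrm{i}c_2$ and $b$-period $4\pi\mathrm{i}c_1$. The point $Q_0$ moves with $x$ so that $c_1,c_2$ stay constant. *)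

theory Defs
  imports "HOL-Complex_Analysis.Complex_Analysis"
begin

section \<open>The compact curve\<close>

text \<open>
  The selectors \<open>u_of\<close> and \<open>v_of\<close> are unspecified at the point over \<open>u = \<infinity>\<close>.
\<close>

datatype pt = Infty | Aff (u_of: complex) (v_of: complex)

definition cubic :: "complex \<Rightarrow> complex \<Rightarrow> complex" where
  "cubic x u = u * (u - 1) * (u - x)"

definition curve :: "complex \<Rightarrow> pt set" where
  "curve x = insert Infty {Aff u v | u v. v\<^sup>2 = cubic x u}"

text \<open>The complement of the four ramification points of the projection to the \<open>u\<close>-sphere.\<close>

definition unram :: "complex \<Rightarrow> pt set" where
  "unram x = {P \<in> curve x. P \<noteq> Infty \<and> v_of P \<noteq> 0}"

fun star :: "pt \<Rightarrow> pt" where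
  "star Infty = Infty"
| "star (Aff u v) = Aff u (- v)"

text \<open>The projection to the \<open>u\<close>-sphere; \<open>None\<close> is the point at infinity.\<close>

fun u_proj :: "pt \<Rightarrow> complex option" where
  "u_proj Infty = None"
| "u_proj (Aff u v) = Some u"

text \<open>
  \<open>local_par x P\<close> is a biholomorphic map from a neighbourhood of \<open>0\<close> onto a neighbourhood
  of \<open>P\<close> on the curve. The local parameter \<open>t\<close> is \<open>u - u(P)\<close> at unramified points, a square
  root of \<open>u - u(P)\<close> at finite ramification points, and \<open>u\<close> to the power \<open>-1/2\<close> at infinity.
  All arguments of the square roots tend to \<open>1\<close> as \<open>t\<close> tends to \<open>0\<close>, except for the constant
  \<open>deriv (cubic x) u\<close>.
\<close>

fun local_par :: "complex \<Rightarrow> pt \<Rightarrow> complex \<Rightarrow> pt" where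
  "local_par x Infty t =
     (if t = 0 then Infty
      else Aff (1 / t\<^sup>2) (csqrt ((1 - t\<^sup>2) * (1 - x * t\<^sup>2)) / t ^ 3))"
| "local_par x (Aff u v) t =
     (if v = 0
      then Aff (u + t\<^sup>2)
             (t * csqrt (deriv (cubic x) u) *
              csqrt (cubic x (u + t\<^sup>2) / (t\<^sup>2 * deriv (cubic x) u)))
      else Aff (u + t) (v * csqrt (cubic x (u + t) / cubic x u)))"


section \<open>Differentials\<close>

text \<open>
  A meromorphic differential is represented by its coefficient \<open>h\<close> with respect to \<open>du\<close>,
  a function on the curve whose values at the ramification points and at the poles are
  irrelevant. \<open>pullback x h P\<close> is the coefficient of the differential \<open>h du\<close> with respect to
  \<open>dt\<close>, where \<open>t\<close> is the local parameter at \<open>P\<close>.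
\<close>

definition pullback :: "complex \<Rightarrow> (pt \<Rightarrow> complex) \<Rightarrow> pt \<Rightarrow> complex \<Rightarrow> complex" where
  "pullback x h P t = h (local_par x P t) * deriv (\<lambda>s. u_of (local_par x P s)) t"

text \<open>
  The restriction to unramified points only exempts \<open>t = 0\<close>, and this only when \<open>P\<close> is a
  ramification point.
\<close>

definition diff_holo_at :: "complex \<Rightarrow> (pt \<Rightarrow> complex) \<Rightarrow> pt \<Rightarrow> bool" where
  "diff_holo_at x h P \<longleftrightarrow>
     (\<exists>r>0. \<exists>g. g holomorphic_on ball 0 r \<and>
        (\<forall>t\<in>ball 0 r. local_par x P t \<in> unram x \<longrightarrow> pullback x h P t = g t))"

text \<open>
  The differential has the form \<open>(c / t ^ n + O(1 / t ^ (n - 1))) dt\<close> at \<open>P\<close>. For \<open>n = 1\<close> and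
  \<open>c \<noteq> 0\<close> this is a simple pole with residue \<open>c\<close>.
\<close>

definition diff_pole_at :: "complex \<Rightarrow> (pt \<Rightarrow> complex) \<Rightarrow> pt \<Rightarrow> nat \<Rightarrow> complex \<Rightarrow> bool" where
  "diff_pole_at x h P n c \<longleftrightarrow>
     (\<exists>r>0. \<exists>g. g holomorphic_on ball 0 r \<and> g 0 = c \<and>
        (\<forall>t\<in>ball 0 r - {0}. t ^ n * pullback x h P t = g t))"

definition diff_zero_at :: "complex \<Rightarrow> (pt \<Rightarrow> complex) \<Rightarrow> pt \<Rightarrow> bool" where
  "diff_zero_at x h P \<longleftrightarrow> (pullback x h P \<longlongrightarrow> 0) (at 0)"

definition diff_zeros :: "complex \<Rightarrow> (pt \<Rightarrow> complex) \<Rightarrow> pt set" where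
  "diff_zeros x h = {P \<in> curve x. diff_zero_at x h P}"


section \<open>Paths, cycles and integrals\<close>

text \<open>
  Paths and cycles avoid the ramification points (apart from the initial point of a path that
  starts at infinity). Every homotopy class of paths and every homology class of cycles on the
  curve has such representatives.
\<close>

definition line_int :: "(pt \<Rightarrow> complex) \<Rightarrow> (real \<Rightarrow> pt) \<Rightarrow> real \<Rightarrow> real \<Rightarrow> complex" where
  "line_int h \<gamma> r s =
     integral {r..s} (\<lambda>t. h (\<gamma> t) * vector_derivative (\<lambda>\<tau>. u_of (\<gamma> \<tau>)) (at t))"

definition period :: "(pt \<Rightarrow> complex) \<Rightarrow> (real \<Rightarrow> pt) \<Rightarrow> complex" where
  "period h \<gamma> = line_int h \<gamma> 0 1"

definition cycle_on :: "complex \<Rightarrow> (real \<Rightarrow> pt) \<Rightarrow> bool" where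
  "cycle_on x \<gamma> \<longleftrightarrow>
     \<gamma> ` {0..1} \<subseteq> unram x \<and> \<gamma> 0 = \<gamma> 1 \<and>
     valid_path (\<lambda>t. u_of (\<gamma> t)) \<and> continuous_on {0..1} (\<lambda>t. v_of (\<gamma> t))"

text \<open>
  A locally constant continuation of a cycle: its projection to the \<open>u\<close>-sphere does not
  depend on \<open>x\<close>, and its lift to the curve varies continuously.
\<close>

definition cycle_family :: "complex set \<Rightarrow> (complex \<Rightarrow> real \<Rightarrow> pt) \<Rightarrow> bool" where
  "cycle_family D a \<longleftrightarrow>
     (\<forall>x\<in>D. cycle_on x (a x)) \<and>
     (\<forall>x\<in>D. \<forall>x'\<in>D. \<forall>t\<in>{0..1}. u_of (a x t) = u_of (a x' t)) \<and>
     continuous_on (D \<times> {0..1}) (\<lambda>(x, t). v_of (a x t))"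

definition crossings :: "(real \<Rightarrow> pt) \<Rightarrow> (real \<Rightarrow> pt) \<Rightarrow> (real \<times> real) set" where
  "crossings a b = {(s, t). s \<in> {0..1} \<and> t \<in> {0..1} \<and> a s = b t}"

text \<open>
  \<open>u\<close> is a local coordinate off the ramification points. At a transversal crossing the tangent
  vectors \<open>p\<close> of \<open>a\<close> and \<open>q\<close> of \<open>b\<close> form a positively oriented frame iff \<open>Im (cnj p * q) > 0\<close>.
\<close>

definition cross_det :: "(real \<Rightarrow> pt) \<Rightarrow> (real \<Rightarrow> pt) \<Rightarrow> real \<Rightarrow> real \<Rightarrow> real" where
  "cross_det a b s t =
     Im (cnj (vector_derivative (\<lambda>\<tau>. u_of (a \<tau>)) (at s)) *
         vector_derivative (\<lambda>\<tau>. u_of (b \<tau>)) (at t))"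

definition transversal :: "(real \<Rightarrow> pt) \<Rightarrow> (real \<Rightarrow> pt) \<Rightarrow> bool" where
  "transversal a b \<longleftrightarrow>
     finite (crossings a b) \<and>
     (\<forall>(s, t)\<in>crossings a b.
        s \<in> {0<..<1} \<and> t \<in> {0<..<1} \<and>
        (\<exists>e>0. (\<lambda>\<tau>. u_of (a \<tau>)) C1_differentiable_on {s - e<..<s + e} \<and>
               (\<lambda>\<tau>. u_of (b \<tau>)) C1_differentiable_on {t - e<..<t + e}) \<and>
        cross_det a b s t \<noteq> 0)"

definition intersection_index :: "(real \<Rightarrow> pt) \<Rightarrow> (real \<Rightarrow> pt) \<Rightarrow> real" where
  "intersection_index a b = (\<Sum>(s, t)\<in>crossings a b. sgn (cross_det a b s t))"

definition path_from_infty :: "complex \<Rightarrow> (real \<Rightarrow> pt) \<Rightarrow> bool" where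
  "path_from_infty x \<gamma> \<longleftrightarrow>
     \<gamma> 0 = Infty \<and> \<gamma> ` {0<..1} \<subseteq> unram x \<and>
     filterlim (\<lambda>t. u_of (\<gamma> t)) at_infinity (at_right 0) \<and>
     (\<forall>e\<in>{0<..<1}. (\<lambda>t. u_of (\<gamma> t)) piecewise_C1_differentiable_on {e..1}) \<and>
     continuous_on {0<..1} (\<lambda>t. v_of (\<gamma> t))"

text \<open>The integral from infinity is improper because the coordinate \<open>u\<close> is infinite there.\<close>

definition has_int_from_infty :: "(pt \<Rightarrow> complex) \<Rightarrow> (real \<Rightarrow> pt) \<Rightarrow> complex \<Rightarrow> bool" where
  "has_int_from_infty h \<gamma> I \<longleftrightarrow> ((\<lambda>e. line_int h \<gamma> e 1) \<longlongrightarrow> I) (at_right 0)"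


section \<open>Normalised differentials\<close>

definition normalized_holomorphic :: "complex \<Rightarrow> (real \<Rightarrow> pt) \<Rightarrow> (pt \<Rightarrow> complex) \<Rightarrow> bool" where
  "normalized_holomorphic x a \<omega> \<longleftrightarrow>
     (\<forall>P\<in>curve x. diff_holo_at x \<omega> P) \<and> period \<omega> a = 1"

text \<open>
  \<open>W P R\<close> is the coefficient of the bidifferential with respect to \<open>du(P) du(R)\<close>. Holomorphy in
  the first argument follows from symmetry. At an unramified \<open>P\<close> the local parameter is the
  difference of the values of the coordinate \<open>u\<close> at \<open>R\<close> and \<open>P\<close>, so the leading coefficient of
  the double pole is the biresidue.
\<close>

definition canonical_bidifferential ::
    "complex \<Rightarrow> (real \<Rightarrow> pt) \<Rightarrow> (pt \<Rightarrow> pt \<Rightarrow> complex) \<Rightarrow> bool" where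
  "canonical_bidifferential x a W \<longleftrightarrow>
     (\<forall>P\<in>unram x. \<forall>R\<in>unram x. P \<noteq> R \<longrightarrow> W P R = W R P) \<and>
     (\<forall>P\<in>unram x.
        (\<forall>R\<in>curve x - {P}. diff_holo_at x (W P) R) \<and>
        diff_pole_at x (W P) P 2 1 \<and>
        (P \<notin> a ` {0..1} \<longrightarrow> period (W P) a = 0))"

text \<open>
  The differential with simple poles only at the end point \<open>Q\<close> of \<open>\<gamma>\<close> (residue \<open>1\<close>) and at
  \<open>star Q\<close> (residue \<open>-1\<close>), given by the integral of \<open>W\<close> along the path from \<open>star Q\<close> to \<open>Q\<close>
  consisting of the reverse of \<open>star \<circ> \<gamma>\<close> followed by \<open>\<gamma>\<close>. Its \<open>a\<close>-period vanishes; this is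
  literally true for cycles that do not meet the path, while moving the cycle across a pole
  changes the period by a multiple of \<open>2 * pi * \<i>\<close>. The integral formula selects the
  differential without reference to the position of the cycle.
\<close>

definition third_kind ::
    "complex \<Rightarrow> (real \<Rightarrow> pt) \<Rightarrow> (pt \<Rightarrow> pt \<Rightarrow> complex) \<Rightarrow> (real \<Rightarrow> pt) \<Rightarrow> (pt \<Rightarrow> complex) \<Rightarrow> bool" where
  "third_kind x a W \<gamma> h \<longleftrightarrow>
     (let Q = \<gamma> 1; C = \<gamma> ` {0..1} \<union> (star \<circ> \<gamma>) ` {0..1} in
        (\<forall>P\<in>curve x - {Q, star Q}. diff_holo_at x h P) \<and>
        diff_pole_at x h Q 1 1 \<and> diff_pole_at x h (star Q) 1 (-1) \<and>
        (a ` {0..1} \<inter> C = {} \<longrightarrow> period h a = 0) \<and>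
        (\<forall>P\<in>unram x - C. \<exists>I J.
            has_int_from_infty (W P) \<gamma> I \<and> has_int_from_infty (W P) (star \<circ> \<gamma>) J \<and>
            h P = I - J))"


section \<open>The Painleve VI equation\<close>

definition painleve_VI_at ::
    "complex \<Rightarrow> complex \<Rightarrow> complex \<Rightarrow> complex \<Rightarrow> (complex \<Rightarrow> complex) \<Rightarrow> complex \<Rightarrow> bool" where
  "painleve_VI_at \<alpha> \<beta> \<gamma> \<delta> y x \<longleftrightarrow>
     deriv (deriv y) x =
       1 / 2 * (1 / y x + 1 / (y x - 1) + 1 / (y x - x)) * (deriv y x)\<^sup>2
       - (1 / x + 1 / (x - 1) + 1 / (y x - x)) * deriv y x
       + y x * (y x - 1) * (y x - x) / (x\<^sup>2 * (x - 1)\<^sup>2) *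
         (\<alpha> + \<beta> * x / (y x)\<^sup>2 + \<gamma> * (x - 1) / (y x - 1)\<^sup>2 + \<delta> * x * (x - 1) / (y x - x)\<^sup>2)"

end

theory Submission
 imports Defs
begin

text \<open>
 Let \<open>(q, w)\<close> be the end point of the path and \<open>T\<close> the integral of \<open>du / (u v)\<close> along it,
 reduced by \<open>c1\<close> times the \<open>a\<close>-period and \<open>c2\<close> times the \<open>b\<close>-period. Expressing the normalised
 differentials by \<open>du / v\<close> and \<open>du / (u v)\<close> and using the Legendre relation, the differential
 becomes \<open>(w / (u - q) + C) du / v\<close> with \<open>C = w / q + x T / 2\<close>, so its zeros lie over
 \<open>y = q - w / C\<close>. Integrals over curves with fixed projection to the \<open>u\<close>-sphere can be
 differentiated in \<open>x\<close>; together with the constancy of \<open>c1\<close> and \<open>c2\<close> this gives first order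
 equations for \<open>y\<close> and \<open>p = C / w = 1 / (q - y)\<close>, the Hamiltonian form of Painleve VI.
 The path is not assumed to depend continuously on \<open>x\<close>. That its end point, and its integral of
 \<open>du / (u v)\<close>, only depend on its integral of \<open>du / v\<close> follows from a uniformization of the
 curve by entire functions, \<open>u = N / D\<close>, with \<open>- N' / N\<close> inverting the second integral.
\<close>

subsection \<open>Local branches of the curve\<close>

text \<open>The differential \<open>du / (u v)\<close> is a convenient partner of
  \<open>du / v\<close> because it vanishes at the base point over infinity and has its only pole, a
  double one, over \<open>u = 0\<close>: both forms can be integrated from infinity, which fails for
  \<open>u du / v\<close>. The term with \<open>c2\<close> fits because the Legendre relation
  rewrites \<open>4 pi i\<close> divided by the \<open>a\<close>-period of \<open>du / v\<close>
  through the other periods; \<open>c1\<close> and \<open>c2\<close> then enter only as constant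
  coefficients of periods, which can be differentiated in \<open>x\<close>. The cycles are merely
  transversal with signed crossing number 1, so there is no cut surface to integrate around; the
  relation is read off from the jumps of a third-kind integral over \<open>b\<close> while its pole
  travels along \<open>a\<close>. Paths in different fibres are unrelated, so no homotopy joins
  them; a numerator and a denominator without common zeros turn continuation of the inverse integral
  into a matter of entire functions. The map \<open>q -> q - 1 / p\<close> at the end is an Okamoto
  transformation, taking Picard's solution \<open>q\<close> to \<open>y\<close>.\<close>

lemma square_roots_agree:
 fixes f g :: "'a::topological_space \<Rightarrow> complex"
 assumes "connected S" "continuous_on S f" "continuous_on S g"
  and "\<And>z. z \<in> S ==> (f z)\<^sup>2 = (g z)\<^sup>2" "\<And>z. z \<in> S ==> g z \<noteq> 0"
  and "a \<in> S" "f a = g a" "z \<in> S"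
 shows "f z = g z"
proof -
 \<comment> \<open>The quotient is continuous with only two possible values, hence constant on a
   connected set. All identifications of branches of the square root, along paths, between fibres
   and in the uniformization, go back to this.\<close>
 have *: "f w / g w \<in> {1, -1}" if "w \<in> S" for w
 proof -
  have "(f w / g w)\<^sup>2 = 1" using assms(4,5)[OF that] by (simp add: power_divide)
  then show ?thesis by (simp add: power2_eq_1_iff)
 qed
 have "(\<lambda>w. f w / g w) constant_on S"
 proof (rule continuous_finite_range_constant[OF assms(1)])
  show "continuous_on S (\<lambda>w. f w / g w)"
   using assms by (intro continuous_intros) auto
  show "finite ((\<lambda>w. f w / g w) ` S)"
   by (rule finite_subset[of _ "{1,-1}"]) (use * in blast, simp)
 qed
 then obtain k where "\<And>w. w \<in> S ==> f w / g w = k" unfolding constant_on_def by auto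
 then have "f z / g z = f a / g a" using assms by metis
 then show ?thesis using assms by (auto simp: divide_simps)
qed

definition dcubic :: "complex \<Rightarrow> complex \<Rightarrow> complex" where
 "dcubic x u = (u - 1) * (u - x) + u * (u - x) + u * (u - 1)"

lemma cubic_has_derivative [derivative_intros]:
 "(f has_field_derivative f') (at z within S) ==>
   ((\<lambda>z. cubic x (f z)) has_field_derivative dcubic x (f z) * f') (at z within S)"
 unfolding cubic_def dcubic_def
 by (rule derivative_eq_intros refl | assumption)+ (simp add: algebra_simps)

lemma deriv_cubic: "deriv (cubic x) u = dcubic x u"
 by (rule DERIV_imp_deriv) (use cubic_has_derivative[OF DERIV_ident, of x u] in simp)

lemma continuous_on_cubic [continuous_intros]:
 "continuous_on S f ==> continuous_on S (\<lambda>z. cubic x (f z))"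
 unfolding cubic_def by (intro continuous_intros)

lemma holomorphic_on_cubic [holomorphic_intros]:
 "f holomorphic_on S ==> (\<lambda>z. cubic x (f z)) holomorphic_on S"
 unfolding cubic_def by (intro holomorphic_intros)

lemma cubic_eq_0_iff: "cubic x u = 0 \<longleftrightarrow> u = 0 \<or> u = 1 \<or> u = x"
 by (auto simp: cubic_def)

lemma dcubic_nonzero: "x \<noteq> 0 ==> x \<noteq> 1 ==> cubic x u = 0 ==> dcubic x u \<noteq> 0"
 by (auto simp: cubic_eq_0_iff dcubic_def)

lemma Aff_in_curve: "Aff u v \<in> curve x \<longleftrightarrow> v\<^sup>2 = cubic x u"
 by (auto simp: curve_def)

lemma Aff_in_unram: "Aff u v \<in> unram x \<longleftrightarrow> v\<^sup>2 = cubic x u \<and> cubic x u \<noteq> 0"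
 by (auto simp: unram_def curve_def)

lemma unramE:
 assumes "P \<in> unram x"
 obtains u v where "P = Aff u v" "v\<^sup>2 = cubic x u" "v \<noteq> 0" "cubic x u \<noteq> 0"
proof (cases P)
 case (Aff u v)
 then have "v\<^sup>2 = cubic x u" "cubic x u \<noteq> 0" using assms by (auto simp: Aff_in_unram)
 moreover from this have "v \<noteq> 0" by auto
 ultimately show ?thesis using that[OF Aff] by auto
qed (use assms in \<open>simp add: unram_def\<close>)

lemma star_in_unram: "star P \<in> unram x \<longleftrightarrow> P \<in> unram x"
 by (cases P) (auto simp: Aff_in_unram unram_def curve_def)

text \<open>The principal root is taken of a quotient that equals 1 at \<open>u0\<close>, so its cut
  is not met near \<open>u0\<close>, and the factor \<open>v0\<close> selects the sheet. The formula
  is that of \<open>local_par\<close> at unramified points.\<close>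

lemma branch:
 assumes "v0\<^sup>2 = cubic x u0" "v0 \<noteq> 0"
 defines "V \<equiv> \<lambda>u. v0 * csqrt (cubic x u / cubic x u0)"
 obtains r where "r > 0" "V holomorphic_on ball u0 r" "V u0 = v0"
  "\<And>u. u \<in> ball u0 r ==> (V u)\<^sup>2 = cubic x u"
  "\<And>u. u \<in> ball u0 r ==> V u \<noteq> 0"
  "\<And>u. u \<in> ball u0 r ==> (V has_field_derivative dcubic x u / (2 * V u)) (at u)"
proof -
 have nz: "cubic x u0 \<noteq> 0" using assms by auto
 have "open {u. 0 < Re (cubic x u / cubic x u0)}"
  by (rule open_Collect_less) (auto intro!: continuous_intros nz)
 moreover have "u0 \<in> {u. 0 < Re (cubic x u / cubic x u0)}" using nz by simp
 ultimately obtain r where r: "r > 0" "ball u0 r \<subseteq> {u. 0 < Re (cubic x u / cubic x u0)}"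
  by (meson open_contains_ball)
 have hol: "V holomorphic_on ball u0 r"
  unfolding V_def using r nz
  by (intro holomorphic_intros) (auto simp: complex_nonpos_Reals_iff subset_iff)
 have sq: "(V u)\<^sup>2 = cubic x u" for u
  using assms nz by (simp add: V_def power_mult_distrib)
 have nz': "V u \<noteq> 0" if "u \<in> ball u0 r" for u
  using that r assms by (auto simp: V_def subset_iff)
 have der: "(V has_field_derivative dcubic x u / (2 * V u)) (at u)" if u: "u \<in> ball u0 r" for u
 proof -
  obtain d where d: "(V has_field_derivative d) (at u)"
   using holomorphic_on_open[OF open_ball] hol u by blast
  have "((\<lambda>u. (V u)\<^sup>2) has_field_derivative 2 * V u * d) (at u)"
   by (rule derivative_eq_intros d | simp)+
  moreover have "((\<lambda>u. (V u)\<^sup>2) has_field_derivative dcubic x u * 1) (at u)"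
   unfolding sq by (rule derivative_intros)+
  ultimately have "2 * V u * d = dcubic x u" using DERIV_unique by force
  then have "d = dcubic x u / (2 * V u)" using nz'[OF u] by (simp add: field_simps)
  then show ?thesis using d by simp
 qed
 show thesis
  by (rule that[OF r(1) hol _ _ nz' der]) (use nz sq in \<open>auto simp: V_def\<close>)
qed

subsection \<open>Pullbacks in the local parameters\<close>

lemma pullback_unram:
 assumes "v \<noteq> 0"
 shows "pullback x h (Aff u v) t = h (Aff (u + t) (v * csqrt (cubic x (u + t) / cubic x u)))"
proof -
 have "((\<lambda>s. u + s) has_field_derivative 1) (at t)" by (auto intro!: derivative_eq_intros)
 then show ?thesis using assms by (simp add: pullback_def DERIV_imp_deriv)
qed

lemma pullback_ram:
 "pullback x h (Aff u 0) t = h (local_par x (Aff u 0) t) * (2 * t)"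
proof -
 have "((\<lambda>s. u + s\<^sup>2) has_field_derivative 2 * t) (at t)" by (auto intro!: derivative_eq_intros)
 then show ?thesis by (simp add: pullback_def DERIV_imp_deriv)
qed

lemma pullback_Infty:
 assumes "t \<noteq> 0"
 shows "pullback x h Infty t =
  h (Aff (1 / t\<^sup>2) (csqrt ((1 - t\<^sup>2) * (1 - x * t\<^sup>2)) / t ^ 3)) * (- 2 / t ^ 3)"
proof -
 have "((\<lambda>s. 1 / s\<^sup>2) has_field_derivative - 2 / t ^ 3) (at t)"
  using assms by (auto intro!: derivative_eq_intros simp: field_simps power2_eq_square power3_eq_cube)
 moreover have "eventually (\<lambda>s. u_of (local_par x Infty s) = 1 / s\<^sup>2) (nhds t)"
  using t1_space_nhds[OF assms] by eventually_elim auto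
 ultimately have "deriv (\<lambda>s. u_of (local_par x Infty s)) t = - 2 / t ^ 3"
  by (subst deriv_cong_ev[OF _ refl]) (auto simp: DERIV_imp_deriv)
 then show ?thesis using assms by (simp add: pullback_def)
qed

text \<open>At a zero \<open>e\<close> the cubic factors as \<open>d * s * m s\<close> with
  \<open>m 0 = 1\<close>, so the last root in \<open>local_par\<close> is that of \<open>m\<close>
  at \<open>t^2\<close>, close to 1. It is even in \<open>t\<close>; hence \<open>t -> - t\<close>
  only changes the sign of \<open>v\<close> and is the involution \<open>star\<close> in the local
  parameter.\<close>

lemma local_par_ram:
 assumes "x \<noteq> 0" "x \<noteq> 1" "cubic x e = 0"
 obtains k \<rho> r where "r > 0" "k \<noteq> 0" "isCont \<rho> 0" "\<rho> 0 = 1" "\<And>t. \<rho> (- t) = \<rho> t"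
  "k\<^sup>2 = dcubic x e"
  "\<And>t. 0 < norm t ==> norm t < r ==> local_par x (Aff e 0) t = Aff (e + t\<^sup>2) (t * k * \<rho> t)"
  "\<And>t. 0 < norm t ==> norm t < r ==> (t * k * \<rho> t)\<^sup>2 = cubic x (e + t\<^sup>2)"
  "\<And>t. 0 < norm t ==> norm t < r ==> cubic x (e + t\<^sup>2) \<noteq> 0"
proof -
 define d where "d = dcubic x e"
 have d0: "d \<noteq> 0" using dcubic_nonzero[OF assms] by (simp add: d_def)
 define m where "m t = 1 + (3 * e - 1 - x) * t / d + t\<^sup>2 / d" for t
 have cub: "cubic x (e + s) = d * s * m s" for s
 proof -
  have "cubic x (e + s) = cubic x e + d * s + (3 * e - 1 - x) * s\<^sup>2 + s ^ 3"
   by (simp add: cubic_def d_def dcubic_def algebra_simps power2_eq_square power3_eq_cube)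
  moreover have "d * s * m s = d * s + (3 * e - 1 - x) * s\<^sup>2 + s ^ 3"
   using d0 by (simp add: m_def divide_simps) (simp add: algebra_simps power2_eq_square power3_eq_cube)
  ultimately show ?thesis using assms(3) by simp
 qed
 have mcont: "isCont m 0" unfolding m_def by (intro continuous_intros) (use d0 in auto)
 have m0: "m 0 = 1" by (simp add: m_def)
 have "eventually (\<lambda>s. 0 < Re (m s)) (nhds 0)"
 proof (rule order_tendstoD)
  show "((\<lambda>s. Re (m s)) \<longlongrightarrow> Re (m 0)) (nhds 0)"
   using mcont by (intro tendsto_Re) (simp add: isCont_def tendsto_at_iff_tendsto_nhds)
 qed (simp add: m0)
 then obtain r0 where r0: "r0 > 0" "\<And>s. norm s < r0 ==> 0 < Re (m s)"
  by (auto simp: eventually_nhds_metric dist_norm)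
 define \<rho> where "\<rho> t = csqrt (m (t\<^sup>2))" for t
 have "isCont \<rho> 0" unfolding \<rho>_def
 proof (rule isCont_o2[where g = csqrt])
  show "isCont (\<lambda>a. m (a\<^sup>2)) 0"
   by (rule isCont_o2[where g = m]) (use mcont in auto)
  show "isCont csqrt (m (0\<^sup>2))" by (rule continuous_at_csqrt) (simp add: m0)
 qed
 \<comment> \<open>The bound 1 on the radius gives \<open>norm (t^2) \<le> norm t\<close>, which
   puts \<open>t^2\<close> into the disc found for \<open>m\<close>.\<close>
 show thesis
 proof (rule that[of "min 1 r0" "csqrt d" \<rho>])
  show "isCont \<rho> 0" by fact
  show "csqrt d \<noteq> 0" using d0 by simp
  fix t :: complex assume t: "0 < norm t" "norm t < min 1 r0"
  have "norm (t\<^sup>2) \<le> norm t"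
   using t mult_left_le[of "norm t" "norm t"] by (simp add: norm_power power2_eq_square norm_mult)
  then have pos: "0 < Re (m (t\<^sup>2))" using r0 t by auto
  then show "cubic x (e + t\<^sup>2) \<noteq> 0" using d0 t by (auto simp: cub)
  show "(t * csqrt d * \<rho> t)\<^sup>2 = cubic x (e + t\<^sup>2)"
   by (simp add: cub \<rho>_def power_mult_distrib)
  show "local_par x (Aff e 0) t = Aff (e + t\<^sup>2) (t * csqrt d * \<rho> t)"
   using t d0 by (auto simp: deriv_cubic d_def[symmetric] cub \<rho>_def)
 qed (use r0 in \<open>auto simp: \<rho>_def m0 d_def\<close>)
qed

text \<open>With \<open>u = 1 / t^2\<close> the cubic is \<open>m t / t ^ 6\<close> with
  \<open>m 0 = 1\<close>. The evenness of \<open>\<rho>\<close> and the odd power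
  \<open>t ^ 3\<close> again make \<open>t -> - t\<close> the involution.\<close>

lemma local_par_Infty:
 fixes x :: complex
 obtains \<rho> r where "r > 0" "isCont \<rho> 0" "\<rho> 0 = 1" "\<And>t. \<rho> (- t) = \<rho> t"
  "\<And>t. 0 < norm t ==> norm t < r ==> local_par x Infty t = Aff (1 / t\<^sup>2) (\<rho> t / t ^ 3)"
  "\<And>t. 0 < norm t ==> norm t < r ==> (\<rho> t / t ^ 3)\<^sup>2 = cubic x (1 / t\<^sup>2)"
  "\<And>t. 0 < norm t ==> norm t < r ==> cubic x (1 / t\<^sup>2) \<noteq> 0"
  "\<And>t h. 0 < norm t ==> pullback x h Infty t = h (Aff (1 / t\<^sup>2) (\<rho> t / t ^ 3)) * (- 2 / t ^ 3)"
proof -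
 define m where "m t = (1 - t\<^sup>2) * (1 - x * t\<^sup>2)" for t
 have cub: "cubic x (1 / t\<^sup>2) = m t / t ^ 6" if "t \<noteq> 0" for t
  using that by (simp add: cubic_def m_def field_simps eval_nat_numeral)
 have mcont: "isCont m 0" unfolding m_def by (intro continuous_intros)
 have m0: "m 0 = 1" by (simp add: m_def)
 have "eventually (\<lambda>s. 0 < Re (m s)) (nhds 0)"
 proof (rule order_tendstoD)
  show "((\<lambda>s. Re (m s)) \<longlongrightarrow> Re (m 0)) (nhds 0)"
   using mcont by (intro tendsto_Re) (simp add: isCont_def tendsto_at_iff_tendsto_nhds)
 qed (simp add: m0)
 then obtain r0 where r0: "r0 > 0" "\<And>s. norm s < r0 ==> 0 < Re (m s)"
  by (auto simp: eventually_nhds_metric dist_norm)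
 define \<rho> where "\<rho> t = csqrt (m t)" for t
 have "isCont \<rho> 0" unfolding \<rho>_def
 proof (rule isCont_o2[where g = csqrt])
  show "isCont csqrt (m 0)" by (rule continuous_at_csqrt) (simp add: m0)
 qed (use mcont in auto)
 show thesis
 proof (rule that[of r0 \<rho>])
  show "isCont \<rho> 0" by fact
  fix t :: complex assume t: "0 < norm t" "norm t < r0"
  have pos: "0 < Re (m t)" using r0 t by auto
  then show "cubic x (1 / t\<^sup>2) \<noteq> 0" using t by (auto simp: cub)
  show "(\<rho> t / t ^ 3)\<^sup>2 = cubic x (1 / t\<^sup>2)"
   using t by (simp add: cub \<rho>_def power_divide power_mult[symmetric])
  show "local_par x Infty t = Aff (1 / t\<^sup>2) (\<rho> t / t ^ 3)"
   using t by (auto simp: \<rho>_def m_def)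
 next
  fix t :: complex and h assume t: "0 < norm t"
  show "pullback x h Infty t = h (Aff (1 / t\<^sup>2) (\<rho> t / t ^ 3)) * (- 2 / t ^ 3)"
   using t by (simp add: pullback_Infty \<rho>_def m_def)
 qed (use r0 in \<open>auto simp: \<rho>_def m0 m_def\<close>)
qed


subsection \<open>Differentials with poles over one point of the sphere\<close>

text \<open>The sum over the two points above \<open>u\<close>. It is invariant under exchange of
  the sheets, so the principal root only serves to name the two points; \<open>even_odd_part\<close>
  frees the expression from that choice.\<close>

definition even_part :: "complex \<Rightarrow> (pt \<Rightarrow> complex) \<Rightarrow> complex \<Rightarrow> complex" where
 "even_part x h u = h (Aff u (csqrt (cubic x u))) + h (Aff u (- csqrt (cubic x u)))"

text \<open>The difference of the sheets changes sign with the sheet, and the factor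
  \<open>v\<close> compensates, so this too is a single-valued function of \<open>u\<close>.\<close>

definition odd_part :: "complex \<Rightarrow> (pt \<Rightarrow> complex) \<Rightarrow> complex \<Rightarrow> complex" where
 "odd_part x h u = csqrt (cubic x u) *
   (h (Aff u (csqrt (cubic x u))) - h (Aff u (- csqrt (cubic x u))))"

lemma even_odd_part:
 assumes "v\<^sup>2 = cubic x u"
 shows "even_part x h u = h (Aff u v) + h (Aff u (- v))"
  and "odd_part x h u = v * (h (Aff u v) - h (Aff u (- v)))"
proof -
 have "v = csqrt (cubic x u) \<or> v = - csqrt (cubic x u)"
  using assms by (metis power2_csqrt power2_eq_iff)
 then show "even_part x h u = h (Aff u v) + h (Aff u (- v))"
  "odd_part x h u = v * (h (Aff u v) - h (Aff u (- v)))"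
  by (auto simp: even_part_def odd_part_def algebra_simps)
qed

lemma diff_holo_at_unramE:
 assumes "v0\<^sup>2 = cubic x u0" "v0 \<noteq> 0" "diff_holo_at x h (Aff u0 v0)"
 obtains r g where "r > 0" "g holomorphic_on ball u0 r"
  "\<And>u. u \<in> ball u0 r ==> h (Aff u (v0 * csqrt (cubic x u / cubic x u0))) = g u"
proof -
 obtain r g where r: "r > 0" "g holomorphic_on ball 0 r"
  "\<And>t. t\<in>ball 0 r ==> local_par x (Aff u0 v0) t \<in> unram x ==> pullback x h (Aff u0 v0) t = g t"
  using assms(3) unfolding diff_holo_at_def by blast
 obtain r1 where r1: "r1 > 0"
  "\<And>u. u \<in> ball u0 r1 ==> (v0 * csqrt (cubic x u / cubic x u0))\<^sup>2 = cubic x u"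
  "\<And>u. u \<in> ball u0 r1 ==> v0 * csqrt (cubic x u / cubic x u0) \<noteq> 0"
  using branch[OF assms(1,2)] by metis
 show thesis
 proof (rule that[of "min r r1" "\<lambda>u. g (u - u0)"])
  show "(\<lambda>u. g (u - u0)) holomorphic_on ball u0 (min r r1)"
   by (rule holomorphic_on_compose_gen[OF _ r(2), unfolded o_def])
     (auto intro!: holomorphic_intros simp: dist_norm norm_minus_commute)
  fix u assume u: "u \<in> ball u0 (min r r1)"
  have "local_par x (Aff u0 v0) (u - u0) \<in> unram x"
   using u r1(2)[of u] r1(3)[of u] assms(2) by (auto simp: Aff_in_unram)
  then show "h (Aff u (v0 * csqrt (cubic x u / cubic x u0))) = g (u - u0)"
   using r(3)[of "u - u0"] u assms(2) by (simp add: pullback_unram dist_norm norm_minus_commute)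
 qed (use r r1 in auto)
qed

lemma diff_pole_at_unramE:
 assumes "v0\<^sup>2 = cubic x u0" "v0 \<noteq> 0" "diff_pole_at x h (Aff u0 v0) n c"
 obtains r g where "r > 0" "g holomorphic_on ball u0 r" "g u0 = c"
  "\<And>u. u \<in> ball u0 r ==> u \<noteq> u0 ==>
    (u - u0) ^ n * h (Aff u (v0 * csqrt (cubic x u / cubic x u0))) = g u"
proof -
 obtain r g where r: "r > 0" "g holomorphic_on ball 0 r" "g 0 = c"
  "\<And>t. t\<in>ball 0 r - {0} ==> t ^ n * pullback x h (Aff u0 v0) t = g t"
  using assms(3) unfolding diff_pole_at_def by blast
 show thesis
 proof (rule that[of r "\<lambda>u. g (u - u0)"])
  show "(\<lambda>u. g (u - u0)) holomorphic_on ball u0 r"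
   by (rule holomorphic_on_compose_gen[OF _ r(2), unfolded o_def])
     (auto intro!: holomorphic_intros simp: dist_norm norm_minus_commute)
  fix u assume u: "u \<in> ball u0 r" "u \<noteq> u0"
  then show "(u - u0) ^ n * h (Aff u (v0 * csqrt (cubic x u / cubic x u0))) = g (u - u0)"
   using r(4)[of "u - u0"] assms(2) by (simp add: pullback_unram dist_norm norm_minus_commute)
 qed (use r in auto)
qed

lemma diff_holo_at_imp_pole_at:
 assumes "v0\<^sup>2 = cubic x u0" "v0 \<noteq> 0" "diff_holo_at x h (Aff u0 v0)" "n > 0"
 shows "diff_pole_at x h (Aff u0 v0) n 0"
proof -
 obtain r g where r: "r > 0" "g holomorphic_on ball u0 r"
  "\<And>u. u \<in> ball u0 r ==> h (Aff u (v0 * csqrt (cubic x u / cubic x u0))) = g u"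
  using diff_holo_at_unramE[OF assms(1-3)] by metis
 have "(\<lambda>t. t ^ n * g (u0 + t)) holomorphic_on ball 0 r"
  by (intro holomorphic_intros holomorphic_on_compose_gen[OF _ r(2), unfolded o_def])
    (auto simp: dist_norm)
 then show ?thesis
  unfolding diff_pole_at_def using r assms(2,4)
  by (intro exI[of _ r] conjI exI[of _ "\<lambda>t. t ^ n * g (u0 + t)"])
    (auto simp: pullback_unram dist_norm)
qed

lemma diff_pole_at_mono:
 assumes "diff_pole_at x h P n c" "n < m"
 shows "diff_pole_at x h P m 0"
proof -
 obtain r g where r: "r > 0" "g holomorphic_on ball 0 r" "g 0 = c"
  "\<And>t. t\<in>ball 0 r - {0} ==> t ^ n * pullback x h P t = g t"
  using assms(1) unfolding diff_pole_at_def by blast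
 have "(\<lambda>t. t ^ (m - n) * g t) holomorphic_on ball 0 r"
  by (intro holomorphic_intros r)
 moreover have "t ^ m = t ^ (m - n) * t ^ n" for t :: complex
  using assms(2) by (simp flip: power_add)
 ultimately show ?thesis
  unfolding diff_pole_at_def using r assms(2)
  by (intro exI[of _ r] conjI exI[of _ "\<lambda>t. t ^ (m - n) * g t"]) (auto simp: mult.assoc)
qed

text \<open>Limits at the exceptional points make them removable, and an entire function of
  polynomial growth is a polynomial. At points of \<open>K\<close> the conclusion concerns the
  limit, since the value of \<open>F\<close> there is arbitrary.\<close>

lemma Liouville_except_finite:
 fixes F :: "complex \<Rightarrow> complex"
 assumes "finite K" "F holomorphic_on - K" "\<And>z. z \<in> K ==> \<exists>L. (F \<longlongrightarrow> L) (at z)"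
  and "\<And>z. A \<le> norm z ==> norm (F z) \<le> B * norm z ^ n"
 obtains p where "\<And>z. z \<notin> K ==> F z = (\<Sum>k\<le>n. p k * z ^ k)"
  "\<And>z. z \<in> K ==> (F \<longlongrightarrow> (\<Sum>k\<le>n. p k * z ^ k)) (at z)"
proof -
 obtain L where L: "\<And>z. z \<in> K ==> (F \<longlongrightarrow> L z) (at z)" using assms(3) by metis
 define G where "G z = (if z \<in> K then L z else F z)" for z
 have ev: "eventually (\<lambda>w. F w = G w) (at z)" for z
 proof -
  have "eventually (\<lambda>w. w \<in> - (K - {z})) (nhds z)"
   by (rule eventually_nhds_in_open) (auto intro!: finite_imp_closed assms(1) open_Compl simp del: Compl_Diff_eq)
  then show ?thesis by (auto simp: eventually_at_filter G_def elim: eventually_mono)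
 qed
 have lim: "(G \<longlongrightarrow> G z) (at z within UNIV)" if "z \<in> K" for z
 proof -
  have "G z = L z" using that by (simp add: G_def)
  then show ?thesis using Lim_transform_eventually[OF L[OF that] ev] by simp
 qed
 have "G holomorphic_on - K"
  by (rule holomorphic_transform[OF assms(2)]) (simp add: G_def)
 then have "G holomorphic_on UNIV - K"
  by (simp add: Compl_eq_Diff_UNIV)
 then have hol: "G holomorphic_on UNIV"
  using no_isolated_singularity'[OF lim _ open_UNIV assms(1)] by blast
 obtain R where R: "\<And>z. z \<in> K ==> norm z < R"
  using finite_imp_bounded[OF assms(1)] by (metis bounded_pos_less)
 have G: "G z = (\<Sum>k\<le>n. (deriv ^^ k) G 0 / fact k * z ^ k)" for z
  by (rule Liouville_polynomial[OF hol, of "max A R"]) (use assms(4) R in \<open>force simp: G_def\<close>)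
 show thesis
 proof (rule that[of "\<lambda>k. (deriv ^^ k) G 0 / fact k"])
  fix z assume "z \<notin> K" then show "F z = (\<Sum>k\<le>n. (deriv ^^ k) G 0 / fact k * z ^ k)"
   using G[of z] by (simp add: G_def)
 next
  fix z assume "z \<in> K" then show "(F \<longlongrightarrow> (\<Sum>k\<le>n. (deriv ^^ k) G 0 / fact k * z ^ k)) (at z)"
   using L[of z] G[of z] by (simp add: G_def)
 qed
qed

text \<open>A limit in the local parameter becomes one in \<open>u\<close> by inserting
  \<open>t = csqrt (u - e)\<close>. The cut of the root does no harm: the square of \<open>t\<close>
  is \<open>u - e\<close> on either side of it, and only the norm of \<open>t\<close> has to tend to
  0.\<close>

lemma limit_sqrt_substitution:
 fixes F g :: "complex \<Rightarrow> complex"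
 assumes "r > 0" "(g \<longlongrightarrow> L) (at 0)"
  "\<And>t. 0 < norm t ==> norm t < r ==> F (e + t\<^sup>2) = g t"
 shows "(F \<longlongrightarrow> L) (at e)"
proof -
 have "filterlim (\<lambda>u. csqrt (u - e)) (nhds 0) (at e)"
 proof -
  have "((\<lambda>u. sqrt (norm (u - e))) \<longlongrightarrow> sqrt (norm (e - e))) (at e)"
   by (intro tendsto_intros)
  then have "((\<lambda>u. norm (csqrt (u - e))) \<longlongrightarrow> 0) (at e)"
   by (simp only: norm_csqrt diff_self norm_zero real_sqrt_zero)
  then show ?thesis by (rule tendsto_norm_zero_cancel)
 qed
 then have fl: "filterlim (\<lambda>u. csqrt (u - e)) (at 0) (at e)"
  by (rule filterlim_atI) (auto simp: eventually_at_filter)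
 have "eventually (\<lambda>t. F (e + t\<^sup>2) = g t) (at 0)"
  unfolding eventually_at using assms by (intro exI[of _ r]) auto
 then have "eventually (\<lambda>u. F (e + (csqrt (u - e))\<^sup>2) = g (csqrt (u - e))) (at e)"
  using fl by (rule eventually_compose_filterlim)
 then have "eventually (\<lambda>u. g (csqrt (u - e)) = F u) (at e)"
  by (rule eventually_mono) simp
 then show ?thesis
  by (rule Lim_transform_eventually[OF filterlim_compose[OF assms(2) fl]])
qed

text \<open>At a ramification point \<open>du = 2 t dt\<close>, so a holomorphic differential has
  coefficient \<open>g t / (2 t)\<close>, which may blow up. On the other sheet \<open>t\<close>
  becomes \<open>- t\<close>: the sum of both is a difference quotient of \<open>g\<close>, and in
  the odd part the factor \<open>v\<close>, of order \<open>t\<close>, cancels the pole.\<close>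

lemma even_odd_part_limits_ram:
 assumes "x \<noteq> 0" "x \<noteq> 1" "cubic x e = 0" "diff_holo_at x h (Aff e 0)"
 shows "\<exists>L. (even_part x h \<longlongrightarrow> L) (at e)" "\<exists>L. (odd_part x h \<longlongrightarrow> L) (at e)"
proof -
 obtain r g where r: "r > 0" "g holomorphic_on ball 0 r"
  "\<forall>t\<in>ball 0 r. local_par x (Aff e 0) t \<in> unram x \<longrightarrow> pullback x h (Aff e 0) t = g t"
  using assms(4) unfolding diff_holo_at_def by (elim exE conjE)
 obtain k \<rho> r1 where r1: "r1 > 0" "k \<noteq> 0" "isCont \<rho> 0" "\<rho> 0 = 1" "\<And>t. \<rho> (- t) = \<rho> t"
  "\<And>t. 0 < norm t ==> norm t < r1 ==> local_par x (Aff e 0) t = Aff (e + t\<^sup>2) (t * k * \<rho> t)"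
  "\<And>t. 0 < norm t ==> norm t < r1 ==> (t * k * \<rho> t)\<^sup>2 = cubic x (e + t\<^sup>2)"
  "\<And>t. 0 < norm t ==> norm t < r1 ==> cubic x (e + t\<^sup>2) \<noteq> 0"
  using local_par_ram[OF assms(1-3)] by metis
 define d where "d = min r r1"
 have d: "d > 0" using r r1 by (simp add: d_def)
 have h1: "h (Aff (e + t\<^sup>2) (t * k * \<rho> t)) = g t / (2 * t)" if "0 < norm t" "norm t < d" for t
 proof -
  have "local_par x (Aff e 0) t \<in> unram x"
   using that r1(6)[of t] r1(7)[of t] r1(8)[of t]
   by (simp add: Aff_in_unram d_def del: local_par.simps)
  then have "h (Aff (e + t\<^sup>2) (t * k * \<rho> t)) * (2 * t) = g t"
   using bspec[OF r(3), of t] that r1(6)[of t]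
   by (simp add: d_def pullback_ram del: local_par.simps)
  then show ?thesis using that by (simp add: field_simps)
 qed
 have h2: "h (Aff (e + t\<^sup>2) (- (t * k * \<rho> t))) = - g (- t) / (2 * t)" if "0 < norm t" "norm t < d" for t
  using h1[of "-t"] that r1(5)[of t] by simp
 have gd: "(g has_field_derivative deriv g 0) (at 0)"
  using r by (metis centre_in_ball holomorphic_derivI open_ball)
 have gc: "(g \<longlongrightarrow> g 0) (at 0)" using gd DERIV_isCont by (auto simp: isCont_def)
 have gc': "((\<lambda>t. g (- t)) \<longlongrightarrow> g 0) (at 0)"
  by (rule isCont_tendsto_compose[of 0 g "\<lambda>t. - t"])
    (use DERIV_isCont[OF gd] in \<open>auto intro!: tendsto_eq_intros\<close>)
 have q1: "((\<lambda>t. (g t - g 0) / t) \<longlongrightarrow> deriv g 0) (at 0)"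
  using gd by (simp add: has_field_derivative_iff)
 have q2: "((\<lambda>t. (g (- t) - g 0) / t) \<longlongrightarrow> - deriv g 0) (at 0)"
 proof -
  have "((\<lambda>t. g (- t)) has_field_derivative - deriv g 0) (at 0)"
   using DERIV_chain2[of g "deriv g 0" "\<lambda>t. - t" 0 "-1" UNIV] gd DERIV_minus[OF DERIV_ident, of 0 UNIV]
   by simp
  then show ?thesis by (simp add: has_field_derivative_iff)
 qed
 have "((\<lambda>t. ((g t - g 0) / t - (g (- t) - g 0) / t) / 2) \<longlongrightarrow> (deriv g 0 - - deriv g 0) / 2) (at 0)"
  by (intro tendsto_intros q1 q2) auto
 then have "(even_part x h \<longlongrightarrow> (deriv g 0 - - deriv g 0) / 2) (at e)"
 proof (rule limit_sqrt_substitution[OF d])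
  fix t :: complex assume t: "0 < norm t" "norm t < d"
  then have "even_part x h (e + t\<^sup>2) = g t / (2 * t) + - g (- t) / (2 * t)"
   using even_odd_part(1)[of "t * k * \<rho> t" x "e + t\<^sup>2" h] r1(7)[of t] h1[OF t] h2[OF t] by (simp add: d_def)
  then show "even_part x h (e + t\<^sup>2) = ((g t - g 0) / t - (g (- t) - g 0) / t) / 2"
   using t by (simp add: field_simps)
 qed
 then show "\<exists>L. (even_part x h \<longlongrightarrow> L) (at e)" by blast
 have "((\<lambda>t. k * \<rho> t * (g t + g (- t)) / 2) \<longlongrightarrow> k * \<rho> 0 * (g 0 + g 0) / 2) (at 0)"
  by (intro tendsto_intros gc gc' r1(3)[unfolded isCont_def]) auto
 then have "(odd_part x h \<longlongrightarrow> k * \<rho> 0 * (g 0 + g 0) / 2) (at e)"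
 proof (rule limit_sqrt_substitution[OF d])
  fix t :: complex assume t: "0 < norm t" "norm t < d"
  then have "odd_part x h (e + t\<^sup>2) = t * k * \<rho> t * (g t / (2 * t) - - g (- t) / (2 * t))"
   using even_odd_part(2)[of "t * k * \<rho> t" x "e + t\<^sup>2" h] r1(7)[of t] h1[OF t] h2[OF t] by (simp add: d_def)
  then show "odd_part x h (e + t\<^sup>2) = k * \<rho> t * (g t + g (- t)) / 2"
   using t by (simp add: field_simps)
 qed
 then show "\<exists>L. (odd_part x h \<longlongrightarrow> L) (at e)" by blast
qed

text \<open>At infinity a holomorphic differential has coefficient \<open>- g t * t ^ 3 / 2\<close>.
  In the even part the leading terms cancel, which gains a power of \<open>t\<close>; in the odd
  part \<open>v\<close> cancels \<open>t ^ 3\<close>. With the factor \<open>(u - q)^2\<close> the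
  first is bounded and the second grows at most quadratically in \<open>u\<close>, which fixes the
  degrees 0 and 2 of the polynomials to come.\<close>

lemma even_odd_part_bounds_Infty:
 assumes "diff_holo_at x h Infty"
 obtains A B where "A \<ge> 1" "\<And>u. A \<le> norm u ==> norm ((u - q)\<^sup>2 * even_part x h u) \<le> B"
  "\<And>u. A \<le> norm u ==> norm ((u - q)\<^sup>2 * odd_part x h u) \<le> B * norm u ^ 2"
proof -
 obtain r g where r: "r > 0" "g holomorphic_on ball 0 r"
  "\<And>t. t\<in>ball 0 r ==> local_par x Infty t \<in> unram x ==> pullback x h Infty t = g t"
  using assms unfolding diff_holo_at_def by blast
 obtain \<rho> r1 where r1: "r1 > 0" "isCont \<rho> 0" "\<rho> 0 = 1" "\<And>t. \<rho> (- t) = \<rho> t"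
  "\<And>t. 0 < norm t ==> norm t < r1 ==> local_par x Infty t = Aff (1 / t\<^sup>2) (\<rho> t / t ^ 3)"
  "\<And>t. 0 < norm t ==> norm t < r1 ==> (\<rho> t / t ^ 3)\<^sup>2 = cubic x (1 / t\<^sup>2)"
  "\<And>t. 0 < norm t ==> norm t < r1 ==> cubic x (1 / t\<^sup>2) \<noteq> 0"
  "\<And>t h. 0 < norm t ==> pullback x h Infty t = h (Aff (1 / t\<^sup>2) (\<rho> t / t ^ 3)) * (- 2 / t ^ 3)"
  using local_par_Infty[where x = x] by metis
 define d where "d = min r r1"
 have d: "d > 0" using r r1 by (simp add: d_def)
 have h1: "h (Aff (1 / t\<^sup>2) (\<rho> t / t ^ 3)) = - g t * t ^ 3 / 2" if "0 < norm t" "norm t < d" for t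
 proof -
  have "local_par x Infty t \<in> unram x"
   using that r1(5)[of t] r1(6)[of t] r1(7)[of t]
   by (simp add: Aff_in_unram d_def del: local_par.simps)
  then have "h (Aff (1 / t\<^sup>2) (\<rho> t / t ^ 3)) * (- 2 / t ^ 3) = g t"
   using r(3)[of t] that r1(8)[of t] by (simp add: d_def)
  then have "h (Aff (1 / t\<^sup>2) (\<rho> t / t ^ 3)) * (- 2) = g t * t ^ 3" using that by (simp add: field_simps)
  then have "2 * h (Aff (1 / t\<^sup>2) (\<rho> t / t ^ 3)) = - (g t * t ^ 3)" by (simp add: minus_equation_iff[of _ "g t * t ^ 3"] eq_commute)
  then show ?thesis by (simp add: field_simps)
 qed
 have h2: "h (Aff (1 / t\<^sup>2) (- (\<rho> t / t ^ 3))) = g (- t) * t ^ 3 / 2" if "0 < norm t" "norm t < d" for t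
  using h1[of "-t"] that r1(4)[of t] by (simp add: power3_eq_cube)
 have E: "(1 / t\<^sup>2 - q)\<^sup>2 * even_part x h (1 / t\<^sup>2) = - (1 - q * t\<^sup>2)\<^sup>2 * ((g t - g 0) / t - (g (- t) - g 0) / t) / 2"
  if t: "0 < norm t" "norm t < d" for t
 proof -
  have "even_part x h (1 / t\<^sup>2) = - g t * t ^ 3 / 2 + g (- t) * t ^ 3 / 2"
   using even_odd_part(1)[of "\<rho> t / t ^ 3" x "1 / t\<^sup>2" h] r1(6)[of t] h1[OF t] h2[OF t] t by (simp add: d_def)
  then have *: "even_part x h (1 / t\<^sup>2) = (g (- t) - g t) * t ^ 3 / 2" by (simp add: algebra_simps diff_divide_distrib)
  have "(1 / t\<^sup>2 - q)\<^sup>2 * even_part x h (1 / t\<^sup>2) =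
    ((1 / t\<^sup>2 - q)\<^sup>2 * t ^ 3) * ((g (- t) - g t) / 2)"
   unfolding * by simp
  also have "\<dots> = (1 - q * t\<^sup>2)\<^sup>2 / t * ((g (- t) - g t) / 2)"
   using t by (simp add: field_simps power2_eq_square power3_eq_cube)
  also have "\<dots> = - (1 - q * t\<^sup>2)\<^sup>2 * ((g t - g 0) / t - (g (- t) - g 0) / t) / 2"
   using t by (simp add: diff_divide_distrib[symmetric]) (simp add: field_simps)
  finally show ?thesis .
 qed
 have O: "((1 / t\<^sup>2 - q)\<^sup>2 * odd_part x h (1 / t\<^sup>2)) * (t\<^sup>2)\<^sup>2 = - (1 - q * t\<^sup>2)\<^sup>2 * \<rho> t * (g t + g (- t)) / 2"
  if t: "0 < norm t" "norm t < d" for t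
 proof -
  have *: "odd_part x h (1 / t\<^sup>2) = \<rho> t / t ^ 3 * (- g t * t ^ 3 / 2 - g (- t) * t ^ 3 / 2)"
   using even_odd_part(2)[of "\<rho> t / t ^ 3" x "1 / t\<^sup>2" h] r1(6)[of t] h1[OF t] h2[OF t] t by (simp add: d_def)
  show ?thesis unfolding * using t by (simp add: field_simps power2_eq_square power3_eq_cube)
 qed
 have gd: "(g has_field_derivative deriv g 0) (at 0)"
  using r by (metis centre_in_ball holomorphic_derivI open_ball)
 have gc: "(g \<longlongrightarrow> g 0) (at 0)" using gd DERIV_isCont by (auto simp: isCont_def)
 have gc': "((\<lambda>t. g (- t)) \<longlongrightarrow> g 0) (at 0)"
  by (rule isCont_tendsto_compose[of 0 g "\<lambda>t. - t"])
    (use DERIV_isCont[OF gd] in \<open>auto intro!: tendsto_eq_intros\<close>)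
 have q1: "((\<lambda>t. (g t - g 0) / t) \<longlongrightarrow> deriv g 0) (at 0)"
  using gd by (simp add: has_field_derivative_iff)
 have q2: "((\<lambda>t. (g (- t) - g 0) / t) \<longlongrightarrow> - deriv g 0) (at 0)"
 proof -
  have "((\<lambda>t. g (- t)) has_field_derivative - deriv g 0) (at 0)"
   using DERIV_chain2[of g "deriv g 0" "\<lambda>t. - t" 0 "-1" UNIV] gd DERIV_minus[OF DERIV_ident, of 0 UNIV]
   by simp
  then show ?thesis by (simp add: has_field_derivative_iff)
 qed
 have lim1: "((\<lambda>t. - (1 - q * t\<^sup>2)\<^sup>2 * ((g t - g 0) / t - (g (- t) - g 0) / t) / 2) \<longlongrightarrow>
   - (1 - q * 0\<^sup>2)\<^sup>2 * (deriv g 0 - - deriv g 0) / 2) (at 0)"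
  by (intro tendsto_intros q1 q2) auto
 have lim2: "((\<lambda>t. - (1 - q * t\<^sup>2)\<^sup>2 * \<rho> t * (g t + g (- t)) / 2) \<longlongrightarrow>
   - (1 - q * 0\<^sup>2)\<^sup>2 * \<rho> 0 * (g 0 + g 0) / 2) (at 0)"
  by (intro tendsto_intros gc gc' r1(2)[unfolded isCont_def]) auto
 define M where "M = max (norm (- (1 - q * 0\<^sup>2)\<^sup>2 * (deriv g 0 - - deriv g 0) / 2))
  (norm (- (1 - q * 0\<^sup>2)\<^sup>2 * \<rho> 0 * (g 0 + g 0) / 2)) + 1"
 have "eventually (\<lambda>t. norm (- (1 - q * t\<^sup>2)\<^sup>2 * ((g t - g 0) / t - (g (- t) - g 0) / t) / 2) < M) (at 0)"
  by (rule order_tendstoD(2)[OF tendsto_norm[OF lim1]]) (unfold M_def, linarith)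
 moreover have "eventually (\<lambda>t. norm (- (1 - q * t\<^sup>2)\<^sup>2 * \<rho> t * (g t + g (- t)) / 2) < M) (at 0)"
  by (rule order_tendstoD(2)[OF tendsto_norm[OF lim2]]) (unfold M_def, linarith)
 ultimately obtain d1 where d1: "d1 > 0"
  "\<And>t. 0 < norm t ==> norm t < d1 ==> norm (- (1 - q * t\<^sup>2)\<^sup>2 * ((g t - g 0) / t - (g (- t) - g 0) / t) / 2) < M"
  "\<And>t. 0 < norm t ==> norm t < d1 ==> norm (- (1 - q * t\<^sup>2)\<^sup>2 * \<rho> t * (g t + g (- t)) / 2) < M"
  using eventually_conj[of _ "at 0"] unfolding eventually_at
  by (smt (verit, ccfv_threshold) UNIV_I dist_0_norm dist_commute zero_less_norm_iff)
 define e where "e = min 1 (min d d1) / 2"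
 have e: "e > 0" "e < d" "e < d1" "e < 1" using d d1 by (auto simp: e_def)
 show thesis
 proof (rule that[of "1 / e\<^sup>2" M])
  show "1 \<le> 1 / e\<^sup>2" using e by (simp add: field_simps power_le_one)
  fix u :: complex assume u: "1 / e\<^sup>2 \<le> norm u"
  define t where "t = 1 / csqrt u"
  have u0: "u \<noteq> 0" using u e by (auto simp: divide_le_0_iff)
  have ut: "u = 1 / t\<^sup>2" by (simp add: t_def power_divide)
  have "1 / e \<le> sqrt (norm u)"
   using real_sqrt_le_mono[OF u] e by (simp add: real_sqrt_divide)
  then have "norm t \<le> e" using e u0 by (simp add: t_def norm_divide field_simps)
  then have t: "0 < norm t" "norm t < d" "norm t < d1" using e u0 by (auto simp: t_def)
  show "norm ((u - q)\<^sup>2 * even_part x h u) \<le> M"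
   unfolding ut E[OF t(1,2)] using d1(2)[OF t(1,3)] by simp
  have "norm ((u - q)\<^sup>2 * odd_part x h u) * norm ((t\<^sup>2)\<^sup>2) \<le> M"
   unfolding norm_mult[symmetric] unfolding ut O[OF t(1,2)] using d1(3)[OF t(1,3)] by simp
  moreover have "norm ((t\<^sup>2)\<^sup>2) = 1 / norm u ^ 2" by (simp add: ut norm_power norm_divide power_divide)
  ultimately have "norm ((u - q)\<^sup>2 * odd_part x h u) / norm u ^ 2 \<le> M" by simp
  then show "norm ((u - q)\<^sup>2 * odd_part x h u) \<le> M * norm u ^ 2"
   using u0 by (simp add: pos_divide_le_eq)
 qed
qed


lemma even_odd_part_holomorphic:
 assumes "cubic x u0 \<noteq> 0" "v0\<^sup>2 = cubic x u0"
  "diff_holo_at x h (Aff u0 v0)" "diff_holo_at x h (Aff u0 (- v0))"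
 shows "even_part x h field_differentiable at u0" "odd_part x h field_differentiable at u0"
proof -
 have v0: "v0 \<noteq> 0" using assms by auto
 define V where "V = (\<lambda>u. v0 * csqrt (cubic x u / cubic x u0))"
 obtain r where r: "r > 0" "V holomorphic_on ball u0 r"
  "\<And>u. u \<in> ball u0 r ==> (V u)\<^sup>2 = cubic x u"
  using branch[OF assms(2) v0] unfolding V_def by metis
 obtain r1 g1 where 1: "r1 > 0" "g1 holomorphic_on ball u0 r1"
  "\<And>u. u \<in> ball u0 r1 ==> h (Aff u (V u)) = g1 u"
  using diff_holo_at_unramE[OF assms(2) v0 assms(3)] unfolding V_def by metis
 obtain r2 g2 where 2: "r2 > 0" "g2 holomorphic_on ball u0 r2"
  "\<And>u. u \<in> ball u0 r2 ==> h (Aff u (- V u)) = g2 u"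
  by (rule diff_holo_at_unramE[of "- v0" x u0 h]) (use v0 assms in \<open>auto simp: V_def\<close>)
 define d where "d = min r (min r1 r2)"
 have d: "d > 0" using r 1 2 by (simp add: d_def)
 have E: "even_part x h u = g1 u + g2 u" "odd_part x h u = V u * (g1 u - g2 u)" if "u \<in> ball u0 d" for u
  using even_odd_part[of "V u" x u h] 1(3)[of u] 2(3)[of u] r(3)[of u] that by (auto simp: d_def)
 have sub: "ball u0 d \<subseteq> ball u0 r" "ball u0 d \<subseteq> ball u0 r1" "ball u0 d \<subseteq> ball u0 r2"
  by (auto simp: d_def)
 have "(\<lambda>u. g1 u + g2 u) holomorphic_on ball u0 d" "(\<lambda>u. V u * (g1 u - g2 u)) holomorphic_on ball u0 d"
  by (intro holomorphic_intros; rule holomorphic_on_subset[OF _ sub(1)] holomorphic_on_subset[OF _ sub(2)]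
    holomorphic_on_subset[OF _ sub(3)]; fact r(2) 1(2) 2(2))+
 then have "even_part x h holomorphic_on ball u0 d" "odd_part x h holomorphic_on ball u0 d"
  by - (rule holomorphic_transform, assumption, simp add: E)+
 then show "even_part x h field_differentiable at u0" "odd_part x h field_differentiable at u0"
  using d by (simp_all add: holomorphic_on_imp_differentiable_at[of _ "ball u0 d"])
qed

lemma even_odd_part_pole_limits:
 assumes "w\<^sup>2 = cubic x q" "w \<noteq> 0"
  "diff_pole_at x h (Aff q w) 2 c" "diff_pole_at x h (Aff q (- w)) 2 c'"
 shows "((\<lambda>u. (u - q)\<^sup>2 * even_part x h u) \<longlongrightarrow> c + c') (at q)"
  "((\<lambda>u. (u - q)\<^sup>2 * odd_part x h u) \<longlongrightarrow> w * (c - c')) (at q)"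
proof -
 define V where "V = (\<lambda>u. w * csqrt (cubic x u / cubic x q))"
 obtain r where r: "r > 0" "V holomorphic_on ball q r" "V q = w"
  "\<And>u. u \<in> ball q r ==> (V u)\<^sup>2 = cubic x u"
  using branch[OF assms(1,2)] unfolding V_def by metis
 obtain r1 g1 where 1: "r1 > 0" "g1 holomorphic_on ball q r1" "g1 q = c"
  "\<And>u. u \<in> ball q r1 ==> u \<noteq> q ==> (u - q)\<^sup>2 * h (Aff u (V u)) = g1 u"
  using diff_pole_at_unramE[OF assms(1,2,3)] unfolding V_def by metis
 obtain r2 g2 where 2: "r2 > 0" "g2 holomorphic_on ball q r2" "g2 q = c'"
  "\<And>u. u \<in> ball q r2 ==> u \<noteq> q ==> (u - q)\<^sup>2 * h (Aff u (- V u)) = g2 u"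
  by (rule diff_pole_at_unramE[of "- w" x q h 2 c']) (use assms in \<open>auto simp: V_def\<close>)
 define d where "d = min r (min r1 r2)"
 have d: "d > 0" using r 1 2 by (simp add: d_def)
 have c: "isCont V q" "isCont g1 q" "isCont g2 q"
  using holomorphic_on_imp_differentiable_at[OF r(2) open_ball, of q]
   holomorphic_on_imp_differentiable_at[OF 1(2) open_ball, of q]
   holomorphic_on_imp_differentiable_at[OF 2(2) open_ball, of q] r(1) 1(1) 2(1)
  by (simp_all add: field_differentiable_imp_continuous_at)
 have E: "(u - q)\<^sup>2 * even_part x h u = g1 u + g2 u" "(u - q)\<^sup>2 * odd_part x h u = V u * (g1 u - g2 u)"
  if "u \<in> ball q d" "u \<noteq> q" for u
 proof -
  have "(V u)\<^sup>2 = cubic x u" "(u - q)\<^sup>2 * h (Aff u (V u)) = g1 u" "(u - q)\<^sup>2 * h (Aff u (- V u)) = g2 u"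
   using that r 1 2 by (auto simp: d_def)
  then show "(u - q)\<^sup>2 * even_part x h u = g1 u + g2 u" "(u - q)\<^sup>2 * odd_part x h u = V u * (g1 u - g2 u)"
   unfolding even_odd_part[OF \<open>(V u)\<^sup>2 = cubic x u\<close>, of h]
   by (simp_all only: distrib_left right_diff_distrib mult.left_commute[of _ "V u"])
 qed
 have ev: "eventually (\<lambda>u. u \<in> ball q d \<and> u \<noteq> q) (at q)"
  using d by (auto simp: eventually_at dist_commute intro!: exI[of _ d])
 have "((\<lambda>u. g1 u + g2 u) \<longlongrightarrow> g1 q + g2 q) (at q)" "((\<lambda>u. V u * (g1 u - g2 u)) \<longlongrightarrow> V q * (g1 q - g2 q)) (at q)"
  using c by (auto intro!: tendsto_intros simp: isCont_def)
 then show "((\<lambda>u. (u - q)\<^sup>2 * even_part x h u) \<longlongrightarrow> c + c') (at q)"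
  "((\<lambda>u. (u - q)\<^sup>2 * odd_part x h u) \<longlongrightarrow> w * (c - c')) (at q)"
  unfolding r(3) 1(3) 2(3)
  by - (rule Lim_transform_eventually, assumption, rule eventually_mono[OF ev], simp add: E)+
qed

text \<open>After multiplication by \<open>(u - q)^2\<close> the even and the odd part extend to
  polynomials of degree 0 and at most 2, whose values at \<open>q\<close> are given by the leading
  coefficients \<open>c\<close> and \<open>c'\<close>. Free remain \<open>p1\<close>, which governs
  the simple poles over \<open>q\<close>, and \<open>p2\<close>, the multiple of
  \<open>du / v\<close>.\<close>

proposition curve_differential_form:
 assumes "x \<noteq> 0" "x \<noteq> 1" "w\<^sup>2 = cubic x q" "w \<noteq> 0"
  and holo: "\<And>P. P \<in> curve x ==> u_proj P \<noteq> Some q ==> diff_holo_at x h P"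
  and pole: "diff_pole_at x h (Aff q w) 2 c" "diff_pole_at x h (Aff q (- w)) 2 c'"
 obtains p1 p2 where "\<And>u v. v\<^sup>2 = cubic x u ==> v \<noteq> 0 ==> u \<noteq> q ==>
  h (Aff u v) = ((c + c') + (w * (c - c') + p1 * (u - q) + p2 * (u - q)\<^sup>2) / v) / (2 * (u - q)\<^sup>2)"
proof -
 define K where "K = {0, 1, x, q}"
 define E where "E = (\<lambda>u. (u - q)\<^sup>2 * even_part x h u)"
 define F where "F = (\<lambda>u. (u - q)\<^sup>2 * odd_part x h u)"
 have K: "finite K" "q \<in> K" by (auto simp: K_def)
 have fd: "even_part x h field_differentiable at u \<and> odd_part x h field_differentiable at u"
  if "u \<notin> K" for u
 proof -
  have nz: "cubic x u \<noteq> 0" using that by (auto simp: K_def cubic_eq_0_iff)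
  have "diff_holo_at x h (Aff u (csqrt (cubic x u)))" "diff_holo_at x h (Aff u (- csqrt (cubic x u)))"
   by (rule holo; use that in \<open>simp add: Aff_in_curve K_def\<close>)+
  then show ?thesis using even_odd_part_holomorphic[OF nz, of "csqrt (cubic x u)" h] by simp
 qed
 have hol: "E holomorphic_on - K" "F holomorphic_on - K"
  unfolding E_def F_def
  by (intro holomorphic_intros;
    simp add: holomorphic_on_def field_differentiable_at_within fd)+
 have lims: "\<exists>L. (E \<longlongrightarrow> L) (at z)" "\<exists>L. (F \<longlongrightarrow> L) (at z)" if "z \<in> K" for z
 proof -
  have "(\<exists>L. (E \<longlongrightarrow> L) (at z)) \<and> (\<exists>L. (F \<longlongrightarrow> L) (at z))"
  proof (cases "z = q")
   case True then show ?thesis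
    using even_odd_part_pole_limits[OF assms(3,4) pole] unfolding E_def F_def by blast
  next
   case False
   then have 0: "cubic x z = 0" using that by (auto simp: K_def cubic_eq_0_iff)
   have "diff_holo_at x h (Aff z 0)"
    by (rule holo) (use False 0 in \<open>auto simp: Aff_in_curve\<close>)
   from even_odd_part_limits_ram[OF assms(1,2) 0 this]
   obtain L1 L2 where L: "(even_part x h \<longlongrightarrow> L1) (at z)" "(odd_part x h \<longlongrightarrow> L2) (at z)" by blast
   have "(E \<longlongrightarrow> (z - q)\<^sup>2 * L1) (at z)" "(F \<longlongrightarrow> (z - q)\<^sup>2 * L2) (at z)"
    unfolding E_def F_def by (intro tendsto_intros L)+
   then show ?thesis by blast
  qed
  then show "\<exists>L. (E \<longlongrightarrow> L) (at z)" "\<exists>L. (F \<longlongrightarrow> L) (at z)" by auto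
 qed
 have "diff_holo_at x h Infty" by (rule holo) (auto simp: curve_def)
 then obtain A B where AB: "A \<ge> 1" "\<And>u. A \<le> norm u ==> norm (E u) \<le> B * norm u ^ 0"
  "\<And>u. A \<le> norm u ==> norm (F u) \<le> B * norm u ^ 2"
  by (rule even_odd_part_bounds_Infty[of x h q]) (auto simp: E_def F_def)
 obtain e where e: "\<And>z. z \<notin> K ==> E z = (\<Sum>k\<le>0. e k * z ^ k)"
  "\<And>z. z \<in> K ==> (E \<longlongrightarrow> (\<Sum>k\<le>0. e k * z ^ k)) (at z)"
  using Liouville_except_finite[OF K(1) hol(1) lims(1) AB(2)] by metis
 obtain f where f: "\<And>z. z \<notin> K ==> F z = (\<Sum>k\<le>2. f k * z ^ k)"
  "\<And>z. z \<in> K ==> (F \<longlongrightarrow> (\<Sum>k\<le>2. f k * z ^ k)) (at z)"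
  using Liouville_except_finite[OF K(1) hol(2) lims(2) AB(3)] by metis
 have e0: "e 0 = c + c'"
  using e(2)[OF K(2)] even_odd_part_pole_limits(1)[OF assms(3,4) pole]
  unfolding E_def[symmetric] by (auto dest: LIM_unique)
 have "f 0 + f 1 * q + f 2 * q\<^sup>2 = w * (c - c')"
  using f(2)[OF K(2)] even_odd_part_pole_limits(2)[OF assms(3,4) pole]
  unfolding F_def[symmetric] by (auto dest: LIM_unique simp: eval_nat_numeral)
 \<comment> \<open>Eliminating the constant coefficient through the value at \<open>q\<close> allows
   the polynomial to be written in powers of \<open>u - q\<close>.\<close>
 then have f0: "f 0 = w * (c - c') - f 1 * q - f 2 * q\<^sup>2" by (simp add: algebra_simps)
 show thesis
 proof (rule that[of "f 1 + 2 * f 2 * q" "f 2"])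
  fix u v assume uv: "v\<^sup>2 = cubic x u" "v \<noteq> 0" "u \<noteq> q"
  then have "cubic x u \<noteq> 0" by auto
  then have "u \<notin> K" using uv by (auto simp: K_def cubic_eq_0_iff)
  have E: "(u - q)\<^sup>2 * (h (Aff u v) + h (Aff u (- v))) = c + c'"
   using e(1)[OF \<open>u \<notin> K\<close>] e0 even_odd_part(1)[OF uv(1), of h] by (simp add: E_def)
  have "(u - q)\<^sup>2 * (v * (h (Aff u v) - h (Aff u (- v)))) = f 0 + f 1 * u + f 2 * u\<^sup>2"
   using f(1)[OF \<open>u \<notin> K\<close>] even_odd_part(2)[OF uv(1), of h] by (simp add: F_def eval_nat_numeral)
  also have "\<dots> = w * (c - c') + (f 1 + 2 * f 2 * q) * (u - q) + f 2 * (u - q)\<^sup>2"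
   unfolding f0 by (simp add: algebra_simps power2_eq_square)
  finally have "(u - q)\<^sup>2 * (h (Aff u v) - h (Aff u (- v))) =
    (w * (c - c') + (f 1 + 2 * f 2 * q) * (u - q) + f 2 * (u - q)\<^sup>2) / v"
   using uv by (simp add: field_simps)
  moreover have "2 * (r * y) = e + z" if "r * (y + y') = e" "r * (y - y') = z" for r y y' e z :: complex
   using that by (auto simp: algebra_simps)
  ultimately have "2 * ((u - q)\<^sup>2 * h (Aff u v)) =
    c + c' + (w * (c - c') + (f 1 + 2 * f 2 * q) * (u - q) + f 2 * (u - q)\<^sup>2) / v"
   using E by blast
  then show "h (Aff u v) = ((c + c') + (w * (c - c') + (f 1 + 2 * f 2 * q) * (u - q) + f 2 * (u - q)\<^sup>2) / v) / (2 * (u - q)\<^sup>2)"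
   using uv by (simp add: eq_divide_eq mult.commute mult.left_commute)
 qed
qed

section \<open>Paths and integrals on the curve\<close>

text \<open>The local inverse of the projection to \<open>u\<close> that passes through
  \<open>P\<close>. It is used only near \<open>u_of P\<close>, where the quotient under the
  principal root stays off the cut.\<close>

definition branch_pt :: "complex \<Rightarrow> pt \<Rightarrow> complex \<Rightarrow> pt" where
 "branch_pt x P z = Aff z (v_of P * csqrt (cubic x z / cubic x (u_of P)))"

lemma u_of_branch_pt [simp]: "u_of (branch_pt x P z) = z"
 by (simp add: branch_pt_def)

lemma branch_pt_self: "P \<in> unram x ==> branch_pt x P (u_of P) = P"
 by (erule unramE) (simp add: branch_pt_def)

lemma branch_pt:
 assumes "P \<in> unram x" "\<epsilon> > 0"
 obtains \<rho> where "\<rho> > 0" "\<rho> \<le> \<epsilon>"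
  "\<And>z. z \<in> ball (u_of P) \<rho> ==> branch_pt x P z \<in> unram x"
  "(\<lambda>z. v_of (branch_pt x P z)) holomorphic_on ball (u_of P) \<rho>"
  "\<And>z. z \<in> ball (u_of P) \<rho> ==> ((\<lambda>z. v_of (branch_pt x P z)) has_field_derivative
    dcubic x z / (2 * v_of (branch_pt x P z))) (at z)"
proof -
 obtain u v where P: "P = Aff u v" "v\<^sup>2 = cubic x u" "v \<noteq> 0" "cubic x u \<noteq> 0"
  using unramE[OF assms(1)] .
 obtain r where r: "r > 0" "(\<lambda>u'. v * csqrt (cubic x u' / cubic x u)) holomorphic_on ball u r"
  "v * csqrt (cubic x u / cubic x u) = v"
  "\<And>u'. u' \<in> ball u r ==> (v * csqrt (cubic x u' / cubic x u))\<^sup>2 = cubic x u'"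
  "\<And>u'. u' \<in> ball u r ==> v * csqrt (cubic x u' / cubic x u) \<noteq> 0"
  "\<And>u'. u' \<in> ball u r ==> ((\<lambda>u'. v * csqrt (cubic x u' / cubic x u)) has_field_derivative
    dcubic x u' / (2 * (v * csqrt (cubic x u' / cubic x u)))) (at u')"
  by (rule branch[OF P(2,3)]) (rule that)
 show thesis
 proof (rule that[of "min r \<epsilon>"])
  fix z assume z: "z \<in> ball (u_of P) (min r \<epsilon>)"
  have "(v * csqrt (cubic x z / cubic x u))\<^sup>2 = cubic x z" "v * csqrt (cubic x z / cubic x u) \<noteq> 0"
   using r(4,5)[of z] z P by auto
  then show "branch_pt x P z \<in> unram x"
   unfolding branch_pt_def P(1) pt.sel Aff_in_unram by (metis zero_eq_power2)
  show "((\<lambda>z. v_of (branch_pt x P z)) has_field_derivative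
    dcubic x z / (2 * v_of (branch_pt x P z))) (at z)"
   using r(6)[of z] z P by (simp add: branch_pt_def)
 next
  show "(\<lambda>z. v_of (branch_pt x P z)) holomorphic_on ball (u_of P) (min r \<epsilon>)"
   using r(2) P by (auto simp: branch_pt_def intro: holomorphic_on_subset)
 qed (use r assms(2) in auto)
qed

lemma v_of_square: "P \<in> unram x ==> (v_of P)\<^sup>2 = cubic x (u_of P)"
 by (erule unramE) simp

lemma unram_nonzero:
 assumes "P \<in> unram x"
 shows "v_of P \<noteq> 0" "u_of P \<noteq> 0" "u_of P \<noteq> 1" "u_of P \<noteq> x" "P = Aff (u_of P) (v_of P)"
 using assms by (auto elim!: unramE simp: cubic_eq_0_iff)

text \<open>The common part of cycles and of paths from infinity with their initial piece removed.
  The velocity need not be continuous: integrals are evaluated through primitives, as gauge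
  integrals, and for this differentiability off a finite set suffices. The notion is stable under
  \<open>star\<close> and under lifting to other fibres.\<close>

definition curve_path :: "complex \<Rightarrow> (real \<Rightarrow> pt) \<Rightarrow> real \<Rightarrow> real \<Rightarrow> bool" where
 "curve_path x \<gamma> r s \<longleftrightarrow> \<gamma> ` {r..s} \<subseteq> unram x \<and>
   continuous_on {r..s} (\<lambda>t. u_of (\<gamma> t)) \<and> continuous_on {r..s} (\<lambda>t. v_of (\<gamma> t)) \<and>
   (\<exists>S. finite S \<and> (\<forall>t\<in>{r..s} - S. (\<lambda>t. u_of (\<gamma> t)) differentiable at t))"

lemma curve_path_subset: "curve_path x \<gamma> r s ==> r \<le> r' ==> s' \<le> s ==> curve_path x \<gamma> r' s'"
 unfolding curve_path_def
proof (elim conjE exE, intro conjI exI)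
 fix S assume "r \<le> r'" "s' \<le> s" "\<forall>t\<in>{r..s} - S. (\<lambda>t. u_of (\<gamma> t)) differentiable at t"
 then show "\<forall>t\<in>{r'..s'} - S. (\<lambda>t. u_of (\<gamma> t)) differentiable at t" by auto
qed (auto elim: continuous_on_subset)

lemma curve_path_in: "curve_path x \<gamma> r s ==> t \<in> {r..s} ==> \<gamma> t \<in> unram x"
 by (auto simp: curve_path_def)

lemma piecewise_C1_imp_differentiable:
 assumes "f piecewise_C1_differentiable_on {a..b::real}"
 shows "continuous_on {a..b} f" "\<exists>S. finite S \<and> (\<forall>t\<in>{a..b} - S. f differentiable at t)"
 using assms unfolding piecewise_C1_differentiable_on_def C1_differentiable_on_eq by blast+

lemma cycle_on_curve_path: "cycle_on x \<gamma> ==> curve_path x \<gamma> 0 1"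
 using piecewise_C1_imp_differentiable[of "\<lambda>t. u_of (\<gamma> t)" 0 1]
 by (simp add: cycle_on_def curve_path_def valid_path_def)

lemma path_from_infty_curve_path:
 assumes "path_from_infty x \<gamma>" "0 < e"
 shows "curve_path x \<gamma> e 1"
proof -
 define e' where "e' = min e (1/2)"
 have e': "e' \<in> {0<..<1}" "e' \<le> e" using assms(2) by (auto simp: e'_def)
 have "(\<lambda>t. u_of (\<gamma> t)) piecewise_C1_differentiable_on {e'..1}"
  "\<gamma> ` {0<..1} \<subseteq> unram x" "continuous_on {0<..1} (\<lambda>t. v_of (\<gamma> t))"
  using assms(1) e' unfolding path_from_infty_def by blast+
 then have "curve_path x \<gamma> e' 1"
  unfolding curve_path_def
  using piecewise_C1_imp_differentiable[of "\<lambda>t. u_of (\<gamma> t)" e' 1] e'(1)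
  by (intro conjI) (force elim: continuous_on_subset)+
 then show ?thesis using curve_path_subset e'(2) by blast
qed

text \<open>For short times the second coordinate is a continuous root of the cubic, so it agrees
  with the branch through the point at time \<open>t0\<close>. A short piece of the path is thereby
  described by its projection to the \<open>u\<close>-plane.\<close>

lemma path_local_branch:
 assumes "curve_path x \<gamma> r s" "t0 \<in> {r..s}" "\<rho> > 0"
 obtains d where "d > 0"
  "\<And>t. t \<in> {r..s} ==> \<bar>t - t0\<bar> < d ==> u_of (\<gamma> t) \<in> ball (u_of (\<gamma> t0)) \<rho> \<and>
    \<gamma> t = branch_pt x (\<gamma> t0) (u_of (\<gamma> t))"
proof -
 let ?P = "\<gamma> t0" and ?u = "\<lambda>t. u_of (\<gamma> t)" and ?v = "\<lambda>t. v_of (\<gamma> t)"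
 have un: "\<gamma> t \<in> unram x" if "t \<in> {r..s}" for t using assms(1) that by (auto simp: curve_path_def)
 obtain \<rho>' where \<rho>': "\<rho>' > 0" "\<rho>' \<le> \<rho>"
  "\<And>z. z \<in> ball (u_of ?P) \<rho>' ==> branch_pt x ?P z \<in> unram x"
  "(\<lambda>z. v_of (branch_pt x ?P z)) holomorphic_on ball (u_of ?P) \<rho>'"
  using branch_pt[OF un[OF assms(2)] assms(3)] by metis
 have cu: "continuous_on {r..s} ?u" and cv: "continuous_on {r..s} ?v"
  using assms(1) by (auto simp: curve_path_def)
 obtain d where d: "d > 0" "\<And>t. t \<in> {r..s} ==> dist t t0 < d ==> dist (?u t) (?u t0) < \<rho>'"
  using cu assms(2) \<rho>'(1) unfolding continuous_on_iff by metis
 let ?T = "{t \<in> {r..s}. \<bar>t - t0\<bar> < d}"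
 have T: "?T = {r..s} \<inter> {t0-d<..<t0+d}" by (auto simp: abs_less_iff)
 have ball: "?u t \<in> ball (?u t0) \<rho>'" if "t \<in> ?T" for t
  using d(2)[of t] that by (auto simp: dist_real_def dist_commute)
 show thesis
 proof (rule that[OF d(1)])
  fix t assume t: "t \<in> {r..s}" "\<bar>t - t0\<bar> < d"
  then have tT: "t \<in> ?T" by auto
  have "?v t = v_of (branch_pt x ?P (?u t))"
  proof (rule square_roots_agree[of ?T _ _ t0])
   show "connected ?T" unfolding T by (intro is_interval_connected is_interval_Int is_interval_cc is_interval_oo)
   show "continuous_on ?T ?v" by (rule continuous_on_subset[OF cv]) auto
   show "continuous_on ?T (\<lambda>t. v_of (branch_pt x ?P (?u t)))"
    by (rule continuous_on_compose2[OF holomorphic_on_imp_continuous_on[OF \<rho>'(4)]])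
      (use ball in \<open>auto intro: continuous_on_subset[OF cu]\<close>)
   show "?v t0 = v_of (branch_pt x ?P (?u t0))" by (simp only: branch_pt_self[OF un[OF assms(2)]])
   show "(?v z)\<^sup>2 = (v_of (branch_pt x ?P (?u z)))\<^sup>2" "v_of (branch_pt x ?P (?u z)) \<noteq> 0" if "z \<in> ?T" for z
   proof -
    have *: "branch_pt x ?P (?u z) \<in> unram x" using \<rho>'(3) ball[OF that] by auto
    have "\<gamma> z \<in> unram x" using that un by auto
    then show "(?v z)\<^sup>2 = (v_of (branch_pt x ?P (?u z)))\<^sup>2"
     using v_of_square[OF *] by (simp add: v_of_square)
    show "v_of (branch_pt x ?P (?u z)) \<noteq> 0" using unram_nonzero[OF *] by auto
   qed
   show "t0 \<in> ?T" "t \<in> ?T" using d assms(2) tT by auto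
  qed
  then have "\<gamma> t = branch_pt x ?P (?u t)"
   using unram_nonzero(5)[OF un[OF t(1)]] by (simp add: branch_pt_def)
  then show "?u t \<in> ball (?u t0) \<rho> \<and> \<gamma> t = branch_pt x ?P (?u t)"
   using ball[OF tT] \<rho>'(2) by auto
 qed
qed

section \<open>The fundamental theorem and differentiation under the integral along paths\<close>

definition has_u_derivative :: "complex \<Rightarrow> (pt \<Rightarrow> complex) \<Rightarrow> complex \<Rightarrow> pt \<Rightarrow> bool" where
 "has_u_derivative x H D P \<longleftrightarrow>
   ((\<lambda>z. H (branch_pt x P z)) has_field_derivative D) (at (u_of P))"

lemma has_u_derivativeI:
 assumes "P \<in> unram x"
  "\<And>V. V (u_of P) = v_of P ==>
   (V has_field_derivative dcubic x (u_of P) / (2 * v_of P)) (at (u_of P)) ==>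
   ((\<lambda>z. H (Aff z (V z))) has_field_derivative D) (at (u_of P))"
 shows "has_u_derivative x H D P"
proof -
 obtain \<rho> where \<rho>: "\<rho> > 0" "\<And>z. z \<in> ball (u_of P) \<rho> ==> ((\<lambda>z. v_of (branch_pt x P z)) has_field_derivative
    dcubic x z / (2 * v_of (branch_pt x P z))) (at z)"
  using branch_pt[OF assms(1) zero_less_one] by metis
 have "((\<lambda>z. v_of (branch_pt x P z)) has_field_derivative
    dcubic x (u_of P) / (2 * v_of P)) (at (u_of P))"
  using \<rho>(2)[of "u_of P"] \<rho>(1) branch_pt_self[OF assms(1)] by simp
 moreover have "v_of (branch_pt x P (u_of P)) = v_of P" by (simp add: branch_pt_self assms(1))
 moreover have "branch_pt x P z = Aff z (v_of (branch_pt x P z))" for z by (simp add: branch_pt_def)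
 ultimately show ?thesis
  using assms(2)[of "\<lambda>z. v_of (branch_pt x P z)"] unfolding has_u_derivative_def by simp
qed

abbreviation line_integrand :: "(pt \<Rightarrow> complex) \<Rightarrow> (real \<Rightarrow> pt) \<Rightarrow> real \<Rightarrow> complex" where
 "line_integrand h \<gamma> \<equiv> \<lambda>t. h (\<gamma> t) * vector_derivative (\<lambda>\<tau>. u_of (\<gamma> \<tau>)) (at t)"

text \<open>The primitive \<open>H\<close> may change from one time to the next; it is enough that
  near each time \<open>F\<close> is a function of \<open>u\<close> with the right derivative. The
  integral then exists as a gauge integral, whatever the behaviour of the velocity.\<close>

lemma path_FTC_local:
 assumes path: "curve_path x \<gamma> a b" and "a \<le> b" and cont: "continuous_on {a..b} F"
  and der: "\<And>t. t \<in> {a<..<b} ==> \<exists>H \<epsilon>. \<epsilon> > 0 \<and> (\<forall>t'. \<bar>t' - t\<bar> < \<epsilon> \<longrightarrow> F t' = H (u_of (\<gamma> t'))) \<and>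
    (H has_field_derivative h (\<gamma> t)) (at (u_of (\<gamma> t)))"
 shows "(line_integrand h \<gamma> has_integral F b - F a) {a..b}"
proof -
 obtain S where S: "finite S" "\<And>t. t \<in> {a..b} - S ==> (\<lambda>t. u_of (\<gamma> t)) differentiable at t"
  using path unfolding curve_path_def by blast
 show ?thesis
 proof (rule fundamental_theorem_of_calculus_interior_strong[OF S(1) \<open>a \<le> b\<close> _ cont])
  fix t assume t: "t \<in> {a<..<b} - S"
  obtain H \<epsilon> where H: "\<epsilon> > 0" "\<And>t'. \<bar>t' - t\<bar> < \<epsilon> ==> F t' = H (u_of (\<gamma> t'))"
    "(H has_field_derivative h (\<gamma> t)) (at (u_of (\<gamma> t)))" using der[of t] t by auto
  have "(\<lambda>t. u_of (\<gamma> t)) differentiable at t" using S t by auto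
  then have "((\<lambda>t. u_of (\<gamma> t)) has_vector_derivative vector_derivative (\<lambda>\<tau>. u_of (\<gamma> \<tau>)) (at t)) (at t)"
   using vector_derivative_works by blast
  from field_vector_diff_chain_at[OF this H(3)]
  have "((\<lambda>t. H (u_of (\<gamma> t))) has_vector_derivative
    line_integrand h \<gamma> t) (at t)"
   by (simp add: o_def mult.commute)
  then show "(F has_vector_derivative line_integrand h \<gamma> t) (at t)"
   by (rule has_vector_derivative_transform_within[of _ _ _ _ \<epsilon>])
     (use H in \<open>auto simp: dist_real_def\<close>)
 qed
qed

lemma path_FTC:
 assumes path: "curve_path x \<gamma> a b" and "a \<le> b"
  and der: "\<And>t. t \<in> {a..b} ==> has_u_derivative x H (h (\<gamma> t)) (\<gamma> t)"
 shows "(line_integrand h \<gamma> has_integral H (\<gamma> b) - H (\<gamma> a)) {a..b}"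
proof (rule path_FTC_local[OF path \<open>a \<le> b\<close>])
 show "continuous_on {a..b} (\<lambda>t. H (\<gamma> t))"
  unfolding continuous_on_eq_continuous_within
 proof
  fix t0 assume t0: "t0 \<in> {a..b}"
  obtain d where d: "d > 0" "\<And>t. t \<in> {a..b} ==> \<bar>t - t0\<bar> < d ==> \<gamma> t = branch_pt x (\<gamma> t0) (u_of (\<gamma> t))"
   using path_local_branch[OF path t0 zero_less_one] by metis
  have "isCont (\<lambda>z. H (branch_pt x (\<gamma> t0) z)) (u_of (\<gamma> t0))"
   using der[OF t0] unfolding has_u_derivative_def by (rule DERIV_isCont)
  moreover have "continuous (at t0 within {a..b}) (\<lambda>t. u_of (\<gamma> t))"
   using path t0 by (auto simp: curve_path_def continuous_on_eq_continuous_within)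
  ultimately have "continuous (at t0 within {a..b}) (\<lambda>t. H (branch_pt x (\<gamma> t0) (u_of (\<gamma> t))))"
   by (rule continuous_within_compose3)
  then show "continuous (at t0 within {a..b}) (\<lambda>t. H (\<gamma> t))"
   by (rule continuous_transform_within[OF _ d(1) t0]) (use d in \<open>auto simp: dist_real_def\<close>)
 qed
next
 fix t assume t: "t \<in> {a<..<b}"
 then have t': "t \<in> {a..b}" by auto
 obtain d where d: "d > 0" "\<And>t'. t' \<in> {a..b} ==> \<bar>t' - t\<bar> < d ==> \<gamma> t' = branch_pt x (\<gamma> t) (u_of (\<gamma> t'))"
  using path_local_branch[OF path t' zero_less_one] by metis
 show "\<exists>Ha \<epsilon>. \<epsilon> > 0 \<and> (\<forall>t'. \<bar>t' - t\<bar> < \<epsilon> \<longrightarrow> H (\<gamma> t') = Ha (u_of (\<gamma> t'))) \<and>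
    (Ha has_field_derivative h (\<gamma> t)) (at (u_of (\<gamma> t)))"
 proof (intro exI conjI allI impI)
  show "min d (min (t - a) (b - t)) > 0" using d t by auto
  fix t' assume "\<bar>t' - t\<bar> < min d (min (t - a) (b - t))"
  then show "H (\<gamma> t') = H (branch_pt x (\<gamma> t) (u_of (\<gamma> t')))"
   using d(2)[of t'] by (simp add: abs_less_iff)
 qed (use der[OF t'] in \<open>simp add: has_u_derivative_def\<close>)
qed

text \<open>As the velocity may be discontinuous, the parameter derivative is not taken along the
  path itself. On a short piece a primitive shows that the integral equals the one along the chord
  in the \<open>u\<close>-plane, where the integrand is jointly continuous. The Bolzano principle
  joins the pieces, and the parameter neighbourhoods are intersected.\<close>

lemma path_leibniz_local:
 fixes K K' :: "complex \<Rightarrow> pt \<Rightarrow> complex"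
 assumes path: "curve_path x \<gamma> r s" and "r \<le> s"
  and loc: "\<And>t. t \<in> {r..s} ==> \<exists>\<rho>>0. \<exists>X. open X \<and> convex X \<and> y0 \<in> X \<and>
    (\<forall>y\<in>X. (\<lambda>z. K y (branch_pt x (\<gamma> t) z)) holomorphic_on ball (u_of (\<gamma> t)) \<rho>) \<and>
    (\<forall>y\<in>X. (\<lambda>z. K' y (branch_pt x (\<gamma> t) z)) holomorphic_on ball (u_of (\<gamma> t)) \<rho>) \<and>
    (\<forall>y\<in>X. \<forall>z\<in>ball (u_of (\<gamma> t)) \<rho>. ((\<lambda>y. K y (branch_pt x (\<gamma> t) z)) has_field_derivative
      K' y (branch_pt x (\<gamma> t) z)) (at y)) \<and>
    continuous_on (X \<times> ball (u_of (\<gamma> t)) \<rho>) (\<lambda>(y, z). K' y (branch_pt x (\<gamma> t) z))"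
 obtains X where "open X" "convex X" "y0 \<in> X"
  "\<And>y. y \<in> X ==> line_integrand (K y) \<gamma> integrable_on {r..s}"
  "\<And>y. y \<in> X ==> line_integrand (K' y) \<gamma> integrable_on {r..s}"
  "\<And>y. y \<in> X ==> ((\<lambda>y. line_int (K y) \<gamma> r s) has_field_derivative line_int (K' y) \<gamma> r s) (at y)"
proof -
 define PP where "PP a b \<longleftrightarrow> (r \<le> a \<and> b \<le> s \<longrightarrow> (\<exists>X. open X \<and> convex X \<and> y0 \<in> X \<and> (\<forall>y\<in>X.
   line_integrand (K y) \<gamma> integrable_on {a..b} \<and> line_integrand (K' y) \<gamma> integrable_on {a..b} \<and>
   ((\<lambda>y. line_int (K y) \<gamma> a b) has_field_derivative line_int (K' y) \<gamma> a b) (at y))))" for a b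
 have "PP r s"
 proof (rule Bolzano[OF \<open>r \<le> s\<close>])
  fix a b c assume ab: "PP a b" "PP b c" "a \<le> b" "b \<le> c"
  show "PP a c" unfolding PP_def
  proof (intro impI)
   assume ac: "r \<le> a \<and> c \<le> s"
   obtain X1 where X1: "open X1" "convex X1" "y0 \<in> X1" "\<forall>y\<in>X1.
     line_integrand (K y) \<gamma> integrable_on {a..b} \<and> line_integrand (K' y) \<gamma> integrable_on {a..b} \<and>
     ((\<lambda>y. line_int (K y) \<gamma> a b) has_field_derivative line_int (K' y) \<gamma> a b) (at y)"
    using ab ac unfolding PP_def by auto
   obtain X2 where X2: "open X2" "convex X2" "y0 \<in> X2" "\<forall>y\<in>X2.
     line_integrand (K y) \<gamma> integrable_on {b..c} \<and> line_integrand (K' y) \<gamma> integrable_on {b..c} \<and>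
     ((\<lambda>y. line_int (K y) \<gamma> b c) has_field_derivative line_int (K' y) \<gamma> b c) (at y)"
    using ab ac unfolding PP_def by auto
   define X where "X = X1 \<inter> X2"
   have X: "open X" "convex X" "y0 \<in> X" using X1 X2 by (auto simp: X_def intro: convex_Int)
   have 1: "line_integrand (K y) \<gamma> integrable_on {a..b}" "line_integrand (K' y) \<gamma> integrable_on {a..b}"
     "((\<lambda>y. line_int (K y) \<gamma> a b) has_field_derivative line_int (K' y) \<gamma> a b) (at y)"
     "line_integrand (K y) \<gamma> integrable_on {b..c}" "line_integrand (K' y) \<gamma> integrable_on {b..c}"
     "((\<lambda>y. line_int (K y) \<gamma> b c) has_field_derivative line_int (K' y) \<gamma> b c) (at y)" if "y \<in> X" for y
    using X1(4) X2(4) that unfolding X_def by auto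
   have 2: "line_integrand (K y) \<gamma> integrable_on {a..c}" "line_integrand (K' y) \<gamma> integrable_on {a..c}"
    if "y \<in> X" for y
    by (rule Henstock_Kurzweil_Integration.integrable_combine[OF ab(3,4)]; rule 1[OF that])+
   have 3: "line_int (K y) \<gamma> a c = line_int (K y) \<gamma> a b + line_int (K y) \<gamma> b c"
     "line_int (K' y) \<gamma> a c = line_int (K' y) \<gamma> a b + line_int (K' y) \<gamma> b c" if "y \<in> X" for y
    unfolding line_int_def using ab 2[OF that]
    by (auto intro!: Henstock_Kurzweil_Integration.integral_combine[symmetric])
   have 4: "((\<lambda>y. line_int (K y) \<gamma> a b + line_int (K y) \<gamma> b c) has_field_derivative
     line_int (K' y) \<gamma> a b + line_int (K' y) \<gamma> b c) (at y)" if y: "y \<in> X" for y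
    using 1[OF y] by (intro derivative_intros)
   have "((\<lambda>y. line_int (K y) \<gamma> a c) has_field_derivative line_int (K' y) \<gamma> a c) (at y)"
    if y: "y \<in> X" for y
    unfolding 3(2)[OF y]
    by (rule has_field_derivative_transform_within_open[OF 4[OF y] X(1) y]) (simp add: 3)
   with 2 X show "\<exists>X. open X \<and> convex X \<and> y0 \<in> X \<and> (\<forall>y\<in>X. line_integrand (K y) \<gamma> integrable_on {a..c} \<and>
     line_integrand (K' y) \<gamma> integrable_on {a..c} \<and>
     ((\<lambda>y. line_int (K y) \<gamma> a c) has_field_derivative line_int (K' y) \<gamma> a c) (at y))" by blast
  qed
 next
  fix t0 assume t0: "r \<le> t0" "t0 \<le> s"
  let ?u = "\<lambda>t. u_of (\<gamma> t)" and ?B = "branch_pt x (\<gamma> t0)"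
  have "t0 \<in> {r..s}" using t0 by simp
  from loc[OF this] obtain \<rho> X where \<rho>0: "\<rho> > 0" "open X" "convex X" "y0 \<in> X"
    "\<forall>y\<in>X. (\<lambda>z. K y (?B z)) holomorphic_on ball (?u t0) \<rho>"
    "\<forall>y\<in>X. (\<lambda>z. K' y (?B z)) holomorphic_on ball (?u t0) \<rho>"
    "\<forall>y\<in>X. \<forall>z\<in>ball (?u t0) \<rho>. ((\<lambda>y. K y (?B z)) has_field_derivative K' y (?B z)) (at y)"
    "continuous_on (X \<times> ball (?u t0) \<rho>) (\<lambda>(y, z). K' y (?B z))"
   by - (erule exE, erule conjE, erule exE, (erule conjE)+, rule that; assumption)
  note X = \<rho>0(2-4) and \<rho> = \<rho>0(1,5-8)
  have "t0 \<in> {r..s}" using t0 by simp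
  then obtain d where d0: "d > 0" "\<And>t. t \<in> {r..s} ==> \<bar>t - t0\<bar> < d ==>
    ?u t \<in> ball (?u t0) \<rho> \<and> \<gamma> t = ?B (?u t)"
   by (rule path_local_branch[OF path _ \<rho>(1)]) (rule that)
  then have d: "d > 0" "\<And>t. t \<in> {r..s} ==> \<bar>t - t0\<bar> < d ==> ?u t \<in> ball (?u t0) \<rho>"
    "\<And>t. t \<in> {r..s} ==> \<bar>t - t0\<bar> < d ==> \<gamma> t = ?B (?u t)"
   by auto
  have "PP a b" if ab: "a \<le> t0 \<and> t0 \<le> b \<and> b - a < d" for a b
   unfolding PP_def
  proof (intro impI exI[of _ X] conjI X, intro ballI)
   fix y assume rs: "r \<le> a \<and> b \<le> s" and y: "y \<in> X"
   have in_ball: "?u t \<in> ball (?u t0) \<rho>" "\<gamma> t = ?B (?u t)" if "t \<in> {a..b}" for t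
    using d(2)[of t] d(3)[of t] rs that ab by auto
   have "a \<le> b" using ab by simp
   have seg: "closed_segment (?u a) (?u b) \<subseteq> ball (?u t0) \<rho>"
    using in_ball \<open>a \<le> b\<close> by (intro closed_segment_subset convex_ball) auto
   have path': "curve_path x \<gamma> a b" using curve_path_subset[OF path] rs by blast
   \<comment> \<open>Piece and chord have the same end points inside a disc on which the integrand
     has a primitive, so both integrals are the same difference of its values.\<close>
   have key: "(line_integrand h \<gamma> has_integral contour_integral (linepath (?u a) (?u b)) (\<lambda>z. h (?B z))) {a..b}"
    if h: "(\<lambda>z. h (?B z)) holomorphic_on ball (?u t0) \<rho>" for h
   proof -
    obtain G where G: "\<And>z. z \<in> ball (?u t0) \<rho> ==> (G has_field_derivative h (?B z)) (at z within ball (?u t0) \<rho>)"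
     using holomorphic_convex_primitive'[OF convex_ball open_ball h] by metis
    then have G': "(G has_field_derivative h (?B z)) (at z)" if "z \<in> ball (?u t0) \<rho>" for z
     using that by (metis at_within_open open_ball)
    have "((\<lambda>z. h (?B z)) has_contour_integral G (?u b) - G (?u a)) (linepath (?u a) (?u b))"
     using contour_integral_primitive[OF G, of "linepath (?u a) (?u b)"] seg by simp
    then have "contour_integral (linepath (?u a) (?u b)) (\<lambda>z. h (?B z)) = G (?u b) - G (?u a)"
     by (rule contour_integral_unique)
    moreover have "(line_integrand h \<gamma> has_integral G (?u b) - G (?u a)) {a..b}"
    proof (rule path_FTC_local[OF path' \<open>a \<le> b\<close>])
     have "continuous_on (ball (?u t0) \<rho>) G"
      using G' by (meson DERIV_isCont continuous_at_imp_continuous_on)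
     then show "continuous_on {a..b} (\<lambda>t. G (?u t))"
      by (rule continuous_on_compose2) (use path' in_ball in \<open>auto simp: curve_path_def\<close>)
    next
     fix t assume t: "t \<in> {a<..<b}"
     then have "(G has_field_derivative h (\<gamma> t)) (at (?u t))"
      using G'[of "?u t"] in_ball[of t] by auto
     then show "\<exists>H \<epsilon>. \<epsilon> > 0 \<and> (\<forall>t'. \<bar>t' - t\<bar> < \<epsilon> \<longrightarrow> G (?u t') = H (?u t')) \<and>
      (H has_field_derivative h (\<gamma> t)) (at (?u t))"
      by (intro exI[of _ G] exI[of _ 1]) auto
    qed
    ultimately show ?thesis by simp
   qed
   have I: "line_int (K y) \<gamma> a b = contour_integral (linepath (?u a) (?u b)) (\<lambda>z. K y (?B z))"
     "line_int (K' y) \<gamma> a b = contour_integral (linepath (?u a) (?u b)) (\<lambda>z. K' y (?B z))" if "y \<in> X" for y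
    unfolding line_int_def using key[of "K y"] key[of "K' y"] \<rho> that by (auto intro: integral_unique)
   have lp: "linepath (?u a) (?u b) \<tau> \<in> ball (?u t0) \<rho>" if "\<tau> \<in> {0..1}" for \<tau>
    using seg that linepath_in_path by blast
   have C: "contour_integral (linepath (?u a) (?u b)) f =
     integral (cbox 0 1) (\<lambda>\<tau>. f (linepath (?u a) (?u b) \<tau>) * (?u b - ?u a))" for f
    by (simp add: contour_integral_integral)
   have "((\<lambda>y. integral (cbox 0 1) (\<lambda>\<tau>. K y (?B (linepath (?u a) (?u b) \<tau>)) * (?u b - ?u a)))
      has_field_derivative integral (cbox 0 1) (\<lambda>\<tau>. K' y (?B (linepath (?u a) (?u b) \<tau>)) * (?u b - ?u a))) (at y within X)"
   proof (rule leibniz_rule_field_derivative[OF _ _ _ y X(2)])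
    fix y \<tau> assume y: "y \<in> X" and \<tau>: "\<tau> \<in> cbox 0 (1::real)"
    then have "linepath (?u a) (?u b) \<tau> \<in> ball (?u t0) \<rho>" using lp by simp
    then have "((\<lambda>y. K y (?B (linepath (?u a) (?u b) \<tau>))) has_field_derivative
      K' y (?B (linepath (?u a) (?u b) \<tau>))) (at y)" using \<rho>(4) y by blast
    then show "((\<lambda>y. K y (?B (linepath (?u a) (?u b) \<tau>)) * (?u b - ?u a)) has_field_derivative
      K' y (?B (linepath (?u a) (?u b) \<tau>)) * (?u b - ?u a)) (at y within X)"
     by (intro DERIV_cmult_right) (rule has_field_derivative_at_within)
   next
    fix y assume y: "y \<in> X"
    have "continuous_on (cbox 0 1) (\<lambda>\<tau>. K y (?B (linepath (?u a) (?u b) \<tau>)))"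
     by (rule continuous_on_compose2[OF holomorphic_on_imp_continuous_on[OF bspec[OF \<rho>(2) y]]])
       (use lp in \<open>auto intro!: continuous_intros\<close>)
    then show "(\<lambda>\<tau>. K y (?B (linepath (?u a) (?u b) \<tau>)) * (?u b - ?u a)) integrable_on cbox 0 1"
     by (intro integrable_continuous continuous_intros)
   next
    have "continuous_on (X \<times> cbox 0 1) (\<lambda>w. case (fst w, linepath (?u a) (?u b) (snd w)) of (y, z) \<Rightarrow> K' y (?B z))"
     by (rule continuous_on_compose2[OF \<rho>(5)])
       (use lp in \<open>auto intro!: continuous_intros simp: linepath_def\<close>)
    then show "continuous_on (X \<times> cbox 0 1) (\<lambda>(y, \<tau>). K' y (?B (linepath (?u a) (?u b) \<tau>)) * (?u b - ?u a))"
     by (auto simp: case_prod_unfold intro!: continuous_intros)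
   qed
   then have "((\<lambda>y. contour_integral (linepath (?u a) (?u b)) (\<lambda>z. K y (?B z))) has_field_derivative
     contour_integral (linepath (?u a) (?u b)) (\<lambda>z. K' y (?B z))) (at y)"
    unfolding C using at_within_open[OF y X(1)] by simp
   then have "((\<lambda>y. line_int (K y) \<gamma> a b) has_field_derivative line_int (K' y) \<gamma> a b) (at y)"
    unfolding I(2)[OF y] by (rule has_field_derivative_transform_within_open[OF _ X(1) y]) (simp add: I)
   then show "line_integrand (K y) \<gamma> integrable_on {a..b} \<and> line_integrand (K' y) \<gamma> integrable_on {a..b} \<and>
     ((\<lambda>y. line_int (K y) \<gamma> a b) has_field_derivative line_int (K' y) \<gamma> a b) (at y)"
    using key[of "K y"] key[of "K' y"] \<rho> y by (auto intro: has_integral_integrable)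
  qed
  then show "\<exists>d>0. \<forall>a b. a \<le> t0 \<and> t0 \<le> b \<and> b - a < d \<longrightarrow> PP a b" using d(1) by blast
 qed
 then show thesis
  unfolding PP_def using that by blast
qed

text \<open>Integrability is one of the conclusions of \<open>path_leibniz_local\<close>; it is
  extracted from a family that is constant in its parameter.\<close>

lemma path_integrable:
 assumes "curve_path x \<gamma> r s" "r \<le> s"
  and "\<And>t. t \<in> {r..s} ==> \<exists>\<rho>>0. (\<lambda>z. h (branch_pt x (\<gamma> t) z)) holomorphic_on ball (u_of (\<gamma> t)) \<rho>"
 shows "line_integrand h \<gamma> integrable_on {r..s}"
proof -
 have "\<exists>\<rho>>0. \<exists>X. open X \<and> convex X \<and> 0 \<in> X \<and>
    (\<forall>y\<in>X. (\<lambda>z. h (branch_pt x (\<gamma> t) z)) holomorphic_on ball (u_of (\<gamma> t)) \<rho>) \<and>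
    (\<forall>y\<in>X. (\<lambda>z. 0) holomorphic_on ball (u_of (\<gamma> t)) \<rho>) \<and>
    (\<forall>y\<in>X. \<forall>z\<in>ball (u_of (\<gamma> t)) \<rho>. ((\<lambda>y. h (branch_pt x (\<gamma> t) z)) has_field_derivative 0) (at y)) \<and>
    continuous_on (X \<times> ball (u_of (\<gamma> t)) \<rho>) (\<lambda>(y, z). 0 :: complex)" if t: "t \<in> {r..s}" for t
 proof -
  obtain \<rho> where "\<rho> > 0" "(\<lambda>z. h (branch_pt x (\<gamma> t) z)) holomorphic_on ball (u_of (\<gamma> t)) \<rho>"
   using assms(3)[OF t] by blast
  then show ?thesis
   by (intro exI[of _ \<rho>] exI[of _ UNIV] conjI ballI) (simp_all add: holomorphic_on_const)
 qed
 then show ?thesis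
  by (rule path_leibniz_local[OF assms(1,2), of "0::complex" "\<lambda>_. h" "\<lambda>_ _. 0"])
qed

section \<open>The normalised differentials\<close>

lemma u_of_star' [simp]: "u_of (star P) = u_of P"
 by (cases P) auto

lemma v_of_star_unram [simp]: "P \<in> unram x ==> v_of (star P) = - v_of P"
 by (auto elim: unramE)

lemma curve_path_star:
 assumes "curve_path x \<gamma> r s"
 shows "curve_path x (star \<circ> \<gamma>) r s"
proof -
 have "continuous_on {r..s} (\<lambda>t. - v_of (\<gamma> t))"
  using assms by (intro continuous_intros) (auto simp: curve_path_def)
 then have "continuous_on {r..s} (\<lambda>t. v_of ((star \<circ> \<gamma>) t))"
  by (rule continuous_on_eq) (use v_of_star_unram[OF curve_path_in[OF assms]] in simp)
 then show ?thesis
  using assms curve_path_in[OF assms] unfolding curve_path_def by (auto simp: star_in_unram)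
qed

text \<open>For a monic cubic \<open>f\<close>, expansion at \<open>c\<close> gives
  \<open>f'(u) (u - c) - 2 f(u) = (u - c)^3 - 2 f(c) - f'(c) (u - c)\<close>, since the quadratic
  terms cancel. These exact differentials reduce the elliptic integrals that occur to those of
  \<open>du / v\<close> and \<open>du / (u v)\<close>: \<open>c\<close> is taken at the pole to be
  removed, and at 0.\<close>

lemma has_u_derivative_v_over:
 assumes "P \<in> unram x" "u_of P \<noteq> c"
 shows "has_u_derivative x (\<lambda>P. v_of P / (u_of P - c))
  (((u_of P - c) ^ 3 - 2 * cubic x c - dcubic x c * (u_of P - c)) / (2 * v_of P * (u_of P - c)\<^sup>2)) P"
proof (rule has_u_derivativeI[OF assms(1)])
 fix V assume V: "V (u_of P) = v_of P"
  "(V has_field_derivative dcubic x (u_of P) / (2 * v_of P)) (at (u_of P))"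
 note nz = unram_nonzero[OF assms(1)]
 let ?s = "u_of P" and ?t = "v_of P"
 have "((\<lambda>z. V z / (z - c)) has_field_derivative
   (dcubic x ?s / (2 * ?t) * (?s - c) - ?t) / ((?s - c) * (?s - c))) (at ?s)"
  using V assms(2) by (auto intro!: derivative_eq_intros)
 moreover have "(dcubic x ?s / (2 * ?t) * (?s - c) - ?t) / ((?s - c) * (?s - c)) =
   (dcubic x ?s * (?s - c) - 2 * ?t\<^sup>2) / (2 * ?t * (?s - c)\<^sup>2)"
  using nz assms(2) by (simp add: divide_simps power2_eq_square)
 moreover have "dcubic x ?s * (?s - c) - 2 * ?t\<^sup>2 = (?s - c) ^ 3 - 2 * cubic x c - dcubic x c * (?s - c)"
  unfolding v_of_square[OF assms(1)] cubic_def dcubic_def by (simp add: algebra_simps power3_eq_cube)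
 ultimately show "((\<lambda>z. v_of (Aff z (V z)) / (u_of (Aff z (V z)) - c)) has_field_derivative
   ((?s - c) ^ 3 - 2 * cubic x c - dcubic x c * (?s - c)) / (2 * ?t * (?s - c)\<^sup>2)) (at ?s)"
  by simp
qed

lemma has_u_derivative_rational:
 assumes "P \<in> unram x" "(G has_field_derivative D) (at (u_of P))"
 shows "has_u_derivative x (\<lambda>P. G (u_of P)) D P"
 using assms(2) by (intro has_u_derivativeI[OF assms(1)]) simp

lemma has_u_derivative_cong:
 "has_u_derivative x H D P ==> D = D' ==> has_u_derivative x H D' P" by simp

lemma has_u_derivative_add:
 "has_u_derivative x H D P ==> has_u_derivative x H' D' P ==>
  has_u_derivative x (\<lambda>P. H P + H' P) (D + D') P"
 unfolding has_u_derivative_def by (rule DERIV_add)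

lemma has_u_derivative_diff:
 "has_u_derivative x H D P ==> has_u_derivative x H' D' P ==>
  has_u_derivative x (\<lambda>P. H P - H' P) (D - D') P"
 unfolding has_u_derivative_def by (rule DERIV_diff)

lemma has_u_derivative_cmult:
 "has_u_derivative x H D P ==> has_u_derivative x (\<lambda>P. c * H P) (c * D) P"
 unfolding has_u_derivative_def by (rule DERIV_cmult)

lemma path_integrable_over_v:
 assumes "curve_path x \<gamma> r s" "r \<le> s" "\<And>t. t \<in> {r..s} ==> isCont F (u_of (\<gamma> t))"
  and "open O'" "F holomorphic_on O'" "(\<lambda>t. u_of (\<gamma> t)) ` {r..s} \<subseteq> O'"
 shows "line_integrand (\<lambda>P. F (u_of P) / v_of P) \<gamma> integrable_on {r..s}"
proof (rule path_integrable[OF assms(1,2)])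
 fix t assume t: "t \<in> {r..s}"
 then have "u_of (\<gamma> t) \<in> O'" using assms(6) by auto
 then obtain \<epsilon> where \<epsilon>: "\<epsilon> > 0" "ball (u_of (\<gamma> t)) \<epsilon> \<subseteq> O'"
  using \<open>open O'\<close> by (meson open_contains_ball)
 obtain \<rho> where \<rho>: "\<rho> > 0" "\<rho> \<le> \<epsilon>"
  "\<And>z. z \<in> ball (u_of (\<gamma> t)) \<rho> ==> branch_pt x (\<gamma> t) z \<in> unram x"
  "(\<lambda>z. v_of (branch_pt x (\<gamma> t) z)) holomorphic_on ball (u_of (\<gamma> t)) \<rho>"
  using branch_pt[OF curve_path_in[OF assms(1) t] \<epsilon>(1)] by metis
 have "(\<lambda>z. F z / v_of (branch_pt x (\<gamma> t) z)) holomorphic_on ball (u_of (\<gamma> t)) \<rho>"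
  using \<rho> unram_nonzero(1)[OF \<rho>(3)] \<epsilon>(2)
  by (intro holomorphic_intros holomorphic_on_subset[OF assms(5)]) force+
 then show "\<exists>\<rho>>0. (\<lambda>z. F (u_of (branch_pt x (\<gamma> t) z)) / v_of (branch_pt x (\<gamma> t) z))
   holomorphic_on ball (u_of (\<gamma> t)) \<rho>"
  using \<rho>(1) by auto
qed

section \<open>The differentials du / v and du / (u v), and the normalised differentials in terms of
  them\<close>

abbreviation inv_v :: "pt \<Rightarrow> complex" where "inv_v P \<equiv> 1 / v_of P"
abbreviation inv_uv :: "pt \<Rightarrow> complex" where "inv_uv P \<equiv> 1 / (u_of P * v_of P)"

lemma integrable_inv_v:
 assumes "curve_path x \<gamma> r s" "r \<le> s"
 shows "line_integrand inv_v \<gamma> integrable_on {r..s}"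
 using path_integrable_over_v[OF assms, of "\<lambda>_. 1" UNIV] by (simp add: holomorphic_on_const)

lemma integrable_inv_uv:
 assumes "curve_path x \<gamma> r s" "r \<le> s"
 shows "line_integrand inv_uv \<gamma> integrable_on {r..s}"
proof -
 have "u_of (\<gamma> t) \<noteq> 0" if "t \<in> {r..s}" for t
  using unram_nonzero(2)[OF curve_path_in[OF assms(1) that]] .
 then have "line_integrand (\<lambda>P. 1 / u_of P / v_of P) \<gamma> integrable_on {r..s}"
  using assms by (intro path_integrable_over_v[of x _ r s "\<lambda>z. 1 / z" "- {0}"])
   (auto intro!: holomorphic_intros continuous_intros)
 then show ?thesis by (simp add: divide_divide_eq_left)
qed

lemma diff_pole_at_limit:
 assumes "w\<^sup>2 = cubic x q" "w \<noteq> 0" "diff_pole_at x h (Aff q w) n c"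
 shows "((\<lambda>u. (u - q) ^ n * h (branch_pt x (Aff q w) u)) \<longlongrightarrow> c) (at q)"
proof -
 obtain r g where r: "r > 0" "g holomorphic_on ball q r" "g q = c"
  "\<And>u. u \<in> ball q r ==> u \<noteq> q ==>
    (u - q) ^ n * h (Aff u (w * csqrt (cubic x u / cubic x q))) = g u"
  by (rule diff_pole_at_unramE[OF assms]) (rule that)
 have "isCont g q"
  using holomorphic_on_imp_differentiable_at[OF r(2) open_ball, of q] r(1)
  by (simp add: field_differentiable_imp_continuous_at)
 then have "(g \<longlongrightarrow> c) (at q)" using r(3) by (simp add: isCont_def)
 moreover have "eventually (\<lambda>u. g u = (u - q) ^ n * h (branch_pt x (Aff q w) u)) (at q)"
  unfolding eventually_at using r(1,4) by (intro exI[of _ r]) (auto simp: branch_pt_def dist_commute)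
 ultimately show ?thesis by (rule Lim_transform_eventually)
qed

lemma branch_limits:
 assumes "w\<^sup>2 = cubic x q" "w \<noteq> 0"
 defines "V \<equiv> \<lambda>u. v_of (branch_pt x (Aff q w) u)"
 shows "(V \<longlongrightarrow> w) (at q)" "((\<lambda>u. (V u - w) / (u - q)) \<longlongrightarrow> dcubic x q / (2 * w)) (at q)"
  "eventually (\<lambda>u. u \<noteq> q \<and> V u \<noteq> 0 \<and> (V u)\<^sup>2 = cubic x u \<and> branch_pt x (Aff q w) u = Aff u (V u)) (at q)"
proof -
 have un: "Aff q w \<in> unram x" using assms(1,2) by (auto simp: Aff_in_unram)
 obtain \<rho> where \<rho>: "\<rho> > 0"
  "\<And>z. z \<in> ball q \<rho> ==> branch_pt x (Aff q w) z \<in> unram x"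
  "\<And>z. z \<in> ball q \<rho> ==> (V has_field_derivative dcubic x z / (2 * V z)) (at z)"
  using branch_pt[OF un zero_less_one] unfolding V_def pt.sel by metis
 have Vq: "V q = w" using branch_pt_self[OF un] by (simp add: V_def)
 have D: "(V has_field_derivative dcubic x q / (2 * w)) (at q)" using \<rho>(3)[of q] \<rho>(1) Vq by simp
 show "(V \<longlongrightarrow> w) (at q)" using DERIV_isCont[OF D] Vq by (simp add: isCont_def)
 show "((\<lambda>u. (V u - w) / (u - q)) \<longlongrightarrow> dcubic x q / (2 * w)) (at q)"
  using D Vq by (simp add: has_field_derivative_iff)
 have "u \<noteq> q \<and> V u \<noteq> 0 \<and> (V u)\<^sup>2 = cubic x u \<and> branch_pt x (Aff q w) u = Aff u (V u)"
  if "dist u q < \<rho>" "u \<noteq> q" for u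
 proof -
  have *: "branch_pt x (Aff q w) u \<in> unram x" using \<rho>(2)[of u] that by (simp add: dist_commute)
  show ?thesis using unram_nonzero[OF *] v_of_square[OF *] that by (simp add: V_def)
 qed
 then show "eventually (\<lambda>u. u \<noteq> q \<and> V u \<noteq> 0 \<and> (V u)\<^sup>2 = cubic x u \<and> branch_pt x (Aff q w) u = Aff u (V u)) (at q)"
  unfolding eventually_at using \<rho>(1) by blast
qed

text \<open>A simple pole is a double pole with leading coefficient 0, so
  \<open>curve_differential_form\<close> applies with zero leading coefficients, and its
  \<open>p1\<close> is read off from the residue at \<open>(q, w)\<close>. The constant
  \<open>k\<close> is the undetermined multiple of \<open>du / v\<close>.\<close>

lemma simple_pole_form:
 assumes x: "x \<noteq> 0" "x \<noteq> 1" and q: "w\<^sup>2 = cubic x q" "w \<noteq> 0"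
  and holo: "\<And>P. P \<in> curve x ==> u_proj P \<noteq> Some q ==> diff_holo_at x h P"
  and pole: "diff_pole_at x h (Aff q w) 1 c" "diff_pole_at x h (Aff q (- w)) 1 c'"
 obtains k where "\<And>u v. v\<^sup>2 = cubic x u ==> v \<noteq> 0 ==> u \<noteq> q ==>
  h (Aff u v) = (c * w / (u - q) + k) / v"
proof -
 have one_less_numeral: "(1::nat) < 2" by simp
 obtain p1 p2 where p: "\<And>u v. v\<^sup>2 = cubic x u ==> v \<noteq> 0 ==> u \<noteq> q ==>
  h (Aff u v) = ((0 + 0) + (w * (0 - 0) + p1 * (u - q) + p2 * (u - q)\<^sup>2) / v) / (2 * (u - q)\<^sup>2)"
  using curve_differential_form[OF x q holo diff_pole_at_mono[OF pole(1) one_less_numeral] diff_pole_at_mono[OF pole(2) one_less_numeral]]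
  by blast
 have p': "h (Aff u v) = (p1 / (u - q) + p2) / (2 * v)" if "v\<^sup>2 = cubic x u" "v \<noteq> 0" "u \<noteq> q" for u v
  unfolding p[OF that] using that by (simp add: divide_simps) (simp add: algebra_simps power2_eq_square)
 define V where "V u = v_of (branch_pt x (Aff q w) u)" for u
 note V = branch_limits[OF q, folded V_def]
 have "((\<lambda>u. (u - q) ^ 1 * h (branch_pt x (Aff q w) u)) \<longlongrightarrow> c) (at q)"
  by (rule diff_pole_at_limit[OF q pole(1)])
 moreover have "eventually (\<lambda>u. (u - q) ^ 1 * h (branch_pt x (Aff q w) u) =
   (p1 + p2 * (u - q)) / (2 * V u)) (at q)"
  using V(3)
 proof eventually_elim
  case (elim u)
  then have "h (branch_pt x (Aff q w) u) = (p1 / (u - q) + p2) / (2 * V u)" using p'[of "V u" u] by simp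
  then show ?case using elim by (simp add: divide_simps) (simp add: algebra_simps)
 qed
 ultimately have "((\<lambda>u. (p1 + p2 * (u - q)) / (2 * V u)) \<longlongrightarrow> c) (at q)"
  by (rule Lim_transform_eventually)
 moreover have "((\<lambda>u. (p1 + p2 * (u - q)) / (2 * V u)) \<longlongrightarrow> (p1 + p2 * (q - q)) / (2 * w)) (at q)"
  by (intro tendsto_intros V(1)) (use q in auto)
 ultimately have "c = (p1 + p2 * (q - q)) / (2 * w)" by (rule LIM_unique)
 then have p1: "p1 = 2 * c * w" using q by (simp add: field_simps)
 show thesis
 proof (rule that[of "p2 / 2"])
  fix u v :: complex assume uv: "v\<^sup>2 = cubic x u" "v \<noteq> 0" "u \<noteq> q"
  show "h (Aff u v) = (c * w / (u - q) + p2 / 2) / v"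
   unfolding p'[OF uv] p1 using uv by (simp add: field_simps)
 qed
qed

lemma ex_nonbranch_point:
 assumes "finite F"
 obtains q w :: complex where "q \<notin> F" "w\<^sup>2 = cubic x q" "w \<noteq> 0"
proof -
 have "finite ({0, 1, x} \<union> F)" using assms by simp
 from ex_new_if_finite[OF infinite_UNIV_char_0 this]
 obtain q where "q \<notin> {0, 1, x} \<union> F" ..
 then have "q \<notin> F" "cubic x q \<noteq> 0" by (auto simp: cubic_eq_0_iff)
 then show thesis by (intro that[of q "csqrt (cubic x q)"]) simp_all
qed

text \<open>This is \<open>simple_pole_form\<close> with residue 0, except that the formula leaves
  out the points over \<open>q\<close>. Two different values of \<open>q\<close> reach all points,
  and over a third value the two constants are compared.\<close>

lemma holomorphic_differential_form:
 assumes x: "x \<noteq> 0" "x \<noteq> 1" and holo: "\<And>P. P \<in> curve x ==> diff_holo_at x h P"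
 obtains k where "\<And>P. P \<in> unram x ==> h P = k / v_of P"
proof -
 have ex: "\<exists>k. \<forall>u v. v\<^sup>2 = cubic x u \<longrightarrow> v \<noteq> 0 \<longrightarrow> u \<noteq> q \<longrightarrow> h (Aff u v) = k / v"
  if q: "w\<^sup>2 = cubic x q" "w \<noteq> 0" for q w
 proof -
  have 1: "diff_pole_at x h (Aff q w) 1 0" "diff_pole_at x h (Aff q (- w)) 1 0"
   using q by (auto intro!: diff_holo_at_imp_pole_at holo simp: Aff_in_curve)
  obtain k where "\<And>u v. v\<^sup>2 = cubic x u ==> v \<noteq> 0 ==> u \<noteq> q ==> h (Aff u v) = (0 * w / (u - q) + k) / v"
   by (rule simple_pole_form[OF x q holo 1]) (auto intro: that)
  then show ?thesis by auto
 qed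
 obtain q1 w1 where q1: "w1\<^sup>2 = cubic x q1" "w1 \<noteq> 0" using ex_nonbranch_point[of "{}"] by blast
 obtain q2 w2 where q2: "q2 \<notin> {q1}" "w2\<^sup>2 = cubic x q2" "w2 \<noteq> 0" using ex_nonbranch_point[of "{q1}"] by blast
 obtain q3 w3 where q3: "q3 \<notin> {q1, q2}" "w3\<^sup>2 = cubic x q3" "w3 \<noteq> 0" using ex_nonbranch_point[of "{q1, q2}"] by blast
 obtain k1 where k1: "\<And>u v. v\<^sup>2 = cubic x u ==> v \<noteq> 0 ==> u \<noteq> q1 ==> h (Aff u v) = k1 / v"
  using ex[OF q1] by blast
 obtain k2 where k2: "\<And>u v. v\<^sup>2 = cubic x u ==> v \<noteq> 0 ==> u \<noteq> q2 ==> h (Aff u v) = k2 / v"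
  using ex[OF q2(2,3)] by blast
 have "k1 = k2" using k1[OF q3(2,3)] k2[OF q3(2,3)] q3 by auto
 show thesis
 proof (rule that[of k1])
  fix P assume "P \<in> unram x"
  then show "h P = k1 / v_of P"
   using k1 k2 \<open>k1 = k2\<close> q2(1) by (elim unramE) (metis pt.sel(2) singletonI)
 qed
qed

lemma normalized_holomorphic_form:
 assumes x: "x \<noteq> 0" "x \<noteq> 1" and "cycle_on x a" "normalized_holomorphic x a \<omega>"
 shows "period inv_v a \<noteq> 0" "\<And>P. P \<in> unram x ==> \<omega> P = inv_v P / period inv_v a"
proof -
 obtain k where k: "\<And>P. P \<in> unram x ==> \<omega> P = k / v_of P"
  using holomorphic_differential_form[OF x, of \<omega>] assms(4) unfolding normalized_holomorphic_def by metis
 have "1 = period \<omega> a" using assms(4) by (simp add: normalized_holomorphic_def)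
 also have "\<dots> = integral {0..1} (\<lambda>t. k * line_integrand inv_v a t)"
  unfolding period_def line_int_def
  by (rule Henstock_Kurzweil_Integration.integral_cong)
    (use curve_path_in[OF cycle_on_curve_path[OF assms(3)]] k in simp)
 also have "\<dots> = k * period inv_v a"
  unfolding period_def line_int_def by (rule integral_mult_right)
 finally have eq: "k * period inv_v a = 1" ..
 then have "period inv_v a \<noteq> 0" by auto
 moreover from this eq have "k = 1 / period inv_v a" by (simp add: eq_divide_eq)
 ultimately show "period inv_v a \<noteq> 0" "\<And>P. P \<in> unram x ==> \<omega> P = inv_v P / period inv_v a"
  using k by simp_all
qed

text \<open>The leading coefficients are 1 at \<open>P\<close> and 0 at \<open>star P\<close>. The
  linear coefficient is forced by the absence of a simple pole at \<open>star P\<close>, where the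
  branch is \<open>- v0 - dcubic x u0 / (2 * v0) * (s - u0)\<close> to first order. Only
  \<open>p2\<close> stays free; the \<open>a\<close>-period will fix it.\<close>

lemma bidifferential_form:
 assumes x: "x \<noteq> 0" "x \<noteq> 1" and W: "canonical_bidifferential x a W" and P: "Aff u0 v0 \<in> unram x"
 obtains p2 where "\<And>s t. t\<^sup>2 = cubic x s ==> t \<noteq> 0 ==> s \<noteq> u0 ==>
  W (Aff u0 v0) (Aff s t) =
   (1 + (v0 + dcubic x u0 / (2 * v0) * (s - u0) + p2 * (s - u0)\<^sup>2) / t) / (2 * (s - u0)\<^sup>2)"
proof -
 let ?h = "W (Aff u0 v0)"
 have P': "v0\<^sup>2 = cubic x u0" "v0 \<noteq> 0" using P by (auto simp: Aff_in_unram)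
 have P'': "(- v0)\<^sup>2 = cubic x u0" "- v0 \<noteq> 0" using P' by auto
 have holo: "diff_holo_at x ?h R" if "R \<in> curve x" "R \<noteq> Aff u0 v0" for R
  using W P that unfolding canonical_bidifferential_def by blast
 have pole: "diff_pole_at x ?h (Aff u0 v0) 2 1"
  using W P unfolding canonical_bidifferential_def by blast
 have st: "diff_holo_at x ?h (Aff u0 (- v0))" using holo P' by (auto simp: Aff_in_curve)
 have pole': "diff_pole_at x ?h (Aff u0 (- v0)) 2 0" "diff_pole_at x ?h (Aff u0 (- v0)) 1 0"
  using diff_holo_at_imp_pole_at[OF P'' st] by auto
 obtain p1 p2 where p: "\<And>s t. t\<^sup>2 = cubic x s ==> t \<noteq> 0 ==> s \<noteq> u0 ==>
  ?h (Aff s t) = ((1 + 0) + (v0 * (1 - 0) + p1 * (s - u0) + p2 * (s - u0)\<^sup>2) / t) / (2 * (s - u0)\<^sup>2)"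
  by (rule curve_differential_form[OF x P' _ pole pole'(1)]) (auto intro: holo that)
 define V where "V u = v_of (branch_pt x (Aff u0 (- v0)) u)" for u
 note V = branch_limits[OF P'', folded V_def]
 have "((\<lambda>u. (u - u0) ^ 1 * ?h (branch_pt x (Aff u0 (- v0)) u)) \<longlongrightarrow> 0) (at u0)"
  by (rule diff_pole_at_limit[OF P'' pole'(2)])
 moreover have "eventually (\<lambda>u. (u - u0) ^ 1 * ?h (branch_pt x (Aff u0 (- v0)) u) =
   ((V u - (- v0)) / (u - u0) + p1 + p2 * (u - u0)) / (2 * V u)) (at u0)"
  using V(3)
 proof eventually_elim
  case (elim u)
  then have *: "?h (branch_pt x (Aff u0 (- v0)) u) =
    ((1 + 0) + (v0 * (1 - 0) + p1 * (u - u0) + p2 * (u - u0)\<^sup>2) / V u) / (2 * (u - u0)\<^sup>2)" using p[of "V u" u] by simp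
  show ?case unfolding * using elim by (simp add: divide_simps) (simp add: algebra_simps power2_eq_square)
 qed
 ultimately have "((\<lambda>u. ((V u - (- v0)) / (u - u0) + p1 + p2 * (u - u0)) / (2 * V u)) \<longlongrightarrow> 0) (at u0)"
  by (rule Lim_transform_eventually)
 moreover have "((\<lambda>u. ((V u - (- v0)) / (u - u0) + p1 + p2 * (u - u0)) / (2 * V u)) \<longlongrightarrow>
   (dcubic x u0 / (2 * - v0) + p1 + p2 * (u0 - u0)) / (2 * - v0)) (at u0)"
  by (intro tendsto_intros V(1,2)) (use P' in auto)
 ultimately have "0 = (dcubic x u0 / (2 * - v0) + p1 + p2 * (u0 - u0)) / (2 * - v0)" by (rule LIM_unique)
 then have p1: "p1 = dcubic x u0 / (2 * v0)" using P' by (simp add: field_simps)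
 show thesis by (rule that[of p2]) (use p p1 in simp)
qed

text \<open>The functions \<open>1 / (u - u0)\<close> and \<open>v / (u - u0)\<close> account for
  the poles over \<open>u0\<close>, one for each parity in \<open>v\<close>. The second grows like
  the root of \<open>u\<close> at infinity; subtracting \<open>v / u\<close> makes it vanish there,
  at the price of a pole over 0, and this brings in \<open>du / (u v)\<close>.\<close>

lemma bidifferential_primitive:
 assumes x: "x \<noteq> 0" "x \<noteq> 1" and W: "canonical_bidifferential x a W" and P: "Aff u0 v0 \<in> unram x"
 obtains k where "\<And>R. R \<in> unram x ==> u_of R \<noteq> u0 ==>
  has_u_derivative x (\<lambda>R. (-1/2) * (1 / (u_of R - u0)) +
    (- 1 / (2 * v0)) * (v_of R / (u_of R - u0) - v_of R / (u_of R - 0)))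
   (W (Aff u0 v0) R - (x / (4 * v0) * inv_uv R + k / (2 * v0) * inv_v R)) R"
proof -
 obtain p2 where p: "\<And>s t. t\<^sup>2 = cubic x s ==> t \<noteq> 0 ==> s \<noteq> u0 ==>
  W (Aff u0 v0) (Aff s t) =
   (1 + (v0 + dcubic x u0 / (2 * v0) * (s - u0) + p2 * (s - u0)\<^sup>2) / t) / (2 * (s - u0)\<^sup>2)"
  using bidifferential_form[OF x W P] by metis
 have P': "v0\<^sup>2 = cubic x u0" "v0 \<noteq> 0" using P by (auto simp: Aff_in_unram)
 show thesis
 proof (rule that[of "p2 * v0 - u0 / 2"])
  fix R assume R: "R \<in> unram x" "u_of R \<noteq> u0"
  obtain s t where st: "R = Aff s t" "t\<^sup>2 = cubic x s" "t \<noteq> 0" using unramE[OF R(1)] by metis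
  have s: "s \<noteq> 0" "s \<noteq> u0" using unram_nonzero[OF R(1)] R(2) st by auto
  have 1: "has_u_derivative x (\<lambda>R. 1 / (u_of R - u0)) (- 1 / (s - u0)\<^sup>2) R"
   by (rule has_u_derivative_rational[OF R(1)])
     (use st s in \<open>auto intro!: derivative_eq_intros simp: power2_eq_square\<close>)
  note 2 = has_u_derivative_v_over[OF R]
  note 3 = has_u_derivative_v_over[OF R(1), of 0]
  have "u_of R \<noteq> 0" using s st by simp
  note D = has_u_derivative_add[OF has_u_derivative_cmult[OF 1, of "-1/2"]
    has_u_derivative_cmult[OF has_u_derivative_diff[OF 2 3[OF this]], of "- 1 / (2 * v0)"]]
  have c0: "cubic x 0 = 0" "dcubic x 0 = x" by (simp_all add: cubic_def dcubic_def)
  define d where "d = s - u0"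
  have d: "d \<noteq> 0" "s = u0 + d" using s by (auto simp: d_def)
  have eq: "- 1 / 2 * (- 1 / d\<^sup>2) +
    - 1 / (2 * v0) * ((d ^ 3 - 2 * v0\<^sup>2 - D * d) / (2 * t * d\<^sup>2) - (s ^ 3 - 2 * 0 - x * s) / (2 * t * s\<^sup>2)) =
    (1 + (v0 + D / (2 * v0) * d + p2 * d\<^sup>2) / t) / (2 * d\<^sup>2) - (x / (4 * v0) * (1 / (s * t)) + (p2 * v0 - u0 / 2) / (2 * v0) * (1 / t))"
   for D
  proof -
   have a: "(d ^ 3 - 2 * v0\<^sup>2 - D * d) / (2 * t * d\<^sup>2) = d / (2 * t) - v0\<^sup>2 / (t * d\<^sup>2) - D / (2 * t * d)"
    using d st by (simp add: divide_simps) (simp add: algebra_simps power2_eq_square power3_eq_cube)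
   have b: "(s ^ 3 - 2 * 0 - x * s) / (2 * t * s\<^sup>2) = s / (2 * t) - x / (2 * t * s)"
    using s st by (simp add: divide_simps) (simp add: algebra_simps power2_eq_square power3_eq_cube)
   have c: "(1 + (v0 + D / (2 * v0) * d + p2 * d\<^sup>2) / t) / (2 * d\<^sup>2) =
     1 / (2 * d\<^sup>2) + v0 / (2 * t * d\<^sup>2) + D / (4 * v0 * t * d) + p2 / (2 * t)"
    using d st P' by (simp add: divide_simps) (simp add: algebra_simps power2_eq_square power3_eq_cube)
   show ?thesis unfolding a b c using d(1) st P' s
    by (simp add: divide_simps) (simp add: d(2) algebra_simps power2_eq_square power3_eq_cube)
  qed
  show "has_u_derivative x (\<lambda>R. (-1/2) * (1 / (u_of R - u0)) +
    (- 1 / (2 * v0)) * (v_of R / (u_of R - u0) - v_of R / (u_of R - 0)))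
   (W (Aff u0 v0) R - (x / (4 * v0) * inv_uv R + (p2 * v0 - u0 / 2) / (2 * v0) * inv_v R)) R"
   by (rule has_u_derivative_cong[OF D])
     (use eq[of "dcubic x u0"] p[OF st(2,3) s(2)] P'(1) in \<open>simp add: st(1) c0 d_def\<close>)
 qed
qed


section \<open>The differential of the third kind\<close>

lemma curve_path_image_negligible:
 assumes "curve_path x \<gamma> r s"
 shows "negligible ((\<lambda>t. u_of (\<gamma> t)) ` {r..s})"
proof -
 obtain S where S: "finite S" "\<And>t. t \<in> {r..s} - S ==> (\<lambda>t. u_of (\<gamma> t)) differentiable at t"
  using assms unfolding curve_path_def by blast
 \<comment> \<open>A path that is merely continuous could fill an open set; differentiability off a
   finite set confines its projection to a null set, so points off all given paths exist.\<close>
 have "negligible ((\<lambda>t. u_of (\<gamma> t)) ` ({r..s} - S))"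
  by (rule negligible_differentiable_image_lowdim)
    (use S(2) in \<open>auto simp: differentiable_on_def intro: differentiable_at_withinI\<close>)
 moreover have "negligible ((\<lambda>t. u_of (\<gamma> t)) ` S)" using S(1) by (intro negligible_finite) simp
 ultimately have "negligible ((\<lambda>t. u_of (\<gamma> t)) ` ({r..s} - S) \<union> (\<lambda>t. u_of (\<gamma> t)) ` S)"
  by (rule negligible_Un)
 then show ?thesis by (rule negligible_subset) auto
qed

lemma path_from_infty_image_negligible:
 assumes "path_from_infty x \<gamma>"
 shows "negligible ((\<lambda>t. u_of (\<gamma> t)) ` {0<..1})"
proof -
 have "negligible ((\<lambda>t. u_of (\<gamma> t)) ` {inverse (real (Suc n))..1})" for n
  by (rule curve_path_image_negligible[OF path_from_infty_curve_path[OF assms]]) simp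
 then have "negligible (\<Union>n. (\<lambda>t. u_of (\<gamma> t)) ` {inverse (real (Suc n))..1})"
  by (intro negligible_countable_Union) (auto simp del: of_nat_Suc)
 moreover have "(\<lambda>t. u_of (\<gamma> t)) ` {0<..1} \<subseteq> (\<Union>n. (\<lambda>t. u_of (\<gamma> t)) ` {inverse (real (Suc n))..1})"
 proof clarsimp
  fix t :: real assume t: "0 < t" "t \<le> 1"
  obtain n where "inverse (real (Suc n)) < t" using reals_Archimedean[OF t(1)] by blast
  then show "\<exists>n. u_of (\<gamma> t) \<in> (\<lambda>t. u_of (\<gamma> t)) ` {inverse (1 + real n)..1}"
   using t by (intro exI[of _ n] imageI) auto
 qed
 ultimately show ?thesis by (rule negligible_subset)
qed

text \<open>Here \<open>H\<close> is a primitive only up to a combination of the two basic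
  differentials. On a closed path its end values cancel and just their periods survive.\<close>

lemma line_int_FTC:
 assumes path: "curve_path x \<gamma> e 1" "e \<le> 1"
  and D: "\<And>t. t \<in> {e..1} ==> has_u_derivative x H (h (\<gamma> t) - (k1 * inv_uv (\<gamma> t) + k0 * inv_v (\<gamma> t))) (\<gamma> t)"
 shows "(line_integrand h \<gamma> has_integral
   H (\<gamma> 1) - H (\<gamma> e) + (k1 * line_int inv_uv \<gamma> e 1 + k0 * line_int inv_v \<gamma> e 1)) {e..1}"
proof -
 have 1: "(line_integrand (\<lambda>P. h P - (k1 * inv_uv P + k0 * inv_v P)) \<gamma> has_integral H (\<gamma> 1) - H (\<gamma> e)) {e..1}"
  by (rule path_FTC[OF path]) (use D in auto)
 have 2: "((\<lambda>t. k1 * line_integrand inv_uv \<gamma> t + k0 * line_integrand inv_v \<gamma> t) has_integral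
   (k1 * line_int inv_uv \<gamma> e 1 + k0 * line_int inv_v \<gamma> e 1)) {e..1}"
  unfolding line_int_def
  by (intro has_integral_add has_integral_mult_right integrable_integral
    integrable_inv_v[OF path] integrable_inv_uv[OF path])
 show ?thesis
  by (rule has_integral_eq[OF _ has_integral_add[OF 1 2]]) (simp add: algebra_simps)
qed

text \<open>The square of the difference is a rational function of \<open>1 / u\<close> that
  vanishes at 0, so it does not matter which root the path follows.\<close>

lemma v_quotient_tendsto_0:
 assumes "path_from_infty x \<gamma>"
 shows "((\<lambda>e. v_of (\<gamma> e) / (u_of (\<gamma> e) - c) - v_of (\<gamma> e) / (u_of (\<gamma> e) - d)) \<longlongrightarrow> 0) (at_right 0)"
proof -
 define Z where "Z t = v_of (\<gamma> t) / (u_of (\<gamma> t) - c) - v_of (\<gamma> t) / (u_of (\<gamma> t) - d)" for t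
 have inf: "filterlim (\<lambda>t. u_of (\<gamma> t)) at_infinity (at_right 0)" and un: "\<And>t. t \<in> {0<..1} ==> \<gamma> t \<in> unram x"
  using assms by (auto simp: path_from_infty_def)
 have ev1: "eventually (\<lambda>t. t \<in> {0<..1::real}) (at_right 0)"
  unfolding eventually_at_right_field by (intro exI[of _ 1]) auto
 have ev2: "eventually (\<lambda>t. u_of (\<gamma> t) \<notin> {c, d}) (at_right 0)"
 proof -
  have "eventually (\<lambda>z. z \<notin> {c, d}) (at_infinity :: complex filter)"
   unfolding eventually_at_infinity
   by (rule exI[of _ "norm c + norm d + 1"]) (auto, (smt (verit) norm_ge_zero)+)
  then show ?thesis using inf by (rule eventually_compose_filterlim)
 qed
 have w0: "((\<lambda>t. inverse (u_of (\<gamma> t))) \<longlongrightarrow> 0) (at_right 0)"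
  by (rule filterlim_compose[OF tendsto_inverse_0 inf])
 have lim: "((\<lambda>t. (let z = inverse (u_of (\<gamma> t)) in
   (c - d)\<^sup>2 * z * (1 - z) * (1 - x * z) / ((1 - c * z)\<^sup>2 * (1 - d * z)\<^sup>2))) \<longlongrightarrow>
   (c - d)\<^sup>2 * 0 * (1 - 0) * (1 - x * 0) / ((1 - c * 0)\<^sup>2 * (1 - d * 0)\<^sup>2)) (at_right 0)"
  unfolding Let_def by (intro tendsto_intros w0) auto
 have "eventually (\<lambda>t. (let z = inverse (u_of (\<gamma> t)) in
   (c - d)\<^sup>2 * z * (1 - z) * (1 - x * z) / ((1 - c * z)\<^sup>2 * (1 - d * z)\<^sup>2)) =
   (v_of (\<gamma> t) / (u_of (\<gamma> t) - c) - v_of (\<gamma> t) / (u_of (\<gamma> t) - d))\<^sup>2) (at_right 0)"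
  using ev1 ev2
 proof eventually_elim
  case (elim t)
  define u v where "u = u_of (\<gamma> t)" and "v = v_of (\<gamma> t)"
  have u: "u \<noteq> 0" "u \<noteq> c" "u \<noteq> d" using unram_nonzero[OF un[OF elim(1)]] elim(2) by (auto simp: u_def)
  have v: "v\<^sup>2 = u * (u - 1) * (u - x)" using v_of_square[OF un[OF elim(1)]] by (simp add: u_def v_def cubic_def)
  have "v / (u - c) - v / (u - d) = v * (c - d) / ((u - c) * (u - d))" using u by (simp add: field_simps)
  then have "(v / (u - c) - v / (u - d))\<^sup>2 = u * (u - 1) * (u - x) * (c - d)\<^sup>2 / ((u - c)\<^sup>2 * (u - d)\<^sup>2)"
   by (simp add: power_divide power_mult_distrib v)
  moreover have "1 - c * inverse u = (u - c) / u" "1 - d * inverse u = (u - d) / u"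
    "1 - inverse u = (u - 1) / u" "1 - x * inverse u = (u - x) / u" using u by (simp_all add: field_simps)
  moreover have "(c - d)\<^sup>2 * inverse u * ((u - 1) / u) * ((u - x) / u) / (((u - c) / u)\<^sup>2 * ((u - d) / u)\<^sup>2) =
    u * (u - 1) * (u - x) * (c - d)\<^sup>2 / ((u - c)\<^sup>2 * (u - d)\<^sup>2)"
  proof -
   define X Y where "X = u - c" and "Y = u - d"
   have "X \<noteq> 0" "Y \<noteq> 0" using u by (auto simp: X_def Y_def)
   then show ?thesis unfolding X_def[symmetric] Y_def[symmetric]
    using u(1) by (simp add: field_simps power2_eq_square)
  qed
  ultimately show ?case unfolding Let_def u_def[symmetric] v_def[symmetric] by simp
 qed
 then have "((\<lambda>t. (v_of (\<gamma> t) / (u_of (\<gamma> t) - c) - v_of (\<gamma> t) / (u_of (\<gamma> t) - d))\<^sup>2) \<longlongrightarrow>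
   (c - d)\<^sup>2 * 0 * (1 - 0) * (1 - x * 0) / ((1 - c * 0)\<^sup>2 * (1 - d * 0)\<^sup>2)) (at_right 0)"
  by (rule Lim_transform_eventually[OF lim])
 then have "((\<lambda>t. (Z t)\<^sup>2) \<longlongrightarrow> 0) (at_right 0)" unfolding Z_def[symmetric] by simp
 then have "((\<lambda>t. sqrt (norm ((Z t)\<^sup>2))) \<longlongrightarrow> sqrt (norm (0::complex))) (at_right 0)"
  by (intro tendsto_intros)
 then have "((\<lambda>t. norm (Z t)) \<longlongrightarrow> 0) (at_right 0)" by (simp add: norm_power)
 then show ?thesis unfolding Z_def by (rule tendsto_norm_zero_cancel)
qed

text \<open>By \<open>simple_pole_form\<close> only one constant is unknown, so a single value of
  \<open>h\<close> determines it. The point is taken off the cycle, where the vanishing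
  \<open>a\<close>-period fixes the constant in \<open>W\<close>, and off the path and its image
  under \<open>star\<close>, where the value of \<open>h\<close> is an integral of
  \<open>W\<close>.\<close>

proposition third_kind_form:
 assumes x: "x \<noteq> 0" "x \<noteq> 1" and a: "cycle_on x a" and A: "period inv_v a \<noteq> 0"
  and W: "canonical_bidifferential x a W" and h: "third_kind x a W \<gamma> h"
  and \<gamma>: "path_from_infty x \<gamma>" "\<gamma> 1 = Aff q w"
  and J: "has_int_from_infty inv_v \<gamma> J0" "has_int_from_infty inv_uv \<gamma> J1"
  and uv: "v\<^sup>2 = cubic x u" "v \<noteq> 0" "u \<noteq> q"
 shows "h (Aff u v) =
  (w / (u - q) + (w / q + x / 2 * J1 - x / 2 * (period inv_uv a / period inv_v a) * J0)) / v"
proof -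
 let ?C = "\<gamma> ` {0..1} \<union> (star \<circ> \<gamma>) ` {0..1}"
 have h1: "\<And>P. P \<in> curve x - {Aff q w, Aff q (- w)} ==> diff_holo_at x h P"
  "diff_pole_at x h (Aff q w) 1 1" "diff_pole_at x h (Aff q (- w)) 1 (-1)"
  "\<And>P. P \<in> unram x - ?C ==> \<exists>I J.
      has_int_from_infty (W P) \<gamma> I \<and> has_int_from_infty (W P) (star \<circ> \<gamma>) J \<and> h P = I - J"
  using h unfolding third_kind_def Let_def \<gamma>(2) star.simps by blast+
 have un: "\<And>t. t \<in> {0<..1} ==> \<gamma> t \<in> unram x" and g0: "\<gamma> 0 = Infty"
  using \<gamma> by (auto simp: path_from_infty_def)
 have "Aff q w \<in> unram x" using un[of 1] \<gamma>(2) by auto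
 then have q: "w\<^sup>2 = cubic x q" "w \<noteq> 0" "q \<noteq> 0" using unram_nonzero[of "Aff q w" x] by (auto simp: Aff_in_unram)
 obtain k where k: "\<And>u v. v\<^sup>2 = cubic x u ==> v \<noteq> 0 ==> u \<noteq> q ==> h (Aff u v) = (1 * w / (u - q) + k) / v"
  by (rule simple_pole_form[OF x q(1,2) _ h1(2,3)]) (auto intro!: h1(1) that)
 have "negligible ({0, 1, x, q} \<union> (\<lambda>t. u_of (a t)) ` {0..1} \<union> (\<lambda>t. u_of (\<gamma> t)) ` {0<..1})"
  by (intro negligible_Un negligible_finite curve_path_image_negligible[OF cycle_on_curve_path[OF a]]
    path_from_infty_image_negligible[OF \<gamma>(1)]) auto
 then have "{0, 1, x, q} \<union> (\<lambda>t. u_of (a t)) ` {0..1} \<union> (\<lambda>t. u_of (\<gamma> t)) ` {0<..1} \<noteq> UNIV"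
  using non_negligible_UNIV by metis
 then obtain u0 where "u0 \<notin> {0, 1, x, q} \<union> (\<lambda>t. u_of (a t)) ` {0..1} \<union> (\<lambda>t. u_of (\<gamma> t)) ` {0<..1}" by blast
 then have u0: "u0 \<notin> {0, 1, x, q}" "\<And>t. t \<in> {0..1} ==> u_of (a t) \<noteq> u0" "\<And>t. t \<in> {0<..1} ==> u_of (\<gamma> t) \<noteq> u0"
  by blast+
 define v0 where "v0 = csqrt (cubic x u0)"
 have v0: "v0\<^sup>2 = cubic x u0" "v0 \<noteq> 0" using u0(1) by (auto simp: v0_def cubic_eq_0_iff)
 let ?P = "Aff u0 v0"
 have P: "?P \<in> unram x" using v0 by (auto simp: Aff_in_unram)
 obtain k' where k': "\<And>R. R \<in> unram x ==> u_of R \<noteq> u0 ==>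
  has_u_derivative x (\<lambda>R. (-1/2) * (1 / (u_of R - u0)) +
    (- 1 / (2 * v0)) * (v_of R / (u_of R - u0) - v_of R / (u_of R - 0)))
   (W ?P R - (x / (4 * v0) * inv_uv R + k' / (2 * v0) * inv_v R)) R"
  using bidifferential_primitive[OF x W P] by blast
 define H where "H = (\<lambda>R. (-1/2) * (1 / (u_of R - u0)) +
    (- 1 / (2 * v0)) * (v_of R / (u_of R - u0) - v_of R / (u_of R - 0)))"
 note k' = k'[folded H_def]
 have a': "curve_path x a 0 1" by (rule cycle_on_curve_path[OF a])
 have "(line_integrand (W ?P) a has_integral H (a 1) - H (a 0) +
   (x / (4 * v0) * line_int inv_uv a 0 1 + k' / (2 * v0) * line_int inv_v a 0 1)) {0..1}"
  by (rule line_int_FTC[OF a']) (use k' curve_path_in[OF a'] u0(2) in auto)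
 moreover have "a 0 = a 1" using a by (simp add: cycle_on_def)
 ultimately have "period (W ?P) a = x / (4 * v0) * period inv_uv a + k' / (2 * v0) * period inv_v a"
  by (simp add: period_def line_int_def integral_unique)
 moreover have "?P \<notin> a ` {0..1}" using u0(2) by (metis imageE pt.sel(1))
 then have "period (W ?P) a = 0" using W P unfolding canonical_bidifferential_def by blast
 ultimately have "x / 2 * period inv_uv a + k' * period inv_v a = 0" using v0 by (simp add: field_simps)
 then have k'_eq: "k' = - (x / 2) * (period inv_uv a / period inv_v a)"
  using A by (simp add: field_simps add_eq_0_iff)
 have "?P \<notin> ?C"
 proof
  assume "?P \<in> ?C"
  then obtain t where t: "t \<in> {0..1}" "?P = \<gamma> t \<or> ?P = star (\<gamma> t)" by auto
  then have "t \<noteq> 0" using g0 by (intro notI) auto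
  then have "u_of (\<gamma> t) \<noteq> u0" using u0(3) t(1) by auto
  moreover have "u_of (\<gamma> t) = u0" using t(2) by (metis pt.sel(1) u_of_star')
  ultimately show False by simp
 qed
 then obtain I J where IJ: "has_int_from_infty (W ?P) \<gamma> I" "has_int_from_infty (W ?P) (star \<circ> \<gamma>) J"
   "h ?P = I - J" using h1(4)[of ?P] P by blast
 define Y where "Y = (\<lambda>R. v_of R / (u_of R - u0) - v_of R / (u_of R - 0))"
 \<comment> \<open>In the difference of the integrals along the path and along its image under
   \<open>star\<close> the term \<open>1 / (u - u0)\<close> of the primitive drops out and the terms
   odd in \<open>v\<close> double. This is the factor 2 between \<open>x / (4 * v0)\<close> and
   \<open>x / (2 * v0)\<close>.\<close>
 have diff: "line_int (W ?P) \<gamma> e 1 - line_int (W ?P) (star \<circ> \<gamma>) e 1 =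
   (- 1 / v0) * (Y (\<gamma> 1) - Y (\<gamma> e)) + (x / (2 * v0) * line_int inv_uv \<gamma> e 1 + k' / v0 * line_int inv_v \<gamma> e 1)"
  if e: "0 < e" "e < 1" for e
 proof -
  have p: "curve_path x \<gamma> e 1" by (rule path_from_infty_curve_path[OF \<gamma>(1) e(1)])
  have "(line_integrand (W ?P) \<gamma> has_integral H (\<gamma> 1) - H (\<gamma> e) +
   (x / (4 * v0) * line_int inv_uv \<gamma> e 1 + k' / (2 * v0) * line_int inv_v \<gamma> e 1)) {e..1}"
   by (rule line_int_FTC[OF p]) (use e k' un u0(3) in auto)
  then have 1: "line_int (W ?P) \<gamma> e 1 = H (\<gamma> 1) - H (\<gamma> e) +
   (x / (4 * v0) * line_int inv_uv \<gamma> e 1 + k' / (2 * v0) * line_int inv_v \<gamma> e 1)"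
   by (simp add: line_int_def integral_unique)
  have p': "curve_path x (star \<circ> \<gamma>) e 1" by (rule curve_path_star[OF p])
  have "(line_integrand (W ?P) (star \<circ> \<gamma>) has_integral H ((star \<circ> \<gamma>) 1) - H ((star \<circ> \<gamma>) e) +
   (x / (4 * v0) * line_int inv_uv (star \<circ> \<gamma>) e 1 + k' / (2 * v0) * line_int inv_v (star \<circ> \<gamma>) e 1)) {e..1}"
  proof (rule line_int_FTC[OF p'])
   fix t assume "t \<in> {e..1}"
   then have "star (\<gamma> t) \<in> unram x" "u_of (star (\<gamma> t)) \<noteq> u0"
    using e un[of t] u0(3)[of t] by (auto simp: star_in_unram)
   from k'[OF this] show "has_u_derivative x H (W ?P ((star \<circ> \<gamma>) t) -
     (x / (4 * v0) * inv_uv ((star \<circ> \<gamma>) t) + k' / (2 * v0) * inv_v ((star \<circ> \<gamma>) t))) ((star \<circ> \<gamma>) t)"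
    unfolding o_apply .
  qed (use e in simp)
  then have 2: "line_int (W ?P) (star \<circ> \<gamma>) e 1 = H (star (\<gamma> 1)) - H (star (\<gamma> e)) +
   (x / (4 * v0) * line_int inv_uv (star \<circ> \<gamma>) e 1 + k' / (2 * v0) * line_int inv_v (star \<circ> \<gamma>) e 1)"
   by (simp add: line_int_def integral_unique)
  have neg: "line_int inv_v (star \<circ> \<gamma>) e 1 = - line_int inv_v \<gamma> e 1"
    "line_int inv_uv (star \<circ> \<gamma>) e 1 = - line_int inv_uv \<gamma> e 1"
   unfolding line_int_def integral_neg[symmetric]
   by (rule Henstock_Kurzweil_Integration.integral_cong; use v_of_star_unram[OF un] e in simp)+
  have Hs: "H R - H (star R) = (- 1 / v0) * Y R" if "R \<in> unram x" for R
  proof -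
   have YR: "Y (star R) = - Y R" using that by (simp add: Y_def)
   have HR: "H R = (-1/2) * (1 / (u_of R - u0)) + (- 1 / (2 * v0)) * Y R" for R
    by (simp only: H_def Y_def)
   show ?thesis unfolding HR[of R] HR[of "star R"] YR u_of_star' using v0(2) by (simp add: field_simps)
  qed
  have "\<gamma> 1 \<in> unram x" "\<gamma> e \<in> unram x" using un e by auto
  from this[THEN Hs]
  have "H (\<gamma> 1) = H (star (\<gamma> 1)) + (- 1 / v0) * Y (\<gamma> 1)" "H (\<gamma> e) = H (star (\<gamma> e)) + (- 1 / v0) * Y (\<gamma> e)"
   by (simp_all add: diff_eq_eq add.commute)
  moreover have "x / (2 * v0) = 2 * (x / (4 * v0))" "k' / v0 = 2 * (k' / (2 * v0))" by simp_all
  moreover have "(h1 + c * y1) - (h2 + c * y2) + (a * L1 + b * L0) - (h1 - h2 + (a * - L1 + b * - L0)) =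
    c * (y1 - y2) + (2 * a * L1 + 2 * b * L0)" for h1 h2 c y1 y2 a b L1 L0 :: complex
   by (simp add: algebra_simps)
  ultimately show ?thesis unfolding 1 2 neg by (simp only:)
 qed
 have "((\<lambda>e. line_int (W ?P) \<gamma> e 1 - line_int (W ?P) (star \<circ> \<gamma>) e 1) \<longlongrightarrow> I - J) (at_right 0)"
  using IJ unfolding has_int_from_infty_def by (intro tendsto_diff)
 moreover have "eventually (\<lambda>e. line_int (W ?P) \<gamma> e 1 - line_int (W ?P) (star \<circ> \<gamma>) e 1 =
   (- 1 / v0) * (Y (\<gamma> 1) - Y (\<gamma> e)) + (x / (2 * v0) * line_int inv_uv \<gamma> e 1 + k' / v0 * line_int inv_v \<gamma> e 1)) (at_right 0)"
  unfolding eventually_at_right_field using diff by (intro exI[of _ 1]) auto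
 ultimately have "((\<lambda>e. (- 1 / v0) * (Y (\<gamma> 1) - Y (\<gamma> e)) + (x / (2 * v0) * line_int inv_uv \<gamma> e 1 + k' / v0 * line_int inv_v \<gamma> e 1)) \<longlongrightarrow> I - J) (at_right 0)"
  by (rule Lim_transform_eventually)
 moreover have "((\<lambda>e. (- 1 / v0) * (Y (\<gamma> 1) - Y (\<gamma> e)) + (x / (2 * v0) * line_int inv_uv \<gamma> e 1 + k' / v0 * line_int inv_v \<gamma> e 1)) \<longlongrightarrow>
   (- 1 / v0) * (Y (\<gamma> 1) - 0) + (x / (2 * v0) * J1 + k' / v0 * J0)) (at_right 0)"
  using J v_quotient_tendsto_0[OF \<gamma>(1), of u0 0] unfolding has_int_from_infty_def Y_def
  by (intro tendsto_intros)
 ultimately have "I - J = (- 1 / v0) * (Y (\<gamma> 1) - 0) + (x / (2 * v0) * J1 + k' / v0 * J0)"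
  by (rule tendsto_unique[rotated]) simp
 then have "h ?P = (w / (u0 - q) + w / q + x / 2 * J1 + k' * J0) / v0"
 proof -
  define d where "d = u0 - q"
  have d: "d \<noteq> 0" "q - u0 = - d" using u0(1) by (auto simp: d_def)
  have "I - J = (w / d + w / q + x / 2 * J1 + k' * J0) / v0"
   unfolding \<open>I - J = _\<close> Y_def \<gamma>(2) pt.sel d(2) using v0(2) q(3) d(1)
   by (simp add: divide_simps) (simp add: algebra_simps)
  then show ?thesis using IJ(3) by (simp add: d_def)
 qed
 moreover have "h ?P = (1 * w / (u0 - q) + k) / v0" using k[OF v0] u0(1) by simp
 ultimately have "k = w / q + x / 2 * J1 + k' * J0" using v0(2) by (simp add: add.assoc)
 then show ?thesis unfolding k[OF uv] k'_eq by simp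
qed

section \<open>The Legendre relation\<close>

text \<open>The divided difference of the cubic, as a polynomial so that it keeps its meaning at
  \<open>s = u\<close>.\<close>

definition divdiff :: "complex \<Rightarrow> complex \<Rightarrow> complex \<Rightarrow> complex" where
 "divdiff x u s = s\<^sup>2 + s * u + u\<^sup>2 - (1 + x) * (s + u) + x"

lemma divdiff: "(s - u) * divdiff x u s = cubic x s - cubic x u"
 by (simp add: divdiff_def cubic_def algebra_simps power2_eq_square)

text \<open>In \<open>R\<close> this is the differential
  \<open>(v_P + v_R) / (2 v_R (u_R - u_P)) du_R\<close>, with residue 1 at \<open>P\<close> and its
  other pole at infinity. At \<open>R = star P\<close> the quotient reads 0 / 0 though it is regular
  there; \<open>divdiff\<close> gives a formula valid at that point. One of the two formulas is
  regular wherever \<open>P\<close> and \<open>R\<close> differ.\<close>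

definition kern :: "complex \<Rightarrow> pt \<Rightarrow> pt \<Rightarrow> complex" where
 "kern x P R =
   (if v_of P \<noteq> v_of R then - divdiff x (u_of P) (u_of R) / (2 * v_of R * (v_of P - v_of R))
   else (v_of P + v_of R) / (2 * v_of R * (u_of R - u_of P)))"

text \<open>The derivative of \<open>kern\<close> with respect to \<open>u_P\<close> as
  \<open>P\<close> moves along the curve; \<open>v'\<close> is the derivative of \<open>v\<close> on
  the branch, and the cases are those of \<open>kern\<close>.\<close>

definition kern_deriv :: "complex \<Rightarrow> pt \<Rightarrow> pt \<Rightarrow> complex" where
 "kern_deriv x P R =
   (let u = u_of P; v = v_of P; s = u_of R; t = v_of R; v' = dcubic x u / (2 * v) in
   if v \<noteq> t then - (s + 2 * u - (1 + x)) / (2 * t * (v - t)) + divdiff x u s * v' / (2 * t * (v - t)\<^sup>2)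
   else (v' * (s - u) + (v + t)) / (2 * t * (s - u)\<^sup>2))"

lemma kern_alt:
 assumes "P \<in> unram x" "R \<in> unram x" "u_of P \<noteq> u_of R"
 shows "kern x P R = (v_of P + v_of R) / (2 * v_of R * (u_of R - u_of P))"
proof (cases "v_of P = v_of R")
 case False
 have "(u_of R - u_of P) * divdiff x (u_of P) (u_of R) = - (v_of P + v_of R) * (v_of P - v_of R)"
  unfolding divdiff using v_of_square[OF assms(1)] v_of_square[OF assms(2)]
  by (simp add: algebra_simps power2_eq_square)
 then have D: "divdiff x (u_of P) (u_of R) = - (v_of P + v_of R) * (v_of P - v_of R) / (u_of R - u_of P)"
  using assms(3) by (simp add: eq_divide_eq mult.commute)
 have "- (- p * e / d) / (2 * t * e) = p / (2 * t * d)" if "e \<noteq> 0" for p e d t :: complex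
  using that by simp
 note aux = this
 have "kern x P R = - (- (v_of P + v_of R) * (v_of P - v_of R) / (u_of R - u_of P)) / (2 * v_of R * (v_of P - v_of R))"
  using False unfolding D[symmetric] by (simp add: kern_def)
 also have "\<dots> = (v_of P + v_of R) / (2 * v_of R * (u_of R - u_of P))"
  by (rule aux) (use False in simp)
 finally show ?thesis .
qed (simp add: kern_def)

lemma kern_deriv_alt:
 assumes "P \<in> unram x" "R \<in> unram x" "u_of P \<noteq> u_of R"
 shows "kern_deriv x P R = (dcubic x (u_of P) / (2 * v_of P) * (u_of R - u_of P) + (v_of P + v_of R)) /
  (2 * v_of R * (u_of R - u_of P)\<^sup>2)"
proof (cases "v_of P = v_of R")
 case False
 define u v s t v' D where defs: "u = u_of P" "v = v_of P" "s = u_of R" "t = v_of R"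
  "v' = dcubic x u / (2 * v)" "D = divdiff x u s"
 define d e where de: "d = s - u" "e = v - t"
 have nz: "v \<noteq> 0" "t \<noteq> 0" "d \<noteq> 0" "e \<noteq> 0"
  using unram_nonzero(1-4)[OF assms(1)] unram_nonzero(1-4)[OF assms(2)] False assms(3) by (auto simp: defs de)
 have "d * D = - (v + t) * e"
  unfolding de defs(6) divdiff using v_of_square[OF assms(1)] v_of_square[OF assms(2)]
  by (simp add: defs algebra_simps power2_eq_square)
 then have D: "D = - (v + t) * e / d" using nz by (simp add: eq_divide_eq mult.commute)
 have "d * (s + 2 * u - (1 + x)) = D - dcubic x u"
  by (simp add: de defs(6) divdiff_def dcubic_def algebra_simps power2_eq_square)
 moreover have "dcubic x u = 2 * v * v'" using nz by (simp add: defs(5))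
 ultimately have Du: "s + 2 * u - (1 + x) = (D - 2 * v * v') / d" using nz by (simp add: eq_divide_eq mult.commute)
 have "kern_deriv x P R = - ((D - 2 * v * v') / d) / (2 * t * e) + D * v' / (2 * t * e\<^sup>2)"
 proof -
  have "kern_deriv x P R = - (s + 2 * u - (1 + x)) / (2 * t * e) + D * v' / (2 * t * e\<^sup>2)"
   using False unfolding de by (simp add: kern_deriv_def Let_def defs)
  then show ?thesis unfolding Du .
 qed
 also have "\<dots> = (v' * d + (v + t)) / (2 * t * d\<^sup>2)"
 proof -
  have "v = t + e" by (simp add: de)
  then show ?thesis unfolding D using nz
   by (simp add: divide_simps) (simp add: algebra_simps power2_eq_square)
 qed
 finally show ?thesis by (simp add: defs de)
qed (simp add: kern_deriv_def Let_def)

text \<open>In the sum of the kernels for \<open>P\<close> and \<open>star P\<close> the part odd in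
  \<open>v_P\<close> cancels. Near a crossing the kernel with pole at \<open>star P\<close> is
  regular, so the singular behaviour is that of \<open>1 / (u_R - u_P)\<close>, free of any
  root.\<close>

lemma kern_star:
 assumes "P \<in> unram x" "R \<in> unram x" "u_of P \<noteq> u_of R"
 shows "kern x P R = 1 / (u_of R - u_of P) - kern x (star P) R"
proof -
 have aux: "(v + t) / (2 * t * d) = 1 / d - (- v + t) / (2 * t * d)" if "t \<noteq> 0" "d \<noteq> 0" for v t d :: complex
  using that by (simp add: divide_simps)
 have "kern x (star P) R = (- v_of P + v_of R) / (2 * v_of R * (u_of R - u_of P))"
  using kern_alt[of "star P" x R] assms by (simp add: star_in_unram)
 then show ?thesis
  unfolding kern_alt[OF assms] using aux[OF unram_nonzero(1)[OF assms(2)], of "u_of R - u_of P" "v_of P"] assms(3)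
  by simp
qed

text \<open>Distinct points differ in \<open>v\<close> or in \<open>u\<close>; accordingly one of
  the two formulas for the kernel has a nonvanishing denominator near \<open>(P, R)\<close>, and it
  supplies holomorphy, derivative and joint continuity.\<close>

lemma kern_leibniz_local:
 assumes P: "P \<in> unram x" and R: "R \<in> unram x" and "P \<noteq> R"
 shows "\<exists>\<rho>>0. \<exists>X. open X \<and> convex X \<and> u_of P \<in> X \<and>
   (\<forall>y\<in>X. (\<lambda>z. kern x (branch_pt x P y) (branch_pt x R z)) holomorphic_on ball (u_of R) \<rho>) \<and>
   (\<forall>y\<in>X. (\<lambda>z. kern_deriv x (branch_pt x P y) (branch_pt x R z)) holomorphic_on ball (u_of R) \<rho>) \<and>
   (\<forall>y\<in>X. \<forall>z\<in>ball (u_of R) \<rho>. ((\<lambda>y. kern x (branch_pt x P y) (branch_pt x R z)) has_field_derivative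
     kern_deriv x (branch_pt x P y) (branch_pt x R z)) (at y)) \<and>
   continuous_on (X \<times> ball (u_of R) \<rho>) (\<lambda>(y, z). kern_deriv x (branch_pt x P y) (branch_pt x R z))"
proof -
 define v where "v y = v_of (branch_pt x P y)" for y
 define t where "t z = v_of (branch_pt x R z)" for z
 obtain r1 where r1: "r1 > 0" "\<And>z. z \<in> ball (u_of P) r1 ==> branch_pt x P z \<in> unram x"
  "v holomorphic_on ball (u_of P) r1"
  "\<And>z. z \<in> ball (u_of P) r1 ==> (v has_field_derivative dcubic x z / (2 * v z)) (at z)"
  using branch_pt[OF P zero_less_one] unfolding v_def by metis
 obtain r2 where r2: "r2 > 0" "\<And>z. z \<in> ball (u_of R) r2 ==> branch_pt x R z \<in> unram x"
  "t holomorphic_on ball (u_of R) r2"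
  using branch_pt[OF R zero_less_one] unfolding t_def by metis
 have cv: "continuous_on (ball (u_of P) r1) v" and ct: "continuous_on (ball (u_of R) r2) t"
  using r1(3) r2(3) by (auto intro: holomorphic_on_imp_continuous_on)
 have v0: "v (u_of P) = v_of P" and t0: "t (u_of R) = v_of R"
  by (simp_all add: v_def t_def branch_pt_self P R)
 have vu: "v_of (branch_pt x P y) = v y" "v_of (branch_pt x R y) = t y" for y by (simp_all add: v_def t_def)
 have vnz: "v y \<noteq> 0" if "y \<in> ball (u_of P) r1" for y using unram_nonzero(1)[OF r1(2)[OF that]] by (simp add: v_def)
 have tnz: "t y \<noteq> 0" if "y \<in> ball (u_of R) r2" for y using unram_nonzero(1)[OF r2(2)[OF that]] by (simp add: t_def)
 have DD: "((\<lambda>y. divdiff x y z) has_field_derivative z + 2 * y - (1 + x)) (at y)" for y z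
  unfolding divdiff_def by (auto intro!: derivative_eq_intros)
 have hD: "(\<lambda>z. divdiff x y z) holomorphic_on A" for y A
  unfolding divdiff_def by (intro holomorphic_intros)
 have cD: "continuous_on A (\<lambda>w. divdiff x (fst w) (snd w))" for A
  unfolding divdiff_def by (intro continuous_intros)
 have cdc: "continuous_on A (\<lambda>w. dcubic x (fst w))" for A :: "(complex \<times> complex) set"
  unfolding dcubic_def by (intro continuous_intros)
 show ?thesis
 proof (cases "v_of P = v_of R")
  case False
  \<comment> \<open>Half the distance of the two values of \<open>v\<close>: if each varies by less
    than \<open>e\<close>, they stay different.\<close>
  define e where "e = norm (v_of P - v_of R) / 2"
  have e: "e > 0" using False by (simp add: e_def)
  obtain d1 where d1: "d1 > 0" "\<And>y. y \<in> ball (u_of P) r1 ==> dist y (u_of P) < d1 ==> dist (v y) (v_of P) < e"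
   using cv r1(1) e v0 unfolding continuous_on_iff by (metis centre_in_ball)
  obtain d2 where d2: "d2 > 0" "\<And>y. y \<in> ball (u_of R) r2 ==> dist y (u_of R) < d2 ==> dist (t y) (v_of R) < e"
   using ct r2(1) e t0 unfolding continuous_on_iff by (metis centre_in_ball)
  define X where "X = ball (u_of P) (min r1 d1)"
  define \<rho> where "\<rho> = min r2 d2"
  have ne: "v y \<noteq> t z" if "y \<in> X" "z \<in> ball (u_of R) \<rho>" for y z
  proof
   assume eq: "v y = t z"
   have "dist (v y) (v_of P) < e" "dist (t z) (v_of R) < e"
    using d1(2)[of y] d2(2)[of z] that by (auto simp: X_def \<rho>_def dist_commute)
   then have "dist (v_of P) (v_of R) < e + e" unfolding eq
    by (smt (verit) dist_commute dist_triangle)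
   then show False by (simp add: e_def dist_norm)
  qed
  have sub: "X \<subseteq> ball (u_of P) r1" "ball (u_of R) \<rho> \<subseteq> ball (u_of R) r2" by (auto simp: X_def \<rho>_def)
  have K: "kern x (branch_pt x P y) (branch_pt x R z) = - divdiff x y z / (2 * t z * (v y - t z))"
   "kern_deriv x (branch_pt x P y) (branch_pt x R z) =
    - (z + 2 * y - (1 + x)) / (2 * t z * (v y - t z)) +
     divdiff x y z * (dcubic x y / (2 * v y)) / (2 * t z * (v y - t z)\<^sup>2)"
   if "y \<in> X" "z \<in> ball (u_of R) \<rho>" for y z
   using ne[OF that] by (simp_all add: kern_def kern_deriv_def vu Let_def)
  have ht: "t holomorphic_on ball (u_of R) \<rho>" by (rule holomorphic_on_subset[OF r2(3) sub(2)])
  have nz: "2 * t z * (v y - t z) \<noteq> 0" if "y \<in> X" "z \<in> ball (u_of R) \<rho>" for y z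
   using ne[OF that] tnz[of z] sub that by auto
  show ?thesis
  proof (intro exI[of _ \<rho>] exI[of _ X] conjI ballI)
   fix y assume y: "y \<in> X"
   have "(\<lambda>z. - divdiff x y z / (2 * t z * (v y - t z))) holomorphic_on ball (u_of R) \<rho>"
    using nz[OF y] by (intro holomorphic_intros ht hD) auto
   then show "(\<lambda>z. kern x (branch_pt x P y) (branch_pt x R z)) holomorphic_on ball (u_of R) \<rho>"
    by (rule holomorphic_transform) (simp only: K[OF y])
   have "(\<lambda>z. - (z + 2 * y - (1 + x)) / (2 * t z * (v y - t z)) +
     divdiff x y z * (dcubic x y / (2 * v y)) / (2 * t z * (v y - t z)\<^sup>2)) holomorphic_on ball (u_of R) \<rho>"
    using nz[OF y] by (intro holomorphic_intros ht hD) auto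
   then show "(\<lambda>z. kern_deriv x (branch_pt x P y) (branch_pt x R z)) holomorphic_on ball (u_of R) \<rho>"
    by (rule holomorphic_transform) (simp only: K[OF y])
   fix z assume z: "z \<in> ball (u_of R) \<rho>"
   have "((\<lambda>y. - divdiff x y z / (2 * t z * (v y - t z))) has_field_derivative
     kern_deriv x (branch_pt x P y) (branch_pt x R z)) (at y)"
   proof -
    note nz' = nz[OF y z]
    have "((\<lambda>y. - divdiff x y z / (2 * t z * (v y - t z))) has_field_derivative
     (- (z + 2 * y - (1 + x)) * (2 * t z * (v y - t z)) -
       - divdiff x y z * (2 * t z * (dcubic x y / (2 * v y) - 0))) /
     (2 * t z * (v y - t z) * (2 * t z * (v y - t z)))) (at y)"
     using y sub nz[OF y z]
     by (intro DERIV_divide DERIV_minus DD DERIV_cmult DERIV_diff r1(4) DERIV_const) auto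
    note D = this
    have "(- G * (2 * t * e) - - D * (2 * t * (v' - 0))) / (2 * t * e * (2 * t * e)) =
      - G / (2 * t * e) + D * v' / (2 * t * e\<^sup>2)" if "2 * t * e \<noteq> 0" for G t e D v' :: complex
     using that by (simp add: divide_simps) (simp add: algebra_simps power2_eq_square)
    note eq = this
    show ?thesis unfolding K[OF y z] by (rule D[unfolded eq[OF nz']])
   qed
   then show "((\<lambda>y. kern x (branch_pt x P y) (branch_pt x R z)) has_field_derivative
     kern_deriv x (branch_pt x P y) (branch_pt x R z)) (at y)"
    by (rule has_field_derivative_transform_within_open[of _ _ _ X])
     (use y z K in \<open>auto simp: X_def\<close>)
  next
   have "continuous_on (X \<times> ball (u_of R) \<rho>) (\<lambda>w. v (fst w))"
    by (rule continuous_on_compose2[OF cv]) (use sub in \<open>auto intro!: continuous_intros\<close>)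
   moreover have "continuous_on (X \<times> ball (u_of R) \<rho>) (\<lambda>w. t (snd w))"
    by (rule continuous_on_compose2[OF ct]) (use sub in \<open>auto intro!: continuous_intros\<close>)
   ultimately have "continuous_on (X \<times> ball (u_of R) \<rho>) (\<lambda>w. - (snd w + 2 * fst w - (1 + x)) / (2 * t (snd w) * (v (fst w) - t (snd w))) +
     divdiff x (fst w) (snd w) * (dcubic x (fst w) / (2 * v (fst w))) / (2 * t (snd w) * (v (fst w) - t (snd w))\<^sup>2))"
    using nz vnz sub by (intro continuous_intros cD cdc) (auto simp: subset_iff)
   then show "continuous_on (X \<times> ball (u_of R) \<rho>) (\<lambda>(y, z). kern_deriv x (branch_pt x P y) (branch_pt x R z))"
    by (rule continuous_on_eq) (use K(2) in auto)
  qed (use r1 r2 d1 d2 in \<open>auto simp: X_def \<rho>_def\<close>)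
 next
  case True
  then have us: "u_of P \<noteq> u_of R"
   using \<open>P \<noteq> R\<close> unram_nonzero(5)[OF P] unram_nonzero(5)[OF R] by metis
  define e where "e = dist (u_of P) (u_of R) / 2"
  have e: "e > 0" using us by (simp add: e_def)
  define X where "X = ball (u_of P) (min r1 e)"
  define \<rho> where "\<rho> = min r2 e"
  have ne: "y \<noteq> z" if "y \<in> X" "z \<in> ball (u_of R) \<rho>" for y z
  proof
   assume "y = z"
   then have "dist (u_of P) (u_of R) < e + e" using that
    by (auto simp: X_def \<rho>_def) (smt (verit) dist_commute dist_triangle)
   then show False by (simp add: e_def)
  qed
  have sub: "X \<subseteq> ball (u_of P) r1" "ball (u_of R) \<rho> \<subseteq> ball (u_of R) r2" by (auto simp: X_def \<rho>_def)
  have K: "kern x (branch_pt x P y) (branch_pt x R z) = (v y + t z) / (2 * t z * (z - y))"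
   "kern_deriv x (branch_pt x P y) (branch_pt x R z) =
    (dcubic x y / (2 * v y) * (z - y) + (v y + t z)) / (2 * t z * (z - y)\<^sup>2)"
   if "y \<in> X" "z \<in> ball (u_of R) \<rho>" for y z
  proof -
   have "branch_pt x P y \<in> unram x" "branch_pt x R z \<in> unram x"
    using that sub r1(2) r2(2) by auto
   from kern_alt[OF this] kern_deriv_alt[OF this] ne[OF that]
   show "kern x (branch_pt x P y) (branch_pt x R z) = (v y + t z) / (2 * t z * (z - y))"
   "kern_deriv x (branch_pt x P y) (branch_pt x R z) =
    (dcubic x y / (2 * v y) * (z - y) + (v y + t z)) / (2 * t z * (z - y)\<^sup>2)"
    by (simp_all add: vu)
  qed
  have ht: "t holomorphic_on ball (u_of R) \<rho>" by (rule holomorphic_on_subset[OF r2(3) sub(2)])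
  have nz: "t z * (z - y) \<noteq> 0" if "y \<in> X" "z \<in> ball (u_of R) \<rho>" for y z
   using ne[OF that] tnz[of z] sub that by auto
  show ?thesis
  proof (intro exI[of _ \<rho>] exI[of _ X] conjI ballI)
   fix y assume y: "y \<in> X"
   have "(\<lambda>z. (v y + t z) / (2 * t z * (z - y))) holomorphic_on ball (u_of R) \<rho>"
    using nz[OF y] by (intro holomorphic_intros ht) auto
   then show "(\<lambda>z. kern x (branch_pt x P y) (branch_pt x R z)) holomorphic_on ball (u_of R) \<rho>"
    by (rule holomorphic_transform) (simp only: K[OF y])
   have "(\<lambda>z. (dcubic x y / (2 * v y) * (z - y) + (v y + t z)) / (2 * t z * (z - y)\<^sup>2)) holomorphic_on ball (u_of R) \<rho>"
    using nz[OF y] by (intro holomorphic_intros ht) auto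
   then show "(\<lambda>z. kern_deriv x (branch_pt x P y) (branch_pt x R z)) holomorphic_on ball (u_of R) \<rho>"
    by (rule holomorphic_transform) (simp only: K[OF y])
   fix z assume z: "z \<in> ball (u_of R) \<rho>"
   have "((\<lambda>y. (v y + t z) / (2 * t z * (z - y))) has_field_derivative
     kern_deriv x (branch_pt x P y) (branch_pt x R z)) (at y)"
   proof -
    note nz' = nz[OF y z]
    have "((\<lambda>y. (v y + t z) / (2 * t z * (z - y))) has_field_derivative
     ((dcubic x y / (2 * v y) + 0) * (2 * t z * (z - y)) -
       (v y + t z) * (2 * t z * (0 - 1))) / (2 * t z * (z - y) * (2 * t z * (z - y)))) (at y)"
     using y sub nz[OF y z]
     by (intro DERIV_divide DERIV_add DERIV_cmult DERIV_diff r1(4) DERIV_const DERIV_ident) auto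
    note D = this
    have "((v' + 0) * (2 * t * e) - p * (2 * t * (0 - 1))) / (2 * t * e * (2 * t * e)) =
      (v' * e + p) / (2 * t * e\<^sup>2)" if "t * e \<noteq> 0" for t e p v' :: complex
     using that by (simp add: divide_simps) (simp add: algebra_simps power2_eq_square)
    note eq = this
    show ?thesis unfolding K[OF y z] by (rule D[unfolded eq[OF nz']])
   qed
   then show "((\<lambda>y. kern x (branch_pt x P y) (branch_pt x R z)) has_field_derivative
     kern_deriv x (branch_pt x P y) (branch_pt x R z)) (at y)"
    by (rule has_field_derivative_transform_within_open[of _ _ _ X])
     (use y z K in \<open>auto simp: X_def\<close>)
  next
   have "continuous_on (X \<times> ball (u_of R) \<rho>) (\<lambda>w. v (fst w))"
    by (rule continuous_on_compose2[OF cv]) (use sub in \<open>auto intro!: continuous_intros\<close>)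
   moreover have "continuous_on (X \<times> ball (u_of R) \<rho>) (\<lambda>w. t (snd w))"
    by (rule continuous_on_compose2[OF ct]) (use sub in \<open>auto intro!: continuous_intros\<close>)
   ultimately have "continuous_on (X \<times> ball (u_of R) \<rho>) (\<lambda>w. (dcubic x (fst w) / (2 * v (fst w)) * (snd w - fst w) + (v (fst w) + t (snd w))) / (2 * t (snd w) * (snd w - fst w)\<^sup>2))"
    using nz vnz sub by (intro continuous_intros cdc) (auto simp: subset_iff)
   then show "continuous_on (X \<times> ball (u_of R) \<rho>) (\<lambda>(y, z). kern_deriv x (branch_pt x P y) (branch_pt x R z))"
    by (rule continuous_on_eq) (use K(2) in auto)
  qed (use r1 r2 e in \<open>auto simp: X_def \<rho>_def\<close>)
 qed
qed

lemma kern_path_leibniz: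
 assumes "curve_path x \<gamma> r s" "r \<le> s" "P \<in> unram x" "P \<notin> \<gamma> ` {r..s}"
 obtains X where "open X" "convex X" "u_of P \<in> X"
  "\<And>y. y \<in> X ==> line_integrand (kern x (branch_pt x P y)) \<gamma> integrable_on {r..s}"
  "\<And>y. y \<in> X ==> ((\<lambda>y. line_int (kern x (branch_pt x P y)) \<gamma> r s) has_field_derivative
    line_int (kern_deriv x (branch_pt x P y)) \<gamma> r s) (at y)"
proof -
 note loc = kern_leibniz_local[OF assms(3) curve_path_in[OF assms(1)]]
 show thesis
  by (rule path_leibniz_local[OF assms(1,2), of "u_of P" "\<lambda>y. kern x (branch_pt x P y)" "\<lambda>y. kern_deriv x (branch_pt x P y)", OF loc])
    (use assms(4) that in auto)
qed

lemma kern_integrable: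
 assumes "curve_path x \<gamma> r s" "r \<le> s" "P \<in> unram x" "P \<notin> \<gamma> ` {r..s}"
 shows "line_integrand (kern x P) \<gamma> integrable_on {r..s}"
proof -
 obtain X where "u_of P \<in> X"
  "\<And>y. y \<in> X ==> line_integrand (kern x (branch_pt x P y)) \<gamma> integrable_on {r..s}"
  using kern_path_leibniz[OF assms] by metis
 from this(2)[OF this(1)] show ?thesis by (simp only: branch_pt_self[OF assms(3)])
qed

lemma has_u_derivative_transform:
 assumes "has_u_derivative x H D P" "P \<in> unram x" "open U" "u_of P \<in> U"
  "\<And>R. R \<in> unram x ==> u_of R \<in> U ==> H R = H' R"
 shows "has_u_derivative x H' D P"
proof -
 obtain \<rho> where \<rho>: "\<rho> > 0" "\<And>z. z \<in> ball (u_of P) \<rho> ==> branch_pt x P z \<in> unram x"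
  using branch_pt[OF assms(2) zero_less_one] by metis
 show ?thesis
  unfolding has_u_derivative_def
  by (rule has_field_derivative_transform_within_open[OF assms(1)[unfolded has_u_derivative_def], of "U \<inter> ball (u_of P) \<rho>"])
    (use assms \<rho> in auto)
qed

text \<open>The product \<open>- (v_R / v_P) * kern x P R\<close> is the kernel with
  \<open>P\<close> and \<open>R\<close> exchanged. This is the interchange law of such kernels: the
  derivative in the pole and the derivative of the exchanged kernel in \<open>R\<close> differ only
  by an exact term and the two basic differentials. The case \<open>u_P = u_R\<close>, that is
  \<open>R = star P\<close>, goes through the formula with \<open>divdiff\<close>.\<close>

lemma kern_deriv_primitive:
 assumes P: "P \<in> unram x" and R: "R \<in> unram x" and ne: "P \<noteq> R"
 shows "has_u_derivative x (\<lambda>R. - (v_of R / v_of P) * kern x P R + 1 / (2 * v_of P) * (v_of R / (u_of R - 0)))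
  (kern_deriv x P R - (x / (4 * v_of P) * inv_uv R + - u_of P / (4 * v_of P) * inv_v R)) R"
proof -
 define u v s t where defs: "u = u_of P" "v = v_of P" "s = u_of R" "t = v_of R"
 note nzP = unram_nonzero(1-4)[OF P, folded defs] and nzR = unram_nonzero(1-4)[OF R, folded defs]
 have sqv: "v\<^sup>2 = cubic x u" and sqt: "t\<^sup>2 = cubic x s" using v_of_square P R by (simp_all add: defs)
 have c0: "cubic x 0 = 0" "dcubic x 0 = x" by (simp_all add: cubic_def dcubic_def)
 show ?thesis
 proof (cases "u = s")
  case False
  have 1: "has_u_derivative x (\<lambda>R. 1 / (u_of R - u)) (- 1 / (s - u)\<^sup>2) R"
   by (rule has_u_derivative_rational[OF R])
     (use False in \<open>auto intro!: derivative_eq_intros simp: power2_eq_square defs\<close>)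
  have 2: "has_u_derivative x (\<lambda>P. v_of P / (u_of P - u))
    (((s - u) ^ 3 - 2 * cubic x u - dcubic x u * (s - u)) / (2 * t * (s - u)\<^sup>2)) R"
   using has_u_derivative_v_over[OF R, of u] False by (simp add: defs)
  have 3: "has_u_derivative x (\<lambda>P. v_of P / (u_of P - 0)) ((s ^ 3 - x * s) / (2 * t * s\<^sup>2)) R"
   using has_u_derivative_v_over[OF R, of 0] nzR by (simp add: defs c0)
  note D = has_u_derivative_add[OF has_u_derivative_add[OF has_u_derivative_cmult[OF 1, of "-1/2"]
    has_u_derivative_cmult[OF 2, of "- 1 / (2 * v)"]] has_u_derivative_cmult[OF 3, of "1 / (2 * v)"]]
  have "has_u_derivative x (\<lambda>R. - (v_of R / v_of P) * kern x P R + 1 / (2 * v_of P) * (v_of R / (u_of R - 0)))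
    (- 1 / 2 * (- 1 / (s - u)\<^sup>2) + - 1 / (2 * v) * (((s - u) ^ 3 - 2 * cubic x u - dcubic x u * (s - u)) / (2 * t * (s - u)\<^sup>2)) +
     1 / (2 * v) * ((s ^ 3 - x * s) / (2 * t * s\<^sup>2))) R"
  proof (rule has_u_derivative_transform[OF D R, of "- {u}"])
   fix R' assume R': "R' \<in> unram x" "u_of R' \<in> - {u}"
   have k: "kern x P R' = (v + v_of R') / (2 * v_of R' * (u_of R' - u))"
    using kern_alt[OF P R'(1)] R'(2) by (auto simp: defs)
   show "- 1 / 2 * (1 / (u_of R' - u)) + - 1 / (2 * v) * (v_of R' / (u_of R' - u)) +
      1 / (2 * v) * (v_of R' / (u_of R' - 0)) =
     - (v_of R' / v_of P) * kern x P R' + 1 / (2 * v_of P) * (v_of R' / (u_of R' - 0))"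
    unfolding k defs(2)[symmetric] using unram_nonzero(1-4)[OF R'(1)] R'(2) nzP
     by (simp add: divide_simps) (simp add: algebra_simps)
  qed (use False defs in auto)
  then show ?thesis
  proof (rule has_u_derivative_cong)
   define d where "d = s - u"
   have d: "d \<noteq> 0" using False by (simp add: d_def)
   have s: "s = u + d" by (simp add: d_def)
   have kd: "kern_deriv x P R = (dcubic x u / (2 * v) * d + (v + t)) / (2 * t * d\<^sup>2)"
    using kern_deriv_alt[OF P R] False by (simp add: defs d_def)
   have a: "- 1 / (2 * v) * ((d ^ 3 - 2 * cubic x u - dcubic x u * d) / (2 * t * d\<^sup>2)) =
     - d / (4 * v * t) + v / (2 * t * d\<^sup>2) + dcubic x u / (4 * v * t * d)"
    unfolding sqv[symmetric] using nzP nzR d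
    by (simp add: divide_simps) (simp add: algebra_simps power2_eq_square power3_eq_cube)
   have b: "1 / (2 * v) * ((s ^ 3 - x * s) / (2 * t * s\<^sup>2)) = s / (4 * v * t) - x / (4 * v * t * s)"
    using nzP nzR by (simp add: divide_simps) (simp add: algebra_simps power2_eq_square power3_eq_cube)
   have c: "kern_deriv x P R = dcubic x u / (4 * v * t * d) + v / (2 * t * d\<^sup>2) + 1 / (2 * d\<^sup>2)"
    unfolding kd using nzP nzR d by (simp add: divide_simps) (simp add: algebra_simps power2_eq_square)
   have e: "s / (4 * v * t) = d / (4 * v * t) + u / (4 * v * t)"
    by (simp add: s add_divide_distrib)
   have "x / (4 * v) * (1 / (s * t)) = x / (4 * v * t * s)" "- u / (4 * v) * (1 / t) = - (u / (4 * v * t))"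
    by simp_all
   then show "- 1 / 2 * (- 1 / (s - u)\<^sup>2) + - 1 / (2 * v) * (((s - u) ^ 3 - 2 * cubic x u - dcubic x u * (s - u)) / (2 * t * (s - u)\<^sup>2)) +
     1 / (2 * v) * ((s ^ 3 - x * s) / (2 * t * s\<^sup>2)) =
    kern_deriv x P R - (x / (4 * v_of P) * inv_uv R + - u_of P / (4 * v_of P) * inv_v R)"
    unfolding d_def[symmetric] defs[symmetric] a b c e by (simp only:) simp
  qed
 next
  case True
  have "t \<noteq> v" using True ne nzP nzR defs by (metis unram_nonzero(5)[OF P] unram_nonzero(5)[OF R])
  then have t: "t = - v" using True sqv sqt by (metis power2_eq_iff)
  have ds: "((\<lambda>z. divdiff x u z) has_field_derivative 2 * s + u - (1 + x)) (at s)"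
   unfolding divdiff_def by (auto intro!: derivative_eq_intros)
  show ?thesis
  proof (rule has_u_derivativeI[OF R])
   fix V assume V: "V (u_of R) = v_of R" "(V has_field_derivative dcubic x (u_of R) / (2 * v_of R)) (at (u_of R))"
   note V = V[folded defs]
   have "isCont V s" by (rule DERIV_isCont[OF V(2)])
   then have "(V \<longlongrightarrow> t) (at s)" using V(1) by (simp add: isCont_def)
   then have "eventually (\<lambda>z. V z \<noteq> v) (at s)" using \<open>t \<noteq> v\<close> by (rule tendsto_imp_eventually_ne)
   then have "eventually (\<lambda>z. V z \<noteq> v) (nhds s)" using V(1) \<open>t \<noteq> v\<close>
    by (auto simp: eventually_at_filter elim: eventually_mono)
   moreover have "eventually (\<lambda>z. V z \<noteq> 0) (nhds s)"
    using tendsto_imp_eventually_ne[OF \<open>(V \<longlongrightarrow> t) (at s)\<close> nzR(1)] V(1) nzR(1)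
    by (auto simp: eventually_at_filter elim: eventually_mono)
   ultimately have ev: "eventually (\<lambda>z. - (v_of (Aff z (V z)) / v_of P) * kern x P (Aff z (V z)) + 1 / (2 * v_of P) * (v_of (Aff z (V z)) / (u_of (Aff z (V z)) - 0)) =
     divdiff x u z / (2 * v * (v - V z)) + V z / (2 * v * z)) (nhds s)"
   proof eventually_elim
    case (elim z)
    then have "kern x P (Aff z (V z)) = - divdiff x u z / (2 * V z * (v - V z))" by (simp add: kern_def defs)
    then show ?case using elim nzP by (simp add: defs[symmetric])
   qed
   have kd: "kern_deriv x P R = - (s + 2 * u - (1 + x)) / (2 * t * (v - t)) + divdiff x u s * (dcubic x u / (2 * v)) / (2 * t * (v - t)\<^sup>2)"
    using \<open>t \<noteq> v\<close> by (simp add: kern_deriv_def Let_def defs[symmetric])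
   define F where "F = dcubic x u"
   have F: "divdiff x u s = F" by (simp add: True[symmetric] F_def divdiff_def dcubic_def algebra_simps power2_eq_square)
   have "((\<lambda>z. divdiff x u z / (2 * v * (v - V z)) + V z / (2 * v * z)) has_field_derivative
     ((2 * s + u - (1 + x)) * (2 * v * (v - V s)) - divdiff x u s * (2 * v * (0 - dcubic x s / (2 * t)))) / (2 * v * (v - V s) * (2 * v * (v - V s))) +
     (dcubic x s / (2 * t) * (2 * v * s) - V s * (2 * v * 1)) / (2 * v * s * (2 * v * s))) (at s)"
    by (intro DERIV_add DERIV_divide DERIV_cmult DERIV_diff ds V(2) DERIV_const DERIV_ident)
     (use nzP nzR \<open>t \<noteq> v\<close> V(1) in auto)
   moreover have "((2 * s + u - (1 + x)) * (2 * v * (v - V s)) - divdiff x u s * (2 * v * (0 - dcubic x s / (2 * t)))) / (2 * v * (v - V s) * (2 * v * (v - V s))) +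
     (dcubic x s / (2 * t) * (2 * v * s) - V s * (2 * v * 1)) / (2 * v * s * (2 * v * s)) =
     kern_deriv x P R - (x / (4 * v) * (1 / (s * t)) + - u / (4 * v) * (1 / t))"
   proof -
    have e1: "V u = - v" "s = u" "dcubic x s = F" using V(1) t True by (auto simp: F_def)
    have "F * u - 2 * v\<^sup>2 = u ^ 3 - x * u"
     unfolding sqv F_def by (simp add: cubic_def dcubic_def algebra_simps power2_eq_square power3_eq_cube)
    then have e2: "F = (u ^ 3 - x * u + 2 * v\<^sup>2) / u" using nzP by (simp add: field_simps)
    have a: "((2 * u + u - (1 + x)) * (2 * v * (v - - v)) - F * (2 * v * (0 - F / (2 * - v)))) / (2 * v * (v - - v) * (2 * v * (v - - v))) =
      (3 * u - (1 + x)) / (4 * v\<^sup>2) - F\<^sup>2 / (16 * v ^ 4)"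
     using nzP by (simp add: divide_simps) (simp add: algebra_simps eval_nat_numeral)
    have b: "- (u + 2 * u - (1 + x)) / (2 * - v * (v - - v)) + F * (F / (2 * v)) / (2 * - v * (v - - v)\<^sup>2) =
      (3 * u - (1 + x)) / (4 * v\<^sup>2) - F\<^sup>2 / (16 * v ^ 4)"
     using nzP by (simp add: divide_simps) (simp add: algebra_simps eval_nat_numeral)
    have c: "(F / (2 * - v) * (2 * v * u) - - v * (2 * v * 1)) / (2 * v * u * (2 * v * u)) =
      - (x / (4 * v) * (1 / (u * - v)) + - u / (4 * v) * (1 / - v))"
     unfolding e2 using nzP by (simp add: divide_simps) (simp add: algebra_simps eval_nat_numeral)
    show ?thesis
     unfolding kd F e1(3) F_def[symmetric] unfolding e1(2) t e1(1) a b c by simp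
   qed
   ultimately have "((\<lambda>z. divdiff x u z / (2 * v * (v - V z)) + V z / (2 * v * z)) has_field_derivative
     kern_deriv x P R - (x / (4 * v) * (1 / (s * t)) + - u / (4 * v) * (1 / t))) (at s)" by simp
   then show "((\<lambda>z. - (v_of (Aff z (V z)) / v_of P) * kern x P (Aff z (V z)) + 1 / (2 * v_of P) * (v_of (Aff z (V z)) / (u_of (Aff z (V z)) - 0)))
     has_field_derivative kern_deriv x P R - (x / (4 * v_of P) * inv_uv R + - u_of P / (4 * v_of P) * inv_v R)) (at (u_of R))"
    unfolding defs[symmetric] by (subst DERIV_cong_ev[OF refl _ refl]) (use ev in \<open>simp_all add: defs\<close>)
  qed
 qed
qed

lemma closed_path_kern_deriv:
 assumes b: "cycle_on x b" and P: "P \<in> unram x" "P \<notin> b ` {0..1}"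
 shows "line_int (kern_deriv x P) b 0 1 =
  x / (4 * v_of P) * period inv_uv b + - u_of P / (4 * v_of P) * period inv_v b"
proof -
 have p: "curve_path x b 0 1" by (rule cycle_on_curve_path[OF b])
 define H where "H = (\<lambda>R. - (v_of R / v_of P) * kern x P R + 1 / (2 * v_of P) * (v_of R / (u_of R - 0)))"
 have "(line_integrand (kern_deriv x P) b has_integral H (b 1) - H (b 0) +
   (x / (4 * v_of P) * line_int inv_uv b 0 1 + - u_of P / (4 * v_of P) * line_int inv_v b 0 1)) {0..1}"
 proof (rule line_int_FTC[OF p])
  fix t :: real assume t: "t \<in> {0..1}"
  then have "P \<noteq> b t" using P(2) by auto
  from kern_deriv_primitive[OF P(1) curve_path_in[OF p t] this]
  show "has_u_derivative x H (kern_deriv x P (b t) - (x / (4 * v_of P) * inv_uv (b t) + - u_of P / (4 * v_of P) * inv_v (b t))) (b t)"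
   unfolding H_def .
 qed simp
 moreover have "b 0 = b 1" using b by (simp add: cycle_on_def)
 ultimately show ?thesis by (simp add: period_def line_int_def integral_unique)
qed

section \<open>Periods of the kernel as functions of its pole\<close>

definition abel_sum :: "complex \<Rightarrow> (real \<Rightarrow> pt) \<Rightarrow> pt \<Rightarrow> complex" where
 "abel_sum x b P = line_int (kern x P) b 0 1 + period inv_v b / 2 * (v_of P / u_of P)"

text \<open>The differential of \<open>abel_sum\<close> in the position of the pole. Differentiating
  the kernel integral alone produces \<open>u du / v\<close>; the term with \<open>v / u\<close> in
  \<open>abel_sum\<close> trades it for \<open>du / (u v)\<close>.\<close>

definition abel_form :: "complex \<Rightarrow> (real \<Rightarrow> pt) \<Rightarrow> pt \<Rightarrow> complex" where
 "abel_form x b P = x / 4 * (period inv_uv b * inv_v P - period inv_v b * inv_uv P)"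

lemma abel_sum_deriv:
 assumes b: "cycle_on x b" and P: "P \<in> unram x" "P \<notin> b ` {0..1}"
 obtains \<epsilon> where "\<epsilon> > 0"
  "\<And>y. y \<in> ball (u_of P) \<epsilon> ==> branch_pt x P y \<in> unram x"
  "\<And>y. y \<in> ball (u_of P) \<epsilon> ==> ((\<lambda>y. abel_sum x b (branch_pt x P y)) has_field_derivative
    abel_form x b (branch_pt x P y)) (at y)"
proof -
 have p: "curve_path x b 0 1" by (rule cycle_on_curve_path[OF b])
 obtain X where X: "open X" "convex X" "u_of P \<in> X"
  "\<And>y. y \<in> X ==> ((\<lambda>y. line_int (kern x (branch_pt x P y)) b 0 1) has_field_derivative
    line_int (kern_deriv x (branch_pt x P y)) b 0 1) (at y)"
  by (rule kern_path_leibniz[OF p zero_le_one P]) (rule that)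
 obtain e0 where e0: "e0 > 0" "ball (u_of P) e0 \<subseteq> X" using X by (meson open_contains_ball)
 \<comment> \<open>The cycle is compact, so it also misses the points near \<open>P\<close>. The
   argument is run on coordinate pairs \<open>(u, v)\<close>, which carry a topology while
   \<open>pt\<close> does not.\<close>
 have "\<exists>e1>0. \<forall>y\<in>ball (u_of P) e1. branch_pt x P y \<notin> b ` {0..1}"
 proof -
  have cu: "continuous_on {0..1} (\<lambda>t. u_of (b t))" and cv: "continuous_on {0..1} (\<lambda>t. v_of (b t))"
   using p by (auto simp: curve_path_def)
  define S where "S = (\<lambda>t. (u_of (b t), v_of (b t))) ` {0..1}"
  have "compact S" unfolding S_def by (intro compact_continuous_image continuous_intros cu cv) auto
  then have "closed S" by (rule compact_imp_closed)
  have "(u_of P, v_of P) \<notin> S"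
  proof
   assume "(u_of P, v_of P) \<in> S"
   then obtain t where t: "t \<in> {0..1}" "u_of P = u_of (b t)" "v_of P = v_of (b t)" by (auto simp: S_def)
   then have "P = b t"
    using unram_nonzero(5)[OF P(1)] unram_nonzero(5)[OF curve_path_in[OF p t(1)]] by metis
   then show False using P(2) t(1) by blast
  qed
  then have "open (- S)" "(u_of P, v_of P) \<in> - S" using \<open>closed S\<close> by auto
  then obtain A B where AB: "open A" "open B" "u_of P \<in> A" "v_of P \<in> B" "A \<times> B \<subseteq> - S"
   by (rule open_prod_elim) (auto intro: that)
  obtain \<rho> where \<rho>: "\<rho> > 0" "(\<lambda>z. v_of (branch_pt x P z)) holomorphic_on ball (u_of P) \<rho>"
   using branch_pt[OF P(1) zero_less_one] by metis
  have "continuous_on (ball (u_of P) \<rho>) (\<lambda>z. v_of (branch_pt x P z))"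
   using \<rho>(2) by (rule holomorphic_on_imp_continuous_on)
  then have "open ((\<lambda>z. v_of (branch_pt x P z)) -` B \<inter> ball (u_of P) \<rho>)"
   using AB(2) continuous_on_open_vimage[OF open_ball] by blast
  then have "open (A \<inter> ((\<lambda>z. v_of (branch_pt x P z)) -` B \<inter> ball (u_of P) \<rho>))" using AB(1) by blast
  moreover have "u_of P \<in> A \<inter> ((\<lambda>z. v_of (branch_pt x P z)) -` B \<inter> ball (u_of P) \<rho>)"
   using AB \<rho>(1) by (simp add: branch_pt_self[OF P(1)])
  ultimately obtain e1 where e1: "e1 > 0"
   "ball (u_of P) e1 \<subseteq> A \<inter> ((\<lambda>z. v_of (branch_pt x P z)) -` B \<inter> ball (u_of P) \<rho>)"
   by (meson open_contains_ball)
  have "branch_pt x P y \<notin> b ` {0..1}" if "y \<in> ball (u_of P) e1" for y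
  proof
   assume "branch_pt x P y \<in> b ` {0..1}"
   then obtain t where t: "t \<in> {0..1}" "branch_pt x P y = b t" by auto
   then have "(u_of (b t), v_of (b t)) \<in> A \<times> B" using e1(2) that t(2)[symmetric] by auto
   then show False using AB(5) t(1) by (auto simp: S_def)
  qed
  then show ?thesis using e1(1) by blast
 qed
 then obtain e1 where e1: "e1 > 0" "\<And>y. y \<in> ball (u_of P) e1 ==> branch_pt x P y \<notin> b ` {0..1}" by blast
 obtain \<rho> where \<rho>: "\<rho> > 0" "\<And>z. z \<in> ball (u_of P) \<rho> ==> branch_pt x P z \<in> unram x"
  "\<And>z. z \<in> ball (u_of P) \<rho> ==> ((\<lambda>z. v_of (branch_pt x P z)) has_field_derivative
    dcubic x z / (2 * v_of (branch_pt x P z))) (at z)"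
  using branch_pt[OF P(1) zero_less_one] by metis
 show thesis
 proof (rule that[of "min \<rho> (min e0 e1)"])
  fix y assume y: "y \<in> ball (u_of P) (min \<rho> (min e0 e1))"
  then have y': "y \<in> X" "branch_pt x P y \<notin> b ` {0..1}" "branch_pt x P y \<in> unram x" "y \<in> ball (u_of P) \<rho>"
   using e0 e1 \<rho> by auto
  define v where "v = v_of (branch_pt x P y)"
  note nz = unram_nonzero(1-4)[OF y'(3)]
  have nz': "v \<noteq> 0" "y \<noteq> 0" using nz by (simp_all add: v_def)
  have sq: "v\<^sup>2 = cubic x y" using v_of_square[OF y'(3)] by (simp add: v_def)
  have D: "((\<lambda>y. line_int (kern x (branch_pt x P y)) b 0 1 + period inv_v b / 2 * (v_of (branch_pt x P y) / y))
   has_field_derivative (x / (4 * v) * period inv_uv b + - y / (4 * v) * period inv_v b) +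
    period inv_v b / 2 * ((dcubic x y / (2 * v) * y - v * 1) / (y * y))) (at y)"
   using X(4)[OF y'(1)] \<rho>(3)[OF y'(4)] nz'
   unfolding closed_path_kern_deriv[OF b y'(3,2)] v_def u_of_branch_pt
   by (intro DERIV_add DERIV_cmult DERIV_divide DERIV_ident) auto
  have eq: "(dcubic x y / (2 * v) * y - v * 1) / (y * y) = y / (2 * v) - x / (2 * y * v)"
  proof -
   have "dcubic x y * y - 2 * v\<^sup>2 = y ^ 3 - x * y"
    unfolding sq by (simp add: cubic_def dcubic_def algebra_simps power2_eq_square power3_eq_cube)
   then have d: "dcubic x y = (y ^ 3 - x * y + 2 * v\<^sup>2) / y" using nz' by (simp add: field_simps)
   show ?thesis unfolding d using nz' by (simp add: divide_simps) (simp add: algebra_simps eval_nat_numeral)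
  qed
  note D[unfolded eq]
  moreover have "(x / (4 * v) * period inv_uv b + - y / (4 * v) * period inv_v b) +
    period inv_v b / 2 * (y / (2 * v) - x / (2 * y * v)) = abel_form x b (branch_pt x P y)"
   unfolding abel_form_def v_def[symmetric] u_of_branch_pt using nz' by (simp add: field_simps)
  ultimately show "((\<lambda>y. abel_sum x b (branch_pt x P y)) has_field_derivative
    abel_form x b (branch_pt x P y)) (at y)" by (simp add: abel_sum_def)
 qed (use \<rho> e0 e1 in auto)
qed

lemma abel_form_integrable:
 assumes "curve_path x a r s" "r \<le> s"
 shows "line_integrand (abel_form x b) a integrable_on {r..s}"
  "line_int (abel_form x b) a r s = x / 4 * (period inv_uv b * line_int inv_v a r s - period inv_v b * line_int inv_uv a r s)"
proof -
 have "((\<lambda>t. x / 4 * (period inv_uv b * line_integrand inv_v a t - period inv_v b * line_integrand inv_uv a t)) has_integral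
   x / 4 * (period inv_uv b * line_int inv_v a r s - period inv_v b * line_int inv_uv a r s)) {r..s}"
  unfolding line_int_def
  by (intro has_integral_mult_right has_integral_diff integrable_integral
    integrable_inv_v[OF assms] integrable_inv_uv[OF assms])
 then have "(line_integrand (abel_form x b) a has_integral
   x / 4 * (period inv_uv b * line_int inv_v a r s - period inv_v b * line_int inv_uv a r s)) {r..s}"
  by (rule has_integral_eq[rotated]) (simp add: abel_form_def algebra_simps)
 then show "line_integrand (abel_form x b) a integrable_on {r..s}"
  "line_int (abel_form x b) a r s = x / 4 * (period inv_uv b * line_int inv_v a r s - period inv_v b * line_int inv_uv a r s)"
  by (auto simp: line_int_def has_integral_integrable integral_unique)
qed

text \<open>The period of the kernel while its pole follows \<open>a\<close>, minus the change
  predicted by its differential: a step function of \<open>\<tau>\<close> with steps only where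
  \<open>a\<close> meets \<open>b\<close>.\<close>

definition abel_diff :: "complex \<Rightarrow> (real \<Rightarrow> pt) \<Rightarrow> (real \<Rightarrow> pt) \<Rightarrow> real \<Rightarrow> complex" where
 "abel_diff x a b \<tau> = abel_sum x b (a \<tau>) - line_int (abel_form x b) a 0 \<tau>"

text \<open>As long as the pole stays off \<open>b\<close>, \<open>abel_sum\<close> is locally a
  primitive of \<open>abel_form\<close>, so the two terms change by the same amount.\<close>

lemma abel_diff_locally_constant:
 assumes a: "cycle_on x a" and b: "cycle_on x b" and \<tau>: "\<tau> \<in> {0..1}" "a \<tau> \<notin> b ` {0..1}"
 obtains d where "d > 0" "\<And>\<sigma>. \<sigma> \<in> {0..1} ==> \<bar>\<sigma> - \<tau>\<bar> < d ==> abel_diff x a b \<sigma> = abel_diff x a b \<tau>"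
proof -
 have pa: "curve_path x a 0 1" by (rule cycle_on_curve_path[OF a])
 note un = curve_path_in[OF pa]
 obtain \<epsilon> where \<epsilon>: "\<epsilon> > 0"
  "\<And>y. y \<in> ball (u_of (a \<tau>)) \<epsilon> ==> branch_pt x (a \<tau>) y \<in> unram x"
  "\<And>y. y \<in> ball (u_of (a \<tau>)) \<epsilon> ==> ((\<lambda>y. abel_sum x b (branch_pt x (a \<tau>) y)) has_field_derivative
    abel_form x b (branch_pt x (a \<tau>) y)) (at y)"
  by (rule abel_sum_deriv[OF b un[OF \<tau>(1)] \<tau>(2)]) (rule that)
 obtain d where d: "d > 0"
  "\<And>t. t \<in> {0..1} ==> \<bar>t - \<tau>\<bar> < d ==> u_of (a t) \<in> ball (u_of (a \<tau>)) \<epsilon> \<and>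
    a t = branch_pt x (a \<tau>) (u_of (a t))"
  by (rule path_local_branch[OF pa \<tau>(1) \<epsilon>(1)]) (rule that)
 define G where "G = (\<lambda>y. abel_sum x b (branch_pt x (a \<tau>) y))"
 have *: "abel_diff x a b \<tau>1 = abel_diff x a b \<tau>2"
  if t: "\<tau>1 \<in> {0..1}" "\<tau>2 \<in> {0..1}" "\<tau>1 \<le> \<tau>2" "\<bar>\<tau>1 - \<tau>\<bar> < d" "\<bar>\<tau>2 - \<tau>\<bar> < d" for \<tau>1 \<tau>2
 proof -
  have p12: "curve_path x a \<tau>1 \<tau>2" using curve_path_subset[OF pa] t by auto
  have nb: "u_of (a t) \<in> ball (u_of (a \<tau>)) \<epsilon>" "a t = branch_pt x (a \<tau>) (u_of (a t))" if "t \<in> {\<tau>1..\<tau>2}" for t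
   using d(2)[of t] that t by auto
  have "(line_integrand (abel_form x b) a has_integral G (u_of (a \<tau>2)) - G (u_of (a \<tau>1))) {\<tau>1..\<tau>2}"
  proof (rule path_FTC_local[OF p12 t(3)])
   have "continuous_on (ball (u_of (a \<tau>)) \<epsilon>) G"
    using \<epsilon>(3) unfolding G_def by (meson DERIV_isCont continuous_at_imp_continuous_on)
   then show "continuous_on {\<tau>1..\<tau>2} (\<lambda>t. G (u_of (a t)))"
    by (rule continuous_on_compose2) (use p12 nb in \<open>auto simp: curve_path_def\<close>)
   fix t assume "t \<in> {\<tau>1<..<\<tau>2}"
   then have t': "t \<in> {\<tau>1..\<tau>2}" by auto
   have "(G has_field_derivative abel_form x b (a t)) (at (u_of (a t)))"
    using \<epsilon>(3)[OF nb(1)[OF t']] nb(2)[OF t'] unfolding G_def by simp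
   then show "\<exists>H \<epsilon>. \<epsilon> > 0 \<and> (\<forall>t'. \<bar>t' - t\<bar> < \<epsilon> \<longrightarrow> G (u_of (a t')) = H (u_of (a t'))) \<and>
     (H has_field_derivative abel_form x b (a t)) (at (u_of (a t)))"
    by (intro exI[of _ G] exI[of _ 1]) auto
  qed
  moreover have "G (u_of (a \<tau>1)) = abel_sum x b (a \<tau>1)" "G (u_of (a \<tau>2)) = abel_sum x b (a \<tau>2)"
   unfolding G_def using nb(2)[of \<tau>1] nb(2)[of \<tau>2] t(3) by auto
  ultimately have 1: "line_int (abel_form x b) a \<tau>1 \<tau>2 = abel_sum x b (a \<tau>2) - abel_sum x b (a \<tau>1)"
   by (simp add: line_int_def integral_unique)
  have "line_int (abel_form x b) a 0 \<tau>2 = line_int (abel_form x b) a 0 \<tau>1 + line_int (abel_form x b) a \<tau>1 \<tau>2"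
   unfolding line_int_def
   by (rule Henstock_Kurzweil_Integration.integral_combine[symmetric])
     (use t in \<open>auto intro!: abel_form_integrable(1) curve_path_subset[OF pa]\<close>)
  then show ?thesis unfolding abel_diff_def 1 by simp
 qed
 show thesis
 proof (rule that[OF d(1)])
  fix \<sigma> :: real assume \<sigma>: "\<sigma> \<in> {0..1}" "\<bar>\<sigma> - \<tau>\<bar> < d"
  have "\<bar>\<tau> - \<tau>\<bar> < d" using d(1) by simp
  then show "abel_diff x a b \<sigma> = abel_diff x a b \<tau>"
   using *[OF \<sigma>(1) \<tau>(1) _ \<sigma>(2)] *[OF \<tau>(1) \<sigma>(1) _ _ \<sigma>(2)] by (metis linear)
 qed
qed

text \<open>
 The factor \<open>\<i>\<close> turns the cut of the principal logarithm into the half line on which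
 \<open>\<beta> t - \<alpha> \<tau>\<close>, rotated so that \<open>\<beta>\<close> crosses along the real axis, never lies.
\<close>

lemma log_jump:
 fixes \<alpha> \<beta> :: "real \<Rightarrow> complex"
 assumes \<alpha>: "(\<alpha> has_vector_derivative p) (at \<tau>0)" and \<beta>: "(\<beta> has_vector_derivative q) (at t0)"
  and eq: "\<alpha> \<tau>0 = \<beta> t0" and det: "Im (cnj p * q) \<noteq> 0"
 obtains e0 where "e0 > 0" "\<And>e. 0 < e ==> e \<le> e0 ==> \<exists>I L d. d > 0 \<and>
   (I \<longlongrightarrow> L) (at_left \<tau>0) \<and> (I \<longlongrightarrow> L - 2 * pi * \<i> * sgn (Im (cnj p * q))) (at_right \<tau>0) \<and>
   (\<forall>\<tau>. 0 < \<bar>\<tau> - \<tau>0\<bar> \<and> \<bar>\<tau> - \<tau>0\<bar> < d \<longrightarrow> (\<exists>H. I \<tau> = H (\<beta> (t0 + e)) - H (\<beta> (t0 - e)) \<and>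
    (\<forall>t\<in>{t0 - e..t0 + e}. (H has_field_derivative 1 / (\<beta> t - \<alpha> \<tau>)) (at (\<beta> t)))))"
proof -
 have q: "q \<noteq> 0" using det by auto
 define m where "m = p / q"
 have m: "Im m = - Im (cnj p * q) / (norm q)\<^sup>2"
  by (simp add: m_def Im_divide cmod_power2 algebra_simps)
 then have Imm: "Im m \<noteq> 0" using det q by simp
 \<comment> \<open>Division by \<open>q\<close> makes the tangent of \<open>\<beta>\<close> the
   positive real axis; the sign of \<open>Im m\<close> then tells to which side
   \<open>\<alpha>\<close> crosses.\<close>
 define \<zeta> where "\<zeta> t = (\<beta> t - \<beta> t0) / q" for t
 define \<eta> where "\<eta> \<tau> = (\<alpha> \<tau> - \<alpha> \<tau>0) / q" for \<tau>
 define M where "M = norm m + 1"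
 have M: "M > 0" "\<bar>Re m\<bar> \<le> norm m" by (auto simp: M_def abs_Re_le_cmod add_nonneg_pos)
 \<comment> \<open>The error allowed in the linear approximations. The bound 1/2 gives
   \<open>|Re (\<eta> \<tau>)| \<le> M * |\<tau> - \<tau>0|\<close>; the other bound makes
   \<open>\<epsilon> * (2 * M + 1)\<close> at most half of \<open>|Im m|\<close>, which is what
   keeps the difference of the curves off the cut.\<close>
 define \<epsilon> where "\<epsilon> = min (1/2) (\<bar>Im m\<bar> / (2 * (2 * M + 1)))"
 have "\<epsilon> > 0" using Imm M by (simp add: \<epsilon>_def)
 moreover have "\<epsilon> \<le> 1/2" unfolding \<epsilon>_def by (rule min.cobounded1)
 ultimately have \<epsilon>: "\<epsilon> > 0" "\<epsilon> \<le> 1/2" .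
 have \<epsilon>2: "2 * \<epsilon> * M + \<epsilon> < \<bar>Im m\<bar>"
 proof -
  have pos: "0 < 2 * (2 * M + 1)" using M(1) by simp
  have "\<epsilon> \<le> \<bar>Im m\<bar> / (2 * (2 * M + 1))" unfolding \<epsilon>_def by (rule min.cobounded2)
  then have "\<epsilon> * (2 * (2 * M + 1)) \<le> \<bar>Im m\<bar>" by (simp only: pos_le_divide_eq[OF pos])
  then show ?thesis using Imm M \<epsilon> by (simp add: algebra_simps)
 qed
 have "(\<zeta> has_vector_derivative 1) (at t0)" unfolding \<zeta>_def
  by (rule derivative_eq_intros \<beta> refl)+ (use q in auto)
 then obtain e0' where e0': "e0' > 0" "\<And>t. \<bar>t - t0\<bar> < e0' ==> norm (\<zeta> t - of_real (t - t0)) \<le> \<epsilon> * \<bar>t - t0\<bar>"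
  using \<epsilon>(1) unfolding has_vector_derivative_def has_derivative_at_alt
  by (simp add: \<zeta>_def scaleR_conv_of_real) metis
 have "(\<eta> has_vector_derivative m) (at \<tau>0)" unfolding \<eta>_def m_def
  by (rule derivative_eq_intros \<alpha> refl)+ (use q in auto)
 then obtain d where d: "d > 0" "\<And>\<tau>. \<bar>\<tau> - \<tau>0\<bar> < d ==> norm (\<eta> \<tau> - of_real (\<tau> - \<tau>0) * m) \<le> \<epsilon> * \<bar>\<tau> - \<tau>0\<bar>"
  using \<epsilon>(1) unfolding has_vector_derivative_def has_derivative_at_alt
  by (simp add: \<eta>_def scaleR_conv_of_real) metis
 have \<eta>_cont: "(\<eta> \<longlongrightarrow> 0) (at \<tau>0)"
 proof -
  have "isCont \<alpha> \<tau>0" using \<alpha> has_vector_derivative_continuous by blast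
  then have "(\<eta> \<longlongrightarrow> (\<alpha> \<tau>0 - \<alpha> \<tau>0) / q) (at \<tau>0)" unfolding \<eta>_def by (intro tendsto_intros q) (simp add: isCont_def)
  then show ?thesis by simp
 qed
 have zeta_bounds: "\<bar>Im (\<zeta> t)\<bar> \<le> \<epsilon> * \<bar>t - t0\<bar>" "\<bar>Re (\<zeta> t) - (t - t0)\<bar> \<le> \<epsilon> * \<bar>t - t0\<bar>"
  if "\<bar>t - t0\<bar> < e0'" for t
  using e0'(2)[OF that] abs_Im_le_cmod[of "\<zeta> t - of_real (t - t0)"] abs_Re_le_cmod[of "\<zeta> t - of_real (t - t0)"]
  by auto
 have eta_bounds: "\<bar>Im (\<eta> \<tau>) - (\<tau> - \<tau>0) * Im m\<bar> \<le> \<epsilon> * \<bar>\<tau> - \<tau>0\<bar>" "\<bar>Re (\<eta> \<tau>)\<bar> \<le> M * \<bar>\<tau> - \<tau>0\<bar>"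
  if "\<bar>\<tau> - \<tau>0\<bar> < d" for \<tau>
 proof -
  show "\<bar>Im (\<eta> \<tau>) - (\<tau> - \<tau>0) * Im m\<bar> \<le> \<epsilon> * \<bar>\<tau> - \<tau>0\<bar>"
   using d(2)[OF that] abs_Im_le_cmod[of "\<eta> \<tau> - of_real (\<tau> - \<tau>0) * m"] by auto
  have "norm (\<eta> \<tau>) \<le> norm (\<eta> \<tau> - of_real (\<tau> - \<tau>0) * m) + norm (of_real (\<tau> - \<tau>0) * m)"
   using norm_triangle_ineq[of "\<eta> \<tau> - of_real (\<tau> - \<tau>0) * m" "of_real (\<tau> - \<tau>0) * m"] by simp
  also have "\<dots> \<le> \<epsilon> * \<bar>\<tau> - \<tau>0\<bar> + \<bar>\<tau> - \<tau>0\<bar> * norm m"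
   using d(2)[OF that] by (simp only: norm_mult norm_of_real add_mono order_refl)
  also have "\<dots> \<le> M * \<bar>\<tau> - \<tau>0\<bar>"
   using mult_right_mono[of \<epsilon> 1 "\<bar>\<tau> - \<tau>0\<bar>"] \<epsilon>(2) by (simp add: M_def algebra_simps)
  finally show "\<bar>Re (\<eta> \<tau>)\<bar> \<le> M * \<bar>\<tau> - \<tau>0\<bar>" using abs_Re_le_cmod[of "\<eta> \<tau>"] by linarith
 qed
 have sgn_eta: "sgn (Im (\<eta> \<tau>)) = sgn ((\<tau> - \<tau>0) * Im m)"
  and small: "2 * \<epsilon> * (M * \<bar>\<tau> - \<tau>0\<bar>) < \<bar>Im (\<eta> \<tau>)\<bar>" if "\<bar>\<tau> - \<tau>0\<bar> < d" "\<tau> \<noteq> \<tau>0" for \<tau>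
 proof -
  have pos: "\<bar>\<tau> - \<tau>0\<bar> > 0" using that by simp
  have "(2 * \<epsilon> * M + \<epsilon>) * \<bar>\<tau> - \<tau>0\<bar> < \<bar>Im m\<bar> * \<bar>\<tau> - \<tau>0\<bar>" using \<epsilon>2 pos by (rule mult_strict_right_mono)
  then have *: "2 * \<epsilon> * (M * \<bar>\<tau> - \<tau>0\<bar>) + \<epsilon> * \<bar>\<tau> - \<tau>0\<bar> < \<bar>(\<tau> - \<tau>0) * Im m\<bar>"
  proof -
   have eq: "\<bar>(\<tau> - \<tau>0) * Im m\<bar> = \<bar>Im m\<bar> * \<bar>\<tau> - \<tau>0\<bar>" by (simp add: abs_mult)
   show ?thesis using \<open>(2 * \<epsilon> * M + \<epsilon>) * \<bar>\<tau> - \<tau>0\<bar> < _\<close> unfolding eq by (simp add: algebra_simps)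
  qed
  have nn: "0 \<le> 2 * \<epsilon> * (M * \<bar>\<tau> - \<tau>0\<bar>)" using \<epsilon> M by simp
  from eta_bounds(1)[OF that(1)] * nn show "2 * \<epsilon> * (M * \<bar>\<tau> - \<tau>0\<bar>) < \<bar>Im (\<eta> \<tau>)\<bar>" by linarith
  from eta_bounds(1)[OF that(1)] * nn show "sgn (Im (\<eta> \<tau>)) = sgn ((\<tau> - \<tau>0) * Im m)"
   unfolding sgn_real_def by (smt (verit))
 qed
 have half: "h \<le> 2 * r" if "h - r \<le> X" "X \<le> eh" "eh \<le> 1/2 * h" for h r X eh :: real
  using that by linarith
 \<comment> \<open>On the cut the real parts of \<open>\<zeta> t\<close> and
   \<open>\<eta> \<tau>\<close> agree, so \<open>t - t0\<close> is at most of the order of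
   \<open>\<tau> - \<tau>0\<close>. Then \<open>\<zeta> t\<close> is too close to the real axis to
   reach the imaginary part of \<open>\<eta> \<tau>\<close>.\<close>
 have avoid: "\<i> * (\<zeta> t - \<eta> \<tau>) \<notin> \<real>\<^sub>\<le>\<^sub>0" if "Im (\<eta> \<tau>) > 0" "\<bar>t - t0\<bar> < e0'" "\<bar>\<tau> - \<tau>0\<bar> < d" "\<tau> \<noteq> \<tau>0" for t \<tau>
 proof
  assume "\<i> * (\<zeta> t - \<eta> \<tau>) \<in> \<real>\<^sub>\<le>\<^sub>0"
  then have r: "Re (\<zeta> t) = Re (\<eta> \<tau>)" "Im (\<zeta> t) \<ge> Im (\<eta> \<tau>)" by (auto simp: complex_nonpos_Reals_iff)
  have "\<epsilon> * \<bar>t - t0\<bar> \<le> 1/2 * \<bar>t - t0\<bar>" using \<epsilon>(2) by (intro mult_right_mono) auto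
  then have "\<bar>t - t0\<bar> \<le> 2 * \<bar>Re (\<eta> \<tau>)\<bar>"
   using half[OF _ zeta_bounds(2)[OF that(2)]] abs_triangle_ineq2_sym[of "t - t0" "Re (\<zeta> t)"] r(1) by simp
  also have "\<dots> \<le> 2 * (M * \<bar>\<tau> - \<tau>0\<bar>)" using eta_bounds(2)[OF that(3)] by simp
  finally have "\<epsilon> * \<bar>t - t0\<bar> \<le> \<epsilon> * (2 * (M * \<bar>\<tau> - \<tau>0\<bar>))" using \<epsilon>(1) by simp
  then show False using zeta_bounds(1)[OF that(2)] r(2) small[OF that(3,4)] that(1) by linarith
 qed
 have avoid': "- \<i> * (\<zeta> t - \<eta> \<tau>) \<notin> \<real>\<^sub>\<le>\<^sub>0" if "Im (\<eta> \<tau>) < 0" "\<bar>t - t0\<bar> < e0'" "\<bar>\<tau> - \<tau>0\<bar> < d" "\<tau> \<noteq> \<tau>0" for t \<tau>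
 proof
  assume "- \<i> * (\<zeta> t - \<eta> \<tau>) \<in> \<real>\<^sub>\<le>\<^sub>0"
  then have r: "Re (\<zeta> t) = Re (\<eta> \<tau>)" "Im (\<zeta> t) \<le> Im (\<eta> \<tau>)" by (auto simp: complex_nonpos_Reals_iff)
  have "\<epsilon> * \<bar>t - t0\<bar> \<le> 1/2 * \<bar>t - t0\<bar>" using \<epsilon>(2) by (intro mult_right_mono) auto
  then have "\<bar>t - t0\<bar> \<le> 2 * \<bar>Re (\<eta> \<tau>)\<bar>"
   using half[OF _ zeta_bounds(2)[OF that(2)]] abs_triangle_ineq2_sym[of "t - t0" "Re (\<zeta> t)"] r(1) by simp
  also have "\<dots> \<le> 2 * (M * \<bar>\<tau> - \<tau>0\<bar>)" using eta_bounds(2)[OF that(3)] by simp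
  finally have "\<epsilon> * \<bar>t - t0\<bar> \<le> \<epsilon> * (2 * (M * \<bar>\<tau> - \<tau>0\<bar>))" using \<epsilon>(1) by simp
  then show False using zeta_bounds(1)[OF that(2)] r(2) small[OF that(3,4)] that(1) by linarith
 qed
 show thesis
 proof (rule that[of "e0' / 2"])
  fix e assume e: "0 < e" "e \<le> e0' / 2"
  define z1 where "z1 = \<zeta> (t0 + e)"
  define z2 where "z2 = \<zeta> (t0 - e)"
  have "\<bar>Re z1 - e\<bar> \<le> \<epsilon> * e" "\<bar>Re z2 + e\<bar> \<le> \<epsilon> * e"
   using zeta_bounds(2)[of "t0 + e"] zeta_bounds(2)[of "t0 - e"] e e0'(1) by (auto simp: z1_def z2_def)
  moreover have "\<epsilon> * e < e" using \<epsilon> e by simp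
  ultimately have z: "Re z1 > 0" "Re z2 < 0" by linarith+
  define I where "I \<tau> = (if Im (\<eta> \<tau>) > 0 then Ln (\<i> * (z1 - \<eta> \<tau>)) - Ln (\<i> * (z2 - \<eta> \<tau>))
    else Ln (- \<i> * (z1 - \<eta> \<tau>)) - Ln (- \<i> * (z2 - \<eta> \<tau>)))" for \<tau>
  have nn: "\<i> * z1 \<notin> \<real>\<^sub>\<le>\<^sub>0" "\<i> * z2 \<notin> \<real>\<^sub>\<le>\<^sub>0" "- \<i> * z1 \<notin> \<real>\<^sub>\<le>\<^sub>0" "- \<i> * z2 \<notin> \<real>\<^sub>\<le>\<^sub>0"
   using z by (auto simp: complex_nonpos_Reals_iff)
  have lim0: "((\<lambda>\<tau>. k * (w - \<eta> \<tau>)) \<longlongrightarrow> k * w) (at \<tau>0)" for k w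
  proof -
   have "((\<lambda>\<tau>. k * (w - \<eta> \<tau>)) \<longlongrightarrow> k * (w - 0)) (at \<tau>0)" by (intro tendsto_intros \<eta>_cont)
   then show ?thesis by simp
  qed
  have lim1: "((\<lambda>\<tau>. Ln (\<i> * (z1 - \<eta> \<tau>)) - Ln (\<i> * (z2 - \<eta> \<tau>))) \<longlongrightarrow> Ln (\<i> * z1) - Ln (\<i> * z2)) (at \<tau>0)"
   by (intro tendsto_diff tendsto_Ln lim0 nn)
  have lim2: "((\<lambda>\<tau>. Ln (- \<i> * (z1 - \<eta> \<tau>)) - Ln (- \<i> * (z2 - \<eta> \<tau>))) \<longlongrightarrow> Ln (- \<i> * z1) - Ln (- \<i> * z2)) (at \<tau>0)"
   by (intro tendsto_diff tendsto_Ln lim0 nn)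
  have z10: "\<i> * z1 \<noteq> 0" "\<i> * z2 \<noteq> 0" using z by auto
  \<comment> \<open>Here \<open>z1\<close> lies in the right and \<open>z2\<close> in the left half
    plane, so replacing \<open>\<i>\<close> by \<open>- \<i>\<close> changes the two logarithms by
    \<open>- \<i> * pi\<close> and \<open>\<i> * pi\<close>. The difference of the logarithms
    therefore changes by \<open>- 2 * pi * \<i>\<close>.\<close>
  have "Ln (- \<i> * z1) = Ln (\<i> * z1) - \<i> * pi" "Ln (- \<i> * z2) = Ln (\<i> * z2) + \<i> * pi"
   using Ln_minus[OF z10(1)] Ln_minus[OF z10(2)] z by simp_all
  then have jump: "Ln (- \<i> * z1) - Ln (- \<i> * z2) = Ln (\<i> * z1) - Ln (\<i> * z2) - 2 * pi * \<i>" by simp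
  have evd: "eventually (\<lambda>\<tau>. \<bar>\<tau> - \<tau>0\<bar> < d \<and> \<tau> \<noteq> \<tau>0) (at \<tau>0 within S)" for S
   unfolding eventually_at using d(1) by (intro exI[of _ d]) (auto simp: dist_real_def)
  have evl: "eventually (\<lambda>\<tau>. \<tau> < \<tau>0) (at_left \<tau>0)" and evr: "eventually (\<lambda>\<tau>. \<tau> > \<tau>0) (at_right \<tau>0)"
   by (auto simp: eventually_at_filter)
  define L1 where "L1 = Ln (\<i> * z1) - Ln (\<i> * z2)"
  have pos_case: "(I \<longlongrightarrow> L1) F"
   if F: "F \<le> at \<tau>0" and ev: "eventually (\<lambda>\<tau>. Im (\<eta> \<tau>) > 0) F" for F
   by (rule Lim_transform_eventually[OF tendsto_mono[OF F lim1[folded L1_def]]])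
     (rule eventually_mono[OF ev], simp add: I_def)
  have neg_case: "(I \<longlongrightarrow> L1 - 2 * pi * \<i>) F"
   if F: "F \<le> at \<tau>0" and ev: "eventually (\<lambda>\<tau>. Im (\<eta> \<tau>) < 0) F" for F
   by (rule Lim_transform_eventually[OF tendsto_mono[OF F lim2[unfolded jump, folded L1_def]]])
     (rule eventually_mono[OF ev], simp add: I_def)
  have sg: "sgn (Im (\<eta> \<tau>)) = sgn (\<tau> - \<tau>0) * sgn (Im m)" if "\<bar>\<tau> - \<tau>0\<bar> < d \<and> \<tau> \<noteq> \<tau>0" for \<tau>
   using sgn_eta that by (simp add: sgn_mult)
  have lims: "\<exists>L. (I \<longlongrightarrow> L) (at_left \<tau>0) \<and> (I \<longlongrightarrow> L - 2 * pi * \<i> * sgn (Im (cnj p * q))) (at_right \<tau>0)"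
  proof (cases "Im m > 0")
   case True
   then have s: "sgn (Im (cnj p * q)) = -1" using m q det by (simp add: sgn_real_def zero_less_mult_iff zero_less_divide_iff split: if_splits)
   have "eventually (\<lambda>\<tau>. Im (\<eta> \<tau>) < 0) (at_left \<tau>0)"
    using evl evd[of "{..<\<tau>0}"]
   proof eventually_elim
    case (elim \<tau>)
    then have "sgn (Im (\<eta> \<tau>)) = -1" using sg[of \<tau>] True by simp
    then show ?case by (simp add: sgn_real_def split: if_splits)
   qed
   moreover have "eventually (\<lambda>\<tau>. Im (\<eta> \<tau>) > 0) (at_right \<tau>0)"
    using evr evd[of "{\<tau>0<..}"]
   proof eventually_elim
    case (elim \<tau>)
    then have "sgn (Im (\<eta> \<tau>)) = 1" using sg[of \<tau>] True by simp
    then show ?case by (simp add: sgn_real_def split: if_splits)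
   qed
   ultimately have "(I \<longlongrightarrow> L1 - 2 * pi * \<i>) (at_left \<tau>0)" "(I \<longlongrightarrow> L1) (at_right \<tau>0)"
    using neg_case[of "at_left \<tau>0"] pos_case[of "at_right \<tau>0"] by (simp_all add: at_le)
   then show ?thesis unfolding s by (intro exI[of _ "L1 - 2 * pi * \<i>"]) simp
  next
   case False
   then have Im_neg: "Im m < 0" using Imm by simp
   then have s: "sgn (Im (cnj p * q)) = 1" using m q det by (simp add: sgn_real_def zero_less_mult_iff divide_less_0_iff split: if_splits)
   have "eventually (\<lambda>\<tau>. Im (\<eta> \<tau>) > 0) (at_left \<tau>0)"
    using evl evd[of "{..<\<tau>0}"]
   proof eventually_elim
    case (elim \<tau>)
    then have "sgn (Im (\<eta> \<tau>)) = 1" using sg[of \<tau>] Im_neg by simp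
    then show ?case by (simp add: sgn_real_def split: if_splits)
   qed
   moreover have "eventually (\<lambda>\<tau>. Im (\<eta> \<tau>) < 0) (at_right \<tau>0)"
    using evr evd[of "{\<tau>0<..}"]
   proof eventually_elim
    case (elim \<tau>)
    then have "sgn (Im (\<eta> \<tau>)) = -1" using sg[of \<tau>] Im_neg by simp
    then show ?case by (simp add: sgn_real_def split: if_splits)
   qed
   ultimately have "(I \<longlongrightarrow> L1) (at_left \<tau>0)" "(I \<longlongrightarrow> L1 - 2 * pi * \<i>) (at_right \<tau>0)"
    using pos_case[of "at_left \<tau>0"] neg_case[of "at_right \<tau>0"] by (simp_all add: at_le)
   then show ?thesis unfolding s by (intro exI[of _ L1]) simp
  qed
  have prim: "\<exists>H. I \<tau> = H (\<beta> (t0 + e)) - H (\<beta> (t0 - e)) \<and>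
    (\<forall>t\<in>{t0 - e..t0 + e}. (H has_field_derivative 1 / (\<beta> t - \<alpha> \<tau>)) (at (\<beta> t)))"
   if \<tau>: "0 < \<bar>\<tau> - \<tau>0\<bar> \<and> \<bar>\<tau> - \<tau>0\<bar> < d" for \<tau>
  proof -
   have "sgn (Im (\<eta> \<tau>)) \<noteq> 0" using sg[of \<tau>] \<tau> Imm by (auto simp: sgn_eq_0_iff)
   then have nz: "Im (\<eta> \<tau>) \<noteq> 0" by (simp add: sgn_eq_0_iff)
   have dz: "\<zeta> t - \<eta> \<tau> = (\<beta> t - \<alpha> \<tau>) / q" for t
    using eq by (simp add: \<zeta>_def \<eta>_def diff_divide_distrib)
   define k where "k = (if Im (\<eta> \<tau>) > 0 then \<i> else - \<i>)"
   have k0: "k \<noteq> 0" by (simp add: k_def)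
   define H where "H = (\<lambda>z. Ln (k * ((z - \<alpha> \<tau>) / q)))"
   have "I \<tau> = H (\<beta> (t0 + e)) - H (\<beta> (t0 - e))"
    unfolding I_def H_def z1_def z2_def dz k_def by simp
   moreover have "(H has_field_derivative 1 / (\<beta> t - \<alpha> \<tau>)) (at (\<beta> t))" if t: "t \<in> {t0 - e..t0 + e}" for t
   proof -
    have "\<bar>t - t0\<bar> < e0'" using t e e0'(1) by (auto simp: abs_if)
    then have nr: "k * ((\<beta> t - \<alpha> \<tau>) / q) \<notin> \<real>\<^sub>\<le>\<^sub>0"
     using avoid[of \<tau> t] avoid'[of \<tau> t] nz \<tau> unfolding dz k_def by (cases "Im (\<eta> \<tau>) > 0") auto
    then have "\<beta> t - \<alpha> \<tau> \<noteq> 0" by auto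
    then show ?thesis
     unfolding H_def using nr q k0
     by (auto intro!: derivative_eq_intros simp: field_simps)
   qed
   ultimately show ?thesis by blast
  qed
  show "\<exists>I L d. d > 0 \<and>
   (I \<longlongrightarrow> L) (at_left \<tau>0) \<and> (I \<longlongrightarrow> L - 2 * pi * \<i> * sgn (Im (cnj p * q))) (at_right \<tau>0) \<and>
   (\<forall>\<tau>. 0 < \<bar>\<tau> - \<tau>0\<bar> \<and> \<bar>\<tau> - \<tau>0\<bar> < d \<longrightarrow> (\<exists>H. I \<tau> = H (\<beta> (t0 + e)) - H (\<beta> (t0 - e)) \<and>
    (\<forall>t\<in>{t0 - e..t0 + e}. (H has_field_derivative 1 / (\<beta> t - \<alpha> \<tau>)) (at (\<beta> t)))))"
   using lims prim d(1) by blast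
 qed (use e0' in simp)
qed


section \<open>The jump of the kernel integral at a crossing\<close>

lemma isCont_path:
 assumes "curve_path x a r s" "r < \<tau>" "\<tau> < s"
 shows "isCont (\<lambda>t. u_of (a t)) \<tau>" "isCont (\<lambda>t. v_of (a t)) \<tau>"
 using assms unfolding curve_path_def
 by (auto intro!: continuous_on_interior[of "{r..s}"])

text \<open>Off the crossings the integral is differentiable in the coordinate of the pole, and the
  pole moves continuously with \<open>\<tau>\<close>.\<close>

lemma kern_limit_regular:
 assumes a: "curve_path x a 0 1" and \<tau>0: "0 < \<tau>0" "\<tau>0 < 1"
  and b: "curve_path x b r s" "r \<le> s" "a \<tau>0 \<notin> b ` {r..s}"
 shows "((\<lambda>\<tau>. line_int (kern x (a \<tau>)) b r s) \<longlongrightarrow> line_int (kern x (a \<tau>0)) b r s) (at \<tau>0)"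
proof -
 have P: "a \<tau>0 \<in> unram x" using curve_path_in[OF a] \<tau>0 by auto
 have \<tau>0': "\<tau>0 \<in> {0..1}" using \<tau>0 by auto
 define G where "G = (\<lambda>y. line_int (kern x (branch_pt x (a \<tau>0) y)) b r s)"
 obtain X where X: "open X" "convex X" "u_of (a \<tau>0) \<in> X"
  "\<And>y. y \<in> X ==> line_integrand (kern x (branch_pt x (a \<tau>0) y)) b integrable_on {r..s}"
  "\<And>y. y \<in> X ==> ((\<lambda>y. line_int (kern x (branch_pt x (a \<tau>0) y)) b r s) has_field_derivative
    line_int (kern_deriv x (branch_pt x (a \<tau>0) y)) b r s) (at y)"
  by (rule kern_path_leibniz[OF b(1,2) P b(3)]) (rule that)
 note X = X(3) X(5)[folded G_def]
 have "isCont G (u_of (a \<tau>0))" by (rule DERIV_isCont[OF X(2)[OF X(1)]])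
 then have "isCont (\<lambda>\<tau>. G (u_of (a \<tau>))) \<tau>0"
  by (rule isCont_o2[OF isCont_path(1)[OF a \<tau>0]])
 then have lim: "((\<lambda>\<tau>. G (u_of (a \<tau>))) \<longlongrightarrow> line_int (kern x (a \<tau>0)) b r s) (at \<tau>0)"
  by (simp add: isCont_def G_def branch_pt_self[OF P])
 obtain d where d: "d > 0" "\<And>t. t \<in> {0..1} ==> \<bar>t - \<tau>0\<bar> < d ==> u_of (a t) \<in> ball (u_of (a \<tau>0)) 1 \<and>
    a t = branch_pt x (a \<tau>0) (u_of (a t))"
  by (rule path_local_branch[OF a \<tau>0' zero_less_one]) (rule that)
 have "G (u_of (a \<tau>)) = line_int (kern x (a \<tau>)) b r s" if "dist \<tau> \<tau>0 < min d (min \<tau>0 (1 - \<tau>0))" for \<tau>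
 proof -
  have "\<tau> \<in> {0..1}" "\<bar>\<tau> - \<tau>0\<bar> < d" using that by (auto simp: dist_real_def abs_if split: if_splits)
  then have "branch_pt x (a \<tau>0) (u_of (a \<tau>)) = a \<tau>" using d(2)[of \<tau>] by metis
  then show ?thesis unfolding G_def by (simp only:)
 qed
 then have "eventually (\<lambda>\<tau>. G (u_of (a \<tau>)) = line_int (kern x (a \<tau>)) b r s) (at \<tau>0)"
  unfolding eventually_at using d(1) \<tau>0 by (intro exI[of _ "min d (min \<tau>0 (1 - \<tau>0))"]) auto
 with lim show ?thesis by (rule Lim_transform_eventually)
qed

text \<open>By \<open>kern_star\<close> the kernel is \<open>1 / (u_R - u_P)\<close> minus the
  kernel with pole at \<open>star P\<close>. Near the crossing \<open>star P\<close> stays on the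
  other sheet, away from \<open>b\<close>, so the second term is continuous; the first is integrated
  by the logarithms of \<open>log_jump\<close>.\<close>

lemma kern_limit_crossing:
 assumes a: "curve_path x a 0 1" and \<tau>0: "0 < \<tau>0" "\<tau>0 < 1"
  and b: "curve_path x b 0 1" and t0: "0 < t0" "t0 < 1"
  and eq: "a \<tau>0 = b t0"
  and \<alpha>: "((\<lambda>\<tau>. u_of (a \<tau>)) has_vector_derivative p) (at \<tau>0)"
  and \<beta>: "((\<lambda>t. u_of (b t)) has_vector_derivative q) (at t0)"
  and det: "Im (cnj p * q) \<noteq> 0"
  and avoid: "d1 > 0" "\<And>\<tau>. 0 < \<bar>\<tau> - \<tau>0\<bar> ==> \<bar>\<tau> - \<tau>0\<bar> < d1 ==> a \<tau> \<notin> b ` {0..1}"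
 obtains e0 where "e0 > 0" "\<And>e. 0 < e ==> e \<le> e0 ==> \<exists>L.
   ((\<lambda>\<tau>. line_int (kern x (a \<tau>)) b (t0 - e) (t0 + e)) \<longlongrightarrow> L) (at_left \<tau>0) \<and>
   ((\<lambda>\<tau>. line_int (kern x (a \<tau>)) b (t0 - e) (t0 + e)) \<longlongrightarrow> L - 2 * pi * \<i> * sgn (Im (cnj p * q))) (at_right \<tau>0)"
proof -
 let ?\<alpha> = "\<lambda>\<tau>. u_of (a \<tau>)" and ?\<beta> = "\<lambda>t. u_of (b t)"
 have P: "a \<tau>0 \<in> unram x" using curve_path_in[OF a] \<tau>0 by auto
 define v0 where "v0 = v_of (a \<tau>0)"
 have v0: "v0 \<noteq> 0" using unram_nonzero(1)[OF P] by (simp add: v0_def)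
 have eq': "?\<alpha> \<tau>0 = ?\<beta> t0" by (simp add: eq)
 obtain e1 where e1: "e1 > 0" "\<And>e. 0 < e ==> e \<le> e1 ==> \<exists>I L d. d > 0 \<and>
   (I \<longlongrightarrow> L) (at_left \<tau>0) \<and> (I \<longlongrightarrow> L - 2 * pi * \<i> * sgn (Im (cnj p * q))) (at_right \<tau>0) \<and>
   (\<forall>\<tau>. 0 < \<bar>\<tau> - \<tau>0\<bar> \<and> \<bar>\<tau> - \<tau>0\<bar> < d \<longrightarrow> (\<exists>H. I \<tau> = H (?\<beta> (t0 + e)) - H (?\<beta> (t0 - e)) \<and>
    (\<forall>t\<in>{t0 - e..t0 + e}. (H has_field_derivative 1 / (?\<beta> t - ?\<alpha> \<tau>)) (at (?\<beta> t)))))"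
  by (rule log_jump[OF \<alpha> \<beta> eq' det]) (rule that)
 obtain e2 where e2: "e2 > 0" "\<And>t. \<bar>t - t0\<bar> < e2 ==> norm (v_of (b t) - v0) < norm v0"
  using isCont_path(2)[OF b t0] v0 eq unfolding continuous_at_eps_delta v0_def
  by (metis dist_norm dist_real_def real_norm_def zero_less_norm_iff)
 obtain d2 where d2: "d2 > 0" "\<And>t. \<bar>t - \<tau>0\<bar> < d2 ==> norm (v_of (a t) - v0) < norm v0"
  using isCont_path(2)[OF a \<tau>0] v0 unfolding continuous_at_eps_delta v0_def
  by (metis dist_norm dist_real_def real_norm_def zero_less_norm_iff)
 define e0 where "e0 = min e1 (min (e2 / 2) (min (t0 / 2) ((1 - t0) / 2)))"
 have e0: "e0 > 0" using e1 e2 t0 by (simp add: e0_def)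
 show thesis
 proof (rule that[OF e0])
  fix e assume e: "0 < e" "e \<le> e0"
  have b': "curve_path x b (t0 - e) (t0 + e)"
   by (rule curve_path_subset[OF b]) (use e t0 in \<open>auto simp: e0_def\<close>)
  have le: "t0 - e \<le> t0 + e" using e by simp
  have vb: "norm (v_of (b t) - v0) < norm v0" if "t \<in> {t0 - e..t0 + e}" for t
   by (rule e2(2)) (use that e e2(1) in \<open>auto simp: e0_def abs_if\<close>)
  obtain I L d where I: "d > 0" "(I \<longlongrightarrow> L) (at_left \<tau>0)" "(I \<longlongrightarrow> L - 2 * pi * \<i> * sgn (Im (cnj p * q))) (at_right \<tau>0)"
   "\<And>\<tau>. 0 < \<bar>\<tau> - \<tau>0\<bar> \<and> \<bar>\<tau> - \<tau>0\<bar> < d ==> (\<exists>H. I \<tau> = H (?\<beta> (t0 + e)) - H (?\<beta> (t0 - e)) \<and>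
    (\<forall>t\<in>{t0 - e..t0 + e}. (H has_field_derivative 1 / (?\<beta> t - ?\<alpha> \<tau>)) (at (?\<beta> t))))"
   using e1(2)[of e] e by (auto simp: e0_def)
  have sa: "curve_path x (star \<circ> a) 0 1" by (rule curve_path_star[OF a])
  \<comment> \<open>On both short pieces \<open>v\<close> lies within \<open>norm v0\<close> of
    \<open>v0\<close>. A point of \<open>b\<close> equal to \<open>star (a \<tau>)\<close> would
    carry the opposite \<open>v\<close>, and this would give
    \<open>norm (2 * v0) < norm v0 + norm v0\<close>.\<close>
  have nb: "star (a \<tau>) \<notin> b ` {t0 - e..t0 + e}" if "\<bar>\<tau> - \<tau>0\<bar> < d2" "\<tau> \<in> {0..1}" for \<tau>
  proof
   assume "star (a \<tau>) \<in> b ` {t0 - e..t0 + e}"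
   then obtain t where t: "t \<in> {t0 - e..t0 + e}" "star (a \<tau>) = b t" by auto
   then have "v_of (b t) = - v_of (a \<tau>)" using v_of_star_unram[OF curve_path_in[OF a that(2)]] by metis
   then have "norm (2 * v0) = norm ((v_of (b t) - v0) + (v_of (a \<tau>) - v0))"
    by (simp add: norm_minus_commute)
   also have "\<dots> < norm v0 + norm v0"
    by (rule le_less_trans[OF norm_triangle_ineq]) (intro add_strict_mono vb[OF t(1)] d2(2)[OF that(1)])
   finally show False by (simp add: norm_mult)
  qed
  define S where "S = (\<lambda>\<tau>. line_int (kern x (star (a \<tau>))) b (t0 - e) (t0 + e))"
  have "(star \<circ> a) \<tau>0 \<notin> b ` {t0 - e..t0 + e}" using nb[of \<tau>0] d2(1) \<tau>0 by simp
  from kern_limit_regular[OF sa \<tau>0 b' le this]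
  have S: "(S \<longlongrightarrow> S \<tau>0) (at \<tau>0)" by (simp add: S_def)
  have main: "I \<tau> - S \<tau> = line_int (kern x (a \<tau>)) b (t0 - e) (t0 + e)"
   if \<tau>: "0 < \<bar>\<tau> - \<tau>0\<bar>" "\<bar>\<tau> - \<tau>0\<bar> < min d (min d1 (min d2 (min \<tau>0 (1 - \<tau>0))))" for \<tau>
  proof -
   have \<tau>': "\<tau> \<in> {0..1}" using \<tau> by (auto simp: abs_if split: if_splits)
   note una = curve_path_in[OF a \<tau>']
   obtain H where H: "I \<tau> = H (?\<beta> (t0 + e)) - H (?\<beta> (t0 - e))"
    "\<And>t. t\<in>{t0 - e..t0 + e} ==> (H has_field_derivative 1 / (?\<beta> t - ?\<alpha> \<tau>)) (at (?\<beta> t))"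
    using I(4)[of \<tau>] \<tau> by auto
   have 1: "(line_integrand (\<lambda>R. 1 / (u_of R - ?\<alpha> \<tau>)) b has_integral H (?\<beta> (t0 + e)) - H (?\<beta> (t0 - e))) {t0 - e..t0 + e}"
    by (rule path_FTC[OF b' le, of "\<lambda>R. H (u_of R)"])
      (rule has_u_derivative_rational[OF curve_path_in[OF b'] H(2)])
   have 2: "line_integrand (kern x (star (a \<tau>))) b integrable_on {t0 - e..t0 + e}"
    by (rule kern_integrable[OF b' le]) (use una nb[of \<tau>] \<tau> \<tau>' in \<open>auto simp: star_in_unram\<close>)
   have "((\<lambda>t. line_integrand (\<lambda>R. 1 / (u_of R - ?\<alpha> \<tau>)) b t - line_integrand (kern x (star (a \<tau>))) b t) has_integral
     I \<tau> - S \<tau>) {t0 - e..t0 + e}"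
    unfolding H(1) S_def line_int_def by (intro has_integral_diff 1 integrable_integral 2)
   then have "(line_integrand (kern x (a \<tau>)) b has_integral I \<tau> - S \<tau>) {t0 - e..t0 + e}"
   proof (rule has_integral_eq[rotated])
    fix t assume t: "t \<in> {t0 - e..t0 + e}"
    note unb = curve_path_in[OF b' t]
    have "?\<alpha> \<tau> \<noteq> ?\<beta> t"
    proof
     assume u: "?\<alpha> \<tau> = ?\<beta> t"
     have "a \<tau> \<noteq> b t" using avoid(2)[of \<tau>] \<tau> t e t0 by (auto simp: e0_def)
     then have "v_of (a \<tau>) \<noteq> v_of (b t)" using u unram_nonzero(5)[OF una] unram_nonzero(5)[OF unb] by metis
     then have "v_of (b t) = - v_of (a \<tau>)"
      using v_of_square[OF una] v_of_square[OF unb] u by (metis power2_eq_iff minus_minus)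
     then have "star (a \<tau>) = b t"
      using u unram_nonzero(5)[OF una] unram_nonzero(5)[OF unb] by (metis star.simps(2))
     then show False using nb[of \<tau>] \<tau> \<tau>' t by auto
    qed
    from kern_star[OF una unb this]
    show "line_integrand (\<lambda>R. 1 / (u_of R - ?\<alpha> \<tau>)) b t - line_integrand (kern x (star (a \<tau>))) b t = line_integrand (kern x (a \<tau>)) b t"
     by (simp only: left_diff_distrib)
   qed
   then show ?thesis by (simp add: line_int_def integral_unique)
  qed
  define \<delta> where "\<delta> = min d (min d1 (min d2 (min \<tau>0 (1 - \<tau>0))))"
  have "\<delta> > 0" using I(1) avoid(1) d2(1) \<tau>0 by (simp add: \<delta>_def)
  then have ev: "eventually (\<lambda>\<tau>. I \<tau> - S \<tau> = line_int (kern x (a \<tau>)) b (t0 - e) (t0 + e)) (at \<tau>0 within A)" for A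
   unfolding eventually_at using main[folded \<delta>_def] by (intro exI[of _ \<delta>]) (auto simp: dist_real_def)
  have S': "(S \<longlongrightarrow> S \<tau>0) (at \<tau>0 within A)" for A by (rule tendsto_mono[OF at_le S]) simp
  have "((\<lambda>\<tau>. line_int (kern x (a \<tau>)) b (t0 - e) (t0 + e)) \<longlongrightarrow> L - S \<tau>0) (at_left \<tau>0)"
   by (rule Lim_transform_eventually[OF tendsto_diff[OF I(2) S'] ev])
  moreover have "((\<lambda>\<tau>. line_int (kern x (a \<tau>)) b (t0 - e) (t0 + e)) \<longlongrightarrow>
    L - 2 * pi * \<i> * sgn (Im (cnj p * q)) - S \<tau>0) (at_right \<tau>0)"
   by (rule Lim_transform_eventually[OF tendsto_diff[OF I(3) S'] ev])
  ultimately show "\<exists>L.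
   ((\<lambda>\<tau>. line_int (kern x (a \<tau>)) b (t0 - e) (t0 + e)) \<longlongrightarrow> L) (at_left \<tau>0) \<and>
   ((\<lambda>\<tau>. line_int (kern x (a \<tau>)) b (t0 - e) (t0 + e)) \<longlongrightarrow> L - 2 * pi * \<i> * sgn (Im (cnj p * q))) (at_right \<tau>0)"
   by (intro exI[of _ "L - S \<tau>0"]) (simp add: algebra_simps)
 qed
qed

text \<open>A point of \<open>a\<close> may lie on several strands of \<open>b\<close>, so one
  \<open>\<tau>0\<close> can have several crossing times \<open>t\<close>. The induction cuts out
  the earliest of them by a short interval around it, and the jumps add up.\<close>

lemma kern_limits_at_crossings:
 assumes a: "curve_path x a 0 1" and \<tau>0: "0 < \<tau>0" "\<tau>0 < 1"
  and b: "curve_path x b 0 1"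
  and \<alpha>: "(\<lambda>\<tau>. u_of (a \<tau>)) differentiable (at \<tau>0)"
  and avoid: "d1 > 0" "\<And>\<tau>. 0 < \<bar>\<tau> - \<tau>0\<bar> ==> \<bar>\<tau> - \<tau>0\<bar> < d1 ==> a \<tau> \<notin> b ` {0..1}"
  and T: "finite T" "T = {t \<in> {r..s}. b t = a \<tau>0}" "r \<notin> T" "s \<notin> T" "0 \<le> r" "r \<le> s" "s \<le> 1"
  and tr: "\<And>t. t \<in> T ==> (\<lambda>t. u_of (b t)) differentiable (at t) \<and> cross_det a b \<tau>0 t \<noteq> 0"
 shows "\<exists>L. ((\<lambda>\<tau>. line_int (kern x (a \<tau>)) b r s) \<longlongrightarrow> L) (at_left \<tau>0) \<and>
  ((\<lambda>\<tau>. line_int (kern x (a \<tau>)) b r s) \<longlongrightarrow> L - 2 * pi * \<i> * (\<Sum>t\<in>T. sgn (cross_det a b \<tau>0 t))) (at_right \<tau>0)"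
 using T tr
proof (induction "card T" arbitrary: r T)
 case 0
 then have "T = {}" by simp
 then have "a \<tau>0 \<notin> b ` {r..s}" using "0.prems"(2) by (auto simp: image_iff)
 from kern_limit_regular[OF a \<tau>0 curve_path_subset[OF b] _ this] "0.prems"
 have *: "((\<lambda>\<tau>. line_int (kern x (a \<tau>)) b r s) \<longlongrightarrow> line_int (kern x (a \<tau>0)) b r s) (at \<tau>0)" by auto
 have "((\<lambda>\<tau>. line_int (kern x (a \<tau>)) b r s) \<longlongrightarrow> line_int (kern x (a \<tau>0)) b r s) (at \<tau>0 within A)" for A
  by (rule tendsto_mono[OF at_le *]) simp
 then show ?case unfolding \<open>T = {}\<close> by (intro exI[of _ "line_int (kern x (a \<tau>0)) b r s"]) simp
next
 case (Suc n)
 note prems = Suc.prems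
 have Tne: "T \<noteq> {}" using Suc.hyps(2) by auto
 define t0 where "t0 = Min T"
 have t0: "t0 \<in> T" "\<And>t. t \<in> T ==> t0 \<le> t" using Min_in[OF prems(1) Tne] Min_le[OF prems(1)] by (auto simp: t0_def)
 have bt0: "b t0 = a \<tau>0" "t0 \<in> {r..s}" using t0(1) prems(2) by auto
 then have rs: "r < t0" "t0 < s" using t0(1) prems(3,4) by (auto simp: less_le)
 define q where "q = vector_derivative (\<lambda>t. u_of (b t)) (at t0)"
 define p where "p = vector_derivative (\<lambda>\<tau>. u_of (a \<tau>)) (at \<tau>0)"
 have q: "((\<lambda>t. u_of (b t)) has_vector_derivative q) (at t0)"
  unfolding q_def using prems(8)[OF t0(1)] vector_derivative_works by blast
 have p: "((\<lambda>\<tau>. u_of (a \<tau>)) has_vector_derivative p) (at \<tau>0)"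
  unfolding p_def using \<alpha> vector_derivative_works by blast
 have cd: "cross_det a b \<tau>0 t0 = Im (cnj p * q)" by (simp add: cross_det_def p_def q_def)
 then have det: "Im (cnj p * q) \<noteq> 0" using prems(8)[OF t0(1)] by simp
 have t01: "0 < t0" "t0 < 1" using rs prems by auto
 obtain e0 where e0: "e0 > 0" "\<And>e. 0 < e ==> e \<le> e0 ==> \<exists>L.
   ((\<lambda>\<tau>. line_int (kern x (a \<tau>)) b (t0 - e) (t0 + e)) \<longlongrightarrow> L) (at_left \<tau>0) \<and>
   ((\<lambda>\<tau>. line_int (kern x (a \<tau>)) b (t0 - e) (t0 + e)) \<longlongrightarrow> L - 2 * pi * \<i> * sgn (Im (cnj p * q))) (at_right \<tau>0)"
  by (rule kern_limit_crossing[OF a \<tau>0 b t01 bt0(1)[symmetric] p q det avoid]) (assumption+, rule that)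
 obtain e3 where e3: "e3 > 0" "\<And>t. t \<in> T ==> t \<noteq> t0 ==> e3 \<le> dist t0 t"
  using finite_set_avoid[OF prems(1), of t0] by blast
 \<comment> \<open>Less than the distance to the other crossing times, and so small that
   \<open>t0 - e\<close> and \<open>t0 + e\<close> lie strictly inside the interval; hence the new
   end \<open>t0 + e\<close> is not itself a crossing time.\<close>
 define e where "e = min e0 (min (e3 / 2) (min ((t0 - r) / 2) ((s - t0) / 2)))"
 have e: "e > 0" "e \<le> e0" "e < e3" "r < t0 - e" "t0 + e < s" using e0(1) e3(1) rs by (auto simp: e_def min_def field_simps)
 define T' where "T' = T - {t0}"
 have far: "t > t0 + e" if "t \<in> T'" for t
  using e3(2)[of t] t0(2)[of t] that e by (auto simp: T'_def dist_real_def)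
 have T'_eq: "T' = {t \<in> {t0 + e..s}. b t = a \<tau>0}"
  using far prems(2) e rs by (auto simp: T'_def less_imp_le)
 have "\<exists>L. ((\<lambda>\<tau>. line_int (kern x (a \<tau>)) b (t0 + e) s) \<longlongrightarrow> L) (at_left \<tau>0) \<and>
  ((\<lambda>\<tau>. line_int (kern x (a \<tau>)) b (t0 + e) s) \<longlongrightarrow> L - 2 * pi * \<i> * (\<Sum>t\<in>T'. sgn (cross_det a b \<tau>0 t))) (at_right \<tau>0)"
 proof (rule Suc.hyps(1)[OF _ _ T'_eq])
  show "n = card T'" using Suc.hyps(2) t0(1) prems(1) by (simp add: T'_def)
  show "finite T'" using prems(1) by (simp add: T'_def)
  show "t0 + e \<notin> T'" using far by blast
  show "s \<notin> T'" using prems(4) by (simp add: T'_def)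
  show "0 \<le> t0 + e" "t0 + e \<le> s" "s \<le> 1" using e t01 prems by auto
  show "(\<lambda>t. u_of (b t)) differentiable (at t) \<and> cross_det a b \<tau>0 t \<noteq> 0" if "t \<in> T'" for t
   using prems(8)[of t] that by (simp add: T'_def)
 qed
 then obtain L3 where L3: "((\<lambda>\<tau>. line_int (kern x (a \<tau>)) b (t0 + e) s) \<longlongrightarrow> L3) (at_left \<tau>0)"
  "((\<lambda>\<tau>. line_int (kern x (a \<tau>)) b (t0 + e) s) \<longlongrightarrow> L3 - 2 * pi * \<i> * (\<Sum>t\<in>T'. sgn (cross_det a b \<tau>0 t))) (at_right \<tau>0)"
  by blast
 obtain L2 where L2: "((\<lambda>\<tau>. line_int (kern x (a \<tau>)) b (t0 - e) (t0 + e)) \<longlongrightarrow> L2) (at_left \<tau>0)"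
   "((\<lambda>\<tau>. line_int (kern x (a \<tau>)) b (t0 - e) (t0 + e)) \<longlongrightarrow> L2 - 2 * pi * \<i> * sgn (Im (cnj p * q))) (at_right \<tau>0)"
  using e0(2)[OF e(1,2)] by blast
 have "a \<tau>0 \<notin> b ` {r..t0 - e}"
 proof
  assume "a \<tau>0 \<in> b ` {r..t0 - e}"
  then obtain t where "t \<in> {r..t0 - e}" "b t = a \<tau>0" by auto
  then show False using t0(2)[of t] prems(2) e rs by auto
 qed
 from kern_limit_regular[OF a \<tau>0 curve_path_subset[OF b] _ this] prems e rs
 have *: "((\<lambda>\<tau>. line_int (kern x (a \<tau>)) b r (t0 - e)) \<longlongrightarrow> line_int (kern x (a \<tau>0)) b r (t0 - e)) (at \<tau>0)" by auto
 define L1 where "L1 = line_int (kern x (a \<tau>0)) b r (t0 - e)"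
 have L1: "((\<lambda>\<tau>. line_int (kern x (a \<tau>)) b r (t0 - e)) \<longlongrightarrow> L1) (at \<tau>0 within A)" for A
  unfolding L1_def by (rule tendsto_mono[OF at_le *]) simp
 have add: "line_int (kern x (a \<tau>)) b r (t0 - e) + line_int (kern x (a \<tau>)) b (t0 - e) (t0 + e) + line_int (kern x (a \<tau>)) b (t0 + e) s =
   line_int (kern x (a \<tau>)) b r s" if "0 < \<bar>\<tau> - \<tau>0\<bar>" "\<bar>\<tau> - \<tau>0\<bar> < min d1 (min \<tau>0 (1 - \<tau>0))" for \<tau>
 proof -
  have "\<tau> \<in> {0..1}" using that by (auto simp: abs_if split: if_splits)
  then have "line_integrand (kern x (a \<tau>)) b integrable_on {0..1}"
   using avoid(2)[of \<tau>] that by (intro kern_integrable[OF b] curve_path_in[OF a]) auto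
  then have i: "line_integrand (kern x (a \<tau>)) b integrable_on {r'..s'}" if "0 \<le> r'" "s' \<le> 1" for r' s'
   by (rule integrable_on_subinterval) (use that in auto)
  have "line_int (kern x (a \<tau>)) b r (t0 - e) + line_int (kern x (a \<tau>)) b (t0 - e) (t0 + e) = line_int (kern x (a \<tau>)) b r (t0 + e)"
   unfolding line_int_def by (rule Henstock_Kurzweil_Integration.integral_combine) (use e prems in \<open>auto intro!: i\<close>)
  moreover have "line_int (kern x (a \<tau>)) b r (t0 + e) + line_int (kern x (a \<tau>)) b (t0 + e) s = line_int (kern x (a \<tau>)) b r s"
   unfolding line_int_def by (rule Henstock_Kurzweil_Integration.integral_combine) (use e prems in \<open>auto intro!: i\<close>)
  ultimately show ?thesis by simp
 qed
 define \<delta> where "\<delta> = min d1 (min \<tau>0 (1 - \<tau>0))"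
 have "\<delta> > 0" using avoid(1) \<tau>0 by (simp add: \<delta>_def)
 then have ev: "eventually (\<lambda>\<tau>. line_int (kern x (a \<tau>)) b r (t0 - e) + line_int (kern x (a \<tau>)) b (t0 - e) (t0 + e) + line_int (kern x (a \<tau>)) b (t0 + e) s =
   line_int (kern x (a \<tau>)) b r s) (at \<tau>0 within A)" for A
  unfolding eventually_at using add[folded \<delta>_def] by (intro exI[of _ \<delta>]) (auto simp: dist_real_def)
 have "((\<lambda>\<tau>. line_int (kern x (a \<tau>)) b r s) \<longlongrightarrow> L1 + L2 + L3) (at_left \<tau>0)"
  by (rule Lim_transform_eventually[OF tendsto_add[OF tendsto_add[OF L1 L2(1)] L3(1)] ev])
 moreover have "((\<lambda>\<tau>. line_int (kern x (a \<tau>)) b r s) \<longlongrightarrow>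
   L1 + (L2 - 2 * pi * \<i> * sgn (Im (cnj p * q))) + (L3 - 2 * pi * \<i> * (\<Sum>t\<in>T'. sgn (cross_det a b \<tau>0 t)))) (at_right \<tau>0)"
  by (rule Lim_transform_eventually[OF tendsto_add[OF tendsto_add[OF L1 L2(2)] L3(2)] ev])
 moreover have "(\<Sum>t\<in>T. sgn (cross_det a b \<tau>0 t)) = sgn (Im (cnj p * q)) + (\<Sum>t\<in>T'. sgn (cross_det a b \<tau>0 t))"
  unfolding T'_def cd[symmetric] by (rule sum.remove[OF prems(1) t0(1)])
 ultimately show ?case
  by (intro exI[of _ "L1 + L2 + L3"]) (simp add: algebra_simps)
qed


text \<open>On either side of a crossing parameter \<open>abel_diff\<close> has derivative zero,
  hence is constant, and the one-sided limits of the kernel integral identify the two constants. The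
  remaining terms are continuous there.\<close>

lemma abel_diff_jump:
 assumes a: "cycle_on x a" and b: "cycle_on x b" and tr: "transversal a b"
  and \<tau>0: "\<tau>0 \<in> fst ` crossings a b"
 defines "J \<equiv> - 2 * pi * \<i> * (\<Sum>t\<in>{t. (\<tau>0, t) \<in> crossings a b}. sgn (cross_det a b \<tau>0 t))"
 obtains L d where "d > 0" "\<And>\<tau>. \<tau>0 - d < \<tau> ==> \<tau> < \<tau>0 ==> abel_diff x a b \<tau> = L"
  "\<And>\<tau>. \<tau>0 < \<tau> ==> \<tau> < \<tau>0 + d ==> abel_diff x a b \<tau> = L + J"
proof -
 have pa: "curve_path x a 0 1" and pb: "curve_path x b 0 1" using a b by (auto intro: cycle_on_curve_path)
 have fin: "finite (crossings a b)" using tr by (simp add: transversal_def)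
 obtain t1 where t1: "(\<tau>0, t1) \<in> crossings a b" using \<tau>0 by auto
 have trD: "s \<in> {0<..<1} \<and> t \<in> {0<..<1} \<and> (\<lambda>\<tau>. u_of (a \<tau>)) differentiable (at s) \<and>
   (\<lambda>\<tau>. u_of (b \<tau>)) differentiable (at t) \<and> cross_det a b s t \<noteq> 0"
  if "(s, t) \<in> crossings a b" for s t
 proof -
  have *: "s \<in> {0<..<1} \<and> t \<in> {0<..<1} \<and> (\<exists>e>0. (\<lambda>\<tau>. u_of (a \<tau>)) C1_differentiable_on {s - e<..<s + e} \<and>
        (\<lambda>\<tau>. u_of (b \<tau>)) C1_differentiable_on {t - e<..<t + e}) \<and> cross_det a b s t \<noteq> 0"
   using tr that unfolding transversal_def by auto
  then obtain e where e: "e > 0" "(\<lambda>\<tau>. u_of (a \<tau>)) C1_differentiable_on {s - e<..<s + e}"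
        "(\<lambda>\<tau>. u_of (b \<tau>)) C1_differentiable_on {t - e<..<t + e}" by blast
  then have "(\<lambda>\<tau>. u_of (a \<tau>)) differentiable (at s)" "(\<lambda>\<tau>. u_of (b \<tau>)) differentiable (at t)"
   by (auto simp: C1_differentiable_on_eq)
  then show ?thesis using * by blast
 qed
 have \<tau>01: "0 < \<tau>0" "\<tau>0 < 1" using trD[OF t1] by auto
 have \<alpha>: "(\<lambda>\<tau>. u_of (a \<tau>)) differentiable (at \<tau>0)" using trD[OF t1] by auto
 obtain d0 where d0: "d0 > 0" "\<And>\<tau>. \<tau> \<in> fst ` crossings a b ==> \<tau> \<noteq> \<tau>0 ==> d0 \<le> dist \<tau>0 \<tau>"
  using finite_set_avoid[of "fst ` crossings a b" \<tau>0] fin by blast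
 define d1 where "d1 = min d0 (min \<tau>0 (1 - \<tau>0))"
 have d1: "d1 > 0" using d0 \<tau>01 by (simp add: d1_def)
 have in01: "\<tau> \<in> {0..1}" "0 < \<tau>" "\<tau> < 1" if "\<bar>\<tau> - \<tau>0\<bar> < d1" for \<tau>
  using that by (auto simp: d1_def abs_if split: if_splits)
 have avoid: "a \<tau> \<notin> b ` {0..1}" if "0 < \<bar>\<tau> - \<tau>0\<bar>" "\<bar>\<tau> - \<tau>0\<bar> < d1" for \<tau>
 proof
  assume "a \<tau> \<in> b ` {0..1}"
  then obtain t where "t \<in> {0..1}" "a \<tau> = b t" by auto
  then have "(\<tau>, t) \<in> crossings a b" using in01[OF that(2)] by (simp add: crossings_def)
  then have "\<tau> \<in> fst ` crossings a b" by force
  then show False using d0(2)[of \<tau>] that by (auto simp: d1_def dist_real_def)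
 qed
 define T where "T = {t. (\<tau>0, t) \<in> crossings a b}"
 have T: "finite T" "T = {t \<in> {0..1}. b t = a \<tau>0}"
 proof -
  have "T \<subseteq> snd ` crossings a b" by (force simp: T_def)
  then show "finite T" using fin finite_subset by blast
  show "T = {t \<in> {0..1}. b t = a \<tau>0}" using \<tau>01 by (auto simp: T_def crossings_def)
 qed
 have T01: "0 \<notin> T" "1 \<notin> T" using trD by (force simp: T_def)+
 obtain L0 where L0: "((\<lambda>\<tau>. line_int (kern x (a \<tau>)) b 0 1) \<longlongrightarrow> L0) (at_left \<tau>0)"
   "((\<lambda>\<tau>. line_int (kern x (a \<tau>)) b 0 1) \<longlongrightarrow> L0 - 2 * pi * \<i> * (\<Sum>t\<in>T. sgn (cross_det a b \<tau>0 t))) (at_right \<tau>0)"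
  using kern_limits_at_crossings[OF pa \<tau>01 pb \<alpha> d1 avoid T T01] trD by (auto simp: T_def)
 have P: "a \<tau>0 \<in> unram x" using curve_path_in[OF pa] \<tau>01 by auto
 define R where "R = (\<lambda>\<tau>. period inv_v b / 2 * (v_of (a \<tau>) / u_of (a \<tau>)) - line_int (abel_form x b) a 0 \<tau>)"
 have "isCont (\<lambda>\<tau>. line_int (abel_form x b) a 0 \<tau>) \<tau>0"
 proof -
  have "continuous_on {0..1} (\<lambda>\<tau>. line_int (abel_form x b) a 0 \<tau>)"
   unfolding line_int_def by (rule indefinite_integral_continuous_1[OF abel_form_integrable(1)[OF pa]]) simp
  then show ?thesis by (rule continuous_on_interior) (use \<tau>01 in auto)
 qed
 then have Rcont: "isCont R \<tau>0" unfolding R_def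
  using isCont_path[OF pa \<tau>01] unram_nonzero(2)[OF P] by (intro continuous_intros) auto
 then have R: "(R \<longlongrightarrow> R \<tau>0) (at \<tau>0 within A)" for A
  by (intro tendsto_mono[OF at_le, of A UNIV]) (auto simp: isCont_def)
 have decomp: "abel_diff x a b = (\<lambda>\<tau>. line_int (kern x (a \<tau>)) b 0 1 + R \<tau>)"
  by (rule ext) (simp add: abel_diff_def abel_sum_def R_def)
 define L where "L = L0 + R \<tau>0"
 have lims: "(abel_diff x a b \<longlongrightarrow> L) (at_left \<tau>0)" "(abel_diff x a b \<longlongrightarrow> L + J) (at_right \<tau>0)"
 proof -
  show "(abel_diff x a b \<longlongrightarrow> L) (at_left \<tau>0)" unfolding decomp L_def by (rule tendsto_add[OF L0(1) R])
  have "(abel_diff x a b \<longlongrightarrow> (L0 - 2 * pi * \<i> * (\<Sum>t\<in>T. sgn (cross_det a b \<tau>0 t))) + R \<tau>0) (at_right \<tau>0)"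
   unfolding decomp by (rule tendsto_add[OF L0(2) R])
  moreover have "(L0 - 2 * pi * \<i> * (\<Sum>t\<in>T. sgn (cross_det a b \<tau>0 t))) + R \<tau>0 = L + J"
   by (simp add: L_def J_def T_def)
  ultimately show "(abel_diff x a b \<longlongrightarrow> L + J) (at_right \<tau>0)" by (simp only:)
 qed
 have der0: "(abel_diff x a b has_vector_derivative 0) (at \<tau>)" if "0 < \<bar>\<tau> - \<tau>0\<bar>" "\<bar>\<tau> - \<tau>0\<bar> < d1" for \<tau>
 proof -
  note \<tau>_in = in01(1)[OF that(2)] and \<tau>_avoid = avoid[OF that]
  obtain d where d: "d > 0" "\<And>\<sigma>. \<sigma> \<in> {0..1} ==> \<bar>\<sigma> - \<tau>\<bar> < d ==> abel_diff x a b \<sigma> = abel_diff x a b \<tau>"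
   by (rule abel_diff_locally_constant[OF a b \<tau>_in \<tau>_avoid]) (rule that)
  have eq: "abel_diff x a b \<tau> = abel_diff x a b \<sigma>" if "dist \<sigma> \<tau> < min d (min \<tau> (1 - \<tau>))" for \<sigma>
  proof -
   have "\<sigma> \<in> {0..1}" "\<bar>\<sigma> - \<tau>\<bar> < d" using that by (auto simp: dist_real_def abs_if split: if_splits)
   from d(2)[OF this] show ?thesis by (rule sym)
  qed
  have "((\<lambda>_. abel_diff x a b \<tau>) has_vector_derivative 0) (at \<tau>)" by (rule has_vector_derivative_const)
  moreover have "0 < min d (min \<tau> (1 - \<tau>))" using d(1) in01[OF that(2)] by simp
  ultimately show ?thesis
   by (rule has_vector_derivative_transform_within) (simp, rule eq)
 qed
 have const: "\<exists>c. \<forall>\<tau>\<in>S. abel_diff x a b \<tau> = c" if S: "convex S" "\<And>\<tau>. \<tau> \<in> S ==> 0 < \<bar>\<tau> - \<tau>0\<bar> \<and> \<bar>\<tau> - \<tau>0\<bar> < d1" for S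
 proof -
  have "(abel_diff x a b has_vector_derivative 0) (at \<tau> within S)" if "\<tau> \<in> S" for \<tau>
   using der0[of \<tau>] S(2)[OF that] by (auto intro: has_vector_derivative_at_within)
  then show ?thesis using has_vector_derivative_zero_constant[OF S(1)] by metis
 qed
 obtain c1 where c1: "\<And>\<tau>. \<tau> \<in> {\<tau>0 - d1<..<\<tau>0} ==> abel_diff x a b \<tau> = c1"
  using const[of "{\<tau>0 - d1<..<\<tau>0}"] by auto
 obtain c2 where c2: "\<And>\<tau>. \<tau> \<in> {\<tau>0<..<\<tau>0 + d1} ==> abel_diff x a b \<tau> = c2"
  using const[of "{\<tau>0<..<\<tau>0 + d1}"] by auto
 have "eventually (\<lambda>\<tau>. abel_diff x a b \<tau> = c1) (at_left \<tau>0)"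
  unfolding eventually_at_left_field using c1 d1 by (intro exI[of _ "\<tau>0 - d1"]) auto
 then have "((\<lambda>_. c1) \<longlongrightarrow> L) (at_left \<tau>0)" by (rule Lim_transform_eventually[OF lims(1)])
 then have c1L: "c1 = L" by (simp add: tendsto_const_iff)
 have "eventually (\<lambda>\<tau>. abel_diff x a b \<tau> = c2) (at_right \<tau>0)"
  unfolding eventually_at_right_field using c2 d1 by (intro exI[of _ "\<tau>0 + d1"]) auto
 then have "((\<lambda>_. c2) \<longlongrightarrow> L + J) (at_right \<tau>0)" by (rule Lim_transform_eventually[OF lims(2)])
 then have c2L: "c2 = L + J" by (simp add: tendsto_const_iff)
 show thesis by (rule that[OF d1]) (use c1 c2 c1L c2L in auto)
qed

text \<open>Around the closed curve \<open>a\<close> the value of \<open>abel_sum\<close> returns,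
  so the total change of \<open>abel_diff\<close> is minus the integral of \<open>abel_form\<close>,
  the bilinear expression in the periods. Counted by its steps, the same change is
  \<open>- 2 * pi * \<i>\<close> times the intersection index.\<close>

theorem legendre_relation:
 assumes "x \<noteq> 0" and a: "cycle_on x a" and b: "cycle_on x b" and tr: "transversal a b"
  and index: "intersection_index a b = 1"
 shows "period inv_v a * period inv_uv b - period inv_v b * period inv_uv a = 8 * pi * \<i> / x"
proof -
 define C where "C = crossings a b"
 define X where "X = fst ` C"
 define J where "J \<tau> = - 2 * pi * \<i> * (\<Sum>t\<in>{t. (\<tau>, t) \<in> C}. sgn (cross_det a b \<tau> t))" for \<tau>
 have fin: "finite C" using tr by (simp add: transversal_def C_def)
 then have finX: "finite X" by (simp add: X_def)
 have X01: "\<tau> \<in> {0<..<1}" if "\<tau> \<in> X" for \<tau>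
  using tr that unfolding transversal_def X_def C_def by auto
 have pa: "curve_path x a 0 1" by (rule cycle_on_curve_path[OF a])
 have "\<exists>L d. d > 0 \<and> (\<forall>\<tau>. \<tau>0 - d < \<tau> \<and> \<tau> < \<tau>0 \<longrightarrow> abel_diff x a b \<tau> = L) \<and>
   (\<forall>\<tau>. \<tau>0 < \<tau> \<and> \<tau> < \<tau>0 + d \<longrightarrow> abel_diff x a b \<tau> = L + J \<tau>0)" if "\<tau>0 \<in> X" for \<tau>0
 proof -
  have \<tau>0: "\<tau>0 \<in> fst ` crossings a b" using that by (simp add: X_def C_def)
  obtain L d where Ld: "d > 0" "\<And>\<tau>. \<tau>0 - d < \<tau> ==> \<tau> < \<tau>0 ==> abel_diff x a b \<tau> = L"
   "\<And>\<tau>. \<tau>0 < \<tau> ==> \<tau> < \<tau>0 + d ==> abel_diff x a b \<tau> = L + - 2 * pi * \<i> * (\<Sum>t\<in>{t. (\<tau>0, t) \<in> crossings a b}. sgn (cross_det a b \<tau>0 t))"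
   by (rule abel_diff_jump[OF a b tr \<tau>0]) (rule that)
  show ?thesis unfolding J_def C_def
   by (intro exI[of _ L] exI[of _ d] conjI allI impI Ld(1)) (elim conjE, rule Ld(2,3); assumption)+
 qed
 then obtain L d where Ld: "\<And>\<tau>0. \<tau>0 \<in> X ==> d \<tau>0 > 0"
   "\<And>\<tau>0 \<tau>. \<tau>0 \<in> X ==> \<tau>0 - d \<tau>0 < \<tau> ==> \<tau> < \<tau>0 ==> abel_diff x a b \<tau> = L \<tau>0"
   "\<And>\<tau>0 \<tau>. \<tau>0 \<in> X ==> \<tau>0 < \<tau> ==> \<tau> < \<tau>0 + d \<tau>0 ==> abel_diff x a b \<tau> = L \<tau>0 + J \<tau>0"
  by metis
 \<comment> \<open>At a crossing parameter the function gets its limit from the left. The step at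
   \<open>\<sigma>\<close> then belongs to intervals that start there, and sums over
   \<open>r \<le> \<sigma> < s\<close> are additive, as the Bolzano principle requires.\<close>
 define \<psi> where "\<psi> \<tau> = (if \<tau> \<in> X then L \<tau> else abel_diff x a b \<tau>)" for \<tau>
 define PP where "PP r s \<longleftrightarrow> (0 \<le> r \<and> s \<le> 1 \<and> r \<le> s \<longrightarrow> \<psi> s - \<psi> r = (\<Sum>\<sigma>\<in>{\<sigma> \<in> X. r \<le> \<sigma> \<and> \<sigma> < s}. J \<sigma>))" for r s
 have "PP 0 1"
 proof (rule Bolzano)
  fix r s t assume H: "PP r s" "PP s t" "r \<le> s" "s \<le> t"
  show "PP r t" unfolding PP_def
  proof
   assume rt: "0 \<le> r \<and> t \<le> 1 \<and> r \<le> t"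
   have un: "{\<sigma> \<in> X. r \<le> \<sigma> \<and> \<sigma> < t} = {\<sigma> \<in> X. r \<le> \<sigma> \<and> \<sigma> < s} \<union> {\<sigma> \<in> X. s \<le> \<sigma> \<and> \<sigma> < t}"
    using H by auto
   have "(\<Sum>\<sigma>\<in>{\<sigma> \<in> X. r \<le> \<sigma> \<and> \<sigma> < t}. J \<sigma>) = (\<Sum>\<sigma>\<in>{\<sigma> \<in> X. r \<le> \<sigma> \<and> \<sigma> < s}. J \<sigma>) + (\<Sum>\<sigma>\<in>{\<sigma> \<in> X. s \<le> \<sigma> \<and> \<sigma> < t}. J \<sigma>)"
    unfolding un by (rule sum.union_disjoint) (use finX in auto)
   moreover have "\<psi> s - \<psi> r = (\<Sum>\<sigma>\<in>{\<sigma> \<in> X. r \<le> \<sigma> \<and> \<sigma> < s}. J \<sigma>)" "\<psi> t - \<psi> s = (\<Sum>\<sigma>\<in>{\<sigma> \<in> X. s \<le> \<sigma> \<and> \<sigma> < t}. J \<sigma>)"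
    using H rt unfolding PP_def by simp_all
   moreover have "\<psi> t - \<psi> r = (\<psi> s - \<psi> r) + (\<psi> t - \<psi> s)" by simp
   ultimately show "\<psi> t - \<psi> r = (\<Sum>\<sigma>\<in>{\<sigma> \<in> X. r \<le> \<sigma> \<and> \<sigma> < t}. J \<sigma>)" by (simp only:)
  qed
 next
  fix \<tau>0 :: real assume \<tau>0: "0 \<le> \<tau>0" "\<tau>0 \<le> 1"
  obtain d0 where d0: "d0 > 0" "\<And>\<tau>. \<tau> \<in> X ==> \<tau> \<noteq> \<tau>0 ==> d0 \<le> dist \<tau>0 \<tau>"
   using finite_set_avoid[OF finX, of \<tau>0] by blast
  have nX: "\<tau> \<notin> X" if "\<bar>\<tau> - \<tau>0\<bar> < d0" "\<tau> \<noteq> \<tau>0" for \<tau>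
   using d0(2)[of \<tau>] that by (auto simp: dist_real_def)
  show "\<exists>d>0. \<forall>r s. r \<le> \<tau>0 \<and> \<tau>0 \<le> s \<and> s - r < d \<longrightarrow> PP r s"
  proof (cases "\<tau>0 \<in> X")
   case True
   show ?thesis
   proof (intro exI[of _ "min d0 (d \<tau>0)"] conjI allI impI)
    fix r s assume rs: "r \<le> \<tau>0 \<and> \<tau>0 \<le> s \<and> s - r < min d0 (d \<tau>0)"
    have \<psi>r: "\<psi> r = L \<tau>0"
    proof (cases "r = \<tau>0")
     case False
     then have "r \<notin> X" "\<tau>0 - d \<tau>0 < r" "r < \<tau>0" using nX[of r] rs by auto
     then show ?thesis using Ld(2)[OF True, of r] by (simp add: \<psi>_def)
    qed (simp add: \<psi>_def True)
    show "PP r s" unfolding PP_def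
    proof
     assume "0 \<le> r \<and> s \<le> 1 \<and> r \<le> s"
     show "\<psi> s - \<psi> r = (\<Sum>\<sigma>\<in>{\<sigma> \<in> X. r \<le> \<sigma> \<and> \<sigma> < s}. J \<sigma>)"
     proof (cases "s = \<tau>0")
      case s: True
      have "\<sigma> \<notin> X" if "r \<le> \<sigma> \<and> \<sigma> < s" for \<sigma> using nX[of \<sigma>] that rs s by auto
      then have e: "{\<sigma> \<in> X. r \<le> \<sigma> \<and> \<sigma> < s} = {}" by blast
      show ?thesis unfolding e using \<psi>r by (simp add: \<psi>_def s True)
     next
      case False
      then have s: "s \<notin> X" "\<tau>0 < s" "s < \<tau>0 + d \<tau>0" using nX[of s] rs by auto
      have "\<sigma> \<notin> X" if "r \<le> \<sigma> \<and> \<sigma> < s" "\<sigma> \<noteq> \<tau>0" for \<sigma>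
       using nX[of \<sigma>] that rs by (auto simp: abs_if split: if_splits)
      then have e: "{\<sigma> \<in> X. r \<le> \<sigma> \<and> \<sigma> < s} = {\<tau>0}" using True s rs by blast
      show ?thesis unfolding e using \<psi>r Ld(3)[OF True s(2,3)] s(1) by (simp add: \<psi>_def)
     qed
    qed
   qed (use d0 Ld(1)[OF True] in auto)
  next
   case False
   have "a \<tau>0 \<notin> b ` {0..1}"
   proof
    assume "a \<tau>0 \<in> b ` {0..1}"
    then obtain t where "t \<in> {0..1}" "a \<tau>0 = b t" by auto
    then have "(\<tau>0, t) \<in> C" using \<tau>0 by (simp add: C_def crossings_def)
    then show False using False by (force simp: X_def)
   qed
   moreover have "\<tau>0 \<in> {0..1}" using \<tau>0 by simp
   ultimately obtain d2 where d2: "d2 > 0" "\<And>\<sigma>. \<sigma> \<in> {0..1} ==> \<bar>\<sigma> - \<tau>0\<bar> < d2 ==> abel_diff x a b \<sigma> = abel_diff x a b \<tau>0"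
    using abel_diff_locally_constant[OF a b, of \<tau>0] by blast
   show ?thesis
   proof (intro exI[of _ "min d0 d2"] conjI allI impI)
    fix r s assume rs: "r \<le> \<tau>0 \<and> \<tau>0 \<le> s \<and> s - r < min d0 d2"
    show "PP r s" unfolding PP_def
    proof
     assume rs': "0 \<le> r \<and> s \<le> 1 \<and> r \<le> s"
     have nX': "\<sigma> \<notin> X" if "r \<le> \<sigma> \<and> \<sigma> \<le> s" for \<sigma>
      using nX[of \<sigma>] that rs False by (cases "\<sigma> = \<tau>0") (auto simp: abs_if split: if_splits)
     then have e: "{\<sigma> \<in> X. r \<le> \<sigma> \<and> \<sigma> < s} = {}" by auto
     moreover have "\<psi> r = abel_diff x a b \<tau>0" "\<psi> s = abel_diff x a b \<tau>0"
      using nX'[of r] nX'[of s] d2(2)[of r] d2(2)[of s] rs rs' by (auto simp: \<psi>_def)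
     ultimately show "\<psi> s - \<psi> r = (\<Sum>\<sigma>\<in>{\<sigma> \<in> X. r \<le> \<sigma> \<and> \<sigma> < s}. J \<sigma>)" unfolding e by simp
    qed
   qed (use d0 d2 in auto)
  qed
 qed simp
 then have "\<psi> 1 - \<psi> 0 = (\<Sum>\<sigma>\<in>{\<sigma> \<in> X. 0 \<le> \<sigma> \<and> \<sigma> < 1}. J \<sigma>)" by (simp add: PP_def)
 also have "{\<sigma> \<in> X. 0 \<le> \<sigma> \<and> \<sigma> < 1} = X" using X01 by force
 also have "(\<Sum>\<sigma>\<in>X. J \<sigma>) = - 2 * pi * \<i> * of_real (\<Sum>\<sigma>\<in>X. \<Sum>t\<in>{t. (\<sigma>, t) \<in> C}. sgn (cross_det a b \<sigma> t))"
  by (simp add: J_def sum_distrib_left)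
 also have "(\<Sum>\<sigma>\<in>X. \<Sum>t\<in>{t. (\<sigma>, t) \<in> C}. sgn (cross_det a b \<sigma> t)) = intersection_index a b"
 proof -
  have f: "finite {t. (\<sigma>, t) \<in> C}" for \<sigma>
   by (rule finite_subset[of _ "snd ` C"]) (use fin in force)+
  have "(\<Sum>\<sigma>\<in>X. \<Sum>t\<in>{t. (\<sigma>, t) \<in> C}. sgn (cross_det a b \<sigma> t)) =
    (\<Sum>(\<sigma>, t)\<in>Sigma X (\<lambda>\<sigma>. {t. (\<sigma>, t) \<in> C}). sgn (cross_det a b \<sigma> t))"
   using finX f by (intro sum.Sigma) auto
  moreover have "Sigma X (\<lambda>\<sigma>. {t. (\<sigma>, t) \<in> C}) = C" by (force simp: X_def)
  ultimately show ?thesis by (simp add: intersection_index_def C_def)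
 qed
 finally have 1: "\<psi> 1 - \<psi> 0 = - 2 * pi * \<i>" using index by simp
 have "0 \<notin> X" "1 \<notin> X" using X01 by force+
 then have "\<psi> 1 - \<psi> 0 = abel_diff x a b 1 - abel_diff x a b 0" by (simp add: \<psi>_def)
 also have "\<dots> = - line_int (abel_form x b) a 0 1"
  using a by (simp add: abel_diff_def cycle_on_def line_int_def)
 also have "\<dots> = - (x / 4 * (period inv_uv b * period inv_v a - period inv_v b * period inv_uv a))"
  unfolding abel_form_integrable(2)[OF pa zero_le_one] by (simp add: period_def)
 finally have "x / 4 * (period inv_uv b * period inv_v a - period inv_v b * period inv_uv a) = 2 * pi * \<i>"
  using 1 by simp
 then have "x * (period inv_v a * period inv_uv b - period inv_v b * period inv_uv a) = 8 * pi * \<i>"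
  by (simp add: algebra_simps)
 then show ?thesis using assms(1) by (simp add: field_simps)
qed

section \<open>Uniformization\<close>

text \<open>With \<open>u = 1 / s^2\<close> the cubic is \<open>u ^ 3 * quartic x s\<close>: the
  curve in Jacobi's form, with \<open>s\<close> as parameter at the point over infinity.\<close>

definition quartic :: "complex \<Rightarrow> complex \<Rightarrow> complex" where
 "quartic x s = (1 - s\<^sup>2) * (1 - x * s\<^sup>2)"

definition quartic_root :: "complex \<Rightarrow> complex \<Rightarrow> complex" where
 "quartic_root x s = csqrt (quartic x s)"

lemma quartic_root_square: "(quartic_root x s)\<^sup>2 = quartic x s"
 by (simp add: quartic_root_def)

text \<open>The radius depends only on a bound for the modulus, because the same disc has to serve
  all fibres near a given one when integrals from infinity are differentiated in the
  modulus.\<close>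

lemma quartic_near_0:
 assumes "B > 0"
 obtains \<delta> where "\<delta> > 0" "\<And>x s. norm x \<le> B ==> norm s < \<delta> ==> 0 < Re (quartic x s)"
  "\<And>x s. norm x \<le> B ==> norm s < \<delta> ==> 1 / 2 \<le> norm (quartic_root x s)"
proof -
 define \<delta> where "\<delta> = 1 / (2 * (1 + B + B))"
 have \<delta>: "\<delta> > 0" "\<delta> \<le> 1" "\<delta> * (1 + B + B) = 1 / 2" using assms by (auto simp: \<delta>_def field_simps)
 have half: "norm (quartic x s - 1) \<le> 1 / 2" if x: "norm x \<le> B" and s: "norm s < \<delta>" for x s
 proof -
  have s1: "norm s \<le> 1" using s \<delta> by simp
  have "quartic x s - 1 = - s * (s * (1 + x - x * s\<^sup>2))"
   by (simp add: quartic_def algebra_simps power2_eq_square)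
  then have "norm (quartic x s - 1) = norm s * (norm s * norm (1 + x - x * s\<^sup>2))"
   by (simp add: norm_mult)
  also have "\<dots> \<le> \<delta> * (1 * (1 + B + B))"
  proof (intro mult_mono)
   have "norm (1 + x - x * s\<^sup>2) \<le> norm (1 + x) + norm (x * s\<^sup>2)" by (rule norm_triangle_ineq4)
   also have "\<dots> \<le> (1 + norm x) + norm x * 1"
   proof (intro add_mono)
    show "norm (x * s\<^sup>2) \<le> norm x * 1"
     unfolding norm_mult norm_power using s1 by (intro mult_left_mono power_le_one) auto
   qed (use norm_triangle_ineq[of 1 x] in simp)
   also have "\<dots> \<le> 1 + B + B" using x by simp
   finally show "norm (1 + x - x * s\<^sup>2) \<le> 1 + B + B" .
  qed (use s1 s \<delta> in auto)
  also have "\<dots> = 1 / 2" using \<delta>(3) by simp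
  finally show ?thesis .
 qed
 show thesis
 proof (rule that[OF \<delta>(1)])
  fix x s :: complex assume xs: "norm x \<le> B" "norm s < \<delta>"
  show "0 < Re (quartic x s)"
   using half[OF xs] abs_Re_le_cmod[of "quartic x s - 1"] by auto
  have "1 / 2 \<le> norm (quartic x s)"
   using half[OF xs] norm_triangle_ineq2[of 1 "1 - quartic x s"] by (simp add: norm_minus_commute)
  then have "sqrt ((1 / 2)\<^sup>2) \<le> sqrt (norm (quartic x s))" by (intro real_sqrt_le_mono) (simp add: power2_eq_square)
  then show "1 / 2 \<le> norm (quartic_root x s)" by (simp add: quartic_root_def)
 qed
qed

lemma quartic_root_holomorphic:
 assumes "\<And>s. s \<in> A ==> 0 < Re (quartic x s)"
 shows "quartic_root x holomorphic_on A"
proof -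
 have "(\<lambda>s. csqrt ((1 - s\<^sup>2) * (1 - x * s\<^sup>2))) holomorphic_on A"
  using assms by (intro holomorphic_intros) (auto simp: quartic_def complex_nonpos_Reals_iff not_le)
 then show ?thesis by (simp add: quartic_root_def quartic_def cong: holomorphic_cong)
qed

text \<open>
 The inverse \<open>S\<close> of the elliptic integral \<open>I\<close> is a rescaled Jacobi sine, and \<open>1 / S\<^sup>2\<close>
 is the coordinate \<open>u\<close> as a function of the abelian integral.
\<close>

lemma local_inversion:
 fixes x :: complex
 obtains \<delta> r I S where "\<delta> > 0" "r > 0"
  "\<And>s. norm s < \<delta> ==> 0 < Re (quartic x s)"
  "\<And>s. norm s < \<delta> ==> (I has_field_derivative 2 / quartic_root x s) (at s)" "I 0 = 0"
  "\<And>z. norm z < r ==> (S has_field_derivative quartic_root x (S z) / 2) (at z)" "S 0 = 0"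
  "\<And>z. norm z < r ==> norm (S z) < \<delta>"
  "\<And>s. norm s < \<delta> ==> S (I s) = s"
proof -
 obtain d where d: "d > 0" "\<And>s. norm s < d ==> 0 < Re (quartic x s)"
  using quartic_near_0[of "norm x + 1"] norm_ge_zero[of x] by (metis add_nonneg_pos less_add_one less_imp_le zero_less_one)
 let ?h = "quartic_root x"
 have hol: "?h holomorphic_on ball 0 d" by (rule quartic_root_holomorphic) (use d in auto)
 have nz: "?h s \<noteq> 0" if "norm s < d" for s using d(2)[OF that] by (auto simp: quartic_root_def)
 have "(\<lambda>s. 2 / ?h s) holomorphic_on ball 0 d" using nz by (intro holomorphic_intros hol) auto
 then obtain I0 where I0: "\<And>s. s \<in> ball 0 d ==> (I0 has_field_derivative 2 / ?h s) (at s within ball 0 d)"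
  using holomorphic_convex_primitive'[OF convex_ball open_ball] by metis
 define I where "I = (\<lambda>s. I0 s - I0 0)"
 have I: "(I has_field_derivative 2 / ?h s) (at s)" if "norm s < d" for s
 proof -
  have "(I0 has_field_derivative 2 / ?h s) (at s)" using I0[of s] that at_within_open[OF _ open_ball, of s 0 d] by simp
  then show ?thesis unfolding I_def by (auto intro!: derivative_eq_intros)
 qed
 have Ihol: "I holomorphic_on ball 0 d"
  by (rule holomorphic_onI) (use I in \<open>auto simp: field_differentiable_def intro: has_field_derivative_at_within\<close>)
 have dnz: "deriv I 0 \<noteq> 0" using DERIV_imp_deriv[OF I[of 0]] d(1) nz[of 0] by simp
 have "0 \<in> ball 0 d" using d(1) by simp
 then obtain \<delta> where \<delta>: "\<delta> > 0" "ball (0::complex) \<delta> \<subseteq> ball 0 d" "inj_on I (ball 0 \<delta>)"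
  by (rule has_complex_derivative_locally_injective[OF Ihol _ open_ball dnz]) (rule that)
 have Ihol': "I holomorphic_on ball 0 \<delta>" by (rule holomorphic_on_subset[OF Ihol \<delta>(2)])
 obtain S where S: "S holomorphic_on (I ` ball 0 \<delta>)" "\<And>z. z \<in> ball 0 \<delta> ==> deriv I z * deriv S (I z) = 1"
  "\<And>z. z \<in> ball 0 \<delta> ==> S (I z) = z"
  by (rule holomorphic_has_inverse[OF Ihol' open_ball \<delta>(3)]) (rule that)
 have op: "open (I ` ball 0 \<delta>)" by (rule open_mapping_thm3[OF Ihol' open_ball \<delta>(3)])
 have "0 \<in> I ` ball 0 \<delta>" using \<delta>(1) by (auto intro!: image_eqI[of _ _ 0] simp: I_def)
 then obtain r where r: "r > 0" "ball 0 r \<subseteq> I ` ball 0 \<delta>" using op by (meson open_contains_ball)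
 have I0': "I 0 = 0" by (simp add: I_def)
 show thesis
 proof (rule that[OF \<delta>(1) r(1)])
  fix s :: complex assume "norm s < \<delta>"
  then have s: "s \<in> ball 0 \<delta>" "norm s < d" using \<delta>(2) by auto
  show "0 < Re (quartic x s)" using d(2)[OF s(2)] .
  show "(I has_field_derivative 2 / ?h s) (at s)" using I[OF s(2)] .
  show "S (I s) = s" using S(3)[OF s(1)] .
 next
  fix z :: complex assume "norm z < r"
  then obtain s where s: "s \<in> ball 0 \<delta>" "z = I s" using r(2) by auto
  have Sz: "S z = s" using S(3)[OF s(1)] s(2) by simp
  then show "norm (S z) < \<delta>" using s(1) by simp
  have sd: "norm s < d" using s(1) \<delta>(2) by auto
  have "2 / ?h s * deriv S z = 1" using S(2)[OF s(1)] DERIV_imp_deriv[OF I[OF sd]] s(2) by simp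
  then have eq: "deriv S z = ?h (S z) / 2" using nz[OF sd] Sz by (simp add: field_simps)
  have "(S has_field_derivative deriv S z) (at z)"
   using holomorphic_derivI[OF S(1) op] s by blast
  then show "(S has_field_derivative ?h (S z) / 2) (at z)" unfolding eq .
 next
  show "S 0 = 0" using S(3)[of 0] \<delta>(1) I0' by simp
 qed (rule I0')
qed

text \<open>The doubling formulas are polynomial in the homogeneous pair \<open>(N, D)\<close>, so
  the pair at \<open>z\<close> can be defined from the pair at \<open>z / 2\<close>, and every use
  doubles the disc. The quotient would acquire poles, the pair does not; \<open>x \<noteq> 0\<close>
  and \<open>x \<noteq> 1\<close> keep it free of common zeros.\<close>

lemma entire_extension:
 fixes N D :: "complex \<Rightarrow> complex"
 assumes x: "x \<noteq> 0" "x \<noteq> 1" and r: "r > 0"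
  and hol: "N holomorphic_on ball 0 r" "D holomorphic_on ball 0 r"
  and nz: "\<And>z. norm z < r ==> N z \<noteq> 0 \<or> D z \<noteq> 0"
  and dbl: "\<And>z. norm z < r / 2 ==> N (2 * z) = ((N z)\<^sup>2 - x * (D z)\<^sup>2)\<^sup>2"
   "\<And>z. norm z < r / 2 ==> D (2 * z) = 4 * N z * D z * (N z - D z) * (N z - x * D z)"
 obtains N' D' where "N' holomorphic_on UNIV" "D' holomorphic_on UNIV"
  "\<And>z. norm z < r ==> N' z = N z" "\<And>z. norm z < r ==> D' z = D z"
  "\<And>z. N' z \<noteq> 0 \<or> D' z \<noteq> 0"
proof -
 define step :: "(complex \<Rightarrow> complex \<times> complex) \<Rightarrow> complex \<Rightarrow> complex \<times> complex" where
  "step F z = (((fst (F (z / 2)))\<^sup>2 - x * (snd (F (z / 2)))\<^sup>2)\<^sup>2,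
   4 * fst (F (z / 2)) * snd (F (z / 2)) * (fst (F (z / 2)) - snd (F (z / 2))) * (fst (F (z / 2)) - x * snd (F (z / 2))))" for F z
 define F where "F n = (step ^^ n) (\<lambda>z. (N z, D z))" for n
 have F0: "F 0 z = (N z, D z)" and FS: "F (Suc n) z = step (F n) z" for n z by (simp_all add: F_def)
 have half: "norm (z / 2) < 2 ^ n * r" if "norm z < 2 ^ Suc n * r" for z :: complex and n
  using that by (simp add: norm_divide)
 have Fhol: "(\<lambda>z. fst (F n z)) holomorphic_on ball 0 (2 ^ n * r) \<and> (\<lambda>z. snd (F n z)) holomorphic_on ball 0 (2 ^ n * r)" for n
 proof (induction n)
  case (Suc n)
  have 1: "(\<lambda>z. fst (F n (z / 2))) holomorphic_on ball 0 (2 ^ Suc n * r)"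
   by (rule holomorphic_on_compose_gen[OF _ conjunct1[OF Suc], unfolded o_def])
     (auto intro!: holomorphic_intros simp: norm_divide)
  have 2: "(\<lambda>z. snd (F n (z / 2))) holomorphic_on ball 0 (2 ^ Suc n * r)"
   by (rule holomorphic_on_compose_gen[OF _ conjunct2[OF Suc], unfolded o_def])
     (auto intro!: holomorphic_intros simp: norm_divide)
  show ?case unfolding FS step_def fst_conv snd_conv by (intro conjI holomorphic_intros 1 2)
 qed (use hol in \<open>simp add: F0\<close>)
 have Feq1: "F (Suc n) z = F n z" if "norm z < 2 ^ n * r" for n z
  using that
 proof (induction n arbitrary: z)
  case 0
  then have "norm (z / 2) < r / 2" by (simp add: norm_divide)
  from dbl(1)[OF this] dbl(2)[OF this] show ?case by (simp add: FS F0 step_def)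
 next
  case (Suc n)
  have "F (Suc n) (z / 2) = F n (z / 2)" by (rule Suc.IH[OF half[OF Suc.prems]])
  then show ?case unfolding FS[of "Suc n"] FS[of n z] by (simp only: step_def)
 qed
 have Feq: "F (n + k) z = F n z" if "norm z < 2 ^ n * r" for n k z
 proof (induction k)
  case (Suc k)
  have "(2::real) ^ n * r \<le> 2 ^ (n + k) * r" using r by (intro mult_right_mono power_increasing) auto
  then show ?case using Feq1[of z "n + k"] that Suc by simp
 qed simp
 have Fnz: "fst (F n z) \<noteq> 0 \<or> snd (F n z) \<noteq> 0" if "norm z < 2 ^ n * r" for n z
  using that
 proof (induction n arbitrary: z)
  case (Suc n)
  define p q where "p = fst (F n (z / 2))" and "q = snd (F n (z / 2))"
  have pq: "p \<noteq> 0 \<or> q \<noteq> 0" using Suc.IH[OF half[OF Suc.prems]] by (simp add: p_def q_def)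
  \<comment> \<open>If both new components vanished, \<open>p^2 = x * q^2\<close> together with
    \<open>p = 0\<close>, \<open>q = 0\<close>, \<open>p = q\<close> or \<open>p = x * q\<close>
    would force \<open>p = q = 0\<close>.\<close>
  have "p\<^sup>2 - x * q\<^sup>2 \<noteq> 0" if z: "p * q * (p - q) * (p - x * q) = 0"
  proof
   assume 0: "p\<^sup>2 - x * q\<^sup>2 = 0"
   from z consider "p = 0" | "q = 0" | "p = q" | "p = x * q" by auto
   then show False
   proof cases
    case 3
    then have "(1 - x) * q\<^sup>2 = 0" using 0 by (simp add: algebra_simps)
    then show False using 3 pq x by auto
   next
    case 4
    then have "x * (x - 1) * q\<^sup>2 = 0" using 0 by (simp add: algebra_simps power2_eq_square)
    then show False using 4 pq x by auto
   qed (use 0 pq x in auto)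
  qed
  then show ?case unfolding FS step_def p_def[symmetric] q_def[symmetric] fst_conv snd_conv by auto
 qed (use nz in \<open>simp add: F0\<close>)
 define k where "k z = (LEAST n. norm z < 2 ^ n * r)" for z :: complex
 have ex: "\<exists>n. norm z < 2 ^ n * r" for z :: complex
 proof -
  obtain n where "norm z / r < 2 ^ n" using real_arch_pow[of 2 "norm z / r"] by auto
  then show ?thesis using r by (auto simp: pos_divide_less_eq)
 qed
 define G where "G z = F (k z) z" for z
 have G: "G z = F n z" if "norm z < 2 ^ n * r" for n z
 proof -
  have "norm z < 2 ^ k z * r" unfolding k_def by (rule LeastI_ex[OF ex])
  moreover have "k z \<le> n" unfolding k_def using that by (rule Least_le)
  ultimately show ?thesis using Feq[of z "k z" "n - k z"] by (simp add: G_def)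
 qed
 have Ghol: "(\<lambda>z. p (G z)) holomorphic_on UNIV"
  if p: "\<And>n. (\<lambda>z. p (F n z)) holomorphic_on ball 0 (2 ^ n * r)" for p :: "complex \<times> complex \<Rightarrow> complex"
  unfolding holomorphic_on_def
 proof
  fix z :: complex
  obtain n where n: "norm z < 2 ^ n * r" using ex by blast
  have "(\<lambda>z. p (G z)) holomorphic_on ball 0 (2 ^ n * r)"
   by (rule holomorphic_transform[OF p[of n]]) (simp add: G)
  then show "(\<lambda>z. p (G z)) field_differentiable at z within UNIV"
   using n by (auto simp: holomorphic_on_imp_differentiable_at[OF _ open_ball])
 qed
 show thesis
 proof (rule that[of "\<lambda>z. fst (G z)" "\<lambda>z. snd (G z)"])
  show "(\<lambda>z. fst (G z)) holomorphic_on UNIV" "(\<lambda>z. snd (G z)) holomorphic_on UNIV"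
   using Fhol by (auto intro!: Ghol)
  show "fst (G z) = N z" "snd (G z) = D z" if "norm z < r" for z
   using G[of z 0] that by (simp_all add: F0)
  show "fst (G z) \<noteq> 0 \<or> snd (G z) \<noteq> 0" for z
   using ex[of z] Fnz G by metis
 qed
qed

lemma constant_of_zero_derivative:
 fixes f :: "complex \<Rightarrow> complex"
 assumes "\<And>z. norm z < r ==> (f has_field_derivative 0) (at z)" "norm z < r"
 shows "f z = f 0"
proof -
 have "0 \<in> ball 0 r" "z \<in> ball 0 r" using assms(2) by (auto intro: le_less_trans[OF norm_ge_zero])
 then show ?thesis
  using has_field_derivative_zero_constant[OF convex_ball, of 0 r f] assms(1)
  by (metis (no_types, lifting) at_within_open dist_0_norm mem_ball open_ball)
qed

text \<open>Near 0 put \<open>D / N = S^2\<close>, which is \<open>1 / u\<close>, and let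
  \<open>N\<close> solve \<open>(log N)'' = - (x / 2) * D / N\<close>; this makes \<open>N\<close> a
  function of the kind of Weierstrass' sigma, without poles. The first differential identity says
  that \<open>N / D\<close> and its derivative satisfy the equation of the curve, the second that
  \<open>- N' / N\<close> is a primitive of \<open>x / (2 u)\<close>. Both hold globally once
  doubling has made the pair entire.\<close>

theorem uniformization:
 assumes x: "x \<noteq> 0" "x \<noteq> 1"
 obtains N D I \<delta> where "N holomorphic_on UNIV" "D holomorphic_on UNIV"
  "\<And>z. N z \<noteq> 0 \<or> D z \<noteq> 0"
  "\<And>z. (deriv N z * D z - N z * deriv D z)\<^sup>2 = N z * D z * (N z - D z) * (N z - x * D z)"
  "\<And>z. N z * deriv (deriv N) z - (deriv N z)\<^sup>2 = - (x / 2) * D z * N z"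
  "N 0 \<noteq> 0" "deriv N 0 = 0" "\<delta> > 0" "I 0 = 0"
  "\<And>s. norm s < \<delta> ==> 0 < Re (quartic x s)"
  "\<And>s. norm s < \<delta> ==> (I has_field_derivative 2 / quartic_root x s) (at s)"
  "\<And>s. norm s < \<delta> ==> N (I s) \<noteq> 0" "\<And>s. norm s < \<delta> ==> D (I s) = s\<^sup>2 * N (I s)"
  "\<And>s. norm s < \<delta> ==> deriv N (I s) * D (I s) - N (I s) * deriv D (I s) =
    - s * quartic_root x s * (N (I s))\<^sup>2"
proof -
 obtain \<delta> r0 I S where L: "\<delta> > 0" "r0 > 0"
  "\<And>s. norm s < \<delta> ==> 0 < Re (quartic x s)"
  "\<And>s. norm s < \<delta> ==> (I has_field_derivative 2 / quartic_root x s) (at s)" "I 0 = 0"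
  "\<And>z. norm z < r0 ==> (S has_field_derivative quartic_root x (S z) / 2) (at z)" "S 0 = 0"
  "\<And>z. norm z < r0 ==> norm (S z) < \<delta>"
  "\<And>s. norm s < \<delta> ==> S (I s) = s"
  by (rule local_inversion[of x]) (rule that)
 define h where "h z = quartic_root x (S z)" for z
 note dS = L(6)[folded h_def]
 have h2: "(h z)\<^sup>2 = quartic x (S z)" for z by (simp add: h_def quartic_root_square)
 have hnz: "h z \<noteq> 0" if "norm z < r0" for z
  using L(3)[OF L(8)[OF that]] by (auto simp: h_def quartic_root_def)
 define g1 where "g1 s = - 2 * (1 + x) * s + 4 * x * s ^ 3" for s
 have dq: "(quartic x has_field_derivative g1 s) (at s)" for s
  unfolding quartic_def g1_def by (auto intro!: derivative_eq_intros simp: algebra_simps power2_eq_square power3_eq_cube)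
 have dh: "(h has_field_derivative g1 (S z) / 4) (at z)" if z: "norm z < r0" for z
 proof -
  have "quartic_root x holomorphic_on ball 0 \<delta>" by (rule quartic_root_holomorphic) (use L(3) in auto)
  then obtain d where d: "(quartic_root x has_field_derivative d) (at (S z))"
   using L(8)[OF z] holomorphic_on_open[OF open_ball] by (metis dist_0_norm mem_ball)
  have D: "(h has_field_derivative d * (h z / 2)) (at z)"
   unfolding h_def using DERIV_chain2[OF d L(6)[OF z]] .
  have "((\<lambda>z. (h z)\<^sup>2) has_field_derivative 2 * h z * (d * (h z / 2))) (at z)"
   by (rule derivative_eq_intros D | simp)+
  moreover have "((\<lambda>z. (h z)\<^sup>2) has_field_derivative g1 (S z) * (h z / 2)) (at z)"
   unfolding h2 by (rule DERIV_chain2[OF dq dS[OF z]])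
  ultimately have "2 * h z * (d * (h z / 2)) = g1 (S z) * (h z / 2)" by (rule DERIV_unique)
  then have eq: "d * (h z / 2) = g1 (S z) / 4" using hnz[OF z] by (simp add: field_simps)
  show ?thesis using D unfolding eq .
 qed
 define V where "V z = (S z)\<^sup>2" for z
 define V1 where "V1 z = S z * h z" for z
 have dV: "(V has_field_derivative V1 z) (at z)" if "norm z < r0" for z
  unfolding V_def V1_def by (rule derivative_eq_intros dS[OF that] | simp)+
 have dV1: "(V1 has_field_derivative (1 - 2 * (1 + x) * V z + 3 * x * (V z)\<^sup>2) / 2) (at z)" if "norm z < r0" for z
 proof -
  have "(V1 has_field_derivative h z / 2 * h z + S z * (g1 (S z) / 4)) (at z)"
   unfolding V1_def by (rule derivative_eq_intros dS[OF that] dh[OF that] refl)+ simp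
  moreover have "h z / 2 * h z = quartic x (S z) / 2" using h2[of z] by (simp add: power2_eq_square)
  moreover have "quartic x (S z) / 2 + S z * (g1 (S z) / 4) = (1 - 2 * (1 + x) * V z + 3 * x * (V z)\<^sup>2) / 2"
   by (simp add: quartic_def g1_def V_def field_simps eval_nat_numeral)
  ultimately show ?thesis by (simp only:)
 qed
 have V1sq: "(V1 z)\<^sup>2 = V z * (1 - V z) * (1 - x * V z)" for z
  by (simp add: V1_def V_def power_mult_distrib h2 quartic_def)
 have V0: "V 0 = 0" "V1 0 = 0" by (simp_all add: V_def V1_def L(7))
 have contS: "continuous_on (ball 0 r0) S" "continuous_on (ball 0 r0) h"
  using dS dh by (auto intro!: continuous_at_imp_continuous_on DERIV_isCont)
 \<comment> \<open>The right side of \<open>sn (2 w) = 2 sn w cn w dn w / (1 - k^2 sn^4 w)\<close>,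
   with \<open>S z = sn (z / 2)\<close>, \<open>h = cn dn\<close> and
   \<open>k^2 = x\<close>.\<close>
 define S2 where "S2 z = 2 * S z * h z / (1 - x * S z ^ 4)" for z
 obtain r1 where r1: "r1 > 0" "r1 \<le> r0" "\<And>z. norm z < r1 ==> 1 - x * S z ^ 4 \<noteq> 0 \<and> norm (S2 z) < \<delta>"
 proof -
  have cS: "isCont S 0" and ch: "isCont h 0" using dS[of 0] dh[of 0] L(2) by (auto intro: DERIV_isCont)
  have c1: "((\<lambda>z. 1 - x * S z ^ 4) \<longlongrightarrow> 1 - x * S 0 ^ 4) (nhds 0)"
   using cS by (intro tendsto_intros) (simp add: isCont_def tendsto_at_iff_tendsto_nhds)
  have ch': "(h \<longlongrightarrow> h 0) (nhds 0)" "(S \<longlongrightarrow> S 0) (nhds 0)"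
   using ch cS by (simp_all add: isCont_def tendsto_at_iff_tendsto_nhds)
  have c2: "(S2 \<longlongrightarrow> S2 0) (nhds 0)" unfolding S2_def
   by (intro tendsto_intros c1 ch') (simp add: L(7))
  have "eventually (\<lambda>z. 1 - x * S z ^ 4 \<noteq> 0) (nhds 0)"
   by (rule tendsto_imp_eventually_ne[OF c1]) (simp add: L(7))
  moreover have "eventually (\<lambda>z. norm (S2 z) < \<delta>) (nhds 0)"
   by (rule order_tendstoD(2)[OF tendsto_norm[OF c2]]) (simp add: S2_def L(7) L(1))
  ultimately have "eventually (\<lambda>z. 1 - x * S z ^ 4 \<noteq> 0 \<and> norm (S2 z) < \<delta>) (nhds 0)" by (rule eventually_conj)
  then obtain d where "d > 0" "\<And>z. norm z < d ==> 1 - x * S z ^ 4 \<noteq> 0 \<and> norm (S2 z) < \<delta>"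
   by (auto simp: eventually_nhds_metric)
  then show thesis using that[of "min d r0"] L(2) by auto
 qed
 define r where "r = min r1 r0"
 have r: "r > 0" "r \<le> r1" "r \<le> r0" using r1 L(2) by (auto simp: r_def)
 \<comment> \<open>The derivative of \<open>S2\<close>, with \<open>h\<close> eliminated through its
   square, so that the square of \<open>P\<close> can be compared with
   \<open>quartic x (S2 z)\<close> by pure algebra.\<close>
 define P where "P z = ((quartic x (S z) + S z * g1 (S z) / 2) * (1 - x * S z ^ 4) + 4 * x * S z ^ 4 * quartic x (S z)) / (1 - x * S z ^ 4)\<^sup>2" for z
 have dS2: "(S2 has_field_derivative P z) (at z)" if z: "norm z < r" for z
 proof -
  have z0: "norm z < r0" and q: "1 - x * S z ^ 4 \<noteq> 0" using z r r1(3)[of z] by auto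
  have D: "(S2 has_field_derivative ((2 * (h z / 2) * h z + 2 * S z * (g1 (S z) / 4)) * (1 - x * S z ^ 4) -
    2 * S z * h z * (- (x * (4 * S z ^ 3 * (h z / 2))))) / ((1 - x * S z ^ 4) * (1 - x * S z ^ 4))) (at z)"
   unfolding S2_def
   by (rule derivative_eq_intros dS[OF z0] dh[OF z0] refl)+ (use q in \<open>auto simp: algebra_simps\<close>)
  have e1: "2 * (h z / 2) * h z + 2 * S z * (g1 (S z) / 4) = quartic x (S z) + S z * g1 (S z) / 2"
   using h2[of z] by (simp add: power2_eq_square)
  have e2: "2 * S z * h z * (- (x * (4 * S z ^ 3 * (h z / 2)))) = - (4 * x * S z ^ 4 * quartic x (S z))"
   unfolding h2[symmetric] by (simp add: eval_nat_numeral)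
  show ?thesis using D unfolding e1 e2 P_def power2_eq_square by (simp only: diff_minus_eq_add)
 qed
 have Psq: "(P z)\<^sup>2 = quartic x (S2 z)" if z: "norm z < r" for z
 proof -
  define s where "s = S z"
  define K where "K = 1 - x * s ^ 4"
  have K: "K \<noteq> 0" using z r r1(3)[of z] by (auto simp: K_def s_def)
  have S2sq: "(S2 z)\<^sup>2 = 4 * s\<^sup>2 * quartic x s / K\<^sup>2"
   by (simp add: S2_def power_divide power_mult_distrib h2 s_def K_def)
  have "((quartic x s + s * g1 s / 2) * K + 4 * x * s ^ 4 * quartic x s)\<^sup>2 =
    (K\<^sup>2 - 4 * s\<^sup>2 * quartic x s) * (K\<^sup>2 - x * (4 * s\<^sup>2 * quartic x s))"
   unfolding K_def quartic_def g1_def by algebra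
  then have "(P z)\<^sup>2 = (K\<^sup>2 - 4 * s\<^sup>2 * quartic x s) * (K\<^sup>2 - x * (4 * s\<^sup>2 * quartic x s)) / (K\<^sup>2 * K\<^sup>2)"
   by (simp add: P_def s_def[symmetric] K_def[symmetric] power_divide power2_eq_square)
  also have "\<dots> = (1 - 4 * s\<^sup>2 * quartic x s / K\<^sup>2) * (1 - x * (4 * s\<^sup>2 * quartic x s / K\<^sup>2))"
   using K by (simp add: divide_simps)
  finally show ?thesis unfolding quartic_def[of x "S2 z"] S2sq .
 qed
 have Peq: "P z = quartic_root x (S2 z)" if z: "norm z < r" for z
 proof (rule square_roots_agree[of "ball 0 r" P "\<lambda>z. quartic_root x (S2 z)" 0])
  have sub: "ball 0 r \<subseteq> ball 0 r0" using r by auto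
  have q: "1 - x * S z ^ 4 \<noteq> 0" if "z \<in> ball 0 r" for z using r1(3)[of z] r that by auto
  have g: "continuous_on A (quartic x)" "continuous_on A g1" for A
   unfolding quartic_def g1_def by (intro continuous_intros)+
  have cS: "continuous_on (ball 0 r) S" by (rule continuous_on_subset[OF contS(1) sub])
  have 1: "continuous_on (ball 0 r) (\<lambda>z. quartic x (S z))"
   by (rule continuous_on_compose2[OF g(1)[of UNIV] cS]) simp
  have 2: "continuous_on (ball 0 r) (\<lambda>z. g1 (S z))"
   by (rule continuous_on_compose2[OF g(2)[of UNIV] cS]) simp
  show "continuous_on (ball 0 r) P" unfolding P_def
   using q by (intro continuous_intros 1 2 cS) auto
  have "continuous_on (ball 0 \<delta>) (quartic_root x)"
   by (intro holomorphic_on_imp_continuous_on quartic_root_holomorphic) (use L(3) in auto)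
  moreover have "continuous_on (ball 0 r) S2"
   using dS2 by (auto intro!: continuous_at_imp_continuous_on DERIV_isCont)
  ultimately show "continuous_on (ball 0 r) (\<lambda>z. quartic_root x (S2 z))"
   by (rule continuous_on_compose2) (use r1(3) r in auto)
  show "(P w)\<^sup>2 = (quartic_root x (S2 w))\<^sup>2" if "w \<in> ball 0 r" for w
   using Psq[of w] that by (simp add: quartic_root_square)
  show "quartic_root x (S2 w) \<noteq> 0" if "w \<in> ball 0 r" for w
   using L(3)[of "S2 w"] r1(3)[of w] r that by (auto simp: quartic_root_def)
  show "P 0 = quartic_root x (S2 0)" by (simp add: P_def S2_def L(7) quartic_def quartic_root_def)
 qed (use z r in auto)
 \<comment> \<open>Because \<open>P\<close> is the correct root, \<open>I (S2 z)\<close> has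
   derivative 2 and so equals \<open>2 * z\<close>; applying \<open>S\<close> gives the duplication
   formula.\<close>
 have S_dbl: "S (2 * z) = S2 z" if z: "norm z < r" for z
 proof -
  have "((\<lambda>z. I (S2 z) - 2 * z) has_field_derivative 0) (at w)" if w: "norm w < r" for w
  proof -
   have s: "norm (S2 w) < \<delta>" using r1(3)[of w] w r by auto
   have "((\<lambda>z. I (S2 z)) has_field_derivative 2 / quartic_root x (S2 w) * P w) (at w)"
    by (rule DERIV_chain2[OF L(4)[OF s] dS2[OF w]])
   moreover have "2 / quartic_root x (S2 w) * P w = 2"
    using L(3)[OF s] by (auto simp: Peq[OF w] quartic_root_def)
   ultimately show ?thesis by (auto intro!: derivative_eq_intros)
  qed
  from constant_of_zero_derivative[OF this z] have "I (S2 z) = 2 * z" by (simp add: S2_def L(5,7))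
  then show ?thesis using L(9)[of "S2 z"] r1(3)[of z] z r by auto
 qed
 have V_dbl: "V (2 * z) = 4 * V z * (1 - V z) * (1 - x * V z) / (1 - x * (V z)\<^sup>2)\<^sup>2" if z: "norm z < r" for z
  unfolding V_def S_dbl[OF z] S2_def by (simp add: power_divide power_mult_distrib h2 quartic_def)
 have Vhol: "V holomorphic_on ball 0 r0"
  by (rule holomorphic_onI) (use dV in \<open>auto simp: field_differentiable_def intro: has_field_derivative_at_within\<close>)
 have prim: "\<exists>G. (\<forall>z\<in>ball 0 r0. (G has_field_derivative f z) (at z)) \<and> G 0 = 0"
  if f: "f holomorphic_on ball 0 r0" for f :: "complex \<Rightarrow> complex"
 proof -
  obtain G where G: "\<And>z. z \<in> ball 0 r0 ==> (G has_field_derivative f z) (at z within ball 0 r0)"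
   using holomorphic_convex_primitive'[OF convex_ball open_ball f] by metis
  have "((\<lambda>z. G z - G 0) has_field_derivative f z) (at z)" if "z \<in> ball 0 r0" for z
   using G[OF that] at_within_open[OF that open_ball] by (auto intro!: derivative_eq_intros)
  then show ?thesis by (intro exI[of _ "\<lambda>z. G z - G 0"]) auto
 qed
 \<comment> \<open>Two integrations produce the logarithmic derivative \<open>m\<close> and the
   logarithm \<open>l\<close> of \<open>N\<close>; as an exponential, \<open>N\<close> has no zeros
   on the disc.\<close>
 have "(\<lambda>z. - (x / 2) * V z) holomorphic_on ball 0 r0" by (intro holomorphic_intros Vhol)
 from prim[OF this] obtain m where
  m0: "\<forall>z\<in>ball 0 r0. (m has_field_derivative - (x / 2) * V z) (at z)" "m 0 = 0" by blast
 have m: "\<And>z. norm z < r0 ==> (m has_field_derivative - (x / 2) * V z) (at z)" "m 0 = 0"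
  using m0(1)[THEN bspec] m0(2) by (simp_all only: dist_0_norm mem_ball)
 have mhol: "m holomorphic_on ball 0 r0"
  by (rule holomorphic_onI) (use m in \<open>auto simp: field_differentiable_def intro: has_field_derivative_at_within\<close>)
 from prim[OF mhol] obtain l where
  l0: "\<forall>z\<in>ball 0 r0. (l has_field_derivative m z) (at z)" "l 0 = 0" by blast
 have l: "\<And>z. norm z < r0 ==> (l has_field_derivative m z) (at z)" "l 0 = 0"
  using l0(1)[THEN bspec] l0(2) by (simp_all only: dist_0_norm mem_ball)
 define N where "N z = exp (l z)" for z
 define D where "D z = V z * N z" for z
 have dN: "(N has_field_derivative m z * N z) (at z)" if "norm z < r0" for z
  unfolding N_def by (rule derivative_eq_intros l(1)[OF that] | simp)+
 have Nnz: "N z \<noteq> 0" for z by (simp add: N_def)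
 have dD: "(D has_field_derivative V1 z * N z + V z * (m z * N z)) (at z)" if "norm z < r0" for z
  unfolding D_def by (rule derivative_eq_intros dV[OF that] dN[OF that] refl)+ (simp add: algebra_simps)
 define E where "E z = 1 - x * (V z)\<^sup>2" for z
 have Enz: "E z \<noteq> 0" if "norm z < r" for z using r1(3)[of z] that r by (simp add: E_def V_def power_mult[symmetric])
 have dE: "(E has_field_derivative - 2 * x * V z * V1 z) (at z)" if "norm z < r0" for z
  unfolding E_def by (rule derivative_eq_intros dV[OF that] refl)+ simp
 \<comment> \<open>The logarithmic derivative of \<open>N (2 * z) / (N z ^ 4 * (E z)^2)\<close>, the
   quotient that doubling requires to be 1. Its own derivative vanishes by the duplication formula
   for \<open>V\<close>, and it is 0 at 0.\<close>
 define k where "k z = 2 * m (2 * z) - 4 * m z - 2 * (- 2 * x * V z * V1 z) / E z" for z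
 have dk: "(k has_field_derivative 0) (at z)" if z: "norm z < r / 2" for z
 proof -
  have z': "norm z < r" "norm z < r0" "norm (2 * z) < r0" using z r by (auto simp: norm_mult)
  have d2: "((\<lambda>z. m (2 * z)) has_field_derivative - (x / 2) * V (2 * z) * 2) (at z)"
   by (rule DERIV_chain2[where f = m and g = "\<lambda>z. 2 * z", OF m(1)[OF z'(3)]]) (auto intro!: derivative_eq_intros)
  define v where "v = V z"
  have e: "1 - x * v\<^sup>2 \<noteq> 0" using Enz[OF z'(1)] by (simp add: E_def v_def)
  have "(k has_field_derivative 2 * (- (x / 2) * V (2 * z) * 2) - 4 * (- (x / 2) * V z) -
    (2 * (- 2 * x * (V1 z * V1 z + V z * ((1 - 2 * (1 + x) * V z + 3 * x * (V z)\<^sup>2) / 2))) * E z -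
    2 * (- 2 * x * V z * V1 z) * (- 2 * x * V z * V1 z)) / (E z * E z)) (at z)"
   unfolding k_def
   by (rule derivative_eq_intros d2 m(1)[OF z'(2)] dV[OF z'(2)] dV1[OF z'(2)] dE[OF z'(2)] refl)+
     (use Enz[OF z'(1)] in \<open>auto simp: algebra_simps\<close>)
  moreover have "2 * (- (x / 2) * V (2 * z) * 2) - 4 * (- (x / 2) * V z) -
    (2 * (- 2 * x * (V1 z * V1 z + V z * ((1 - 2 * (1 + x) * V z + 3 * x * (V z)\<^sup>2) / 2))) * E z -
    2 * (- 2 * x * V z * V1 z) * (- 2 * x * V z * V1 z)) / (E z * E z) = 0"
  proof -
   have V1': "V1 z * V1 z = v * (1 - v) * (1 - x * v)" using V1sq[of z] by (simp add: power2_eq_square v_def)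
   have a: "2 * (- 2 * x * (V1 z * V1 z + v * ((1 - 2 * (1 + x) * v + 3 * x * v\<^sup>2) / 2))) * E z -
    2 * (- 2 * x * v * V1 z) * (- 2 * x * v * V1 z) =
    2 * x * v * (1 - x * v\<^sup>2)\<^sup>2 - 8 * x * (v * (1 - v) * (1 - x * v))"
   proof -
    have "2 * (- 2 * x * (V1 z * V1 z + v * ((1 - 2 * (1 + x) * v + 3 * x * v\<^sup>2) / 2))) * E z -
    2 * (- 2 * x * v * V1 z) * (- 2 * x * v * V1 z) =
     - 4 * x * ((V1 z * V1 z) + v * ((1 - 2 * (1 + x) * v + 3 * x * v\<^sup>2) / 2)) * (1 - x * v\<^sup>2) - 8 * x\<^sup>2 * v\<^sup>2 * (V1 z * V1 z)"
     by (simp add: E_def v_def[symmetric] power2_eq_square algebra_simps)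
    also have "\<dots> = 2 * x * v * (1 - x * v\<^sup>2)\<^sup>2 - 8 * x * (v * (1 - v) * (1 - x * v))"
     unfolding V1' by (simp add: field_simps power2_eq_square)
    finally show ?thesis .
   qed
   show ?thesis
    unfolding v_def[symmetric] a unfolding V_dbl[OF z'(1)] E_def v_def[symmetric]
    using e by (simp add: divide_simps power2_eq_square)
  qed
  ultimately show ?thesis by simp
 qed
 have k0: "k z = 0" if "norm z < r / 2" for z
  using constant_of_zero_derivative[OF dk that] by (simp add: k_def m(2) V0)
 have N_dbl: "N (2 * z) = N z ^ 4 * (E z)\<^sup>2" if z: "norm z < r / 2" for z
 proof -
  have "((\<lambda>z. N (2 * z) / (N z ^ 4 * (E z)\<^sup>2)) has_field_derivative 0) (at w)" if w: "norm w < r / 2" for w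
  proof -
   have w': "norm w < r" "norm w < r0" "norm (2 * w) < r0" using w r by (auto simp: norm_mult)
   have d2: "((\<lambda>z. N (2 * z)) has_field_derivative m (2 * w) * N (2 * w) * 2) (at w)"
    by (rule DERIV_chain2[where f = N and g = "\<lambda>z. 2 * z", OF dN[OF w'(3)]]) (auto intro!: derivative_eq_intros)
   define e1 where "e1 = - 2 * x * V w * V1 w"
   have "((\<lambda>z. N z ^ 4 * (E z)\<^sup>2) has_field_derivative
     4 * N w ^ 3 * (m w * N w) * (E w)\<^sup>2 + 2 * E w * e1 * N w ^ 4) (at w)"
    unfolding e1_def by (rule derivative_eq_intros dN[OF w'(2)] dE[OF w'(2)] refl)+ simp
   then have "((\<lambda>z. N (2 * z) / (N z ^ 4 * (E z)\<^sup>2)) has_field_derivative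
    (m (2 * w) * N (2 * w) * 2 * (N w ^ 4 * (E w)\<^sup>2) - N (2 * w) * (4 * N w ^ 3 * (m w * N w) * (E w)\<^sup>2 + 2 * E w * e1 * N w ^ 4)) /
    (N w ^ 4 * (E w)\<^sup>2 * (N w ^ 4 * (E w)\<^sup>2))) (at w)"
    by (rule DERIV_divide[OF d2]) (use Nnz Enz[OF w'(1)] in simp)
   moreover have "m (2 * w) * N (2 * w) * 2 * (N w ^ 4 * (E w)\<^sup>2) - N (2 * w) * (4 * N w ^ 3 * (m w * N w) * (E w)\<^sup>2 + 2 * E w * e1 * N w ^ 4) =
     N (2 * w) * N w ^ 4 * (E w)\<^sup>2 * k w"
    unfolding k_def e1_def[symmetric] using Enz[OF w'(1)] by (simp add: field_simps eval_nat_numeral)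
   ultimately show ?thesis using k0[OF w] by simp
  qed
  from constant_of_zero_derivative[OF this z]
  have "N (2 * z) / (N z ^ 4 * (E z)\<^sup>2) = 1" by (simp add: N_def l(2) E_def V0)
  then show ?thesis unfolding divide_eq_1_iff by blast
 qed
 have hol: "N holomorphic_on ball 0 r" "D holomorphic_on ball 0 r"
  unfolding holomorphic_on_open[OF open_ball]
  by (intro ballI exI, rule dN, use r in simp, intro ballI exI, rule dD, use r in simp)
 have dbl1: "N (2 * z) = ((N z)\<^sup>2 - x * (D z)\<^sup>2)\<^sup>2" if "norm z < r / 2" for z
  unfolding N_dbl[OF that] by (simp add: D_def E_def eval_nat_numeral algebra_simps)
 have dbl2: "D (2 * z) = 4 * N z * D z * (N z - D z) * (N z - x * D z)" if z: "norm z < r / 2" for z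
 proof -
  have z': "norm z < r" using z r by simp
  have "D (2 * z) = 4 * V z * (1 - V z) * (1 - x * V z) / (E z)\<^sup>2 * (N z ^ 4 * (E z)\<^sup>2)"
   unfolding D_def[of "2 * z"] N_dbl[OF z] V_dbl[OF z'] E_def ..
  also have "\<dots> = 4 * V z * (1 - V z) * (1 - x * V z) * N z ^ 4" using Enz[OF z'] by simp
  finally show ?thesis by (simp add: D_def eval_nat_numeral algebra_simps)
 qed
 have nzz: "N z \<noteq> 0 \<or> D z \<noteq> 0" for z using Nnz by blast
 obtain N' D' where ND: "N' holomorphic_on UNIV" "D' holomorphic_on UNIV"
  "\<And>z. norm z < r ==> N' z = N z" "\<And>z. norm z < r ==> D' z = D z"
  "\<And>z. N' z \<noteq> 0 \<or> D' z \<noteq> 0"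
  by (rule entire_extension[OF x r(1) hol nzz]) (rule dbl1, assumption, rule dbl2, assumption, rule that)
 have dN': "(N' has_field_derivative m z * N z) (at z)" "(D' has_field_derivative V1 z * N z + V z * (m z * N z)) (at z)"
  if z: "norm z < r" for z
 proof -
  have "norm z < r0" using z r by simp
  from dN[OF this] show "(N' has_field_derivative m z * N z) (at z)"
   by (rule has_field_derivative_transform_within_open[OF _ open_ball[of 0 r]]) (use z ND in auto)
  from dD[OF \<open>norm z < r0\<close>] show "(D' has_field_derivative V1 z * N z + V z * (m z * N z)) (at z)"
   by (rule has_field_derivative_transform_within_open[OF _ open_ball[of 0 r]]) (use z ND in auto)
 qed
 have d1: "deriv N' z = m z * N z" "deriv D' z = V1 z * N z + V z * (m z * N z)" if "norm z < r" for z
  using dN'[OF that] by (simp_all add: DERIV_imp_deriv)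
 have dd: "deriv (deriv N') z = (- (x / 2) * V z + (m z)\<^sup>2) * N z" if z: "norm z < r" for z
 proof -
  have z0: "norm z < r0" using z r by simp
  have "((\<lambda>z. m z * N z) has_field_derivative (- (x / 2) * V z + (m z)\<^sup>2) * N z) (at z)"
   by (rule derivative_eq_intros m(1)[OF z0] dN[OF z0] refl)+ (simp add: algebra_simps power2_eq_square)
  then have "(deriv N' has_field_derivative (- (x / 2) * V z + (m z)\<^sup>2) * N z) (at z)"
   by (rule has_field_derivative_transform_within_open[OF _ open_ball[of 0 r]]) (use z d1 in auto)
  then show ?thesis by (rule DERIV_imp_deriv)
 qed
 have W: "deriv N' z * D' z - N' z * deriv D' z = - V1 z * (N z)\<^sup>2" if "norm z < r" for z
  using that by (simp add: d1 ND(3,4) D_def algebra_simps power2_eq_square)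
 \<comment> \<open>Identities between entire functions need only be checked on the small disc, where
   \<open>N\<close>, \<open>V\<close> and \<open>m\<close> are explicit.\<close>
 have global: "f z = g z" if f: "f holomorphic_on UNIV" "g holomorphic_on UNIV" and eq: "\<And>z. norm z < r ==> f z = g z"
  for f g :: "complex \<Rightarrow> complex" and z
 proof -
  have "(\<lambda>z. f z - g z) holomorphic_on UNIV" using f by (intro holomorphic_intros)
  moreover have "(0::complex) islimpt ball 0 r" using r(1) by (simp add: islimpt_ball)
  ultimately have "f z - g z = 0"
   by (rule analytic_continuation[OF _ open_UNIV connected_UNIV subset_UNIV[of "ball 0 r"] UNIV_I[of 0]]) (use eq in auto)
  then show ?thesis by simp
 qed
 have dhol: "deriv N' holomorphic_on UNIV" "deriv D' holomorphic_on UNIV" "deriv (deriv N') holomorphic_on UNIV"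
  using ND(1,2) by (auto intro!: holomorphic_deriv)
 define \<delta>' where "\<delta>' = \<delta>"
 obtain \<delta>2 where \<delta>2: "\<delta>2 > 0" "\<delta>2 \<le> \<delta>" "\<And>s. norm s < \<delta>2 ==> norm (I s) < r"
 proof -
  have "isCont I 0" using L(4)[of 0] L(1) by (auto intro: DERIV_isCont)
  then obtain d where "d > 0" "\<And>s. dist s 0 < d ==> dist (I s) (I 0) < r"
   using r(1) unfolding continuous_at_eps_delta by (metis dist_commute)
  then show thesis using that[of "min d \<delta>"] L(1,5) by (auto simp: dist_norm)
 qed
 show thesis
 proof (rule that[of N' D' \<delta>2 I])
  show "(deriv N' z * D' z - N' z * deriv D' z)\<^sup>2 = N' z * D' z * (N' z - D' z) * (N' z - x * D' z)" for z
  proof (rule global[of "\<lambda>z. (deriv N' z * D' z - N' z * deriv D' z)\<^sup>2" "\<lambda>z. N' z * D' z * (N' z - D' z) * (N' z - x * D' z)"])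
   fix z :: complex assume z: "norm z < r"
   have e: "(- V1 z * (N z)\<^sup>2)\<^sup>2 = (V1 z)\<^sup>2 * N z ^ 4" by (simp add: power_mult_distrib power_mult[symmetric])
   show "(deriv N' z * D' z - N' z * deriv D' z)\<^sup>2 = N' z * D' z * (N' z - D' z) * (N' z - x * D' z)"
    unfolding W[OF z] unfolding ND(3)[OF z] ND(4)[OF z] D_def e V1sq
    by (simp add: algebra_simps eval_nat_numeral)
  qed (use ND dhol in \<open>auto intro!: holomorphic_intros\<close>)
  show "N' z * deriv (deriv N') z - (deriv N' z)\<^sup>2 = - (x / 2) * D' z * N' z" for z
  proof (rule global[of "\<lambda>z. N' z * deriv (deriv N') z - (deriv N' z)\<^sup>2" "\<lambda>z. - (x / 2) * D' z * N' z"])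
   fix z :: complex assume z: "norm z < r"
   show "N' z * deriv (deriv N') z - (deriv N' z)\<^sup>2 = - (x / 2) * D' z * N' z"
    unfolding dd[OF z] d1[OF z] ND(3)[OF z] ND(4)[OF z] D_def by (simp add: algebra_simps power2_eq_square)
  qed (use ND dhol in \<open>auto intro!: holomorphic_intros\<close>)
  show "N' 0 \<noteq> 0" using ND(3)[of 0] r(1) Nnz by simp
  show "deriv N' 0 = 0" using d1(1)[of 0] r(1) m(2) by simp
  show "I 0 = 0" by (rule L(5))
  fix s :: complex assume s: "norm s < \<delta>2"
  then have s': "norm s < \<delta>" "norm (I s) < r" using \<delta>2 by auto
  show "0 < Re (quartic x s)" "(I has_field_derivative 2 / quartic_root x s) (at s)" using L(3,4)[OF s'(1)] .
  have SI: "S (I s) = s" by (rule L(9)[OF s'(1)])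
  show "N' (I s) \<noteq> 0" using Nnz ND(3)[OF s'(2)] by simp
  show "D' (I s) = s\<^sup>2 * N' (I s)" using ND(3,4)[OF s'(2)] SI by (simp add: D_def V_def)
  show "deriv N' (I s) * D' (I s) - N' (I s) * deriv D' (I s) = - s * quartic_root x s * (N' (I s))\<^sup>2"
   unfolding W[OF s'(2)] unfolding ND(3)[OF s'(2)] by (simp add: V1_def SI h_def)
 qed (use ND \<delta>2 in auto)
qed

section \<open>Integrals near the point over infinity\<close>

definition sigma :: "complex \<Rightarrow> pt \<Rightarrow> complex" where
 "sigma x P = - (u_of P / v_of P) * csqrt (cubic x (u_of P) / u_of P ^ 3)"

lemma sigma_square:
 assumes "P \<in> unram x"
 shows "(sigma x P)\<^sup>2 = 1 / u_of P"
proof -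
 have "(sigma x P)\<^sup>2 = (u_of P)\<^sup>2 / (v_of P)\<^sup>2 * (cubic x (u_of P) / u_of P ^ 3)"
  by (simp add: sigma_def power_mult_distrib power_divide)
 then show ?thesis
  unfolding v_of_square[OF assms, symmetric] using unram_nonzero(1,2)[OF assms]
  by (simp add: power2_eq_square power3_eq_cube)
qed

lemma norm_sigma: "P \<in> unram x ==> norm (sigma x P) = sqrt (norm (1 / u_of P))"
 using sigma_square[of P x] by (metis norm_ge_zero norm_power real_sqrt_unique)

lemma quartic_sigma:
 assumes "P \<in> unram x"
 shows "quartic x (sigma x P) = cubic x (u_of P) / u_of P ^ 3"
  "quartic_root x (sigma x P) = csqrt (cubic x (u_of P) / u_of P ^ 3)"
proof -
 show "quartic x (sigma x P) = cubic x (u_of P) / u_of P ^ 3"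
  using unram_nonzero(2)[OF assms]
  by (simp add: quartic_def sigma_square[OF assms] cubic_def field_simps power3_eq_cube)
 then show "quartic_root x (sigma x P) = csqrt (cubic x (u_of P) / u_of P ^ 3)"
  by (simp add: quartic_root_def)
qed

text \<open>The sign in \<open>sigma\<close> is the one for which
  \<open>v = - quartic_root / sigma ^ 3\<close>. With \<open>u = 1 / sigma^2\<close> this gives
  \<open>du / v = 2 d sigma / quartic_root\<close>, which explains the factor 2 and the plus sign in
  the hypothesis on \<open>I\<close>.\<close>

lemma has_u_derivative_sigma:
 assumes P: "P \<in> unram x" and pos: "0 < Re (quartic x (sigma x P))"
  and I: "(I has_field_derivative 2 * g / quartic_root x (sigma x P)) (at (sigma x P))"
 shows "has_u_derivative x (\<lambda>P. I (sigma x P)) (g / v_of P) P"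
proof (rule has_u_derivativeI[OF P])
 define u v r where "u = u_of P" and "v = v_of P" and "r = csqrt (cubic x u / u ^ 3)"
 note nz = unram_nonzero(1,2)[OF P, folded u_def v_def]
 have m: "cubic x u / u ^ 3 \<notin> \<real>\<^sub>\<le>\<^sub>0"
  using pos unfolding quartic_sigma(1)[OF P] u_def[symmetric] by (simp add: complex_nonpos_Reals_iff)
 then have r: "r \<noteq> 0" by (auto simp: r_def)
 have r2: "r\<^sup>2 = v\<^sup>2 / u ^ 3" using v_of_square[OF P] by (simp add: r_def u_def v_def)
 fix V assume "V (u_of P) = v_of P" "(V has_field_derivative dcubic x (u_of P) / (2 * v_of P)) (at (u_of P))"
 note V = this[folded u_def v_def]
 have "((\<lambda>z. - (z / V z) * csqrt (cubic x z / z ^ 3)) has_field_derivative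
   (- ((1 * v - u * (dcubic x u / (2 * v))) / (v * v))) * r +
    ((dcubic x u * 1 * u ^ 3 - cubic x u * (3 * u\<^sup>2)) / (u ^ 3 * u ^ 3) * inverse (2 * r)) * - (u / v)) (at u)"
 proof -
  have "((\<lambda>z. z / V z) has_field_derivative (1 * V u - u * (dcubic x u / (2 * v))) / (V u * V u)) (at u)"
   by (rule DERIV_divide[OF DERIV_ident V(2)]) (use V(1) nz in simp)
  then have 1: "((\<lambda>z. - (z / V z)) has_field_derivative - ((1 * v - u * (dcubic x u / (2 * v))) / (v * v))) (at u)"
   unfolding V(1) by (rule DERIV_minus)
  have 2: "((\<lambda>z. cubic x z / z ^ 3) has_field_derivative (dcubic x u * 1 * u ^ 3 - cubic x u * (3 * u\<^sup>2)) / (u ^ 3 * u ^ 3)) (at u)"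
   using nz by (auto intro!: derivative_eq_intros)
  have "(csqrt has_field_derivative inverse (2 * csqrt (cubic x u / u ^ 3))) (at (cubic x u / u ^ 3))"
   using m by (rule has_field_derivative_csqrt)
  from DERIV_mult[OF 1 DERIV_chain2[OF this 2]] show ?thesis
   unfolding r_def[symmetric] V(1) by (simp add: mult.commute)
 qed
 moreover have "(- ((1 * v - u * (dcubic x u / (2 * v))) / (v * v))) * r +
    ((dcubic x u * 1 * u ^ 3 - cubic x u * (3 * u\<^sup>2)) / (u ^ 3 * u ^ 3) * inverse (2 * r)) * - (u / v) = r / (2 * v)"
 proof -
  have c: "cubic x u = u ^ 3 * r\<^sup>2" using nz r2 v_of_square[OF P] by (simp add: u_def v_def)
  have v2: "v * v = u ^ 3 * r\<^sup>2" using nz r2 by (simp add: power2_eq_square)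
  define d where "d = dcubic x u"
  have "- ((1 * v - u * (d / (2 * v))) / (v * v)) = - 1 / v + u * d / (2 * (v * v) * v)"
   using nz by (simp add: field_simps)
  moreover have "(d * 1 * u ^ 3 - u ^ 3 * r\<^sup>2 * (3 * u\<^sup>2)) / (u ^ 3 * u ^ 3) = d / u ^ 3 - 3 * r\<^sup>2 / u"
   using nz by (simp add: field_simps eval_nat_numeral)
  ultimately show ?thesis
   unfolding c d_def[symmetric] v2 using nz r by (simp add: divide_simps) (simp add: algebra_simps eval_nat_numeral)
 qed
 ultimately have "((\<lambda>z. - (z / V z) * csqrt (cubic x z / z ^ 3)) has_field_derivative r / (2 * v)) (at u)" by simp
 then have s: "((\<lambda>z. sigma x (Aff z (V z))) has_field_derivative r / (2 * v)) (at u)"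
  by (simp add: sigma_def)
 have "sigma x (Aff u (V u)) = sigma x P" using unram_nonzero(5)[OF P] V(1) by (simp add: u_def v_def)
 then have "(I has_field_derivative 2 * g / r) (at (sigma x (Aff u (V u))))"
  using I unfolding quartic_sigma(2)[OF P] r_def u_def by simp
 from DERIV_chain2[OF this s] show "((\<lambda>z. I (sigma x (Aff z (V z)))) has_field_derivative g / v_of P) (at (u_of P))"
  using r by (simp add: u_def v_def)
qed

text \<open>Nothing is known about the velocity of the path near its start, so convergence is not
  proved by estimating the integrand. In the parameter \<open>sigma\<close> the form is
  \<open>2 g / quartic_root d sigma\<close>, regular at 0, and its primitive \<open>I\<close> has a
  limit there. The factor \<open>g\<close> allows for powers of
  \<open>1 / u = sigma^2\<close>.\<close>

lemma integral_from_infty: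
 assumes \<gamma>: "path_from_infty x \<gamma>" and \<delta>: "\<delta> > 0"
  and pos: "\<And>s. norm s < \<delta> ==> 0 < Re (quartic x s)"
  and I: "\<And>s. norm s < \<delta> ==> (I has_field_derivative 2 * g s / quartic_root x s) (at s)"
  and h: "\<And>P. P \<in> unram x ==> h P = g (sigma x P) / v_of P"
  and int: "\<And>e. 0 < e ==> e \<le> 1 ==> line_integrand h \<gamma> integrable_on {e..1}"
  and t1: "0 < t1" "t1 \<le> 1" "\<And>t. 0 < t ==> t \<le> t1 ==> norm (1 / u_of (\<gamma> t)) < \<delta>\<^sup>2"
 obtains J where "has_int_from_infty h \<gamma> J"
  "\<And>t. 0 < t ==> t \<le> t1 ==> J - line_int h \<gamma> t 1 = I (sigma x (\<gamma> t)) - I 0"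
proof -
 have un: "\<gamma> t \<in> unram x" if "0 < t" "t \<le> 1" for t using \<gamma> that by (auto simp: path_from_infty_def)
 have inf: "filterlim (\<lambda>t. u_of (\<gamma> t)) at_infinity (at_right 0)" using \<gamma> by (simp add: path_from_infty_def)
 have small: "norm (sigma x (\<gamma> t)) < \<delta>" if "0 < t" "t \<le> t1" for t
 proof -
  have "norm (sigma x (\<gamma> t)) = sqrt (norm (1 / u_of (\<gamma> t)))" using norm_sigma[OF un] that t1 by simp
  also have "\<dots> < sqrt (\<delta>\<^sup>2)" using t1(3)[OF that] by (rule real_sqrt_less_mono)
  finally show ?thesis using \<delta> by simp
 qed
 have near: "(line_integrand h \<gamma> has_integral I (sigma x (\<gamma> t)) - I (sigma x (\<gamma> e))) {e..t}"
  if e: "0 < e" "e \<le> t" "t \<le> t1" for e t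
 proof (rule path_FTC[OF _ e(2)])
  show "curve_path x \<gamma> e t"
   by (rule curve_path_subset[OF path_from_infty_curve_path[OF \<gamma> e(1)]]) (use e t1 in auto)
  fix t' assume "t' \<in> {e..t}"
  then have t': "0 < t'" "t' \<le> t1" "t' \<le> 1" using e t1 by auto
  show "has_u_derivative x (\<lambda>P. I (sigma x P)) (h (\<gamma> t')) (\<gamma> t')"
   unfolding h[OF un[OF t'(1,3)]]
   by (rule has_u_derivative_sigma[OF un[OF t'(1,3)] pos[OF small[OF t'(1,2)]] I[OF small[OF t'(1,2)]]])
 qed
 define J where "J = I (sigma x (\<gamma> t1)) - I 0 + line_int h \<gamma> t1 1"
 have split: "line_int h \<gamma> e 1 = (I (sigma x (\<gamma> t)) - I (sigma x (\<gamma> e))) + line_int h \<gamma> t 1"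
  if e: "0 < e" "e \<le> t" "t \<le> t1" for e t
 proof -
  have "line_int h \<gamma> e 1 = line_int h \<gamma> e t + line_int h \<gamma> t 1"
   unfolding line_int_def by (rule Henstock_Kurzweil_Integration.integral_combine[symmetric]) (use e t1 int in auto)
  then show ?thesis using near[OF e] by (simp add: line_int_def integral_unique)
 qed
 show thesis
 proof (rule that[of J])
  have "((\<lambda>e. norm (sigma x (\<gamma> e))) \<longlongrightarrow> 0) (at_right 0)"
  proof -
   have "((\<lambda>t. inverse (u_of (\<gamma> t))) \<longlongrightarrow> 0) (at_right 0)"
    by (rule filterlim_compose[OF tendsto_inverse_0 inf])
   then have l: "((\<lambda>t. sqrt (norm (inverse (u_of (\<gamma> t))))) \<longlongrightarrow> sqrt (norm (0::complex))) (at_right 0)"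
    by (intro tendsto_intros)
   have "eventually (\<lambda>e. sqrt (norm (inverse (u_of (\<gamma> e)))) = norm (sigma x (\<gamma> e))) (at_right 0)"
    unfolding eventually_at_right_field using norm_sigma[OF un]
    by (intro exI[of _ 1]) (auto simp: inverse_eq_divide)
   from Lim_transform_eventually[OF l this] show ?thesis by simp
  qed
  then have s0: "((\<lambda>e. sigma x (\<gamma> e)) \<longlongrightarrow> 0) (at_right 0)" by (rule tendsto_norm_zero_cancel)
  have "isCont I 0" using I[of 0] \<delta> by (auto intro: DERIV_isCont)
  then have "((\<lambda>e. I (sigma x (\<gamma> e))) \<longlongrightarrow> I 0) (at_right 0)" by (rule isCont_tendsto_compose[OF _ s0])
  then have "((\<lambda>e. (I (sigma x (\<gamma> t1)) - I (sigma x (\<gamma> e))) + line_int h \<gamma> t1 1) \<longlongrightarrow> J) (at_right 0)"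
   unfolding J_def by (intro tendsto_intros)
  moreover have "eventually (\<lambda>e. (I (sigma x (\<gamma> t1)) - I (sigma x (\<gamma> e))) + line_int h \<gamma> t1 1 = line_int h \<gamma> e 1) (at_right 0)"
   unfolding eventually_at_right_field
  proof (intro exI[of _ t1] conjI allI impI)
   fix e assume "0 < e" "e < t1"
   then show "(I (sigma x (\<gamma> t1)) - I (sigma x (\<gamma> e))) + line_int h \<gamma> t1 1 = line_int h \<gamma> e 1"
    by (intro split[symmetric]) auto
  qed (use t1 in simp)
  ultimately show "has_int_from_infty h \<gamma> J"
   unfolding has_int_from_infty_def by (rule Lim_transform_eventually)
  fix t assume t: "0 < t" "t \<le> t1"
  have "line_int h \<gamma> t 1 = (I (sigma x (\<gamma> t1)) - I (sigma x (\<gamma> t))) + line_int h \<gamma> t1 1"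
   by (rule split) (use t in auto)
  then show "J - line_int h \<gamma> t 1 = I (sigma x (\<gamma> t)) - I 0" by (simp add: J_def)
 qed
qed

lemma path_near_infty:
 assumes "path_from_infty x \<gamma>" "\<epsilon> > 0"
 obtains t1 where "0 < t1" "t1 \<le> 1" "\<And>t. 0 < t ==> t \<le> t1 ==> norm (1 / u_of (\<gamma> t)) < \<epsilon>"
proof -
 have "((\<lambda>t. inverse (u_of (\<gamma> t))) \<longlongrightarrow> 0) (at_right 0)"
  using assms(1) by (intro filterlim_compose[OF tendsto_inverse_0]) (simp add: path_from_infty_def)
 then have "eventually (\<lambda>t. norm (inverse (u_of (\<gamma> t))) < \<epsilon>) (at_right 0)"
  using assms(2) by (auto dest: tendstoD simp: dist_norm)
 then obtain b where "b > 0" "\<And>t. 0 < t ==> t < b ==> norm (inverse (u_of (\<gamma> t))) < \<epsilon>"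
  unfolding eventually_at_right_field by auto
 then show thesis by (intro that[of "min 1 (b / 2)"]) (auto simp: inverse_eq_divide)
qed

section \<open>Continuation of the inverse integral along paths\<close>

locale uniformized =
 fixes x :: complex and N D :: "complex \<Rightarrow> complex"
 assumes hol: "N holomorphic_on UNIV" "D holomorphic_on UNIV"
  and nz: "\<And>z. N z \<noteq> 0 \<or> D z \<noteq> 0"
  and wronskian_square: "\<And>z. (deriv N z * D z - N z * deriv D z)\<^sup>2 = N z * D z * (N z - D z) * (N z - x * D z)"
  and log_N: "\<And>z. N z * deriv (deriv N) z - (deriv N z)\<^sup>2 = - (x / 2) * D z * N z"
begin

definition W :: "complex \<Rightarrow> complex" where
 "W z = deriv N z * D z - N z * deriv D z"

text \<open>The parameter \<open>z\<close> is sent to \<open>P\<close>: \<open>u = N / D\<close> and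
  \<open>v = (N / D)' = W / D^2\<close>, with denominators cleared. The case \<open>D z = 0\<close>
  is excluded automatically, for it would make \<open>N z = 0\<close> as well.\<close>

definition at_pt :: "complex \<Rightarrow> pt \<Rightarrow> bool" where
 "at_pt z P \<longleftrightarrow> N z = u_of P * D z \<and> W z = v_of P * (D z)\<^sup>2"

lemma at_pt_D: "at_pt z P ==> D z \<noteq> 0"
 using nz[of z] by (auto simp: at_pt_def)

lemma at_pt_unique: "at_pt z P ==> at_pt z Q ==> u_of P = u_of Q \<and> v_of P = v_of Q"
 using at_pt_D[of z P] by (auto simp: at_pt_def)

lemma derivs: "(N has_field_derivative deriv N z) (at z)" "(D has_field_derivative deriv D z) (at z)"
  "(deriv N has_field_derivative deriv (deriv N) z) (at z)"
 using hol holomorphic_deriv[OF hol(1)] by (auto intro!: holomorphic_derivI[OF _ open_UNIV])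

lemma W_holomorphic: "W holomorphic_on UNIV"
 unfolding W_def using hol by (intro holomorphic_intros holomorphic_deriv) auto

lemma quotient_deriv:
 assumes "D z \<noteq> 0"
 shows "((\<lambda>z. N z / D z) has_field_derivative W z / (D z)\<^sup>2) (at z)"
 using DERIV_divide[OF derivs(1) derivs(2) assms] by (simp add: W_def power2_eq_square)

text \<open>Near \<open>H y1\<close> the quotient \<open>U = N / D\<close> has derivative
  \<open>V (U z)\<close> on the chosen branch, so it is a local inverse of the primitive
  \<open>H\<close>. This gives the claim near \<open>y1\<close>; since \<open>N\<close>,
  \<open>D\<close> and \<open>W\<close> are entire, the two equations of \<open>at_pt\<close> are
  equations between holomorphic functions on the ball and extend to all of it.\<close>

lemma continuation_ball:
 assumes V: "V holomorphic_on ball c \<rho>" "\<And>y. y \<in> ball c \<rho> ==> V y \<noteq> 0" "\<And>y. y \<in> ball c \<rho> ==> (V y)\<^sup>2 = cubic x y"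
  and H: "\<And>y. y \<in> ball c \<rho> ==> (H has_field_derivative 1 / V y) (at y)"
  and y1: "y1 \<in> ball c \<rho>" "at_pt (H y1) (Aff y1 (V y1))"
  and y: "y \<in> ball c \<rho>"
 shows "at_pt (H y) (Aff y (V y))"
proof -
 let ?B = "ball c \<rho>"
 define z1 where "z1 = H y1"
 define U where "U z = N z / D z" for z
 have D1: "D z1 \<noteq> 0" using at_pt_D[OF y1(2)] by (simp add: z1_def)
 have U1: "U z1 = y1" using y1(2) D1 by (simp add: U_def at_pt_def z1_def)
 have Hhol: "H holomorphic_on ?B"
  unfolding holomorphic_on_open[OF open_ball] using H by blast
 have cU: "isCont U z1" unfolding U_def by (rule DERIV_isCont[OF quotient_deriv[OF D1]])
 have "eventually (\<lambda>z. U z \<in> ?B) (nhds z1)"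
 proof -
  have "(U \<longlongrightarrow> U z1) (nhds z1)" using cU by (simp add: isCont_def tendsto_at_iff_tendsto_nhds)
  then show ?thesis using topological_tendstoD[OF _ open_ball, of U "U z1" _ c \<rho>] y1(1) U1 by simp
 qed
 moreover have "eventually (\<lambda>z. D z \<noteq> 0) (nhds z1)"
 proof -
  have "isCont D z1" by (rule DERIV_isCont[OF derivs(2)])
  then have "(D \<longlongrightarrow> D z1) (nhds z1)" by (simp add: isCont_def tendsto_at_iff_tendsto_nhds)
  then show ?thesis using D1 by (rule tendsto_imp_eventually_ne)
 qed
 ultimately have "eventually (\<lambda>z. U z \<in> ?B \<and> D z \<noteq> 0) (nhds z1)" by (rule eventually_conj)
 then obtain \<epsilon> where \<epsilon>: "\<epsilon> > 0" "\<And>z. z \<in> ball z1 \<epsilon> ==> U z \<in> ?B \<and> D z \<noteq> 0"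
  unfolding eventually_nhds_metric by (auto simp: dist_commute)
 have WV: "W z / (D z)\<^sup>2 = V (U z)" if z: "z \<in> ball z1 \<epsilon>" for z
 proof (rule square_roots_agree[of "ball z1 \<epsilon>" "\<lambda>z. W z / (D z)\<^sup>2" "\<lambda>z. V (U z)" z1])
  have cD: "continuous_on (ball z1 \<epsilon>) D" "continuous_on (ball z1 \<epsilon>) N" "continuous_on (ball z1 \<epsilon>) W"
   using hol W_holomorphic by (auto intro: holomorphic_on_imp_continuous_on holomorphic_on_subset)
  show "continuous_on (ball z1 \<epsilon>) (\<lambda>z. W z / (D z)\<^sup>2)" using \<epsilon>(2) by (intro continuous_intros cD) auto
  have "continuous_on (ball z1 \<epsilon>) U" unfolding U_def using \<epsilon>(2) by (intro continuous_intros cD) auto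
  then show "continuous_on (ball z1 \<epsilon>) (\<lambda>z. V (U z))"
   by (rule continuous_on_compose2[OF holomorphic_on_imp_continuous_on[OF V(1)]]) (use \<epsilon>(2) in auto)
  show "(W w / (D w)\<^sup>2)\<^sup>2 = (V (U w))\<^sup>2" if "w \<in> ball z1 \<epsilon>" for w
  proof -
   have d: "D w \<noteq> 0" and u: "U w \<in> ?B" using \<epsilon>(2)[OF that] by auto
   have aux: "m * d * (m - d) * (m - x * d) / d ^ 4 = (m / d) * (m / d - 1) * (m / d - x)" if "d \<noteq> 0" for m d :: complex
    using that by (simp add: field_simps eval_nat_numeral)
   have "(W w / (D w)\<^sup>2)\<^sup>2 = (W w)\<^sup>2 / (D w) ^ 4" by (simp add: power_divide)
   also have "\<dots> = N w * D w * (N w - D w) * (N w - x * D w) / (D w) ^ 4"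
    unfolding W_def wronskian_square ..
   also have "\<dots> = cubic x (U w)" unfolding cubic_def U_def by (rule aux[OF d])
   finally show ?thesis unfolding V(3)[OF u] .
  qed
  show "V (U w) \<noteq> 0" if "w \<in> ball z1 \<epsilon>" for w using \<epsilon>(2)[OF that] V(2) by blast
  show "W z1 / (D z1)\<^sup>2 = V (U z1)" using y1(2) D1 by (simp add: U1 at_pt_def z1_def[symmetric])
 qed (use \<epsilon>(1) z in auto)
 \<comment> \<open>\<open>H (U z)\<close> has derivative \<open>(1 / V) * V = 1\<close> and agrees
   with \<open>z\<close> at \<open>z1\<close>.\<close>
 have HU: "H (U z) = z" if z: "z \<in> ball z1 \<epsilon>" for z
 proof -
  have "((\<lambda>z. H (U z) - z) has_field_derivative 0) (at w within ball z1 \<epsilon>)" if w: "w \<in> ball z1 \<epsilon>" for w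
  proof -
   have w': "U w \<in> ?B" "D w \<noteq> 0" using \<epsilon>(2)[OF w] by auto
   have dU: "(U has_field_derivative V (U w)) (at w)" unfolding WV[OF w, symmetric] unfolding U_def by (rule quotient_deriv[OF w'(2)])
   have "((\<lambda>z. H (U z)) has_field_derivative 1 / V (U w) * V (U w)) (at w)" by (rule DERIV_chain2[OF H[OF w'(1)] dU])
   then have "((\<lambda>z. H (U z) - z) has_field_derivative 1 / V (U w) * V (U w) - 1) (at w)" by (rule DERIV_diff[OF _ DERIV_ident])
   then show ?thesis using V(2)[OF w'(1)] by (auto intro: has_field_derivative_at_within)
  qed
  then have "\<exists>k. \<forall>w\<in>ball z1 \<epsilon>. H (U w) - w = k"
   by (rule has_field_derivative_zero_constant[OF convex_ball])
  then obtain k where k: "\<And>w. w \<in> ball z1 \<epsilon> ==> H (U w) - w = k" by auto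
  have "k = H (U z1) - z1" using k[of z1] \<epsilon>(1) by simp
  also have "\<dots> = 0" unfolding U1 unfolding z1_def by simp
  finally show ?thesis using k[OF z] by simp
 qed
 have "deriv H y1 \<noteq> 0" using DERIV_imp_deriv[OF H[OF y1(1)]] V(2)[OF y1(1)] by simp
 then obtain \<rho>1 where \<rho>1: "\<rho>1 > 0" "ball y1 \<rho>1 \<subseteq> ?B" "inj_on H (ball y1 \<rho>1)"
  by (rule has_complex_derivative_locally_injective[OF Hhol y1(1) open_ball]) (rule that)
 have "isCont H y1" by (rule DERIV_isCont[OF H[OF y1(1)]])
 have cUH: "isCont (\<lambda>y. U (H y)) y1" by (rule isCont_o2[OF \<open>isCont H y1\<close>]) (use cU in \<open>simp add: z1_def\<close>)
 have "eventually (\<lambda>y. H y \<in> ball z1 \<epsilon>) (nhds y1)"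
  using \<open>isCont H y1\<close> topological_tendstoD[OF _ open_ball, of H "H y1" "nhds y1" z1 \<epsilon>] \<epsilon>(1)
  by (simp add: isCont_def tendsto_at_iff_tendsto_nhds z1_def)
 moreover have "eventually (\<lambda>y. U (H y) \<in> ball y1 \<rho>1) (nhds y1)"
 proof -
  have "((\<lambda>y. U (H y)) \<longlongrightarrow> U (H y1)) (nhds y1)"
   using cUH tendsto_at_iff_tendsto_nhds[of "\<lambda>y. U (H y)" y1] unfolding isCont_def by (rule iffD1[rotated])
  moreover have "U (H y1) \<in> ball y1 \<rho>1" using \<rho>1(1) U1 by (simp add: z1_def)
  ultimately show ?thesis by (rule topological_tendstoD[OF _ open_ball])
 qed
 moreover have "eventually (\<lambda>y. y \<in> ball y1 \<rho>1) (nhds y1)" using \<rho>1(1) by (intro eventually_nhds_in_open) auto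
 ultimately have "eventually (\<lambda>y. H y \<in> ball z1 \<epsilon> \<and> U (H y) \<in> ball y1 \<rho>1 \<and> y \<in> ball y1 \<rho>1) (nhds y1)"
  by (intro eventually_conj)
 then obtain \<eta> where \<eta>: "\<eta> > 0" "\<And>y. dist y y1 < \<eta> ==> H y \<in> ball z1 \<epsilon> \<and> U (H y) \<in> ball y1 \<rho>1 \<and> y \<in> ball y1 \<rho>1"
  unfolding eventually_nhds_metric by auto
 \<comment> \<open>\<open>HU\<close> gives \<open>H (U (H y)) = H y\<close>; injectivity of
   \<open>H\<close> near \<open>y1\<close> removes the outer \<open>H\<close>.\<close>
 have near: "N (H y) - y * D (H y) = 0 \<and> W (H y) - V y * (D (H y))\<^sup>2 = 0" if "y \<in> ball y1 \<eta>" for y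
 proof -
  have *: "H y \<in> ball z1 \<epsilon>" "U (H y) \<in> ball y1 \<rho>1" "y \<in> ball y1 \<rho>1" using \<eta>(2)[of y] that by (auto simp: dist_commute)
  have "H (U (H y)) = H y" by (rule HU[OF *(1)])
  then have Uy: "U (H y) = y" using \<rho>1(3) * by (auto dest: inj_onD)
  have "D (H y) \<noteq> 0" using \<epsilon>(2)[OF *(1)] by auto
  then show ?thesis using Uy WV[OF *(1)] by (simp add: U_def field_simps)
 qed
 have lim: "y1 islimpt ball y1 \<eta>" using \<eta>(1) by (simp add: islimpt_ball)
 have sub: "ball y1 \<eta> \<subseteq> ?B" using \<eta>(2) \<rho>1(2) by (auto simp: dist_commute)
 have ND: "(\<lambda>y. N (H y)) holomorphic_on ?B" "(\<lambda>y. D (H y)) holomorphic_on ?B" "(\<lambda>y. W (H y)) holomorphic_on ?B"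
  using holomorphic_on_compose_gen[OF Hhol hol(1)] holomorphic_on_compose_gen[OF Hhol hol(2)]
   holomorphic_on_compose_gen[OF Hhol W_holomorphic] by (auto simp: o_def)
 have "N (H y) - y * D (H y) = 0"
  by (rule analytic_continuation[of "\<lambda>y. N (H y) - y * D (H y)" ?B "ball y1 \<eta>" y1])
    (use ND near lim sub y1(1) y in \<open>auto intro!: holomorphic_intros\<close>)
 moreover have "W (H y) - V y * (D (H y))\<^sup>2 = 0"
  by (rule analytic_continuation[of "\<lambda>y. W (H y) - V y * (D (H y))\<^sup>2" ?B "ball y1 \<eta>" y1])
    (use ND V(1) near lim sub y1(1) y in \<open>auto intro!: holomorphic_intros\<close>)
 ultimately show ?thesis by (simp add: at_pt_def)
qed

text \<open>The inverse of the second integral in terms of the first: from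
  \<open>(log N)'' = - (x / 2) * D / N\<close> its derivative in \<open>z\<close> is
  \<open>x / (2 u)\<close>, and \<open>dz = du / v\<close>.\<close>

definition L :: "complex \<Rightarrow> complex" where
 "L z = - (deriv N z / N z)"

lemma L_along:
 assumes H: "(H has_field_derivative 1 / v) (at y)" and g: "at_pt (H y) (Aff y v)" and "y \<noteq> 0"
 shows "((\<lambda>y. L (H y)) has_field_derivative x / 2 * (1 / (y * v))) (at y)"
proof -
 define z where "z = H y"
 have D: "D z \<noteq> 0" using at_pt_D[OF g] by (simp add: z_def)
 have N: "N z = y * D z" using g by (simp add: at_pt_def z_def)
 have N0: "N z \<noteq> 0" using N D assms(3) by simp
 have "(L has_field_derivative - ((deriv (deriv N) z * N z - deriv N z * deriv N z) / (N z * N z))) (at z)"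
  unfolding L_def by (rule DERIV_minus[OF DERIV_divide[OF derivs(3) derivs(1) N0]])
 moreover have "deriv (deriv N) z * N z - deriv N z * deriv N z = - (x / 2) * D z * N z"
  using log_N[of z] by (simp add: power2_eq_square mult.commute)
 moreover have "- (- (x / 2) * D z * N z / (N z * N z)) = x / 2 * (1 / y)"
  unfolding N using D assms(3) by (simp add: field_simps)
 ultimately have "(L has_field_derivative x / 2 * (1 / y)) (at (H y))" unfolding z_def by simp
 from DERIV_chain2[OF this H] show ?thesis by (simp add: field_simps)
qed

text \<open>On a short piece \<open>continuation_ball\<close> applies to the primitive of
  \<open>1 / V\<close> normalised to the current parameter at the start of the piece; the Bolzano
  principle joins the pieces.\<close>

lemma continuation_path:
 assumes path: "curve_path x \<gamma> r s" and "r \<le> s" and start: "at_pt z (\<gamma> r)"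
 shows "at_pt (z + line_int inv_v \<gamma> r s) (\<gamma> s)"
  "x / 2 * line_int inv_uv \<gamma> r s = L (z + line_int inv_v \<gamma> r s) - L z"
proof -
 \<comment> \<open>The starting parameter is quantified inside, because for a later piece it is
   known only after the earlier ones.\<close>
 define PP where "PP a b \<longleftrightarrow> (r \<le> a \<and> b \<le> s \<and> a \<le> b \<longrightarrow> (\<forall>z. at_pt z (\<gamma> a) \<longrightarrow> at_pt (z + line_int inv_v \<gamma> a b) (\<gamma> b) \<and>
   x / 2 * line_int inv_uv \<gamma> a b = L (z + line_int inv_v \<gamma> a b) - L z))" for a b
 have "PP r s"
 proof (rule Bolzano[OF \<open>r \<le> s\<close>])
  fix a b c assume H: "PP a b" "PP b c" "a \<le> b" "b \<le> c"
  show "PP a c" unfolding PP_def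
  proof (intro impI allI)
   fix z assume ac: "r \<le> a \<and> c \<le> s \<and> a \<le> c" and z: "at_pt z (\<gamma> a)"
   have p: "curve_path x \<gamma> a c" using curve_path_subset[OF path] ac by blast
   have "line_int inv_v \<gamma> a b + line_int inv_v \<gamma> b c = line_int inv_v \<gamma> a c"
     "line_int inv_uv \<gamma> a b + line_int inv_uv \<gamma> b c = line_int inv_uv \<gamma> a c"
    unfolding line_int_def using integrable_inv_v[OF p] integrable_inv_uv[OF p] H(3,4) ac
    by (auto intro!: Henstock_Kurzweil_Integration.integral_combine)
   note eq = this[symmetric]
   have 1: "at_pt (z + line_int inv_v \<gamma> a b) (\<gamma> b)" "x / 2 * line_int inv_uv \<gamma> a b = L (z + line_int inv_v \<gamma> a b) - L z"
    using H(1,3,4) ac z unfolding PP_def by auto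
   have 2: "at_pt (z + line_int inv_v \<gamma> a b + line_int inv_v \<gamma> b c) (\<gamma> c)"
    "x / 2 * line_int inv_uv \<gamma> b c = L (z + line_int inv_v \<gamma> a b + line_int inv_v \<gamma> b c) - L (z + line_int inv_v \<gamma> a b)"
    using H(2,3,4) ac 1(1) unfolding PP_def by auto
   show "at_pt (z + line_int inv_v \<gamma> a c) (\<gamma> c) \<and> x / 2 * line_int inv_uv \<gamma> a c = L (z + line_int inv_v \<gamma> a c) - L z"
    unfolding eq distrib_left 1(2) 2(2) using 2(1) by (simp add: add.assoc)
  qed
 next
  fix t0 assume "r \<le> t0" "t0 \<le> s"
  then have t0: "t0 \<in> {r..s}" by simp
  let ?B = "branch_pt x (\<gamma> t0)"
  note un0 = curve_path_in[OF path t0]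
  obtain \<rho> where \<rho>: "\<rho> > 0" "\<rho> \<le> 1" "\<And>z. z \<in> ball (u_of (\<gamma> t0)) \<rho> ==> ?B z \<in> unram x"
   "(\<lambda>z. v_of (?B z)) holomorphic_on ball (u_of (\<gamma> t0)) \<rho>"
   "\<And>z. z \<in> ball (u_of (\<gamma> t0)) \<rho> ==> ((\<lambda>z. v_of (?B z)) has_field_derivative dcubic x z / (2 * v_of (?B z))) (at z)"
   by (rule branch_pt[OF un0 zero_less_one]) (rule that)
  define V where "V z = v_of (?B z)" for z
  have BV: "?B z = Aff z (V z)" for z by (simp add: V_def branch_pt_def)
  have V: "V holomorphic_on ball (u_of (\<gamma> t0)) \<rho>" "V y \<noteq> 0" "(V y)\<^sup>2 = cubic x y" "y \<noteq> 0"
   if "y \<in> ball (u_of (\<gamma> t0)) \<rho>" for y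
   using \<rho>(4) unram_nonzero(1,2)[OF \<rho>(3)[OF that]] v_of_square[OF \<rho>(3)[OF that]] by (simp_all add: V_def[abs_def])
  have Vhol: "V holomorphic_on ball (u_of (\<gamma> t0)) \<rho>" using \<rho>(4) by (simp add: V_def[abs_def])
  have "(\<lambda>y. 1 / V y) holomorphic_on ball (u_of (\<gamma> t0)) \<rho>" using V(2) by (intro holomorphic_intros Vhol) auto
  then obtain H0 where H0: "\<And>y. y \<in> ball (u_of (\<gamma> t0)) \<rho> ==> (H0 has_field_derivative 1 / V y) (at y within ball (u_of (\<gamma> t0)) \<rho>)"
   by (rule holomorphic_convex_primitive'[OF convex_ball open_ball, THEN exE]) auto
  have H0': "(H0 has_field_derivative 1 / V y) (at y)" if "y \<in> ball (u_of (\<gamma> t0)) \<rho>" for y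
   using H0[OF that] at_within_open[OF that open_ball] by simp
  obtain d where d: "d > 0" "\<And>t. t \<in> {r..s} ==> \<bar>t - t0\<bar> < d ==> u_of (\<gamma> t) \<in> ball (u_of (\<gamma> t0)) \<rho> \<and> \<gamma> t = ?B (u_of (\<gamma> t))"
   by (rule path_local_branch[OF path t0 \<rho>(1)]) (rule that)
  have "PP a b" if ab: "a \<le> t0 \<and> t0 \<le> b \<and> b - a < d" for a b
   unfolding PP_def
  proof (intro impI allI)
   fix z assume rs: "r \<le> a \<and> b \<le> s \<and> a \<le> b" and z: "at_pt z (\<gamma> a)"
   have nb: "u_of (\<gamma> t) \<in> ball (u_of (\<gamma> t0)) \<rho>" "\<gamma> t = Aff (u_of (\<gamma> t)) (V (u_of (\<gamma> t)))" if "t \<in> {a..b}" for t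
    using d(2)[of t] rs that ab BV by auto
   have ain: "a \<in> {a..b}" "b \<in> {a..b}" using rs by auto
   define H where "H y = H0 y - H0 (u_of (\<gamma> a)) + z" for y
   have H: "(H has_field_derivative 1 / V y) (at y)" if "y \<in> ball (u_of (\<gamma> t0)) \<rho>" for y
    unfolding H_def using H0'[OF that] by (auto intro!: derivative_eq_intros)
   have "at_pt (H (u_of (\<gamma> a))) (Aff (u_of (\<gamma> a)) (V (u_of (\<gamma> a))))"
    using z nb(2)[OF ain(1)] by (simp add: H_def)
   note st = this
   have cont: "at_pt (H y) (Aff y (V y))" if "y \<in> ball (u_of (\<gamma> t0)) \<rho>" for y
    by (rule continuation_ball[OF Vhol V(2) V(3) H nb(1)[OF ain(1)] st that])
   have p: "curve_path x \<gamma> a b" using curve_path_subset[OF path] rs by blast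
   have int: "(line_integrand h \<gamma> has_integral G (u_of (\<gamma> b)) - G (u_of (\<gamma> a))) {a..b}"
    if G: "\<And>y. y \<in> ball (u_of (\<gamma> t0)) \<rho> ==> (G has_field_derivative h (Aff y (V y))) (at y)" for G h
   proof (rule path_FTC_local[OF p])
    have "continuous_on (ball (u_of (\<gamma> t0)) \<rho>) G"
     using G by (meson DERIV_isCont continuous_at_imp_continuous_on)
    then show "continuous_on {a..b} (\<lambda>t. G (u_of (\<gamma> t)))"
     by (rule continuous_on_compose2) (use p nb in \<open>auto simp: curve_path_def\<close>)
    fix t assume "t \<in> {a<..<b}"
    then have t: "t \<in> {a..b}" by auto
    have "(G has_field_derivative h (\<gamma> t)) (at (u_of (\<gamma> t)))"
     using G[OF nb(1)[OF t]] nb(2)[OF t] by simp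
    then show "\<exists>H \<epsilon>. \<epsilon> > 0 \<and> (\<forall>t'. \<bar>t' - t\<bar> < \<epsilon> \<longrightarrow> G (u_of (\<gamma> t')) = H (u_of (\<gamma> t'))) \<and>
     (H has_field_derivative h (\<gamma> t)) (at (u_of (\<gamma> t)))"
     by (intro exI[of _ G] exI[of _ 1]) auto
   qed (use rs in simp)
   have "(line_integrand inv_v \<gamma> has_integral H (u_of (\<gamma> b)) - H (u_of (\<gamma> a))) {a..b}"
    by (rule int) (use H in simp)
   then have I1: "z + line_int inv_v \<gamma> a b = H (u_of (\<gamma> b))" by (simp add: line_int_def integral_unique H_def)
   have "(line_integrand (\<lambda>P. x / 2 * inv_uv P) \<gamma> has_integral L (H (u_of (\<gamma> b))) - L (H (u_of (\<gamma> a)))) {a..b}"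
   proof (rule int[of "\<lambda>y. L (H y)"])
    fix y assume y: "y \<in> ball (u_of (\<gamma> t0)) \<rho>"
    show "((\<lambda>y. L (H y)) has_field_derivative x / 2 * inv_uv (Aff y (V y))) (at y)"
     unfolding pt.sel by (rule L_along[OF H[OF y] cont[OF y] V(4)[OF y]])
   qed
   moreover have "((\<lambda>t. x / 2 * line_integrand inv_uv \<gamma> t) has_integral x / 2 * line_int inv_uv \<gamma> a b) {a..b}"
    unfolding line_int_def by (intro has_integral_mult_right integrable_integral integrable_inv_uv[OF p]) (use rs in simp)
   ultimately have "x / 2 * line_int inv_uv \<gamma> a b = L (H (u_of (\<gamma> b))) - L (H (u_of (\<gamma> a)))"
    by (intro has_integral_unique[of "\<lambda>t. x / 2 * line_integrand inv_uv \<gamma> t"]) (simp_all only: mult.assoc)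
   moreover have "H (u_of (\<gamma> a)) = z" by (simp add: H_def)
   ultimately show "at_pt (z + line_int inv_v \<gamma> a b) (\<gamma> b) \<and> x / 2 * line_int inv_uv \<gamma> a b = L (z + line_int inv_v \<gamma> a b) - L z"
    unfolding I1 using cont[OF nb(1)[OF ain(2)]] nb(2)[OF ain(2)] by simp
  qed
  then show "\<exists>d>0. \<forall>a b. a \<le> t0 \<and> t0 \<le> b \<and> b - a < d \<longrightarrow> PP a b" using d(1) by blast
 qed
 then show "at_pt (z + line_int inv_v \<gamma> r s) (\<gamma> s)"
  "x / 2 * line_int inv_uv \<gamma> r s = L (z + line_int inv_v \<gamma> r s) - L z"
  using start \<open>r \<le> s\<close> unfolding PP_def by auto
qed

end

text \<open>\<open>continuation_path\<close> needs a finite initial point. The piece near infinity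
  is handled by \<open>integral_from_infty\<close>, where the uniformization is explicit in
  \<open>sigma\<close> and yields a correct starting parameter \<open>z t\<close>; continuation does
  the rest. For the second integral the limit uses that \<open>z t\<close> tends to 0, where
  \<open>L\<close> vanishes.\<close>

theorem abel_inversion:
 assumes x: "x \<noteq> 0" "x \<noteq> 1"
 obtains N D where "uniformized x N D"
  "\<And>\<gamma> \<zeta>. path_from_infty x \<gamma> ==> has_int_from_infty inv_v \<gamma> \<zeta> ==> uniformized.at_pt N D \<zeta> (\<gamma> 1)"
  "\<And>\<gamma> \<zeta>. path_from_infty x \<gamma> ==> has_int_from_infty inv_v \<gamma> \<zeta> ==>
    has_int_from_infty inv_uv \<gamma> (2 / x * uniformized.L N \<zeta>)"
proof -
 obtain N D I \<delta> where U: "N holomorphic_on UNIV" "D holomorphic_on UNIV"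
  "\<And>z. N z \<noteq> 0 \<or> D z \<noteq> 0"
  "\<And>z. (deriv N z * D z - N z * deriv D z)\<^sup>2 = N z * D z * (N z - D z) * (N z - x * D z)"
  "\<And>z. N z * deriv (deriv N) z - (deriv N z)\<^sup>2 = - (x / 2) * D z * N z"
  "N 0 \<noteq> 0" "deriv N 0 = 0" "\<delta> > 0" "I 0 = 0"
  "\<And>s. norm s < \<delta> ==> 0 < Re (quartic x s)"
  "\<And>s. norm s < \<delta> ==> (I has_field_derivative 2 / quartic_root x s) (at s)"
  "\<And>s. norm s < \<delta> ==> N (I s) \<noteq> 0" "\<And>s. norm s < \<delta> ==> D (I s) = s\<^sup>2 * N (I s)"
  "\<And>s. norm s < \<delta> ==> deriv N (I s) * D (I s) - N (I s) * deriv D (I s) =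
    - s * quartic_root x s * (N (I s))\<^sup>2"
  by (rule uniformization[OF x]) (rule that)
 interpret uniformized x N D by unfold_locales (fact U)+
 have main: "at_pt \<zeta> (\<gamma> 1) \<and> has_int_from_infty inv_uv \<gamma> (2 / x * L \<zeta>)"
  if \<gamma>: "path_from_infty x \<gamma>" and \<zeta>: "has_int_from_infty inv_v \<gamma> \<zeta>" for \<gamma> \<zeta>
 proof -
  have path: "curve_path x \<gamma> e 1" if "0 < e" for e by (rule path_from_infty_curve_path[OF \<gamma> that])
  have un: "\<gamma> t \<in> unram x" if "0 < t" "t \<le> 1" for t using \<gamma> that by (auto simp: path_from_infty_def)
  have "\<delta>\<^sup>2 > 0" using U(8) by simp
  then obtain t1 where t1: "0 < t1" "t1 \<le> 1" "\<And>t. 0 < t ==> t \<le> t1 ==> norm (1 / u_of (\<gamma> t)) < \<delta>\<^sup>2"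
   by (rule path_near_infty[OF \<gamma>]) (rule that)
  have I': "(I has_field_derivative 2 * 1 / quartic_root x s) (at s)" if "norm s < \<delta>" for s using U(11)[OF that] by simp
  obtain J where J: "has_int_from_infty inv_v \<gamma> J"
   "\<And>t. 0 < t ==> t \<le> t1 ==> J - line_int inv_v \<gamma> t 1 = I (sigma x (\<gamma> t)) - I 0"
  proof (rule integral_from_infty[OF \<gamma> U(8), where h = inv_v and g = "\<lambda>_. 1" and I = I and ?t1.0 = t1])
   show "0 < Re (quartic x s)" if "norm s < \<delta>" for s by (rule U(10)[OF that])
   show "(I has_field_derivative 2 * 1 / quartic_root x s) (at s)" if "norm s < \<delta>" for s by (rule I'[OF that])
   show "inv_v P = 1 / v_of P" if "P \<in> unram x" for P by simp
   show "line_integrand inv_v \<gamma> integrable_on {e..1}" if "0 < e" "e \<le> 1" for e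
    by (rule integrable_inv_v[OF path[OF that(1)] that(2)])
   show "0 < t1" "t1 \<le> 1" by (fact t1)+
   show "norm (1 / u_of (\<gamma> t)) < \<delta>\<^sup>2" if "0 < t" "t \<le> t1" for t by (rule t1(3)[OF that])
  qed (rule that)
  have "J = \<zeta>" using J(1) \<zeta> unfolding has_int_from_infty_def
   by (rule tendsto_unique[rotated]) simp
  define z where "z t = \<zeta> - line_int inv_v \<gamma> t 1" for t
  have z: "z t = I (sigma x (\<gamma> t))" if "0 < t" "t \<le> t1" for t
   using J(2)[OF that] \<open>J = \<zeta>\<close> U(9) by (simp add: z_def)
  \<comment> \<open>The parameter is \<open>I s\<close> with
    \<open>s = sigma x (\<gamma> t)\<close>. The local formulas for \<open>D\<close> and for the
    Wronskian at \<open>I s\<close> become those of the point because \<open>s^2 = 1 / u\<close> and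
    because of the sign built into \<open>sigma\<close>.\<close>
  have start: "at_pt (z t) (\<gamma> t)" if t: "0 < t" "t \<le> t1" for t
  proof -
   have P: "\<gamma> t \<in> unram x" using un t t1 by simp
   define s where "s = sigma x (\<gamma> t)"
   have "norm s = sqrt (norm (1 / u_of (\<gamma> t)))" using norm_sigma[OF P] by (simp add: s_def)
   also have "\<dots> < sqrt (\<delta>\<^sup>2)" using t1(3)[OF t] by (rule real_sqrt_less_mono)
   finally have s: "norm s < \<delta>" using U(8) by simp
   have s2: "s\<^sup>2 = 1 / u_of (\<gamma> t)" using sigma_square[OF P] by (simp add: s_def)
   note nzP = unram_nonzero(1,2)[OF P]
   have sr: "s = - (u_of (\<gamma> t) / v_of (\<gamma> t)) * quartic_root x s"
    unfolding s_def quartic_sigma(2)[OF P] by (simp add: sigma_def)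
   have zt: "z t = I s" using z[OF t] by (simp add: s_def)
   have "N (z t) = u_of (\<gamma> t) * D (z t)"
    unfolding zt U(13)[OF s] s2 using nzP by simp
   moreover have "W (z t) = v_of (\<gamma> t) * (D (z t))\<^sup>2"
   proof -
    have q: "quartic_root x s = - s * v_of (\<gamma> t) / u_of (\<gamma> t)"
     by (subst (2) sr) (use nzP in simp)
    have "W (z t) = - s * quartic_root x s * (N (I s))\<^sup>2" unfolding W_def zt by (rule U(14)[OF s])
    also have "\<dots> = s\<^sup>2 * v_of (\<gamma> t) / u_of (\<gamma> t) * (N (I s))\<^sup>2" unfolding q by (simp add: power2_eq_square)
    also have "\<dots> = v_of (\<gamma> t) * (D (z t))\<^sup>2"
     unfolding zt U(13)[OF s] power_mult_distrib s2 using nzP by (simp add: power2_eq_square)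
    finally show ?thesis .
   qed
   ultimately show ?thesis by (simp add: at_pt_def)
  qed
  have zl: "z t + line_int inv_v \<gamma> t 1 = \<zeta>" for t by (simp add: z_def)
  have "at_pt \<zeta> (\<gamma> 1)"
   using continuation_path(1)[OF path[OF t1(1)] t1(2) start[OF t1(1) order_refl]] zl by simp
  moreover have "has_int_from_infty inv_uv \<gamma> (2 / x * L \<zeta>)"
  proof -
   have e: "x / 2 * line_int inv_uv \<gamma> t 1 = L \<zeta> - L (z t)" if t: "0 < t" "t \<le> t1" for t
   proof -
    have "t \<le> 1" using t t1 by simp
    from continuation_path(2)[OF path[OF t(1)] this start[OF t]] zl show ?thesis by simp
   qed
   have "((\<lambda>t. \<zeta> - line_int inv_v \<gamma> t 1) \<longlongrightarrow> \<zeta> - \<zeta>) (at_right 0)"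
    using \<zeta> unfolding has_int_from_infty_def by (intro tendsto_intros)
   then have z0: "(z \<longlongrightarrow> 0) (at_right 0)" by (simp add: z_def[abs_def])
   have "isCont L 0" unfolding L_def using U(6) derivs(1,3) by (intro continuous_intros) (auto intro: DERIV_isCont)
   then have "((\<lambda>t. L (z t)) \<longlongrightarrow> L 0) (at_right 0)" by (rule isCont_tendsto_compose[OF _ z0])
   then have "((\<lambda>t. 2 / x * (L \<zeta> - L (z t))) \<longlongrightarrow> 2 / x * (L \<zeta> - L 0)) (at_right 0)" by (intro tendsto_intros)
   moreover have "L 0 = 0" using U(7) by (simp add: L_def)
   moreover have "eventually (\<lambda>t. 2 / x * (L \<zeta> - L (z t)) = line_int inv_uv \<gamma> t 1) (at_right 0)"
    unfolding eventually_at_right_field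
   proof (intro exI[of _ t1] conjI allI impI)
    fix t assume "0 < t" "t < t1"
    then have "x / 2 * line_int inv_uv \<gamma> t 1 = L \<zeta> - L (z t)" using e by simp
    then show "2 / x * (L \<zeta> - L (z t)) = line_int inv_uv \<gamma> t 1" using x by (simp add: field_simps)
   qed (use t1 in simp)
   ultimately show ?thesis unfolding has_int_from_infty_def by (auto elim: Lim_transform_eventually)
  qed
  ultimately show ?thesis by blast
 qed
 show thesis
 proof (rule that[of N D])
  show "uniformized x N D" by unfold_locales
 qed (use main in blast)+
qed

text \<open>No homotopy between the two paths is assumed. The uniformization sees a path only
  through its integral of \<open>du / v\<close>, so continuing from the end of the second path
  inside the ball and following the first path lead to the same point and the same second
  integral.\<close>

theorem abel_jacobi:
 assumes x: "x \<noteq> 0" "x \<noteq> 1"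
  and 1: "path_from_infty x \<gamma>1" "\<gamma>1 1 = Aff q1 w1" "has_int_from_infty inv_v \<gamma>1 (J0 + H0 y)"
  and 2: "path_from_infty x \<gamma>2" "\<gamma>2 1 = Aff c (V c)" "has_int_from_infty inv_v \<gamma>2 J0" "has_int_from_infty inv_uv \<gamma>2 J1"
  and V: "V holomorphic_on ball c \<rho>" "\<And>y. y \<in> ball c \<rho> ==> V y \<noteq> 0" "\<And>y. y \<in> ball c \<rho> ==> (V y)\<^sup>2 = cubic x y"
  and H: "\<And>y. y \<in> ball c \<rho> ==> (H0 has_field_derivative 1 / V y) (at y)"
   "\<And>y. y \<in> ball c \<rho> ==> (H1 has_field_derivative 1 / (y * V y)) (at y)" "H0 c = 0" "H1 c = 0"
  and y: "y \<in> ball c \<rho>"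
 shows "q1 = y" "w1 = V y" "has_int_from_infty inv_uv \<gamma>1 (J1 + H1 y)"
proof -
 obtain N D where u: "uniformized x N D"
  and inv: "\<And>\<gamma> \<zeta>. path_from_infty x \<gamma> ==> has_int_from_infty inv_v \<gamma> \<zeta> ==> uniformized.at_pt N D \<zeta> (\<gamma> 1)"
  "\<And>\<gamma> \<zeta>. path_from_infty x \<gamma> ==> has_int_from_infty inv_v \<gamma> \<zeta> ==>
    has_int_from_infty inv_uv \<gamma> (2 / x * uniformized.L N \<zeta>)"
  by (rule abel_inversion[OF x]) (rule that)
 interpret uniformized x N D by (rule u)
 have c: "c \<in> ball c \<rho>" using y by (auto intro: le_less_trans[OF zero_le_dist])
 define H where "H y = J0 + H0 y" for y
 have dH: "(H has_field_derivative 1 / V y) (at y)" if "y \<in> ball c \<rho>" for y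
  unfolding H_def using H(1)[OF that] by (auto intro!: derivative_eq_intros)
 have st: "at_pt (H c) (Aff c (V c))" using inv(1)[OF 2(1,3)] 2(2) H(3) by (simp add: H_def)
 have "at_pt (H y) (Aff q1 w1)" using inv(1)[OF 1(1,3)] 1(2) by (simp add: H_def)
 from at_pt_unique[OF this continuation_ball[OF V dH c st y]] show "q1 = y" "w1 = V y" by simp_all
 have y0: "y \<noteq> 0" if "y \<in> ball c \<rho>" for y using V(2,3)[OF that] by (auto simp: cubic_def)
 have "((\<lambda>y. L (H y) - x / 2 * H1 y) has_field_derivative 0) (at y within ball c \<rho>)" if y: "y \<in> ball c \<rho>" for y
  using DERIV_diff[OF L_along[OF dH[OF y] continuation_ball[OF V dH c st y] y0[OF y]] DERIV_cmult[OF H(2)[OF y], of "x / 2"]]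
  by (auto intro: has_field_derivative_at_within)
 then have "\<exists>k. \<forall>y\<in>ball c \<rho>. L (H y) - x / 2 * H1 y = k"
  by (rule has_field_derivative_zero_constant[OF convex_ball])
 then obtain k where k: "\<And>y. y \<in> ball c \<rho> ==> L (H y) - x / 2 * H1 y = k" by auto
 have "L (H y) - x / 2 * H1 y = L (H c)" using k[OF y] k[OF c] H(4) by simp
 then have "2 / x * L (H y) = 2 / x * L J0 + H1 y" using x H(3) by (simp add: H_def field_simps)
 moreover have "2 / x * L J0 = J1"
  using inv(2)[OF 2(1,3)] 2(4) unfolding has_int_from_infty_def by (rule tendsto_unique[rotated]) simp
 ultimately show "has_int_from_infty inv_uv \<gamma>1 (J1 + H1 y)"
  using inv(2)[OF 1(1,3)] by (simp add: H_def)
qed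

section \<open>Dependence on the modulus\<close>

subsection \<open>Lifting a curve to the neighbouring fibres\<close>

text \<open>Keeps \<open>u\<close> and rescales \<open>v\<close>, as
  \<open>cubic y u = cubic x0 u * (u - y) / (u - x0)\<close>. For \<open>y\<close> near
  \<open>x0\<close> the principal root is near 1, so the sheet is followed continuously.\<close>

definition lift :: "complex \<Rightarrow> complex \<Rightarrow> pt \<Rightarrow> pt" where
 "lift x0 y P = (case P of Infty \<Rightarrow> Infty | Aff u v \<Rightarrow> Aff u (v * csqrt ((u - y) / (u - x0))))"

lemma u_of_lift [simp]: "u_of (lift x0 y P) = u_of P"
 by (cases P) (simp_all add: lift_def)

lemma lift_Infty [simp]: "lift x0 y Infty = Infty"
 by (simp add: lift_def)

lemma v_of_lift: "P \<noteq> Infty ==> v_of (lift x0 y P) = v_of P * csqrt ((u_of P - y) / (u_of P - x0))"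
 by (cases P) (simp_all add: lift_def)

lemma unram_not_Infty: "P \<in> unram x ==> P \<noteq> Infty"
 by (auto simp: unram_def)

text \<open>The quotient is 1 minus a number of norm below 1, hence lies in the right half plane,
  off the cut and away from 0.\<close>

lemma lift_ratio:
 fixes u x0 y :: complex
 assumes "2 * r \<le> norm (u - x0)" "norm (y - x0) < r"
 shows "u \<noteq> x0" "u \<noteq> y" "(u - y) / (u - x0) \<notin> \<real>\<^sub>\<le>\<^sub>0" "csqrt ((u - y) / (u - x0)) \<noteq> 0"
proof -
 have r: "0 < r" using assms(2) norm_ge_zero[of "y - x0"] by linarith
 show u: "u \<noteq> x0" using assms(1) r by auto
 have "norm ((y - x0) / (u - x0)) = norm (y - x0) / norm (u - x0)" by (simp add: norm_divide)
 also have "\<dots> < 1" using u assms r by (subst divide_less_eq_1_pos) auto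
 finally have "Re ((y - x0) / (u - x0)) < 1" using complex_Re_le_cmod[of "(y - x0) / (u - x0)"] by linarith
 moreover have "(u - y) / (u - x0) = 1 - (y - x0) / (u - x0)" using u by (simp add: field_simps)
 ultimately have pos: "0 < Re ((u - y) / (u - x0))" by simp
 then show "(u - y) / (u - x0) \<notin> \<real>\<^sub>\<le>\<^sub>0" by (auto simp: complex_nonpos_Reals_iff)
 show "u \<noteq> y" "csqrt ((u - y) / (u - x0)) \<noteq> 0" using pos by auto
qed

lemma lift_unram:
 assumes P: "P \<in> unram x0" and far: "2 * r \<le> norm (u_of P - x0)" "norm (y - x0) < r"
 shows "lift x0 y P \<in> unram y"
proof -
 obtain u v where uv: "P = Aff u v" "v\<^sup>2 = cubic x0 u" "v \<noteq> 0" "cubic x0 u \<noteq> 0" by (rule unramE[OF P]) (rule that)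
 note f = lift_ratio[OF far]
 have "(v * csqrt ((u - y) / (u - x0)))\<^sup>2 = cubic y u"
  using f(1) uv by (simp add: power_mult_distrib cubic_def)
 moreover have "v * csqrt ((u - y) / (u - x0)) \<noteq> 0" using f(4) uv by simp
 ultimately show ?thesis using uv(1) by (auto simp: lift_def Aff_in_unram)
qed

lemma curve_path_lift:
 assumes path: "curve_path x0 \<gamma> r s"
  and far: "\<And>t. t \<in> {r..s} ==> 2 * \<rho> \<le> norm (u_of (\<gamma> t) - x0)" "norm (y - x0) < \<rho>"
 shows "curve_path y (lift x0 y \<circ> \<gamma>) r s"
proof -
 have "continuous_on {r..s} (\<lambda>t. v_of (\<gamma> t) * csqrt ((u_of (\<gamma> t) - y) / (u_of (\<gamma> t) - x0)))"
  using path lift_ratio[OF far]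
  by (intro continuous_intros continuous_on_compose2[OF continuous_on_csqrt]) (auto simp: curve_path_def)
 then have "continuous_on {r..s} (\<lambda>t. v_of (lift x0 y (\<gamma> t)))"
  by (rule iffD2[OF continuous_on_cong[OF refl], rotated])
    (rule v_of_lift[OF unram_not_Infty[OF curve_path_in[OF path]]])
 then show ?thesis
  using path lift_unram[OF curve_path_in[OF path] far] by (auto simp: curve_path_def)
qed

lemma continuous_on_half_open:
 fixes f :: "real \<Rightarrow> 'a::topological_space"
 assumes "\<And>e. 0 < e ==> continuous_on {e..1} f"
 shows "continuous_on {0<..1} f"
 unfolding continuous_on_eq_continuous_within
proof
 fix t :: real assume t: "t \<in> {0<..1}"
 then have "continuous (at t within {t/2..1}) f"
  using assms[of "t / 2"] by (auto simp: continuous_on_eq_continuous_within)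
 moreover have "at t within {0<..1} = at t within {t/2..1}"
  by (rule at_within_nhd[of _ "{t/2<..}"]) (use t in auto)
 ultimately show "continuous (at t within {0<..1}) f" by simp
qed

lemma path_from_infty_lift:
 assumes path: "path_from_infty x0 \<gamma>"
  and far: "\<And>t. t \<in> {0<..1} ==> 2 * \<rho> \<le> norm (u_of (\<gamma> t) - x0)" "norm (y - x0) < \<rho>"
 shows "path_from_infty y (lift x0 y \<circ> \<gamma>)"
proof -
 have c: "curve_path y (lift x0 y \<circ> \<gamma>) e 1" if "0 < e" for e
  by (rule curve_path_lift[OF path_from_infty_curve_path[OF path that] far]) (use that in auto)
 have "continuous_on {0<..1} (\<lambda>t. v_of ((lift x0 y \<circ> \<gamma>) t))"
  by (rule continuous_on_half_open) (use c in \<open>auto simp: curve_path_def\<close>)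
 moreover have "lift x0 y (\<gamma> t) \<in> unram y" if "t \<in> {0<..1}" for t
  using curve_path_in[OF c, of t t] that by auto
 ultimately show ?thesis using path by (auto simp: path_from_infty_def)
qed

section \<open>Derivatives of integrals over lifted paths\<close>

lemma line_int_cong:
 assumes "\<And>t. t \<in> {r..s} ==> u_of (\<gamma> t) = u_of (\<gamma>' t)" "\<And>t. t \<in> {r..s} ==> h (\<gamma> t) = h' (\<gamma>' t)"
 shows "line_int h \<gamma> r s = line_int h' \<gamma>' r s"
 unfolding line_int_def
\<comment> \<open>The velocity is a two-sided derivative, so at the ends of the interval it also
  depends on the curves outside; two points are negligible.\<close>
proof (rule integral_spike[of "{r, s}"])
 fix t assume t: "t \<in> {r..s} - {r, s}"
 have "eventually (\<lambda>\<tau>. \<tau> \<in> {r<..<s}) (nhds t)" using t by (intro eventually_nhds_in_open) auto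
 then have "eventually (\<lambda>\<tau>. \<tau> \<in> UNIV \<longrightarrow> u_of (\<gamma>' \<tau>) = u_of (\<gamma> \<tau>)) (nhds t)"
  by eventually_elim (use assms(1) in auto)
 then have "vector_derivative (\<lambda>\<tau>. u_of (\<gamma>' \<tau>)) (at t) = vector_derivative (\<lambda>\<tau>. u_of (\<gamma> \<tau>)) (at t)"
  by (rule vector_derivative_cong_eq) auto
 then show "line_integrand h' \<gamma>' t = line_integrand h \<gamma> t" using assms(2) t by simp
qed simp

text \<open>Over a fixed \<open>u\<close> the lifted \<open>v\<close> is proportional to a root of
  \<open>u - y\<close>, so the derivative of \<open>1 / v\<close> in \<open>y\<close> is
  \<open>1 / (2 (u - y) v)\<close>. The exponents \<open>n = 0\<close> and \<open>n = 1\<close> will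
  give \<open>du / v\<close> and \<open>du / (u v)\<close>.\<close>

lemma lift_leibniz:
 assumes path: "curve_path x0 \<gamma> r s" and "r \<le> s"
  and far: "\<And>t. t \<in> {r..s} ==> 2 * \<rho> \<le> norm (u_of (\<gamma> t) - x0)" and y0: "norm (y0 - x0) < \<rho>"
 shows "((\<lambda>y. line_int (\<lambda>P. 1 / (u_of P ^ n * v_of P)) (lift x0 y \<circ> \<gamma>) r s) has_field_derivative
   line_int (\<lambda>P. 1 / (u_of P ^ n * v_of P) / (2 * (u_of P - y0))) (lift x0 y0 \<circ> \<gamma>) r s) (at y0)"
proof -
 define k where "k y P = 1 / (u_of P ^ n * (v_of P * csqrt ((u_of P - y) / (u_of P - x0))))" for y P
 define k' where "k' y P = k y P / (2 * (u_of P - y))" for y P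
 \<comment> \<open>Halfway between \<open>norm (y0 - x0)\<close> and \<open>\<rho>\<close>: points
   within \<open>\<epsilon>\<close> of the path keep distance \<open>2 * \<rho>'\<close> from
   \<open>x0\<close>, and the disc of radius \<open>\<rho>'\<close> around \<open>x0\<close> is
   still a neighbourhood of \<open>y0\<close>.\<close>
 define \<rho>' where "\<rho>' = (\<rho> + norm (y0 - x0)) / 2"
 define \<epsilon> where "\<epsilon> = \<rho> - norm (y0 - x0)"
 have \<epsilon>: "\<epsilon> > 0" and \<rho>': "\<rho>' < \<rho>" "norm (y0 - x0) < \<rho>'" "2 * \<rho>' = 2 * \<rho> - \<epsilon>" using y0 by (auto simp: \<rho>'_def \<epsilon>_def)
 obtain X where X: "y0 \<in> X" "\<And>y. y \<in> X ==> ((\<lambda>y. line_int (k y) \<gamma> r s) has_field_derivative line_int (k' y) \<gamma> r s) (at y)"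
 proof (rule path_leibniz_local[OF path \<open>r \<le> s\<close>, where K = k and K' = k' and ?y0.0 = y0])
  fix t assume t: "t \<in> {r..s}"
  obtain \<delta> where \<delta>: "\<delta> > 0" "\<delta> \<le> \<epsilon>"
   "\<And>z. z \<in> ball (u_of (\<gamma> t)) \<delta> ==> branch_pt x0 (\<gamma> t) z \<in> unram x0"
   "(\<lambda>z. v_of (branch_pt x0 (\<gamma> t) z)) holomorphic_on ball (u_of (\<gamma> t)) \<delta>"
   "\<And>z. z \<in> ball (u_of (\<gamma> t)) \<delta> ==> ((\<lambda>z. v_of (branch_pt x0 (\<gamma> t) z)) has_field_derivative
     dcubic x0 z / (2 * v_of (branch_pt x0 (\<gamma> t) z))) (at z)"
   by (rule branch_pt[OF curve_path_in[OF path t] \<epsilon>]) (rule that)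
  define B where "B = ball (u_of (\<gamma> t)) \<delta>"
  define X where "X = ball x0 \<rho>'"
  define V where "V z = v_of (branch_pt x0 (\<gamma> t) z)" for z
  have Vh: "V holomorphic_on B" using \<delta>(4) by (simp add: V_def[abs_def] B_def)
  have nz: "V z \<noteq> 0" "z \<noteq> 0" if "z \<in> B" for z
   using unram_nonzero(1,2)[OF \<delta>(3)[OF that[unfolded B_def]]] by (auto simp: V_def)
  have fz: "z \<noteq> x0" "z \<noteq> y" "(z - y) / (z - x0) \<notin> \<real>\<^sub>\<le>\<^sub>0" "csqrt ((z - y) / (z - x0)) \<noteq> 0" if "z \<in> B" "y \<in> X" for z y
  proof -
   have "norm (u_of (\<gamma> t) - x0) \<le> norm (u_of (\<gamma> t) - z) + norm (z - x0)"
    using norm_triangle_ineq[of "u_of (\<gamma> t) - z" "z - x0"] by simp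
   then have "2 * \<rho>' \<le> norm (z - x0)" using far[OF t] that(1) \<delta>(2) \<rho>'(3) by (simp add: B_def dist_norm)
   then show "z \<noteq> x0" "z \<noteq> y" "(z - y) / (z - x0) \<notin> \<real>\<^sub>\<le>\<^sub>0" "csqrt ((z - y) / (z - x0)) \<noteq> 0"
    by - (rule lift_ratio[of \<rho>' z x0 y], assumption, use that(2) in \<open>simp add: X_def dist_norm norm_minus_commute\<close>)+
  qed
  have kB: "k y (branch_pt x0 (\<gamma> t) z) = 1 / (z ^ n * (V z * csqrt ((z - y) / (z - x0))))" for y z
   by (simp add: k_def V_def)
  have k'B: "k' y (branch_pt x0 (\<gamma> t) z) = 1 / (z ^ n * (V z * csqrt ((z - y) / (z - x0)))) / (2 * (z - y))" for y z
   unfolding k'_def kB by simp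
  have hol: "(\<lambda>z. 1 / (z ^ n * (V z * csqrt ((z - y) / (z - x0))))) holomorphic_on B" if "y \<in> X" for y
   using nz fz that by (intro holomorphic_intros Vh) auto
  have hol': "(\<lambda>z. 1 / (z ^ n * (V z * csqrt ((z - y) / (z - x0)))) / (2 * (z - y))) holomorphic_on B" if "y \<in> X" for y
   using nz fz that by (intro holomorphic_intros Vh) auto
  have der: "((\<lambda>y. 1 / (z ^ n * (V z * csqrt ((z - y) / (z - x0))))) has_field_derivative
    1 / (z ^ n * (V z * csqrt ((z - y) / (z - x0)))) / (2 * (z - y))) (at y)" if z: "z \<in> B" and y: "y \<in> X" for z y
  proof -
   define c where "c = csqrt ((z - y) / (z - x0))"
   have c: "c \<noteq> 0" "c * c = (z - y) / (z - x0)"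
    using fz(4)[OF z y] power2_csqrt[of "(z - y) / (z - x0)"] by (auto simp: c_def power2_eq_square)
   have zx: "z - x0 \<noteq> 0" "z - y \<noteq> 0" using fz(1,2)[OF z y] by auto
   have "((\<lambda>y. csqrt ((z - y) / (z - x0))) has_field_derivative (- (1 / (z - x0))) / (2 * c)) (at y)"
   proof -
    have "((\<lambda>y. (z - y) / (z - x0)) has_field_derivative (0 - 1) / (z - x0)) (at y)"
     by (intro DERIV_cdivide DERIV_diff DERIV_const DERIV_ident)
    from has_field_derivative_csqrt'[OF this fz(3)[OF z y]] show ?thesis by (simp add: c_def)
   qed
   then have "((\<lambda>y. inverse (csqrt ((z - y) / (z - x0)))) has_field_derivative
     - (inverse c * ((- (1 / (z - x0))) / (2 * c)) * inverse c)) (at y)"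
    unfolding c_def by (rule DERIV_inverse') (use fz(4)[OF z y] in simp)
   then have "((\<lambda>y. 1 / (z ^ n * V z) * inverse (csqrt ((z - y) / (z - x0)))) has_field_derivative
     1 / (z ^ n * V z) * - (inverse c * ((- (1 / (z - x0))) / (2 * c)) * inverse c)) (at y)" by (rule DERIV_cmult)
   moreover have "- (inverse c * ((- (1 / (z - x0))) / (2 * c)) * inverse c) = 1 / c / (2 * (z - y))"
   proof -
    have "- (inverse c * ((- (1 / (z - x0))) / (2 * c)) * inverse c) = 1 / (2 * c * ((z - x0) * (c * c)))"
     using c(1) zx by (simp add: field_simps)
    also have "(z - x0) * (c * c) = z - y" unfolding c(2) using zx by simp
    finally show ?thesis by simp
   qed
   ultimately have "((\<lambda>y. 1 / (z ^ n * V z) * inverse (csqrt ((z - y) / (z - x0)))) has_field_derivative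
     1 / (z ^ n * V z) * (1 / c / (2 * (z - y)))) (at y)" by (simp only:)
   moreover have aux: "1 / (p * v) * inverse s = 1 / (p * (v * s))" "1 / (p * v) * (1 / s / d) = 1 / (p * (v * s)) / d" for p v s d :: complex
    by (simp_all add: divide_inverse)
   ultimately show ?thesis unfolding aux c_def by - assumption
  qed
  have cont: "continuous_on (X \<times> B) (\<lambda>(y, z). 1 / (z ^ n * (V z * csqrt ((z - y) / (z - x0)))) / (2 * (z - y)))"
   unfolding case_prod_unfold
  proof (intro continuous_intros continuous_on_compose2[OF continuous_on_csqrt] continuous_on_compose2[OF holomorphic_on_imp_continuous_on[OF Vh]])
  qed (use nz fz in auto)
  show "\<exists>\<rho>>0. \<exists>X. open X \<and> convex X \<and> y0 \<in> X \<and>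
    (\<forall>y\<in>X. (\<lambda>z. k y (branch_pt x0 (\<gamma> t) z)) holomorphic_on ball (u_of (\<gamma> t)) \<rho>) \<and>
    (\<forall>y\<in>X. (\<lambda>z. k' y (branch_pt x0 (\<gamma> t) z)) holomorphic_on ball (u_of (\<gamma> t)) \<rho>) \<and>
    (\<forall>y\<in>X. \<forall>z\<in>ball (u_of (\<gamma> t)) \<rho>. ((\<lambda>y. k y (branch_pt x0 (\<gamma> t) z)) has_field_derivative
      k' y (branch_pt x0 (\<gamma> t) z)) (at y)) \<and>
    continuous_on (X \<times> ball (u_of (\<gamma> t)) \<rho>) (\<lambda>(y, z). k' y (branch_pt x0 (\<gamma> t) z))"
   unfolding kB k'B
   by (intro exI[of _ \<delta>] exI[of _ X] conjI ballI; (fold B_def)?)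
     (use \<delta>(1) \<rho>' hol hol' der cont in \<open>auto simp: X_def dist_norm norm_minus_commute\<close>)
 qed (rule that)
 have lk: "line_int (\<lambda>P. 1 / (u_of P ^ n * v_of P)) (lift x0 y \<circ> \<gamma>) r s = line_int (k y) \<gamma> r s" for y
  by (rule line_int_cong) (simp_all add: k_def v_of_lift[OF unram_not_Infty[OF curve_path_in[OF path]]])
 have lk': "line_int (\<lambda>P. 1 / (u_of P ^ n * v_of P) / (2 * (u_of P - y0))) (lift x0 y0 \<circ> \<gamma>) r s = line_int (k' y0) \<gamma> r s"
  by (rule line_int_cong) (simp_all add: k_def k'_def v_of_lift[OF unram_not_Infty[OF curve_path_in[OF path]]])
 show ?thesis unfolding lk lk' by (rule X(2)[OF X(1)])
qed

lemma lift_self: "P \<noteq> Infty ==> u_of P \<noteq> x0 ==> lift x0 x0 P = P"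
 by (cases P) (simp_all add: lift_def)

text \<open>The integral from infinity is a limit of integrals holomorphic in \<open>y\<close>. The
  omitted initial part is bounded by \<open>C * sqrt (norm (1 / u))\<close> with \<open>C\<close>
  independent of \<open>y\<close>, so convergence is uniform and derivative and limit may be
  exchanged.\<close>

lemma lifted_integral_derivative:
 assumes path: "path_from_infty x0 \<gamma>" and "\<rho> > 0"
  and far: "\<And>t. t \<in> {0<..1} ==> 2 * \<rho> \<le> norm (u_of (\<gamma> t) - x0)"
 obtains J J' where
  "\<And>y. norm (y - x0) < \<rho> ==> has_int_from_infty (\<lambda>P. 1 / (u_of P ^ n * v_of P)) (lift x0 y \<circ> \<gamma>) (J y)"
  "(J has_field_derivative J') (at x0)"
  "has_int_from_infty (\<lambda>P. 1 / (u_of P ^ n * v_of P) / (2 * (u_of P - x0))) \<gamma> J'"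
proof -
 define h where "h P = 1 / (u_of P ^ n * v_of P)" for P
 define f where "f e y = line_int h (lift x0 y \<circ> \<gamma>) e 1" for e y
 define f' where "f' e y = line_int (\<lambda>P. h P / (2 * (u_of P - y))) (lift x0 y \<circ> \<gamma>) e 1" for e y
 have df: "(f e has_field_derivative f' e y) (at y)" if "0 < e" "e < 1" "norm (y - x0) < \<rho>" for e y
  unfolding f_def[abs_def] f'_def h_def
  by (rule lift_leibniz[OF path_from_infty_curve_path[OF path that(1)] _ far that(3)]) (use that in auto)
 have "norm x0 + \<rho> > 0" using \<open>\<rho> > 0\<close> by (simp add: add_nonneg_pos)
 then obtain \<delta> where \<delta>: "\<delta> > 0" "\<And>x s. norm x \<le> norm x0 + \<rho> ==> norm s < \<delta> ==> 0 < Re (quartic x s)"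
  "\<And>x s. norm x \<le> norm x0 + \<rho> ==> norm s < \<delta> ==> 1 / 2 \<le> norm (quartic_root x s)"
  by (rule quartic_near_0) (rule that)
 have "\<delta>\<^sup>2 > 0" using \<delta>(1) by simp
 then obtain t1 where t1: "0 < t1" "t1 \<le> 1" "\<And>t. 0 < t ==> t \<le> t1 ==> norm (1 / u_of (\<gamma> t)) < \<delta>\<^sup>2"
  by (rule path_near_infty[OF path]) (rule that)
 \<comment> \<open>A bound for \<open>2 * g s / quartic_root y s\<close> on the disc, where
   \<open>g s = (s^2) ^ n\<close> and the root has norm at least 1/2.\<close>
 define C where "C = 4 * (\<delta>\<^sup>2) ^ n"
 have ex: "\<exists>J. has_int_from_infty h (lift x0 y \<circ> \<gamma>) J \<and>
   (\<forall>t. 0 < t \<and> t \<le> t1 \<longrightarrow> norm (J - f t y) \<le> C * sqrt (norm (1 / u_of (\<gamma> t))))" if y: "norm (y - x0) < \<rho>" for y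
 proof -
  let ?\<gamma> = "lift x0 y \<circ> \<gamma>"
  have "norm y \<le> norm x0 + norm (y - x0)" using norm_triangle_sub by blast
  then have ny: "norm y \<le> norm x0 + \<rho>" using y by simp
  have py: "path_from_infty y ?\<gamma>" by (rule path_from_infty_lift[OF path far y])
  define g where "g s = (s\<^sup>2) ^ n" for s :: complex
  have qh: "quartic_root y holomorphic_on ball 0 \<delta>"
   by (rule quartic_root_holomorphic) (use \<delta>(2)[OF ny] in simp)
  have q0: "quartic_root y s \<noteq> 0" if "s \<in> ball 0 \<delta>" for s using \<delta>(3)[OF ny, of s] that by auto
  have "(\<lambda>s. 2 * g s / quartic_root y s) holomorphic_on ball 0 \<delta>"
   unfolding g_def using q0 by (intro holomorphic_intros qh) auto
  then obtain I where I: "\<And>s. s \<in> ball 0 \<delta> ==> (I has_field_derivative 2 * g s / quartic_root y s) (at s within ball 0 \<delta>)"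
   by (rule holomorphic_convex_primitive'[OF convex_ball open_ball, THEN exE]) auto
  have I': "(I has_field_derivative 2 * g s / quartic_root y s) (at s)" if "norm s < \<delta>" for s
   using I[of s] at_within_open[OF _ open_ball, of s 0 \<delta>] that by simp
  have hg: "h P = g (sigma y P) / v_of P" if "P \<in> unram y" for P
   unfolding g_def sigma_square[OF that] h_def by (simp add: power_divide)
  have hint: "line_integrand h ?\<gamma> integrable_on {e..1}" if e: "0 < e" "e \<le> 1" for e
  proof -
   have cp: "curve_path y ?\<gamma> e 1" by (rule path_from_infty_curve_path[OF py e(1)])
   have "line_integrand (\<lambda>P. 1 / u_of P ^ n / v_of P) ?\<gamma> integrable_on {e..1}"
   proof (rule path_integrable_over_v[OF cp e(2), where F = "\<lambda>u. 1 / u ^ n" and O' = "- {0}"])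
    show "isCont (\<lambda>u. 1 / u ^ n) (u_of (?\<gamma> t))" if "t \<in> {e..1}" for t
     using unram_nonzero(2)[OF curve_path_in[OF cp that]] by (intro continuous_intros) auto
    show "(\<lambda>u. 1 / u ^ n) holomorphic_on - {0}" by (intro holomorphic_intros) auto
    show "(\<lambda>t. u_of (?\<gamma> t)) ` {e..1} \<subseteq> - {0}"
     by (intro image_subsetI) (use unram_nonzero(2)[OF curve_path_in[OF cp]] in simp)
   qed (rule open_Compl, simp)
   then show ?thesis by (simp add: h_def[abs_def])
  qed
  obtain J where J: "has_int_from_infty h ?\<gamma> J"
   "\<And>t. 0 < t ==> t \<le> t1 ==> J - line_int h ?\<gamma> t 1 = I (sigma y (?\<gamma> t)) - I 0"
  proof (rule integral_from_infty[OF py \<delta>(1), where h = h and g = g and I = I and ?t1.0 = t1])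
   show "0 < Re (quartic y s)" if "norm s < \<delta>" for s by (rule \<delta>(2)[OF ny that])
   show "(I has_field_derivative 2 * g s / quartic_root y s) (at s)" if "norm s < \<delta>" for s by (rule I'[OF that])
   show "h P = g (sigma y P) / v_of P" if "P \<in> unram y" for P by (rule hg[OF that])
   show "line_integrand h ?\<gamma> integrable_on {e..1}" if "0 < e" "e \<le> 1" for e by (rule hint[OF that])
   show "0 < t1" "t1 \<le> 1" by (fact t1)+
   show "norm (1 / u_of (?\<gamma> t)) < \<delta>\<^sup>2" if "0 < t" "t \<le> t1" for t using t1(3)[OF that] by simp
  qed (rule that)
  have "norm (J - f t y) \<le> C * sqrt (norm (1 / u_of (\<gamma> t)))" if t: "0 < t" "t \<le> t1" for t
  proof -
   have "?\<gamma> t \<in> unram y" using py t t1 by (auto simp: path_from_infty_def)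
   from norm_sigma[OF this] have ns: "norm (sigma y (?\<gamma> t)) = sqrt (norm (1 / u_of (\<gamma> t)))" by simp
   also have "\<dots> < sqrt (\<delta>\<^sup>2)" using t1(3)[OF t] by (rule real_sqrt_less_mono)
   finally have s: "norm (sigma y (?\<gamma> t)) < \<delta>" using \<delta>(1) by simp
   have "norm (I (sigma y (?\<gamma> t)) - I 0) \<le> C * norm (sigma y (?\<gamma> t) - 0)"
   proof (rule field_differentiable_bound[OF convex_ball I])
    fix s assume s: "s \<in> ball (0::complex) \<delta>"
    then have q: "1 / 2 \<le> norm (quartic_root y s)" using \<delta>(3)[OF ny, of s] by simp
    have "norm (2 * g s / quartic_root y s) = 2 * ((norm s)\<^sup>2) ^ n / norm (quartic_root y s)"
     by (simp add: g_def norm_mult norm_divide norm_power)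
    also have "\<dots> \<le> 2 * (\<delta>\<^sup>2) ^ n / (1 / 2)"
     using s q by (intro frac_le mult_mono power_mono) auto
    finally show "norm (2 * g s / quartic_root y s) \<le> C" by (simp add: C_def)
   qed (use s \<delta>(1) in auto)
   then show ?thesis using J(2)[OF t] ns by (simp add: f_def)
  qed
  then show ?thesis using J(1) by blast
 qed
 define J where "J y = (SOME J. has_int_from_infty h (lift x0 y \<circ> \<gamma>) J \<and>
   (\<forall>t. 0 < t \<and> t \<le> t1 \<longrightarrow> norm (J - f t y) \<le> C * sqrt (norm (1 / u_of (\<gamma> t)))))" for y
 have J: "has_int_from_infty h (lift x0 y \<circ> \<gamma>) (J y)"
  "\<And>t. 0 < t ==> t \<le> t1 ==> norm (J y - f t y) \<le> C * sqrt (norm (1 / u_of (\<gamma> t)))" if "norm (y - x0) < \<rho>" for y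
  using someI_ex[OF ex[OF that]] unfolding J_def by blast+
 have "((\<lambda>t. inverse (u_of (\<gamma> t))) \<longlongrightarrow> 0) (at_right 0)"
  using path by (intro filterlim_compose[OF tendsto_inverse_0]) (simp add: path_from_infty_def)
 then have "((\<lambda>t. C * sqrt (norm (inverse (u_of (\<gamma> t))))) \<longlongrightarrow> C * sqrt (norm (0::complex))) (at_right 0)"
  by (intro tendsto_intros)
 then have lim: "((\<lambda>t. C * sqrt (norm (1 / u_of (\<gamma> t)))) \<longlongrightarrow> 0) (at_right 0)" by (simp add: inverse_eq_divide)
 have in01: "eventually (\<lambda>t. 0 < t \<and> t < t1) (at_right (0::real))"
  unfolding eventually_at_right_field using t1(1) by blast
 have "uniform_limit (cball x0 (\<rho> / 2)) f J (at_right 0)"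
 proof (rule uniform_limitI)
  fix \<epsilon> :: real assume "\<epsilon> > 0"
  with lim have "eventually (\<lambda>t. C * sqrt (norm (1 / u_of (\<gamma> t))) < \<epsilon>) (at_right 0)" by (rule order_tendstoD)
  with in01 show "eventually (\<lambda>t. \<forall>y\<in>cball x0 (\<rho> / 2). dist (f t y) (J y) < \<epsilon>) (at_right 0)"
  proof eventually_elim
   case (elim t)
   show ?case
   proof
    fix y assume "y \<in> cball x0 (\<rho> / 2)"
    then have "norm (y - x0) < \<rho>" using \<open>\<rho> > 0\<close> by (simp add: dist_norm norm_minus_commute)
    from J(2)[OF this, of t] elim show "dist (f t y) (J y) < \<epsilon>" by (simp add: dist_norm norm_minus_commute)
   qed
  qed
 qed
 note ul = this
 have ev: "eventually (\<lambda>t. continuous_on (cball x0 (\<rho> / 2)) (f t) \<and>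
   (\<forall>w\<in>ball x0 (\<rho> / 2). (f t has_field_derivative f' t w) (at w))) (at_right 0)"
  using in01
 proof eventually_elim
  case (elim t)
  have d: "(f t has_field_derivative f' t y) (at y)" if "y \<in> cball x0 (\<rho> / 2)" for y
   by (rule df) (use that elim t1 \<open>\<rho> > 0\<close> in \<open>auto simp: dist_norm norm_minus_commute\<close>)
  then have "continuous_on (cball x0 (\<rho> / 2)) (f t)"
   by (intro continuous_at_imp_continuous_on ballI DERIV_isCont)
  then show ?case using d by auto
 qed
 have "\<rho> / 2 > 0" using \<open>\<rho> > 0\<close> by simp
 then obtain J' where J': "continuous_on (cball x0 (\<rho> / 2)) J" "\<And>w. w \<in> ball x0 (\<rho> / 2) ==>
   (J has_field_derivative (J' w)) (at w) \<and> ((\<lambda>t. f' t w) \<longlongrightarrow> J' w) (at_right 0)"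
  by (rule has_complex_derivative_uniform_limit[OF ev ul trivial_limit_at_right_real]) (rule that)
 have J'0: "(J has_field_derivative J' x0) (at x0)" "((\<lambda>t. f' t x0) \<longlongrightarrow> J' x0) (at_right 0)"
  using J'(2)[of x0] \<open>\<rho> > 0\<close> by auto
 have "eventually (\<lambda>t. f' t x0 = line_int (\<lambda>P. h P / (2 * (u_of P - x0))) \<gamma> t 1) (at_right 0)"
  using in01
 proof eventually_elim
  case (elim t)
  have "lift x0 x0 (\<gamma> \<tau>) = \<gamma> \<tau>" if "\<tau> \<in> {t..1}" for \<tau>
  proof -
   have "\<gamma> \<tau> \<in> unram x0" using path that elim by (auto simp: path_from_infty_def)
   from lift_self[OF unram_not_Infty[OF this] unram_nonzero(4)[OF this]] show ?thesis .
  qed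
  then show ?case unfolding f'_def by (intro line_int_cong) simp_all
 qed
 with J'0(2) have "has_int_from_infty (\<lambda>P. h P / (2 * (u_of P - x0))) \<gamma> (J' x0)"
  unfolding has_int_from_infty_def by (rule Lim_transform_eventually)
 with J(1) J'0(1) show thesis by (intro that[of J "J' x0"]) (simp_all add: h_def[abs_def])
qed

text \<open>The forms produced by differentiation in the modulus have a double pole over
  \<open>u = x\<close>. The differential of \<open>v / (u - x)\<close> removes it and that of
  \<open>v / u\<close> compensates the growth at infinity; both come from
  \<open>has_u_derivative_v_over\<close>. For the second form,
  \<open>1 / (u (u - x)) = (1 / (u - x) - 1 / u) / x\<close>.\<close>

lemma line_int_shift:
 assumes path: "curve_path x \<gamma> e 1" "e \<le> 1" and x: "x \<noteq> 0" "x \<noteq> 1"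
 shows "line_int (\<lambda>P. 1 / v_of P / (2 * (u_of P - x))) \<gamma> e 1 =
   1 / (x * (x - 1)) * (v_of (\<gamma> 1) / (u_of (\<gamma> 1) - 0) - v_of (\<gamma> 1) / (u_of (\<gamma> 1) - x)) -
   1 / (x * (x - 1)) * (v_of (\<gamma> e) / (u_of (\<gamma> e) - 0) - v_of (\<gamma> e) / (u_of (\<gamma> e) - x)) +
   (line_int inv_uv \<gamma> e 1 - line_int inv_v \<gamma> e 1) / (2 * (x - 1))"
  and "line_int (\<lambda>P. 1 / (u_of P * v_of P) / (2 * (u_of P - x))) \<gamma> e 1 =
   (line_int (\<lambda>P. 1 / v_of P / (2 * (u_of P - x))) \<gamma> e 1 - line_int inv_uv \<gamma> e 1 / 2) / x"
proof -
 define H where "H P = 1 / (x * (x - 1)) * (v_of P / (u_of P - 0) - v_of P / (u_of P - x))" for P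
 define h where "h P = 1 / v_of P / (2 * (u_of P - x))" for P
 have cc: "cubic x 0 = 0" "cubic x x = 0" "dcubic x 0 = x" "dcubic x x = x * (x - 1)"
  by (simp_all add: cubic_def dcubic_def)
 have aux: "1 / (x * f) * (((d + x) ^ 3 - x * (d + x)) / (2 * v * (d + x)\<^sup>2) - (d ^ 3 - x * f * d) / (2 * v * d\<^sup>2)) =
   1 / v / (2 * d) - (1 / (2 * f) * (1 / ((d + x) * v)) + - (1 / (2 * f)) * (1 / v))"
  if nz: "f \<noteq> 0" "d \<noteq> 0" "d + x \<noteq> 0" "v \<noteq> 0" for d f v
 proof -
  have q: "(s ^ 3 - c * s) / (2 * v * s\<^sup>2) = (s - c / s) / (2 * v)" if "s \<noteq> 0" for s c
   using that nz by (simp add: field_simps eval_nat_numeral)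
  have "((d + x) ^ 3 - x * (d + x)) / (2 * v * (d + x)\<^sup>2) = ((d + x) - x / (d + x)) / (2 * v)"
   by (rule q[OF nz(3)])
  moreover have "(d ^ 3 - x * f * d) / (2 * v * d\<^sup>2) = (d - x * f / d) / (2 * v)"
   by (rule q[OF nz(2)])
  moreover have "1 / (x * f) * ((m - x / m) / (2 * v) - (d - x * f / d) / (2 * v)) =
    1 / v / (2 * d) - (1 / (2 * f) * (1 / (m * v)) + - (1 / (2 * f)) * (1 / v))"
   if m: "m = d + x" "m \<noteq> 0" for m
  proof -
   have md: "m - d = x" using m(1) by simp
   have "m - x / m - (d - x * f / d) = (m - d) - x * (1 / m) + x * (f / d)" by simp
   also have "\<dots> = x * (1 - 1 / m + f / d)" unfolding md by (simp only: distrib_left right_diff_distrib mult_1_right)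
   finally have k1: "m - x / m - (d - x * f / d) = x * (1 - 1 / m + f / d)" .
   have c: "s / (2 * v) - t / (2 * v) = (s - t) * (1 / (2 * v))" "1 / (x * f) * (x * s * t) = 1 / f * s * t" for s t
    using x by (simp_all add: diff_divide_distrib)
   have "1 / (x * f) * ((m - x / m) / (2 * v) - (d - x * f / d) / (2 * v)) = 1 / f * (1 - 1 / m + f / d) * (1 / (2 * v))"
    unfolding c(1) k1 by (rule c(2))
   also have "1 / f * (1 - 1 / m + f / d) = 1 / f - 1 / f * (1 / m) + 1 / d"
   proof -
    have "1 / f * (f / d) = 1 / d" using nz by simp
    then show ?thesis by (simp only: distrib_left right_diff_distrib mult_1_right)
   qed
   also have "(1 / f - 1 / f * (1 / m) + 1 / d) * (1 / (2 * v)) =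
     1 / v / (2 * d) - (1 / (2 * f) * (1 / (m * v)) + - (1 / (2 * f)) * (1 / v))"
   proof -
    have g: "(F - F * N + G) * (1 / 2 * S) = S * (1 / 2 * G) - (1 / 2 * F * (N * S) + - (1 / 2 * F) * S)"
     for F N G S :: complex by (simp add: algebra_simps)
    have e: "1 / (2 * v) = 1 / 2 * (1 / v)" "1 / v / (2 * d) = 1 / v * (1 / 2 * (1 / d))"
     "1 / (2 * f) = 1 / 2 * (1 / f)" "1 / (m * v) = 1 / m * (1 / v)" by simp_all
    show ?thesis unfolding e by (rule g)
   qed
   finally show ?thesis .
  qed
  note this[OF refl nz(3)]
  ultimately show ?thesis by (simp only:)
 qed
 have "(line_integrand h \<gamma> has_integral
   H (\<gamma> 1) - H (\<gamma> e) + (1 / (2 * (x - 1)) * line_int inv_uv \<gamma> e 1 + - (1 / (2 * (x - 1))) * line_int inv_v \<gamma> e 1)) {e..1}"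
 proof (rule line_int_FTC[OF path])
  fix t assume "t \<in> {e..1}"
  then have P: "\<gamma> t \<in> unram x" by (rule curve_path_in[OF path(1)])
  note nz = unram_nonzero(1-4)[OF P]
  have D: "1 / (x * (x - 1)) * (((u_of (\<gamma> t) - 0) ^ 3 - 2 * cubic x 0 - dcubic x 0 * (u_of (\<gamma> t) - 0)) / (2 * v_of (\<gamma> t) * (u_of (\<gamma> t) - 0)\<^sup>2) -
    ((u_of (\<gamma> t) - x) ^ 3 - 2 * cubic x x - dcubic x x * (u_of (\<gamma> t) - x)) / (2 * v_of (\<gamma> t) * (u_of (\<gamma> t) - x)\<^sup>2)) =
    h (\<gamma> t) - (1 / (2 * (x - 1)) * inv_uv (\<gamma> t) + - (1 / (2 * (x - 1))) * inv_v (\<gamma> t))"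
   using aux[of "x - 1" "u_of (\<gamma> t) - x" "v_of (\<gamma> t)"] nz x by (simp add: cc h_def)
  show "has_u_derivative x H (h (\<gamma> t) - (1 / (2 * (x - 1)) * inv_uv (\<gamma> t) + - (1 / (2 * (x - 1))) * inv_v (\<gamma> t))) (\<gamma> t)"
   unfolding D[symmetric] H_def
   by (intro has_u_derivative_cmult has_u_derivative_diff has_u_derivative_v_over P) (use nz in auto)
 qed
 then have h: "line_integrand h \<gamma> integrable_on {e..1}"
  "line_int h \<gamma> e 1 = H (\<gamma> 1) - H (\<gamma> e) + (line_int inv_uv \<gamma> e 1 - line_int inv_v \<gamma> e 1) / (2 * (x - 1))"
  by (auto simp: line_int_def integral_unique diff_divide_distrib)
 from h(2) show "line_int (\<lambda>P. 1 / v_of P / (2 * (u_of P - x))) \<gamma> e 1 =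
   1 / (x * (x - 1)) * (v_of (\<gamma> 1) / (u_of (\<gamma> 1) - 0) - v_of (\<gamma> 1) / (u_of (\<gamma> 1) - x)) -
   1 / (x * (x - 1)) * (v_of (\<gamma> e) / (u_of (\<gamma> e) - 0) - v_of (\<gamma> e) / (u_of (\<gamma> e) - x)) +
   (line_int inv_uv \<gamma> e 1 - line_int inv_v \<gamma> e 1) / (2 * (x - 1))"
  unfolding h_def[abs_def] H_def .
 have "((\<lambda>t. (line_integrand h \<gamma> t - line_integrand inv_uv \<gamma> t / 2) / x) has_integral
   (line_int h \<gamma> e 1 - line_int inv_uv \<gamma> e 1 / 2) / x) {e..1}"
  unfolding line_int_def
  by (intro has_integral_divide has_integral_diff integrable_integral h(1) integrable_inv_uv[OF path])
 moreover have "(line_integrand h \<gamma> t - line_integrand inv_uv \<gamma> t / 2) / x =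
   line_integrand (\<lambda>P. 1 / (u_of P * v_of P) / (2 * (u_of P - x))) \<gamma> t" if "t \<in> {e..1}" for t
 proof -
  have aux2: "(1 / v / (2 * (u - x)) * d - 1 / (u * v) * d / 2) / x = 1 / (u * v) / (2 * (u - x)) * d"
   if "u \<noteq> 0" "v \<noteq> 0" "u \<noteq> x" for u v d
  proof -
   have i: "1 / (u - x) - 1 / u = x * (1 / u * (1 / (u - x)))" using that by (simp add: divide_simps)
   have g: "(S * (1 / 2 * M) * d - N * S * d * (1 / 2)) * X = (M - N) * (S * (1 / 2) * d * X)"
    for S M N X :: complex by (simp add: algebra_simps)
   have e: "1 / v / (2 * (u - x)) = 1 / v * (1 / 2 * (1 / (u - x)))" "1 / (u * v) = 1 / u * (1 / v)" by simp_all
   have "(1 / v / (2 * (u - x)) * d - 1 / (u * v) * d / 2) / x =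
     (1 / v * (1 / 2 * (1 / (u - x))) * d - 1 / u * (1 / v) * d * (1 / 2)) * (1 / x)"
    unfolding e by (simp only: times_divide_eq_right mult_1_right)
   also have "\<dots> = (1 / (u - x) - 1 / u) * (1 / v * (1 / 2) * d * (1 / x))" by (rule g)
   also have "\<dots> = 1 / (u * v) / (2 * (u - x)) * d" unfolding i using x by simp
   finally show ?thesis .
  qed
  show ?thesis unfolding h_def
   by (rule aux2) (use unram_nonzero(1,2,4)[OF curve_path_in[OF path(1) that]] in auto)
 qed
 ultimately have "(line_integrand (\<lambda>P. 1 / (u_of P * v_of P) / (2 * (u_of P - x))) \<gamma> has_integral
   (line_int h \<gamma> e 1 - line_int inv_uv \<gamma> e 1 / 2) / x) {e..1}"
  by (subst (asm) has_integral_cong)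
 then show "line_int (\<lambda>P. 1 / (u_of P * v_of P) / (2 * (u_of P - x))) \<gamma> e 1 =
   (line_int (\<lambda>P. 1 / v_of P / (2 * (u_of P - x))) \<gamma> e 1 - line_int inv_uv \<gamma> e 1 / 2) / x"
  unfolding h_def[abs_def, symmetric] by (simp add: line_int_def integral_unique)
qed

section \<open>Periods and integrals from infinity as functions of the modulus\<close>

lemma unram_eqI:
 assumes "P \<in> unram x" "Q \<in> unram x" "u_of P = u_of Q" "v_of P = v_of Q"
 shows "P = Q"
proof -
 obtain u v where "P = Aff u v" by (rule unramE[OF assms(1)])
 moreover obtain u' v' where "Q = Aff u' v'" by (rule unramE[OF assms(2)])
 ultimately show ?thesis using assms(3,4) by simp
qed

text \<open>At a fixed time the family and the lift of its member at \<open>x0\<close> are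
  continuous roots, in \<open>y\<close>, of the same values \<open>cubic y u\<close>; they agree at
  \<open>y = x0\<close>, hence on the whole disc. The compact projection of the cycle misses
  \<open>x0\<close>, which gives the distance \<open>\<rho>\<close>.\<close>

lemma cycle_family_lift:
 assumes D: "open D" "x0 \<in> D" and a: "cycle_family D a"
 obtains \<rho> where "\<rho> > 0" "ball x0 \<rho> \<subseteq> D" "\<And>t. t \<in> {0..1} ==> 2 * \<rho> \<le> norm (u_of (a x0 t) - x0)"
  "\<And>y t. norm (y - x0) < \<rho> ==> t \<in> {0..1} ==> a y t = lift x0 y (a x0 t)"
proof -
 have cyc: "cycle_on y (a y)" if "y \<in> D" for y using a that by (simp add: cycle_family_def)
 have p0: "curve_path x0 (a x0) 0 1" by (rule cycle_on_curve_path[OF cyc[OF D(2)]])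
 have "compact ((\<lambda>t. u_of (a x0 t)) ` {0..1})"
  using p0 by (intro compact_continuous_image) (auto simp: curve_path_def)
 moreover have "x0 \<notin> (\<lambda>t. u_of (a x0 t)) ` {0..1}"
 proof
  assume "x0 \<in> (\<lambda>t. u_of (a x0 t)) ` {0..1}"
  then obtain t where "t \<in> {0..1}" "x0 = u_of (a x0 t)" by blast
  with unram_nonzero(4)[OF curve_path_in[OF p0]] show False by metis
 qed
 ultimately have "\<exists>d>0. \<forall>u\<in>(\<lambda>t. u_of (a x0 t)) ` {0..1}. d \<le> dist x0 u"
  by (rule separate_point_closed[OF compact_imp_closed])
 then obtain d where d: "d > 0" "\<And>u. u \<in> (\<lambda>t. u_of (a x0 t)) ` {0..1} ==> d \<le> dist x0 u" by auto
 obtain r where r: "r > 0" "ball x0 r \<subseteq> D" using D open_contains_ball by blast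
 define \<rho> where "\<rho> = min r (d / 2)"
 have \<rho>: "\<rho> > 0" "ball x0 \<rho> \<subseteq> D" using d(1) r by (auto simp: \<rho>_def)
 have far: "2 * \<rho> \<le> norm (u_of (a x0 t) - x0)" if "t \<in> {0..1}" for t
  using d(2)[of "u_of (a x0 t)"] that by (auto simp: \<rho>_def dist_norm norm_minus_commute)
 have "a y t = lift x0 y (a x0 t)" if y: "norm (y - x0) < \<rho>" and t: "t \<in> {0..1}" for y t
 proof -
  define u v where "u = u_of (a x0 t)" and "v = v_of (a x0 t)"
  have un: "a z t \<in> unram z" if "z \<in> D" for z using cyc[OF that] t by (auto simp: cycle_on_def)
  have uz: "u_of (a z t) = u" if "z \<in> D" for z
   using a that D(2) t unfolding cycle_family_def u_def by blast
  have P0: "a x0 t \<in> unram x0" by (rule un[OF D(2)])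
  have lf: "u \<noteq> x0" "(u - z) / (u - x0) \<notin> \<real>\<^sub>\<le>\<^sub>0" "csqrt ((u - z) / (u - x0)) \<noteq> 0" if "z \<in> ball x0 \<rho>" for z
   using lift_ratio[OF far[OF t], of z] that by (auto simp: u_def dist_norm norm_minus_commute)
  have "v_of (a y t) = v * csqrt ((u - y) / (u - x0))"
  proof (rule square_roots_agree[of "ball x0 \<rho>" "\<lambda>z. v_of (a z t)" "\<lambda>z. v * csqrt ((u - z) / (u - x0))" x0])
   have "continuous_on (D \<times> {0..1}) (\<lambda>(x, t). v_of (a x t))" using a by (simp add: cycle_family_def)
   moreover have "continuous_on (ball x0 \<rho>) (\<lambda>z. (z, t))" by (intro continuous_intros)
   moreover have "(\<lambda>z. (z, t)) ` ball x0 \<rho> \<subseteq> D \<times> {0..1}" using t \<rho>(2) by auto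
   ultimately have "continuous_on (ball x0 \<rho>) (\<lambda>z. (\<lambda>(x, t). v_of (a x t)) (z, t))"
    by (rule continuous_on_compose2)
   then show "continuous_on (ball x0 \<rho>) (\<lambda>z. v_of (a z t))" by simp
   show "continuous_on (ball x0 \<rho>) (\<lambda>z. v * csqrt ((u - z) / (u - x0)))"
    using lf by (intro continuous_intros continuous_on_compose2[OF continuous_on_csqrt]) auto
   fix z assume z: "z \<in> ball x0 \<rho>"
   then have zD: "z \<in> D" using \<rho>(2) by blast
   have "(v * csqrt ((u - z) / (u - x0)))\<^sup>2 = cubic x0 u * ((u - z) / (u - x0))"
    using v_of_square[OF P0] by (simp add: power_mult_distrib u_def v_def)
   also have "\<dots> = cubic z u" using lf(1)[OF z] by (simp add: cubic_def)
   also have "\<dots> = (v_of (a z t))\<^sup>2" using v_of_square[OF un[OF zD]] unfolding uz[OF zD] by simp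
   finally show "(v_of (a z t))\<^sup>2 = (v * csqrt ((u - z) / (u - x0)))\<^sup>2" by simp
   show "v * csqrt ((u - z) / (u - x0)) \<noteq> 0" using lf(3)[OF z] unram_nonzero(1)[OF P0] by (simp add: v_def)
  next
   have "u - x0 \<noteq> 0" using lf(1)[of x0] \<rho>(1) by simp
   then show "v_of (a x0 t) = v * csqrt ((u - x0) / (u - x0))" by (simp add: v_def)
  qed (use y \<rho>(1) in \<open>auto simp: dist_norm norm_minus_commute\<close>)
  moreover have yD: "y \<in> D" using y \<rho>(2) by (auto simp: dist_norm norm_minus_commute)
  ultimately have uv: "u_of (a y t) = u_of (lift x0 y (a x0 t))" "v_of (a y t) = v_of (lift x0 y (a x0 t))"
   using uz[OF yD] v_of_lift[OF unram_not_Infty[OF P0], of x0 y] by (simp_all add: u_def v_def)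
  show ?thesis by (rule unram_eqI[OF un[OF yD] lift_unram[OF P0 far[OF t] y] uv])
 qed
 note fam = this
 show thesis by (rule that[OF \<rho> far fam])
qed

text \<open>On a closed curve the boundary terms of \<open>line_int_shift\<close> cancel. What
  remains is the first-order linear system behind the Picard-Fuchs equation.\<close>

lemma period_derivative:
 assumes D: "open D" "x0 \<in> D" and a: "cycle_family D a" and x0: "x0 \<noteq> 0" "x0 \<noteq> 1"
 defines "A' \<equiv> (period inv_uv (a x0) - period inv_v (a x0)) / (2 * (x0 - 1))"
 shows "((\<lambda>y. period inv_v (a y)) has_field_derivative A') (at x0)"
  "((\<lambda>y. period inv_uv (a y)) has_field_derivative (A' - period inv_uv (a x0) / 2) / x0) (at x0)"
proof -
 have cyc: "cycle_on x0 (a x0)" using a D(2) by (simp add: cycle_family_def)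
 have p0: "curve_path x0 (a x0) 0 1" by (rule cycle_on_curve_path[OF cyc])
 obtain \<rho> where \<rho>: "\<rho> > 0" "ball x0 \<rho> \<subseteq> D" "\<And>t. t \<in> {0..1} ==> 2 * \<rho> \<le> norm (u_of (a x0 t) - x0)"
  "\<And>y t. norm (y - x0) < \<rho> ==> t \<in> {0..1} ==> a y t = lift x0 y (a x0 t)"
  by (rule cycle_family_lift[OF D a]) (rule that)
 have d: "((\<lambda>y. period (\<lambda>P. 1 / (u_of P ^ n * v_of P)) (a y)) has_field_derivative
   line_int (\<lambda>P. 1 / (u_of P ^ n * v_of P) / (2 * (u_of P - x0))) (a x0) 0 1) (at x0)" for n
 proof -
  have "((\<lambda>y. line_int (\<lambda>P. 1 / (u_of P ^ n * v_of P)) (lift x0 y \<circ> a x0) 0 1) has_field_derivative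
    line_int (\<lambda>P. 1 / (u_of P ^ n * v_of P) / (2 * (u_of P - x0))) (lift x0 x0 \<circ> a x0) 0 1) (at x0)"
   by (rule lift_leibniz[OF p0 _ \<rho>(3)]) (use \<rho>(1) in auto)
  note 1 = this
  have 2: "line_int (\<lambda>P. 1 / (u_of P ^ n * v_of P) / (2 * (u_of P - x0))) (lift x0 x0 \<circ> a x0) 0 1 =
    line_int (\<lambda>P. 1 / (u_of P ^ n * v_of P) / (2 * (u_of P - x0))) (a x0) 0 1"
   by (rule line_int_cong) (use \<rho>(1) \<rho>(4)[of x0] in simp_all)
  have 3: "line_int (\<lambda>P. 1 / (u_of P ^ n * v_of P)) (lift x0 y \<circ> a x0) 0 1 = period (\<lambda>P. 1 / (u_of P ^ n * v_of P)) (a y)"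
   if "y \<in> ball x0 \<rho>" for y
   unfolding period_def by (rule line_int_cong) (use \<rho>(4)[of y] that in \<open>simp_all add: dist_norm norm_minus_commute\<close>)
  show ?thesis
  proof (rule has_field_derivative_transform_within_open[OF 1[unfolded 2] open_ball])
   show "x0 \<in> ball x0 \<rho>" by (rule centre_in_ball[THEN iffD2, OF \<rho>(1)])
  qed (rule 3)
 qed
 have cl: "a x0 0 = a x0 1" using cyc by (simp add: cycle_on_def)
 have s1: "line_int (\<lambda>P. 1 / v_of P / (2 * (u_of P - x0))) (a x0) 0 1 = A'"
  unfolding A'_def period_def by (subst line_int_shift(1)[OF p0 zero_le_one x0]) (simp add: cl)
 show "((\<lambda>y. period inv_v (a y)) has_field_derivative A') (at x0)"
  using d[of 0] s1 by simp
 show "((\<lambda>y. period inv_uv (a y)) has_field_derivative (A' - period inv_uv (a x0) / 2) / x0) (at x0)"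
  using d[of 1] line_int_shift(2)[OF p0 zero_le_one x0] s1 by (simp add: period_def)
qed

text \<open>The linear system of the periods again, now with a boundary term at the end point; at
  infinity that term vanishes by \<open>v_quotient_tendsto_0\<close>. The coordinate
  \<open>u\<close> of the end point stays fixed here.\<close>

lemma lifted_integrals:
 assumes x0: "x0 \<noteq> 0" "x0 \<noteq> 1" and path: "path_from_infty x0 \<gamma>" and "\<rho> > 0"
  and far: "\<And>t. t \<in> {0<..1} ==> 2 * \<rho> \<le> norm (u_of (\<gamma> t) - x0)"
  and j: "has_int_from_infty inv_v \<gamma> j0" "has_int_from_infty inv_uv \<gamma> j1"
 defines "J' \<equiv> (j1 - j0) / (2 * (x0 - 1)) +
   1 / (x0 * (x0 - 1)) * (v_of (\<gamma> 1) / (u_of (\<gamma> 1) - 0) - v_of (\<gamma> 1) / (u_of (\<gamma> 1) - x0))"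
 obtains J0 J1 where "J0 x0 = j0" "J1 x0 = j1"
  "\<And>y. norm (y - x0) < \<rho> ==> has_int_from_infty inv_v (lift x0 y \<circ> \<gamma>) (J0 y)"
  "\<And>y. norm (y - x0) < \<rho> ==> has_int_from_infty inv_uv (lift x0 y \<circ> \<gamma>) (J1 y)"
  "(J0 has_field_derivative J') (at x0)" "(J1 has_field_derivative (J' - j1 / 2) / x0) (at x0)"
proof -
 have path': "curve_path x0 \<gamma> e 1" if "0 < e" for e by (rule path_from_infty_curve_path[OF path that])
 have uniq: "I = J" if "has_int_from_infty h \<gamma> I" "has_int_from_infty h \<gamma> J" for h I J
  using that unfolding has_int_from_infty_def by (intro tendsto_unique[OF trivial_limit_at_right_real])
 have in01: "eventually (\<lambda>t. 0 < t \<and> t < 1) (at_right (0::real))"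
  unfolding eventually_at_right_field by (intro exI[of _ 1]) auto
 have self: "has_int_from_infty h \<gamma> I" if "has_int_from_infty h (lift x0 x0 \<circ> \<gamma>) I" for h I
 proof -
  have "eventually (\<lambda>t. line_int h (lift x0 x0 \<circ> \<gamma>) t 1 = line_int h \<gamma> t 1) (at_right 0)"
   using in01
  proof eventually_elim
   case (elim t)
   have "lift x0 x0 (\<gamma> \<tau>) = \<gamma> \<tau>" if "\<tau> \<in> {t..1}" for \<tau>
    using curve_path_in[OF path' that] elim lift_self[OF unram_not_Infty unram_nonzero(4)] by blast
   then show ?case by (intro line_int_cong) simp_all
  qed
  with that show ?thesis unfolding has_int_from_infty_def by (rule Lim_transform_eventually)
 qed
 obtain J0 J0' where J0: "\<And>y. norm (y - x0) < \<rho> ==> has_int_from_infty (\<lambda>P. 1 / (u_of P ^ 0 * v_of P)) (lift x0 y \<circ> \<gamma>) (J0 y)"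
  "(J0 has_field_derivative J0') (at x0)"
  "has_int_from_infty (\<lambda>P. 1 / (u_of P ^ 0 * v_of P) / (2 * (u_of P - x0))) \<gamma> J0'"
  by (rule lifted_integral_derivative[OF path \<open>\<rho> > 0\<close> far, where n = 0]) (assumption, rule that)
 obtain J1 J1' where J1: "\<And>y. norm (y - x0) < \<rho> ==> has_int_from_infty (\<lambda>P. 1 / (u_of P ^ 1 * v_of P)) (lift x0 y \<circ> \<gamma>) (J1 y)"
  "(J1 has_field_derivative J1') (at x0)"
  "has_int_from_infty (\<lambda>P. 1 / (u_of P ^ 1 * v_of P) / (2 * (u_of P - x0))) \<gamma> J1'"
  by (rule lifted_integral_derivative[OF path \<open>\<rho> > 0\<close> far, where n = 1]) (assumption, rule that)
 note J0 = J0[unfolded power_0 mult_1] and J1 = J1[unfolded power_one_right]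
 have jj: "J0 x0 = j0" "J1 x0 = j1"
  using uniq[OF self[OF J0(1)] j(1)] uniq[OF self[OF J1(1)] j(2)] \<open>\<rho> > 0\<close> by simp_all
 let ?Y = "\<lambda>t. 1 / (x0 * (x0 - 1)) * (v_of (\<gamma> t) / (u_of (\<gamma> t) - 0) - v_of (\<gamma> t) / (u_of (\<gamma> t) - x0))"
 have "((\<lambda>e. ?Y 1 - ?Y e + (line_int inv_uv \<gamma> e 1 - line_int inv_v \<gamma> e 1) / (2 * (x0 - 1))) \<longlongrightarrow>
   ?Y 1 - 1 / (x0 * (x0 - 1)) * 0 + (j1 - j0) / (2 * (x0 - 1))) (at_right 0)"
  using j x0 unfolding has_int_from_infty_def by (intro tendsto_intros v_quotient_tendsto_0[OF path]) auto
 moreover have "eventually (\<lambda>e. ?Y 1 - ?Y e + (line_int inv_uv \<gamma> e 1 - line_int inv_v \<gamma> e 1) / (2 * (x0 - 1)) =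
   line_int (\<lambda>P. 1 / v_of P / (2 * (u_of P - x0))) \<gamma> e 1) (at_right 0)"
  using in01 by eventually_elim (rule line_int_shift(1)[OF path' _ x0, symmetric], auto)
 ultimately have "((\<lambda>e. line_int (\<lambda>P. 1 / v_of P / (2 * (u_of P - x0))) \<gamma> e 1) \<longlongrightarrow>
   ?Y 1 - 1 / (x0 * (x0 - 1)) * 0 + (j1 - j0) / (2 * (x0 - 1))) (at_right 0)"
  by (rule Lim_transform_eventually)
 then have l0: "has_int_from_infty (\<lambda>P. 1 / v_of P / (2 * (u_of P - x0))) \<gamma> J'"
  by (simp add: has_int_from_infty_def J'_def add.commute)
 have "((\<lambda>e. (line_int (\<lambda>P. 1 / v_of P / (2 * (u_of P - x0))) \<gamma> e 1 - line_int inv_uv \<gamma> e 1 / 2) / x0) \<longlongrightarrow> (J' - j1 / 2) / x0) (at_right 0)"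
  using l0 j x0 unfolding has_int_from_infty_def by (intro tendsto_intros) auto
 moreover have "eventually (\<lambda>e. (line_int (\<lambda>P. 1 / v_of P / (2 * (u_of P - x0))) \<gamma> e 1 - line_int inv_uv \<gamma> e 1 / 2) / x0 =
   line_int (\<lambda>P. 1 / (u_of P * v_of P) / (2 * (u_of P - x0))) \<gamma> e 1) (at_right 0)"
  using in01 by eventually_elim (rule line_int_shift(2)[OF path' _ x0, symmetric], auto)
 ultimately have l1: "has_int_from_infty (\<lambda>P. 1 / (u_of P * v_of P) / (2 * (u_of P - x0))) \<gamma> ((J' - j1 / 2) / x0)"
  unfolding has_int_from_infty_def by (rule Lim_transform_eventually)
 have "J0' = J'" by (rule uniq[OF J0(3) l0])
 moreover have "J1' = (J' - j1 / 2) / x0" by (rule uniq[OF J1(3) l1])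
 ultimately show thesis using J0(2) J1(2) by (intro that[OF jj J0(1) J1(1)]) simp_all
qed

subsection \<open>The moving end point\<close>

text \<open>The error is measured against \<open>S\<close> and not against \<open>y - x0\<close>,
  because in the application \<open>f\<close> depends on \<open>y\<close> through an equation whose
  right side is \<open>S y\<close>. As \<open>S\<close> is differentiable and vanishes at
  \<open>x0\<close>, an error small against \<open>S\<close> is small against
  \<open>y - x0\<close>.\<close>

lemma has_field_derivative_perturb:
 fixes f S :: "complex \<Rightarrow> complex"
 assumes S: "(S has_field_derivative S') (at x0)" "S x0 = 0"
  and err: "\<And>\<epsilon>. \<epsilon> > 0 ==> eventually (\<lambda>y. norm (f y - f x0 - c * S y) \<le> \<epsilon> * norm (S y)) (at x0)"
 shows "(f has_field_derivative c * S') (at x0)"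
proof -
 have lim: "((\<lambda>y. S y / (y - x0)) \<longlongrightarrow> S') (at x0)"
  using S by (simp add: has_field_derivative_iff)
 have "((\<lambda>y. (f y - f x0 - c * S y) / (y - x0)) \<longlongrightarrow> 0) (at x0)"
 proof (rule tendstoI)
  fix e :: real assume e: "e > 0"
  define M where "M = norm S' + 1"
  have M: "M > 0" by (simp add: M_def add_nonneg_pos)
  have "((\<lambda>y. norm (S y / (y - x0))) \<longlongrightarrow> norm S') (at x0)" by (rule tendsto_norm[OF lim])
  then have "eventually (\<lambda>y. norm (S y / (y - x0)) < M) (at x0)"
   by (rule order_tendstoD) (simp add: M_def)
  moreover have "eventually (\<lambda>y. norm (f y - f x0 - c * S y) \<le> (e / (2 * M)) * norm (S y)) (at x0)"
   by (rule err) (use e M in simp)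
  ultimately show "eventually (\<lambda>y. dist ((f y - f x0 - c * S y) / (y - x0)) 0 < e) (at x0)"
  proof eventually_elim
   case (elim y)
   have "norm ((f y - f x0 - c * S y) / (y - x0)) = norm (f y - f x0 - c * S y) / norm (y - x0)" by (rule norm_divide)
   also have "\<dots> \<le> (e / (2 * M)) * norm (S y) / norm (y - x0)" by (rule divide_right_mono[OF elim(2)]) simp
   also have "\<dots> = (e / (2 * M)) * norm (S y / (y - x0))" by (simp add: norm_divide)
   also have "\<dots> \<le> (e / (2 * M)) * M" using elim(1) e M by (intro mult_left_mono) auto
   also have "\<dots> < e" using e M by simp
   finally show ?case by simp
  qed
 qed
 then have "((\<lambda>y. (f y - f x0 - c * S y) / (y - x0) + c * (S y / (y - x0))) \<longlongrightarrow> 0 + c * S') (at x0)"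
  by (intro tendsto_intros lim)
 moreover have "(f y - f x0 - c * S y) / (y - x0) + c * (S y / (y - x0)) = (f y - f x0) / (y - x0)" for y
  by (simp add: diff_divide_distrib)
 ultimately show ?thesis by (simp add: has_field_derivative_iff)
qed

text \<open>The path in a nearby fibre is compared with the lift of the path of \<open>x0\<close>.
  The lift ends over \<open>q x0\<close> and has integral \<open>J0 y\<close> instead of
  \<open>Z y\<close>; the difference has to be supplied by a short move of the end point to some
  \<open>u\<close>. Such a \<open>u\<close> is produced first, and \<open>abel_jacobi\<close> then
  shows that it is \<open>q y\<close>.\<close>

lemma moving_end_point:
 fixes q w Z K J0 J1 :: "complex \<Rightarrow> complex"
 assumes x0: "x0 \<noteq> 0" "x0 \<noteq> 1" and D: "open D" "x0 \<in> D"
  and path: "\<And>y. y \<in> D ==> path_from_infty y (\<Gamma> y)" and last: "\<And>y. y \<in> D ==> \<Gamma> y 1 = Aff (q y) (w y)"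
  and int: "\<And>y. y \<in> D ==> has_int_from_infty inv_v (\<Gamma> y) (Z y)"
   "\<And>y. y \<in> D ==> has_int_from_infty inv_uv (\<Gamma> y) (K y)"
  and far: "\<And>t. t \<in> {0<..1} ==> 2 * \<rho> \<le> norm (u_of (\<Gamma> x0 t) - x0)" "\<rho> > 0"
  and lifted: "\<And>y. norm (y - x0) < \<rho> ==> has_int_from_infty inv_v (lift x0 y \<circ> \<Gamma> x0) (J0 y)"
   "\<And>y. norm (y - x0) < \<rho> ==> has_int_from_infty inv_uv (lift x0 y \<circ> \<Gamma> x0) (J1 y)"
  and start: "J0 x0 = Z x0" "J1 x0 = K x0"
  and S': "((\<lambda>y. Z y - J0 y) has_field_derivative S') (at x0)"
 shows "(q has_field_derivative w x0 * S') (at x0)"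
  and "((\<lambda>y. K y - J1 y) has_field_derivative 1 / (q x0 * w x0) * (w x0 * S')) (at x0)"
  and "eventually (\<lambda>y. w y = w x0 * csqrt (cubic y (q y) / cubic x0 (q x0))) (nhds x0)"
proof -
 define q0 w0 where "q0 = q x0" and "w0 = w x0"
 define S where "S y = Z y - J0 y" for y
 have "\<Gamma> x0 1 \<in> unram x0" using path[OF D(2)] by (auto simp: path_from_infty_def)
 then have P0: "Aff q0 w0 \<in> unram x0" using last[OF D(2)] by (simp add: q0_def w0_def)
 note nz0 = unram_nonzero(1-4)[OF P0, simplified]
 have w2: "w0\<^sup>2 = cubic x0 q0" using v_of_square[OF P0] by simp
 have c0: "cubic x0 q0 \<noteq> 0" using nz0 w2 by auto
 define g where "g y u = cubic y u / cubic x0 q0" for y u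
 define V where "V y u = w0 * csqrt (g y u)" for y u
 have g0: "g x0 q0 = 1" using c0 by (simp add: g_def)
 have cg: "isCont (\<lambda>p. g (fst p) (snd p)) (x0, q0)"
 proof -
  have "isCont (\<lambda>p. cubic (fst p) (snd p)) (x0, q0)" unfolding cubic_def by (intro continuous_intros)
  then show ?thesis unfolding g_def by (intro continuous_intros) (use c0 in simp_all)
 qed
 have "isCont csqrt 1" by (intro field_differentiable_imp_continuous_at field_differentiable_at_csqrt) (simp add: complex_nonpos_Reals_iff)
 then have cs: "isCont (\<lambda>p. csqrt (g (fst p) (snd p))) (x0, q0)"
  by (intro isCont_o2[OF cg]) (simp add: g0)
 have c1: "isCont (\<lambda>p. 1 / V (fst p) (snd p)) (x0, q0)"
  unfolding V_def by (intro continuous_intros cs) (simp add: g0 nz0)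
 have c2: "isCont (\<lambda>p. 1 / (snd p * V (fst p) (snd p))) (x0, q0)"
  unfolding V_def by (intro continuous_intros cs) (simp add: g0 nz0)
 have S0: "S x0 = 0" using start by (simp add: S_def)
 have cS: "isCont S x0" using DERIV_isCont[OF S'] by (simp add: S_def[abs_def])
 have main: "eventually (\<lambda>y. w y = V y (q y) \<and> norm (q y - q0 - w0 * S y) \<le> \<epsilon> * norm (S y) \<and>
   norm ((K y - J1 y) - 1 / (q0 * w0) * (q y - q0)) \<le> \<epsilon> * norm (q y - q0)) (nhds x0)" if \<epsilon>: "\<epsilon> > 0" for \<epsilon>
 proof -
  \<comment> \<open>The bound \<open>1 / (4 * norm w0)\<close> makes the map \<open>f\<close> below
    send a disc into itself; \<open>\<epsilon> / (2 * (norm w0)^2)\<close> yields the final error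
    \<open>\<epsilon> * norm (S y)\<close>.\<close>
  define \<eta> where "\<eta> = min \<epsilon> (min (1 / (4 * norm w0)) (\<epsilon> / (2 * (norm w0)\<^sup>2)))"
  have \<eta>: "\<eta> > 0" "\<eta> \<le> \<epsilon>" using \<epsilon> nz0 by (auto simp: \<eta>_def)
  have "\<eta> \<le> 1 / (4 * norm w0)" "\<eta> \<le> \<epsilon> / (2 * (norm w0)\<^sup>2)" by (auto simp: \<eta>_def)
  then have \<eta>': "norm w0 * \<eta> \<le> 1 / 4" "2 * (norm w0)\<^sup>2 * \<eta> \<le> \<epsilon>" using nz0 by (simp_all add: field_simps)
  have "eventually (\<lambda>p. 0 < Re (g (fst p) (snd p))) (nhds (x0, q0))"
  proof -
   have "isCont (\<lambda>p. Re (g (fst p) (snd p))) (x0, q0)" by (rule isCont_Re[OF cg])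
   then have "((\<lambda>p. Re (g (fst p) (snd p))) \<longlongrightarrow> 1) (nhds (x0, q0))"
    unfolding isCont_def tendsto_at_iff_tendsto_nhds[of "\<lambda>p. Re (g (fst p) (snd p))"] by (simp add: g0)
   then show ?thesis by (rule order_tendstoD) simp
  qed
  moreover have "eventually (\<lambda>p. dist (1 / V (fst p) (snd p)) (1 / w0) < \<eta>) (nhds (x0, q0))"
  proof -
   have "((\<lambda>p. 1 / V (fst p) (snd p)) \<longlongrightarrow> 1 / w0) (nhds (x0, q0))"
    using c1 unfolding isCont_def tendsto_at_iff_tendsto_nhds[of "\<lambda>p. 1 / V (fst p) (snd p)"] by (simp add: g0 V_def)
   then show ?thesis using \<eta>(1) by (rule tendstoD)
  qed
  moreover have "eventually (\<lambda>p. dist (1 / (snd p * V (fst p) (snd p))) (1 / (q0 * w0)) < \<eta>) (nhds (x0, q0))"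
  proof -
   have "((\<lambda>p. 1 / (snd p * V (fst p) (snd p))) \<longlongrightarrow> 1 / (q0 * w0)) (nhds (x0, q0))"
    using c2 unfolding isCont_def tendsto_at_iff_tendsto_nhds[of "\<lambda>p. 1 / (snd p * V (fst p) (snd p))"] by (simp add: g0 V_def)
   then show ?thesis using \<eta>(1) by (rule tendstoD)
  qed
  ultimately have "eventually (\<lambda>p. 0 < Re (g (fst p) (snd p)) \<and> dist (1 / V (fst p) (snd p)) (1 / w0) < \<eta> \<and>
    dist (1 / (snd p * V (fst p) (snd p))) (1 / (q0 * w0)) < \<eta>) (nhds (x0, q0))" by (intro eventually_conj)
  then obtain d where d: "d > 0" "\<And>p. dist p (x0, q0) < d ==> 0 < Re (g (fst p) (snd p)) \<and>
    dist (1 / V (fst p) (snd p)) (1 / w0) < \<eta> \<and> dist (1 / (snd p * V (fst p) (snd p))) (1 / (q0 * w0)) < \<eta>"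
   unfolding eventually_nhds_metric by blast
  define R where "R = d / 2"
  have R: "R > 0" using d(1) by (simp add: R_def)
  have near: "0 < Re (g y u)" "norm (1 / V y u - 1 / w0) \<le> \<eta>" "norm (1 / (u * V y u) - 1 / (q0 * w0)) \<le> \<eta>"
   if "y \<in> ball x0 R" "u \<in> ball q0 R" for y u
  proof -
   have "dist (y, u) (x0, q0) \<le> dist y x0 + dist u q0"
    unfolding dist_Pair_Pair by (rule sqrt_sum_squares_le_sum) auto
   also have "\<dots> < d" using that by (simp add: R_def dist_commute)
   finally show "0 < Re (g y u)" "norm (1 / V y u - 1 / w0) \<le> \<eta>" "norm (1 / (u * V y u) - 1 / (q0 * w0)) \<le> \<eta>"
    using d(2)[of "(y, u)"] by (auto simp: dist_norm)
  qed
  have "eventually (\<lambda>y. dist (S y) 0 < R / (4 * norm w0)) (nhds x0)"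
  proof -
   have "(S \<longlongrightarrow> 0) (nhds x0)" using cS unfolding isCont_def tendsto_at_iff_tendsto_nhds[of S] by (simp add: S0)
   then show ?thesis by (rule tendstoD) (use R nz0 in simp)
  qed
  moreover have "eventually (\<lambda>y. y \<in> D) (nhds x0)" using D by (rule eventually_nhds_in_open)
  moreover have "eventually (\<lambda>y. y \<in> ball x0 (min \<rho> R)) (nhds x0)" using far(2) R by (intro eventually_nhds_in_open) auto
  moreover have "eventually (\<lambda>y. y \<in> - {0, 1}) (nhds x0)" using x0 by (intro eventually_nhds_in_open) auto
  ultimately show ?thesis
  proof eventually_elim
   case (elim y)
   have yR: "y \<in> ball x0 R" and y\<rho>: "norm (y - x0) < \<rho>" and y01: "y \<noteq> 0" "y \<noteq> 1"
    using elim by (auto simp: dist_norm norm_minus_commute)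
   note nr = near[OF yR]
   let ?B = "ball q0 R"
   have gnz: "g y u \<noteq> 0" "u \<noteq> 0" if "u \<in> ?B" for u using nr(1)[OF that] by (auto simp: g_def cubic_def)
   have Vn: "V y u \<noteq> 0" if "u \<in> ?B" for u using gnz(1)[OF that] nz0 by (simp add: V_def)
   have V2: "(V y u)\<^sup>2 = cubic y u" for u using c0 by (simp add: V_def power_mult_distrib w2 g_def)
   have Vh: "V y holomorphic_on ?B"
   proof -
    have "(\<lambda>u. g y u) holomorphic_on ?B" unfolding g_def cubic_def by (intro holomorphic_intros) (use c0 in auto)
    then have "(\<lambda>u. w0 * csqrt (g y u)) holomorphic_on ?B"
    proof (intro holomorphic_intros)
     show "g y z \<notin> \<real>\<^sub>\<le>\<^sub>0" if "z \<in> ?B" for z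
      using nr(1)[OF that] by (auto simp: complex_nonpos_Reals_iff)
    qed
    then show ?thesis by (simp add: V_def[abs_def])
   qed
   have "(\<lambda>u. 1 / V y u) holomorphic_on ?B" using Vn by (intro holomorphic_intros Vh) auto
   then obtain F0 where F0: "\<And>u. u \<in> ?B ==> (F0 has_field_derivative 1 / V y u) (at u within ?B)"
    by (rule holomorphic_convex_primitive'[OF convex_ball open_ball, THEN exE]) auto
   have "(\<lambda>u. 1 / (u * V y u)) holomorphic_on ?B" using Vn gnz(2) by (intro holomorphic_intros Vh) auto
   then obtain F1 where F1: "\<And>u. u \<in> ?B ==> (F1 has_field_derivative 1 / (u * V y u)) (at u within ?B)"
    by (rule holomorphic_convex_primitive'[OF convex_ball open_ball, THEN exE]) auto
   define H0 where "H0 u = F0 u - F0 q0" for u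
   define H1 where "H1 u = F1 u - F1 q0" for u
   have H0w: "(H0 has_field_derivative 1 / V y u) (at u within ?B)" if "u \<in> ?B" for u
    using DERIV_diff[OF F0[OF that] DERIV_const[of "F0 q0"]] by (simp add: H0_def[abs_def])
   have H1w: "(H1 has_field_derivative 1 / (u * V y u)) (at u within ?B)" if "u \<in> ?B" for u
    using DERIV_diff[OF F1[OF that] DERIV_const[of "F1 q0"]] by (simp add: H1_def[abs_def])
   have H: "(H0 has_field_derivative 1 / V y u) (at u)" "(H1 has_field_derivative 1 / (u * V y u)) (at u)" if "u \<in> ?B" for u
    using H0w[OF that] H1w[OF that] at_within_open[OF that open_ball] by simp_all
   have Hq: "H0 q0 = 0" "H1 q0 = 0" by (simp_all add: H0_def H1_def)
   have q0B: "q0 \<in> ?B" using R by simp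
   have b0: "norm (H0 u - 1 / w0 * (u - q0)) \<le> \<eta> * norm (u - q0)" if "u \<in> ?B" for u
   proof -
    have "norm ((H0 u - 1 / w0 * (u - q0)) - (H0 q0 - 1 / w0 * (q0 - q0))) \<le> \<eta> * norm (u - q0)"
    proof (rule field_differentiable_bound[OF convex_ball _ nr(2) that q0B])
     fix z assume z: "z \<in> ?B"
     have "((\<lambda>u. 1 / w0 * (u - q0)) has_field_derivative 1 / w0 * (1 - 0)) (at z within ?B)"
      by (intro DERIV_cmult DERIV_diff DERIV_ident DERIV_const)
     from DERIV_diff[OF H0w[OF z] this]
     show "((\<lambda>u. H0 u - 1 / w0 * (u - q0)) has_field_derivative 1 / V y z - 1 / w0) (at z within ?B)" by simp
    qed
    then show ?thesis by (simp add: Hq)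
   qed
   have b1: "norm (H1 u - 1 / (q0 * w0) * (u - q0)) \<le> \<eta> * norm (u - q0)" if "u \<in> ?B" for u
   proof -
    have "norm ((H1 u - 1 / (q0 * w0) * (u - q0)) - (H1 q0 - 1 / (q0 * w0) * (q0 - q0))) \<le> \<eta> * norm (u - q0)"
    proof (rule field_differentiable_bound[OF convex_ball _ nr(3) that q0B])
     fix z assume z: "z \<in> ?B"
     have "((\<lambda>u. 1 / (q0 * w0) * (u - q0)) has_field_derivative 1 / (q0 * w0) * (1 - 0)) (at z within ?B)"
      by (intro DERIV_cmult DERIV_diff DERIV_ident DERIV_const)
     from DERIV_diff[OF H1w[OF z] this]
     show "((\<lambda>u. H1 u - 1 / (q0 * w0) * (u - q0)) has_field_derivative 1 / (z * V y z) - 1 / (q0 * w0)) (at z within ?B)" by simp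
    qed
    then show ?thesis by (simp add: Hq)
   qed
   have b0': "norm (w0 * H0 u - (u - q0)) \<le> norm w0 * \<eta> * norm (u - q0)" if "u \<in> ?B" for u
   proof -
    have "w0 * (1 / w0 * (u - q0)) = u - q0" using nz0 by simp
    then have "w0 * H0 u - (u - q0) = w0 * (H0 u - 1 / w0 * (u - q0))" by (simp only: right_diff_distrib)
    then have "norm (w0 * H0 u - (u - q0)) = norm w0 * norm (H0 u - 1 / w0 * (u - q0))" by (simp only: norm_mult)
    also have "\<dots> \<le> norm w0 * (\<eta> * norm (u - q0))" using b0[OF that] by (intro mult_left_mono) auto
    finally show ?thesis by (simp only: mult.assoc)
   qed
   have q4: "norm w0 * \<eta> * norm (u - q0) \<le> 1 / 4 * norm (u - q0)" for u
    using \<eta>'(1) by (intro mult_right_mono) auto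
   have Ssmall: "norm w0 * norm (S y) \<le> R / 4" using elim(1) nz0 by (simp add: field_simps)
   \<comment> \<open>Its fixed points are the solutions of \<open>H0 u = S y\<close>. Brouwer's
     theorem provides one in the closed disc of radius \<open>R / 2\<close>, and
     \<open>abel_jacobi\<close> identifies whichever solution is found with
     \<open>q y\<close>.\<close>
   define f where "f u = u - w0 * (H0 u - S y)" for u
   have sub: "cball q0 (R / 2) \<subseteq> ?B" using R by auto
   obtain u where u: "u \<in> cball q0 (R / 2)" "f u = u"
   proof (rule brouwer[OF compact_cball convex_cball])
    show "cball q0 (R / 2) \<noteq> {}" using R by simp
    have "continuous_on ?B H0" by (rule continuous_at_imp_continuous_on) (blast intro: DERIV_isCont H)
    then show "continuous_on (cball q0 (R / 2)) f"
     unfolding f_def by (intro continuous_intros) (rule continuous_on_subset[OF _ sub])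
    show "f \<in> cball q0 (R / 2) \<rightarrow> cball q0 (R / 2)"
    proof
     fix u assume u: "u \<in> cball q0 (R / 2)"
     then have uB: "u \<in> ?B" using sub by blast
     have "f u - q0 = w0 * S y - (w0 * H0 u - (u - q0))" by (simp add: f_def algebra_simps)
     then have "norm (f u - q0) \<le> norm (w0 * S y) + norm (w0 * H0 u - (u - q0))" by (simp only: norm_triangle_ineq4)
     moreover have "norm (u - q0) \<le> R / 2" using u by (simp add: dist_norm norm_minus_commute)
     ultimately have "norm (f u - q0) \<le> R / 2"
      using b0'[OF uB] q4[of u] Ssmall R by (simp add: norm_mult)
     then show "f u \<in> cball q0 (R / 2)" by (simp add: dist_norm norm_minus_commute)
    qed
   qed (rule that)
   have uB: "u \<in> ?B" using u(1) sub by blast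
   have HS: "H0 u = S y" using u(2) nz0 by (simp add: f_def)
   have Jz: "J0 y + H0 u = Z y" unfolding HS by (simp add: S_def)
   have end': "(lift x0 y \<circ> \<Gamma> x0) 1 = Aff q0 (V y q0)"
   proof -
    have "(q0 - y) / (q0 - x0) = g y q0" using nz0 by (simp add: g_def cubic_def)
    then show ?thesis using last[OF D(2)] by (simp add: lift_def V_def q0_def w0_def)
   qed
   have int1: "has_int_from_infty inv_v (\<Gamma> y) (J0 y + H0 u)" unfolding Jz by (rule int(1)[OF elim(2)])
   have py: "path_from_infty y (lift x0 y \<circ> \<Gamma> x0)" by (rule path_from_infty_lift[OF path[OF D(2)] far(1) y\<rho>])
   note aj = abel_jacobi[OF y01 path[OF elim(2)] last[OF elim(2)] int1 py end' lifted(1)[OF y\<rho>] lifted(2)[OF y\<rho>]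
     Vh Vn V2 H Hq uB]
   have qu: "q y = u" by (rule aj(1))
   have wu: "w y = V y u" by (rule aj(2))
   have "has_int_from_infty inv_uv (\<Gamma> y) (J1 y + H1 u)" by (rule aj(3))
   with int(2)[OF elim(2)] have Kv: "K y = J1 y + H1 u" unfolding has_int_from_infty_def
    by (rule tendsto_unique[OF trivial_limit_at_right_real])
   have e: "norm (u - q0 - w0 * S y) \<le> norm w0 * \<eta> * norm (u - q0)"
    using b0'[OF uB] unfolding HS by (simp only: norm_minus_commute)
   have "norm (u - q0) \<le> norm (u - q0 - w0 * S y) + norm (w0 * S y)"
    using norm_triangle_ineq[of "u - q0 - w0 * S y" "w0 * S y"] by simp
   then have "norm (u - q0) \<le> 2 * (norm w0 * norm (S y))" using e q4[of u] norm_ge_zero[of "u - q0"] unfolding norm_mult by linarith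
   then have "norm w0 * \<eta> * norm (u - q0) \<le> norm w0 * \<eta> * (2 * (norm w0 * norm (S y)))"
    using \<eta>(1) by (intro mult_left_mono) auto
   also have "\<dots> = (2 * (norm w0)\<^sup>2 * \<eta>) * norm (S y)" by (simp add: power2_eq_square)
   also have "\<dots> \<le> \<epsilon> * norm (S y)" using \<eta>'(2) by (intro mult_right_mono) auto
   finally have e': "norm (u - q0 - w0 * S y) \<le> \<epsilon> * norm (S y)" using e by linarith
   have "norm ((K y - J1 y) - 1 / (q0 * w0) * (u - q0)) \<le> \<eta> * norm (u - q0)" using b1[OF uB] Kv by simp
   also have "\<dots> \<le> \<epsilon> * norm (u - q0)" using \<eta>(2) by (intro mult_right_mono) auto
   finally show ?case using wu e' unfolding qu by blast
  qed
 qed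
 have q': "(q has_field_derivative w0 * S') (at x0)"
 proof (rule has_field_derivative_perturb[of S])
  show "(S has_field_derivative S') (at x0)" using S' by (simp add: S_def[abs_def])
  show "eventually (\<lambda>y. norm (q y - q x0 - w0 * S y) \<le> \<epsilon> * norm (S y)) (at x0)" if "\<epsilon> > 0" for \<epsilon>
   using main[OF that] unfolding eventually_at_filter by eventually_elim (simp add: q0_def)
 qed (rule S0)
 then show "(q has_field_derivative w x0 * S') (at x0)" by (simp add: w0_def)
 have "((\<lambda>y. K y - J1 y) has_field_derivative 1 / (q0 * w0) * (w0 * S')) (at x0)"
 proof (rule has_field_derivative_perturb[of "\<lambda>y. q y - q0"])
  show "((\<lambda>y. q y - q0) has_field_derivative w0 * S') (at x0)" using DERIV_diff[OF q' DERIV_const[of q0]] by simp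
  show "eventually (\<lambda>y. norm (K y - J1 y - (K x0 - J1 x0) - 1 / (q0 * w0) * (q y - q0)) \<le> \<epsilon> * norm (q y - q0)) (at x0)"
   if "\<epsilon> > 0" for \<epsilon>
   using main[OF that] unfolding eventually_at_filter by eventually_elim (simp add: start)
 qed (simp add: q0_def)
 then show "((\<lambda>y. K y - J1 y) has_field_derivative 1 / (q x0 * w x0) * (w x0 * S')) (at x0)"
  by (simp only: q0_def w0_def)
 show "eventually (\<lambda>y. w y = w x0 * csqrt (cubic y (q y) / cubic x0 (q x0))) (nhds x0)"
  using main[OF zero_less_one] by eventually_elim (simp add: V_def g_def q0_def w0_def)
qed

section \<open>The zeros of the differential\<close>

lemma diff_zero_at_iff:
 assumes "eventually (\<lambda>t. pullback x h P t = f t) (at 0)" "(f \<longlongrightarrow> L) (at 0)"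
 shows "diff_zero_at x h P \<longleftrightarrow> L = 0"
proof -
 have "(pullback x h P \<longlongrightarrow> L) (at 0)"
  by (rule Lim_transform_eventually[OF assms(2)]) (use assms(1) in \<open>simp add: eq_commute\<close>)
 then show ?thesis unfolding diff_zero_at_def using tendsto_unique[OF trivial_limit_at] by blast
qed

lemma eventually_at_0I:
 fixes Q :: "complex \<Rightarrow> bool"
 assumes "r > 0" "\<And>t. 0 < norm t ==> norm t < r ==> Q t"
 shows "eventually Q (at 0)"
 unfolding eventually_at using assms by (intro exI[of _ r]) auto

text \<open>In every local parameter, also at the four ramification points, \<open>du / v\<close> is
  holomorphic without zeros. Hence the zeros are those of the factor \<open>w / (u - q) + C\<close>,
  which tends to \<open>C\<close> at infinity.\<close>

lemma diff_zeros_form: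
 assumes x: "x \<noteq> 0" "x \<noteq> 1" and w: "w\<^sup>2 = cubic x q" "w \<noteq> 0"
  and h: "\<And>u v. v\<^sup>2 = cubic x u ==> v \<noteq> 0 ==> u \<noteq> q ==> h (Aff u v) = (w / (u - q) + C) / v"
 shows "diff_zero_at x h Infty \<longleftrightarrow> C = 0"
  and "v\<^sup>2 = cubic x u ==> diff_zero_at x h (Aff u v) \<longleftrightarrow> u \<noteq> q \<and> w / (u - q) + C = 0"
proof -
 show "diff_zero_at x h Infty \<longleftrightarrow> C = 0"
 proof -
  obtain \<rho> r where \<rho>: "r > 0" "isCont \<rho> 0" "\<rho> 0 = 1" "\<And>t. \<rho> (- t) = \<rho> t"
   "\<And>t. 0 < norm t ==> norm t < r ==> local_par x Infty t = Aff (1 / t\<^sup>2) (\<rho> t / t ^ 3)"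
   "\<And>t. 0 < norm t ==> norm t < r ==> (\<rho> t / t ^ 3)\<^sup>2 = cubic x (1 / t\<^sup>2)"
   "\<And>t. 0 < norm t ==> norm t < r ==> cubic x (1 / t\<^sup>2) \<noteq> 0"
   "\<And>t h. 0 < norm t ==> pullback x h Infty t = h (Aff (1 / t\<^sup>2) (\<rho> t / t ^ 3)) * (- 2 / t ^ 3)"
   by (rule local_par_Infty) (rule that)
  let ?f = "\<lambda>t. - 2 * (w * t\<^sup>2 / (1 - q * t\<^sup>2) + C) / \<rho> t"
  have "((\<lambda>t. 1 - q * t\<^sup>2) \<longlongrightarrow> 1 - q * 0\<^sup>2) (at 0)" by (intro tendsto_intros)
  then have "eventually (\<lambda>t. 1 - q * t\<^sup>2 \<noteq> 0) (at 0)" by (rule tendsto_imp_eventually_ne) simp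
  moreover have "eventually (\<lambda>t. 0 < norm t \<and> norm t < r) (at (0::complex))" using \<rho>(1) by (rule eventually_at_0I) blast
  ultimately have "eventually (\<lambda>t. pullback x h Infty t = ?f t) (at 0)"
  proof eventually_elim
   case (elim t)
   then have t: "0 < norm t" "norm t < r" "t \<noteq> 0" by auto
   have v0: "\<rho> t / t ^ 3 \<noteq> 0" using \<rho>(6,7)[OF t(1,2)] by (metis zero_power2)
   then have \<rho>0: "\<rho> t \<noteq> 0" by auto
   have uq: "1 / t\<^sup>2 \<noteq> q" using elim t by (auto simp: field_simps)
   have quot: "w / (1 / t\<^sup>2 - q) = w * t\<^sup>2 / (1 - q * t\<^sup>2)"
   proof -
    have "1 / t\<^sup>2 - q = (1 - q * t\<^sup>2) / t\<^sup>2" using t by (simp add: field_simps)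
    then show ?thesis by simp
   qed
   have "pullback x h Infty t = (w * t\<^sup>2 / (1 - q * t\<^sup>2) + C) / (\<rho> t / t ^ 3) * (- 2 / t ^ 3)"
    unfolding \<rho>(8)[OF t(1)] h[OF \<rho>(6)[OF t(1,2)] v0 uq] quot ..
   also have "\<dots> = ?f t"
   proof -
    have "c / (s / m) * (- 2 / m) = - 2 * c / s" if "m \<noteq> 0" for c s m :: complex using that by simp
    note aux = this
    show ?thesis by (rule aux) (use t in simp)
   qed
   finally show ?case .
  qed
  moreover have "(?f \<longlongrightarrow> - 2 * (w * 0\<^sup>2 / (1 - q * 0\<^sup>2) + C) / \<rho> 0) (at 0)"
   using \<rho>(2,3) by (intro tendsto_intros) (auto simp: isCont_def)
  ultimately have "diff_zero_at x h Infty \<longleftrightarrow> - 2 * (w * 0\<^sup>2 / (1 - q * 0\<^sup>2) + C) / \<rho> 0 = 0"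
   by (rule diff_zero_at_iff)
  then show ?thesis using \<rho>(3) by simp
 qed
 assume v: "v\<^sup>2 = cubic x u"
 show "diff_zero_at x h (Aff u v) \<longleftrightarrow> u \<noteq> q \<and> w / (u - q) + C = 0"
 proof (cases "v = 0")
  case False
  obtain r where r: "r > 0" "(\<lambda>z. v * csqrt (cubic x z / cubic x u)) holomorphic_on ball u r"
   "v * csqrt (cubic x u / cubic x u) = v"
   "\<And>z. z \<in> ball u r ==> (v * csqrt (cubic x z / cubic x u))\<^sup>2 = cubic x z"
   "\<And>z. z \<in> ball u r ==> v * csqrt (cubic x z / cubic x u) \<noteq> 0"
   "\<And>z. z \<in> ball u r ==> ((\<lambda>z. v * csqrt (cubic x z / cubic x u)) has_field_derivative dcubic x z / (2 * (v * csqrt (cubic x z / cubic x u)))) (at z)"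
   by (rule branch[OF v False]) (rule that)
  define V where "V t = v * csqrt (cubic x (u + t) / cubic x u)" for t
  have V0: "V 0 = v" using r(3) by (simp add: V_def)
  have "isCont (\<lambda>z. v * csqrt (cubic x z / cubic x u)) (u + 0)"
   using DERIV_isCont[OF r(6)[of u]] r(1) by simp
  moreover have "isCont (\<lambda>t. u + t) 0" by (intro continuous_intros)
  ultimately have "isCont (\<lambda>t. v * csqrt (cubic x (u + t) / cubic x u)) 0" by (rule isCont_o2[rotated])
  then have "isCont V 0" unfolding V_def[abs_def] .
  then have Vl: "(V \<longlongrightarrow> v) (at 0)" using V0 by (simp add: isCont_def)
  have near: "eventually (\<lambda>t. 0 < norm t \<and> norm t < r) (at (0::complex))" using r(1) by (rule eventually_at_0I) blast
  have pb: "pullback x h (Aff u v) t = (w / (u + t - q) + C) / V t" if "norm t < r" "u + t \<noteq> q" for t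
  proof -
   have "u + t \<in> ball u r" using that(1) by (simp add: dist_norm)
   from h[OF r(4)[OF this] r(5)[OF this] that(2)] show ?thesis
    unfolding pullback_unram[OF False] V_def .
  qed
  show ?thesis
  proof (cases "u = q")
   case True
   \<comment> \<open>Over \<open>u = q\<close> the product of \<open>t\<close> and the coefficient
     tends to \<open>w / v\<close>, which is not 0: both points over \<open>q\<close> are poles and
     thus no zeros.\<close>
   have "eventually (\<lambda>t. t * pullback x h (Aff u v) t = (w + C * t) / V t) (at 0)"
    using near
   proof eventually_elim
    case (elim t)
    then have "t * (w / (q + t - q) + C) = w + C * t" by (simp add: distrib_left)
    moreover have "pullback x h (Aff u v) t = (w / (q + t - q) + C) / V t" using pb[of t] elim True by simp
    ultimately show ?case by (simp only: times_divide_eq_right)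
   qed
   moreover have "((\<lambda>t. (w + C * t) / V t) \<longlongrightarrow> (w + C * 0) / v) (at 0)"
    using False by (intro tendsto_intros Vl)
   ultimately have l: "((\<lambda>t. t * pullback x h (Aff u v) t) \<longlongrightarrow> (w + C * 0) / v) (at 0)"
    by (subst filterlim_cong[OF refl refl])
   have "\<not> diff_zero_at x h (Aff u v)"
   proof
    assume "diff_zero_at x h (Aff u v)"
    then have "((\<lambda>t. t * pullback x h (Aff u v) t) \<longlongrightarrow> 0 * 0) (at 0)"
     unfolding diff_zero_at_def by (intro tendsto_intros)
    from tendsto_unique[OF trivial_limit_at this l] show False using w False by simp
   qed
   then show ?thesis using True by simp
  next
   case uq: False
   have "((\<lambda>t. u + t) \<longlongrightarrow> u + 0) (at 0)" by (intro tendsto_intros)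
   then have "eventually (\<lambda>t. u + t \<noteq> q) (at 0)" by (rule tendsto_imp_eventually_ne) (use uq in simp)
   with near have "eventually (\<lambda>t. pullback x h (Aff u v) t = (w / (u + t - q) + C) / V t) (at 0)"
    by eventually_elim (simp add: pb)
   moreover have "((\<lambda>t. (w / (u + t - q) + C) / V t) \<longlongrightarrow> (w / (u + 0 - q) + C) / v) (at 0)"
    using False uq by (intro tendsto_intros Vl) auto
   ultimately have "diff_zero_at x h (Aff u v) \<longleftrightarrow> (w / (u + 0 - q) + C) / v = 0" by (rule diff_zero_at_iff)
   then show ?thesis using False uq by simp
  qed
 next
  case True
  then have e: "cubic x u = 0" using v by simp
  then have uq: "u \<noteq> q" using w by auto
  obtain k \<rho> r where \<rho>: "r > 0" "k \<noteq> 0" "isCont \<rho> 0" "\<rho> 0 = 1" "\<And>t. \<rho> (- t) = \<rho> t"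
   "k\<^sup>2 = dcubic x u"
   "\<And>t. 0 < norm t ==> norm t < r ==> local_par x (Aff u 0) t = Aff (u + t\<^sup>2) (t * k * \<rho> t)"
   "\<And>t. 0 < norm t ==> norm t < r ==> (t * k * \<rho> t)\<^sup>2 = cubic x (u + t\<^sup>2)"
   "\<And>t. 0 < norm t ==> norm t < r ==> cubic x (u + t\<^sup>2) \<noteq> 0"
   by (rule local_par_ram[OF x e]) (rule that)
  let ?f = "\<lambda>t. 2 * (w / (u + t\<^sup>2 - q) + C) / (k * \<rho> t)"
  have "((\<lambda>t. u + t\<^sup>2) \<longlongrightarrow> u + 0\<^sup>2) (at 0)" by (intro tendsto_intros)
  then have "eventually (\<lambda>t. u + t\<^sup>2 \<noteq> q) (at 0)" by (rule tendsto_imp_eventually_ne) (use uq in simp)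
  moreover have "eventually (\<lambda>t. 0 < norm t \<and> norm t < r) (at (0::complex))" using \<rho>(1) by (rule eventually_at_0I) blast
  ultimately have "eventually (\<lambda>t. pullback x h (Aff u v) t = ?f t) (at 0)"
  proof eventually_elim
   case (elim t)
   then have t: "0 < norm t" "norm t < r" "t \<noteq> 0" by auto
   have v0: "t * k * \<rho> t \<noteq> 0" using \<rho>(8,9)[OF t(1,2)] by (metis zero_power2)
   have "pullback x h (Aff u v) t = (w / (u + t\<^sup>2 - q) + C) / (t * k * \<rho> t) * (2 * t)"
    unfolding True pullback_ram \<rho>(7)[OF t(1,2)] h[OF \<rho>(8)[OF t(1,2)] v0 elim(1)] ..
   also have "\<dots> = ?f t" using v0 by (simp add: mult.assoc)
   finally show ?case .
  qed
  moreover have "(?f \<longlongrightarrow> 2 * (w / (u + 0\<^sup>2 - q) + C) / (k * \<rho> 0)) (at 0)"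
   using \<rho>(2,3,4) uq by (intro tendsto_intros) (auto simp: isCont_def)
  ultimately have "diff_zero_at x h (Aff u v) \<longleftrightarrow> 2 * (w / (u + 0\<^sup>2 - q) + C) / (k * \<rho> 0) = 0"
   by (rule diff_zero_at_iff)
  then have "diff_zero_at x h (Aff u v) \<longleftrightarrow> w / (u + 0\<^sup>2 - q) + C = 0"
   unfolding divide_eq_0_iff mult_eq_0_iff using \<rho>(2,4) by simp
  then show ?thesis using uq by simp
 qed
qed

section \<open>The differential equations\<close>

text \<open>The hypothesis on \<open>p'\<close> is what differentiation of
  \<open>1 / q + x / 2 * (T / w)\<close> gives when \<open>w' / w\<close> is written as half the
  logarithmic derivative of the cubic. Inserting \<open>q'\<close> cancels all denominators in
  \<open>q\<close>.\<close>

lemma pole_system: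
 fixes x q p :: complex
 assumes nz: "x \<noteq> 0" "x \<noteq> 1" "q \<noteq> 0" "q \<noteq> 1" "q \<noteq> x"
  and q': "q' = q * (q - 1) * (1 - (q - x) * p) / (x * (x - 1))"
  and p': "p' = - q' / q\<^sup>2 + (p - 1 / q) / (2 * x) - q' / (2 * q\<^sup>2 * (q - 1)) -
   (p - 1 / q) / 2 * (q' / q + q' / (q - 1) + (q' - 1) / (q - x))"
 shows "p' = ((3 * (p * q - 1)\<^sup>2 - 2 * (x + 1) * (p * (p * q - 1)) + x * p\<^sup>2) / 2 + p * q - 1 - x * p) / (x * (x - 1))"
proof -
 define a b c where "a = q" "b = q - 1" "c = q - x"
 have nz': "a \<noteq> 0" "b \<noteq> 0" "c \<noteq> 0" "x \<noteq> 0" "x - 1 \<noteq> 0" using nz by (auto simp: a_b_c_def)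
 \<comment> \<open>The coefficient of \<open>q'\<close>; the remaining terms come from the explicit
   dependence on \<open>x\<close>.\<close>
 define k where "k = - (1 / a\<^sup>2) - 1 / (2 * a\<^sup>2 * b) - (p - 1 / a) / 2 * (1 / a + 1 / b + 1 / c)"
 have "p' = q' * k + (p - 1 / a) / 2 * (1 / x + 1 / c)"
 proof -
  have g: "- (q' * A2) + h * X - q' * H - h * (q' * A + q' * B + (q' - 1) * G) =
    q' * (- A2 - H - h * (A + B + G)) + h * (X + G)" for A2 h X H A B G :: complex
   by (simp add: algebra_simps)
  have e: "- q' / q\<^sup>2 = - (q' * (1 / q\<^sup>2))" "(p - 1 / q) / (2 * x) = (p - 1 / q) / 2 * (1 / x)"
   "q' / (2 * q\<^sup>2 * (q - 1)) = q' * (1 / (2 * q\<^sup>2 * (q - 1)))" "q' / q = q' * (1 / q)"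
   "q' / (q - 1) = q' * (1 / (q - 1))" "(q' - 1) / (q - x) = (q' - 1) * (1 / (q - x))" by simp_all
  show ?thesis unfolding k_def a_b_c_def p' e by (rule g)
 qed
 also have "1 / x + 1 / c = a / (x * c)"
  using nz' by (simp add: divide_simps) (simp add: a_b_c_def)
 also have "q' = a * b * (1 - c * p) / (x * (x - 1))" unfolding q' a_b_c_def ..
 finally have pe: "p' = a * b * (1 - c * p) / (x * (x - 1)) * k + (p - 1 / a) / 2 * (a / (x * c))" .
 have e1: "x * (x - 1) * (Q / (x * (x - 1)) * k) = Q * k" for Q using nz' by simp
 have e2: "x * y * (h * (a / (x * c))) = h * (y * a / c)" for y h using nz' by (simp add: field_simps)
 have f1: "x * (x - 1) * p' = a * b * k * (1 - c * p) + (p - 1 / a) / 2 * ((x - 1) * a / c)"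
  unfolding pe distrib_left e1 e2 by (simp only: mult_ac)
 have f2: "a * b * k = - b / a - 1 / (2 * a) - (p * a - 1) / (2 * a) * (b + a + a * b / c)"
  unfolding k_def using nz' by (simp add: field_simps power2_eq_square)
 have f3: "(p - 1 / a) / 2 * ((x - 1) * a / c) = (p * a - 1) * (x - 1) / (2 * c)"
  using nz' by (simp add: field_simps)
 have f4: "(- b / a - 1 / (2 * a) - (p * a - 1) / (2 * a) * (b + a + a * b / c)) * (1 - c * p) +
   (p * a - 1) * (x - 1) / (2 * c) =
   (3 * (p * q - 1)\<^sup>2 - 2 * (x + 1) * (p * (p * q - 1)) + x * p\<^sup>2) / 2 + p * q - 1 - x * p"
  using nz' by (simp add: divide_simps) (simp add: a_b_c_def algebra_simps power2_eq_square)
 have "p' = x * (x - 1) * p' / (x * (x - 1))" using nz' by simp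
 then show ?thesis unfolding f1 f2 f3 f4 .
qed

text \<open>The relation \<open>p * q = p * y + 1\<close> removes \<open>q\<close>. In the
  derivative of \<open>y\<close>, which is \<open>q' + p' / p^2\<close>, the terms with
  \<open>1 / p\<close> cancel, and what is left is polynomial in \<open>y\<close> and
  \<open>p\<close> and linear in \<open>p\<close>, up to the factor \<open>1 / M\<close>.\<close>

lemma zero_system:
 fixes x q p y :: complex
 assumes p: "p \<noteq> 0" and y: "y = q - 1 / p" and M: "M \<noteq> 0"
  and q': "q' = q * (q - 1) * (1 - (q - x) * p) / M"
  and p': "p' = ((3 * (p * q - 1)\<^sup>2 - 2 * (x + 1) * (p * (p * q - 1)) + x * p\<^sup>2) / 2 + p * q - 1 - x * p) / M"
 shows "p' = (p\<^sup>2 * (3 * y\<^sup>2 - 2 * x * y - 2 * y + x) / 2 + p * (y - x)) / M"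
  and "q' + p' / p\<^sup>2 = ((2 * x * y - x - y\<^sup>2) / 2 - y * (y - 1) * (y - x) * p) / M"
proof -
 define z where "z = 1 / p"
 have pz: "p * z = 1" "p * (z * c) = c" for c using p by (simp_all add: z_def)
 have q: "q = y + z" using y by (simp add: z_def)
 have pq: "p * q = p * y + 1" using pz(1) by (simp add: q distrib_left)
 have "(3 * (p * q - 1)\<^sup>2 - 2 * (x + 1) * (p * (p * q - 1)) + x * p\<^sup>2) / 2 + p * q - 1 - x * p =
   p\<^sup>2 * (3 * y\<^sup>2 - 2 * x * y - 2 * y + x) / 2 + p * (y - x)"
  unfolding pq by (simp add: field_simps power2_eq_square)
 then show p'': "p' = (p\<^sup>2 * (3 * y\<^sup>2 - 2 * x * y - 2 * y + x) / 2 + p * (y - x)) / M" unfolding p' by simp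
 have h1: "p' / p\<^sup>2 = ((3 * y\<^sup>2 - 2 * x * y - 2 * y + x) / 2 + z * (y - x)) / M"
  unfolding p'' z_def using p M by (simp add: field_simps power2_eq_square)
 have h2: "q * (q - 1) * (1 - (q - x) * p) = - (q * (q - 1) * (y - x) * p)"
 proof -
  have "1 - (q - x) * p = 1 - p * z - (y - x) * p" by (simp add: q algebra_simps)
  then have "1 - (q - x) * p = - ((y - x) * p)" unfolding pz(1) by simp
  then show ?thesis by (simp only: mult_minus_right mult.assoc)
 qed
 have h3: "q * (q - 1) * (y - x) * p = (y - x) * (y * (y - 1) * p + 2 * y - 1 + z)"
 proof -
  have "q * (q - 1) * p = y * (y - 1) * p + (2 * y - 1) * (p * z) + z * (p * z)" by (simp add: q algebra_simps)
  then have "q * (q - 1) * p = y * (y - 1) * p + 2 * y - 1 + z" unfolding pz(1) by simp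
  moreover have "q * (q - 1) * (y - x) * p = (y - x) * (q * (q - 1) * p)" by (simp only: mult_ac)
  ultimately show ?thesis by (simp only:)
 qed
 have "q' + p' / p\<^sup>2 = (- ((y - x) * (y * (y - 1) * p + 2 * y - 1 + z)) + ((3 * y\<^sup>2 - 2 * x * y - 2 * y + x) / 2 + z * (y - x))) / M"
  unfolding q' h1 h2 h3 by (rule add_divide_distrib[symmetric])
 also have "- ((y - x) * (y * (y - 1) * p + 2 * y - 1 + z)) + ((3 * y\<^sup>2 - 2 * x * y - 2 * y + x) / 2 + z * (y - x)) =
   (2 * x * y - x - y\<^sup>2) / 2 - y * (y - 1) * (y - x) * p"
  by (simp add: field_simps power2_eq_square)
 finally show "q' + p' / p\<^sup>2 = ((2 * x * y - x - y\<^sup>2) / 2 - y * (y - 1) * (y - x) * p) / M" .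
qed

text \<open>The second derivative and the right side of the equation are compared as polynomials in
  \<open>P\<close>, without solving for \<open>P\<close>. The terms of degree 2 and 1 match by
  \<open>Es\<close>, \<open>b1\<close> and \<open>b2\<close>; the term of degree 0 is the identity
  \<open>A\<close>, which carries the numerical values of the parameters.\<close>

lemma painleve_VI_of_system:
 fixes y p :: "complex \<Rightarrow> complex"
 assumes U: "open U" "x0 \<in> U" and x0: "x0 \<noteq> 0" "x0 \<noteq> 1"
  and y: "\<And>x. x \<in> U ==> (y has_field_derivative
   ((2 * x * y x - x - (y x)\<^sup>2) / 2 - y x * (y x - 1) * (y x - x) * p x) / (x * (x - 1))) (at x)"
  and p: "(p has_field_derivative
   ((p x0)\<^sup>2 * (3 * (y x0)\<^sup>2 - 2 * x0 * y x0 - 2 * y x0 + x0) / 2 + p x0 * (y x0 - x0)) / (x0 * (x0 - 1))) (at x0)"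
  and nz: "y x0 \<noteq> 0" "y x0 \<noteq> 1" "y x0 \<noteq> x0"
 shows "painleve_VI_at (1 / 8) (- 1 / 8) (1 / 8) (3 / 8) y x0"
proof -
 define Y P X where "Y = y x0" "P = p x0" "X = x0"
 define M where "M = X * (X - 1)"
 define n0 where "n0 = (2 * X * Y - X - Y\<^sup>2) / 2"
 define E where "E = Y * (Y - 1) * (Y - X)"
 define e where "e = 3 * Y\<^sup>2 - 2 * X * Y - 2 * Y + X"
 define N where "N = n0 - E * P"
 define y' where "y' = N / M"
 define p' where "p' = (P\<^sup>2 * e / 2 + P * (Y - X)) / M"
 have M: "M \<noteq> 0" using x0 by (simp add: M_def Y_P_X_def)
 have dy: "(y has_field_derivative y') (at x0)"
  using y[OF U(2)] by (simp add: y'_def N_def n0_def E_def M_def Y_P_X_def)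
 have dp: "(p has_field_derivative p') (at x0)"
  using p by (simp add: p'_def e_def M_def Y_P_X_def)
 have dy1: "deriv y x0 = y'" by (rule DERIV_imp_deriv[OF dy])
 define N' where "N' = (2 * Y + 2 * X * y' - 1 - 2 * Y * y') / 2 -
  (((y' * (Y - 1) + Y * y') * (Y - X) + Y * (Y - 1) * (y' - 1)) * P + E * p')"
 have "((\<lambda>x. ((2 * x * y x - x - (y x)\<^sup>2) / 2 - y x * (y x - 1) * (y x - x) * p x) / (x * (x - 1)))
   has_field_derivative (N' * M - N * (2 * X - 1)) / (M * M)) (at x0)"
  using M unfolding N'_def N_def n0_def E_def M_def Y_P_X_def
  by (auto intro!: derivative_eq_intros dy dp simp: field_simps)
 note d2 = this
 have ev: "eventually (\<lambda>x. deriv y x = ((2 * x * y x - x - (y x)\<^sup>2) / 2 - y x * (y x - 1) * (y x - x) * p x) / (x * (x - 1))) (nhds x0)"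
  using eventually_nhds_in_open[OF U] by eventually_elim (rule DERIV_imp_deriv[OF y])
 have dy2: "deriv (deriv y) x0 = (N' * M - N * (2 * X - 1)) / (M * M)"
  unfolding deriv_cong_ev[OF ev refl] by (rule DERIV_imp_deriv[OF d2])
 have yM: "y' * M = N" "p' * M = P\<^sup>2 * e / 2 + P * (Y - X)" using M by (simp_all add: y'_def p'_def)
 have e': "(Y - 1) * (Y - X) + Y * (Y - X) + Y * (Y - 1) = e" by (simp add: e_def algebra_simps power2_eq_square)
 have "N' * M = ((2 * Y - 1) * M + 2 * (X - Y) * (y' * M)) / 2 -
   ((y' * M) * ((Y - 1) * (Y - X) + Y * (Y - X) + Y * (Y - 1)) * P - Y * (Y - 1) * M * P + E * (p' * M))"
  unfolding N'_def by (simp add: field_simps)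
 also have "\<dots> = (2 * Y - 1) * M / 2 + (X - Y) * n0 + (Y * (Y - 1) * M - n0 * e) * P + E * e * P\<^sup>2 / 2"
  unfolding e' yM N_def by (simp add: field_simps power2_eq_square)
 finally have N'M: "N' * M = (2 * Y - 1) * M / 2 + (X - Y) * n0 + (Y * (Y - 1) * M - n0 * e) * P + E * e * P\<^sup>2 / 2" .
 have nz': "Y \<noteq> 0" "Y - 1 \<noteq> 0" "Y - X \<noteq> 0" using nz by (auto simp: Y_P_X_def)
 define s where "s = 1 / Y + 1 / (Y - 1) + 1 / (Y - X)"
 have Es: "E * s = e" unfolding s_def E_def e'[symmetric] using nz' by (simp add: divide_simps) (simp add: algebra_simps)
 define k where "k = 1 / 8 + (- 1 / 8) * X / Y\<^sup>2 + 1 / 8 * (X - 1) / (Y - 1)\<^sup>2 + 3 / 8 * X * (X - 1) / (Y - X)\<^sup>2"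
 \<comment> \<open>As a rational function of \<open>Y\<close> the left side could have poles at 0, 1
   and \<open>X\<close>. The values of \<open>\<beta>\<close>, \<open>\<gamma>\<close> and
   \<open>\<delta>\<close> make the three numerators vanish there, so that the fractions in the
   facts \<open>1\<close>, \<open>2\<close> and \<open>3\<close> are polynomials.\<close>
 have A: "s * n0\<^sup>2 / 2 - n0 * M / (Y - X) + E * k = (2 * Y - 1) * M / 2 + (X - Y) * n0"
 proof -
  define f g where "f = Y - 1" and "g = Y - X"
  have fg: "f \<noteq> 0" "g \<noteq> 0" using nz' by (simp_all add: f_def g_def)
  have Ek: "u * v * r * (1 / 8 + (- 1 / 8) * l / u\<^sup>2 + 1 / 8 * h / v\<^sup>2 + 3 / 8 * l * h / r\<^sup>2) =
    (u * v * r - l * v * r / u + h * u * r / v + 3 * l * h * u * v / r) / 8"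
   if "u \<noteq> 0" "v \<noteq> 0" "r \<noteq> 0" for u v r l h :: complex
   using that by (simp add: divide_simps) (simp add: algebra_simps power2_eq_square)
  have comb: "(1 / u + 1 / v + 1 / r) * n\<^sup>2 / 2 - n * m / r + (u * v * r - l / u + h / v + t / r) / 8 =
    ((4 * n\<^sup>2 - l) / u + (4 * n\<^sup>2 + h) / v + (4 * n\<^sup>2 - 8 * n * m + t) / r + u * v * r) / 8"
   for u v r n m l h t :: complex
   by (simp add: distrib_right add_divide_distrib diff_divide_distrib mult.commute distrib_left)
  have quot: "a / d = c" if "a = c * d" "d \<noteq> 0" for a c d :: complex using that by simp
  have 1: "(4 * n0\<^sup>2 - X * f * g) / Y = - 2 * X * (2 * X - Y) + Y * (2 * X - Y)\<^sup>2 - X * (Y - 1 - X)"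
   by (rule quot[OF _ nz'(1)]) (simp add: n0_def f_def g_def field_simps power2_eq_square)
  have 2: "(4 * n0\<^sup>2 + (X - 1) * Y * g) / f = 2 * (X - 1) * (2 * X - 2 - f) + f * (2 * X - 2 - f)\<^sup>2 + (X - 1) * (2 + f - X)"
   by (rule quot[OF _ fg(1)]) (simp add: n0_def f_def g_def field_simps power2_eq_square)
  have 3: "(4 * n0\<^sup>2 - 8 * n0 * M + 3 * X * (X - 1) * Y * f) / g = 2 * M * g + g ^ 3 + 3 * M * (2 * X - 1 + g)"
   by (rule quot[OF _ fg(2)]) (simp add: n0_def M_def f_def g_def field_simps eval_nat_numeral)
  have "s * n0\<^sup>2 / 2 - n0 * M / g + E * k =
    ((- 2 * X * (2 * X - Y) + Y * (2 * X - Y)\<^sup>2 - X * (Y - 1 - X)) +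
     (2 * (X - 1) * (2 * X - 2 - f) + f * (2 * X - 2 - f)\<^sup>2 + (X - 1) * (2 + f - X)) +
     (2 * M * g + g ^ 3 + 3 * M * (2 * X - 1 + g)) + Y * f * g) / 8"
   unfolding s_def E_def k_def f_def[symmetric] g_def[symmetric] Ek[OF nz'(1) fg] comb 1 2 3 ..
  also have "\<dots> = (2 * Y - 1) * M / 2 + (X - Y) * n0"
   by (simp add: n0_def M_def f_def g_def field_simps eval_nat_numeral)
  finally show ?thesis unfolding g_def .
 qed
 have b1: "s * N\<^sup>2 / 2 = s * n0\<^sup>2 / 2 - n0 * (E * s) * P + E * (E * s) * P\<^sup>2 / 2"
  unfolding N_def by (simp add: field_simps power2_eq_square)
 have b2: "N * M / (Y - X) = n0 * M / (Y - X) - Y * (Y - 1) * M * P"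
  unfolding N_def E_def using nz' by (simp add: field_simps)
 have b3: "(a1 - n * m * P + t) - (a2 - c * P) + a3 = (a1 - a2 + a3) + (c - n * m) * P + t" for a1 a2 a3 n m t c
  by (simp add: algebra_simps)
 have B: "s * N\<^sup>2 / 2 - N * M / (Y - X) + E * k = N' * M"
  unfolding N'M A[symmetric] b1 b2 Es by (rule b3)
 have X: "X \<noteq> 0" "X - 1 \<noteq> 0" using x0 by (auto simp: Y_P_X_def)
 have "1 / X + 1 / (X - 1) = (2 * X - 1) / M" unfolding M_def using X by (simp add: divide_simps)
 then have "1 / 2 * s * y'\<^sup>2 - (1 / X + 1 / (X - 1) + 1 / (Y - X)) * y' + E / (X\<^sup>2 * (X - 1)\<^sup>2) * k =
   1 / 2 * s * (N / M)\<^sup>2 - ((2 * X - 1) / M + 1 / (Y - X)) * (N / M) + E / (M * M) * k"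
  unfolding y'_def by (simp add: M_def power2_eq_square mult_ac)
 also have "\<dots> = ((s * N\<^sup>2 / 2 - N * M / (Y - X) + E * k) - N * (2 * X - 1)) / (M * M)"
  using M nz' by (simp add: divide_simps) (simp add: algebra_simps power2_eq_square)
 also have "\<dots> = deriv (deriv y) x0" unfolding B dy2 ..
 finally show ?thesis
  unfolding painleve_VI_at_def dy1 by (simp add: s_def k_def E_def Y_P_X_def)
qed

text \<open>Integrals with fixed end point and periods obey the same linear system up to boundary
  terms. In \<open>Z' - J'\<close> and in the derivative of \<open>T\<close> the homogeneous parts
  therefore combine into multiples of \<open>T\<close>, and the rest depends on the end point alone;
  this closes the system in \<open>q\<close> and \<open>p\<close>.\<close>

lemma end_point_system:
 fixes a b \<Gamma> :: "complex \<Rightarrow> real \<Rightarrow> pt" and q w K :: "complex \<Rightarrow> complex"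
 assumes D: "open D" "x \<in> D" "D \<subseteq> UNIV - {0, 1}" and ab: "cycle_family D a" "cycle_family D b"
  and path: "\<And>y. y \<in> D ==> path_from_infty y (\<Gamma> y)" and last: "\<And>y. y \<in> D ==> \<Gamma> y 1 = Aff (q y) (w y)"
  and int: "\<And>y. y \<in> D ==> has_int_from_infty inv_v (\<Gamma> y) (c1 * period inv_v (a y) + c2 * period inv_v (b y))"
   "\<And>y. y \<in> D ==> has_int_from_infty inv_uv (\<Gamma> y) (K y)"
 defines "p \<equiv> \<lambda>y. 1 / q y + y / 2 * ((K y - c1 * period inv_uv (a y) - c2 * period inv_uv (b y)) / w y)"
 shows "(q has_field_derivative q x * (q x - 1) * (1 - (q x - x) * p x) / (x * (x - 1))) (at x)"
  and "(p has_field_derivative ((3 * (p x * q x - 1)\<^sup>2 - 2 * (x + 1) * (p x * (p x * q x - 1)) + x * (p x)\<^sup>2) / 2 +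
   p x * q x - 1 - x * p x) / (x * (x - 1))) (at x)"
proof -
 have x: "x \<noteq> 0" "x \<noteq> 1" using D by auto
 have "\<Gamma> x 1 \<in> unram x" using path[OF D(2)] by (auto simp: path_from_infty_def)
 then have P: "Aff (q x) (w x) \<in> unram x" using last[OF D(2)] by simp
 note nz = unram_nonzero(1-4)[OF P, simplified]
 have w2: "(w x)\<^sup>2 = cubic x (q x)" using v_of_square[OF P] by simp
 define Z where "Z y = c1 * period inv_v (a y) + c2 * period inv_v (b y)" for y
 define Z1 where "Z1 y = c1 * period inv_uv (a y) + c2 * period inv_uv (b y)" for y
 define T where "T y = K y - c1 * period inv_uv (a y) - c2 * period inv_uv (b y)" for y
 have TZ: "T y = K y - Z1 y" for y by (simp add: T_def Z1_def)
 have path': "curve_path x (\<Gamma> x) e 1" if "0 < e" for e by (rule path_from_infty_curve_path[OF path[OF D(2)] that])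
 \<comment> \<open>A uniform distance of the path from \<open>u = x\<close>: near infinity
   \<open>norm u\<close> exceeds \<open>norm x + 1\<close>, and the rest of the path is
   compact.\<close>
 obtain \<rho> where \<rho>: "\<rho> > 0" "\<And>t. t \<in> {0<..1} ==> 2 * \<rho> \<le> norm (u_of (\<Gamma> x t) - x)"
 proof -
  define \<epsilon> where "\<epsilon> = 1 / (norm x + 1)"
  have n: "norm x + 1 > 0" by (simp add: add_nonneg_pos)
  then have "\<epsilon> > 0" by (simp add: \<epsilon>_def)
  then obtain t1 where t1: "0 < t1" "t1 \<le> 1" "\<And>t. 0 < t ==> t \<le> t1 ==> norm (1 / u_of (\<Gamma> x t)) < \<epsilon>"
   by (rule path_near_infty[OF path[OF D(2)]]) (rule that)
  let ?I = "(\<lambda>t. u_of (\<Gamma> x t)) ` {t1..1}"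
  have "compact ?I" using path'[OF t1(1)] by (intro compact_continuous_image) (auto simp: curve_path_def)
  moreover have "x \<notin> ?I"
  proof
   assume "x \<in> ?I"
   then obtain t where "t \<in> {t1..1}" "u_of (\<Gamma> x t) = x" by auto
   then show False using unram_nonzero(4)[OF curve_path_in[OF path'[OF t1(1)]]] by blast
  qed
  ultimately have "\<exists>d>0. \<forall>u\<in>?I. d \<le> dist x u" by (rule separate_point_closed[OF compact_imp_closed])
  then obtain d where d: "d > 0" "\<And>u. u \<in> ?I ==> d \<le> dist x u" by auto
  show thesis
  proof (rule that[of "min 1 d / 2"])
   fix t :: real assume t: "t \<in> {0<..1}"
   show "2 * (min 1 d / 2) \<le> norm (u_of (\<Gamma> x t) - x)"
   proof (cases "t \<le> t1")
    case True
    then have l: "norm (1 / u_of (\<Gamma> x t)) < \<epsilon>" using t1(3)[of t] t by simp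
    have u: "u_of (\<Gamma> x t) \<noteq> 0" using unram_nonzero(2)[OF curve_path_in[OF path', of t t]] t by simp
    have "norm x + 1 < norm (u_of (\<Gamma> x t))"
     using l u n by (simp add: \<epsilon>_def norm_divide divide_less_eq less_divide_eq)
    then have "1 \<le> norm (u_of (\<Gamma> x t) - x)" using norm_triangle_ineq2[of "u_of (\<Gamma> x t)" x] by linarith
    then show ?thesis by simp
   next
    case False
    then have "d \<le> dist x (u_of (\<Gamma> x t))" using t by (intro d(2)) auto
    then show ?thesis by (simp add: dist_norm norm_minus_commute)
   qed
  qed (use d(1) in simp)
 qed
 define J' where "J' = (K x - Z x) / (2 * (x - 1)) + 1 / (x * (x - 1)) * (v_of (\<Gamma> x 1) / (u_of (\<Gamma> x 1) - 0) - v_of (\<Gamma> x 1) / (u_of (\<Gamma> x 1) - x))"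
 obtain J0 J1 where J: "J0 x = Z x" "J1 x = K x"
  "\<And>y. norm (y - x) < \<rho> ==> has_int_from_infty inv_v (lift x y \<circ> \<Gamma> x) (J0 y)"
  "\<And>y. norm (y - x) < \<rho> ==> has_int_from_infty inv_uv (lift x y \<circ> \<Gamma> x) (J1 y)"
  "(J0 has_field_derivative J') (at x)" "(J1 has_field_derivative (J' - K x / 2) / x) (at x)"
  by (rule lifted_integrals[OF x path[OF D(2)] \<rho> int(1)[OF D(2), folded Z_def] int(2)[OF D(2)], folded J'_def]) (assumption, rule that)
 define Z' where "Z' = (Z1 x - Z x) / (2 * (x - 1))"
 have dZ: "(Z has_field_derivative Z') (at x)"
 proof -
  have "(Z has_field_derivative c1 * ((period inv_uv (a x) - period inv_v (a x)) / (2 * (x - 1))) +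
    c2 * ((period inv_uv (b x) - period inv_v (b x)) / (2 * (x - 1)))) (at x)"
   unfolding Z_def[abs_def] by (intro DERIV_add DERIV_cmult period_derivative(1)[OF D(1,2) _ x] ab)
  moreover have "c1 * ((period inv_uv (a x) - period inv_v (a x)) / (2 * (x - 1))) +
    c2 * ((period inv_uv (b x) - period inv_v (b x)) / (2 * (x - 1))) = Z'"
   unfolding times_divide_eq_right add_divide_distrib[symmetric] Z'_def Z_def Z1_def by (simp add: algebra_simps)
  ultimately show ?thesis by simp
 qed
 have dZ1: "(Z1 has_field_derivative (Z' - Z1 x / 2) / x) (at x)"
 proof -
  let ?A = "(period inv_uv (a x) - period inv_v (a x)) / (2 * (x - 1))"
  let ?B = "(period inv_uv (b x) - period inv_v (b x)) / (2 * (x - 1))"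
  have "(Z1 has_field_derivative c1 * ((?A - period inv_uv (a x) / 2) / x) + c2 * ((?B - period inv_uv (b x) / 2) / x)) (at x)"
   unfolding Z1_def[abs_def] by (intro DERIV_add DERIV_cmult period_derivative(2)[OF D(1,2) _ x] ab)
  moreover have "c1 * ?A + c2 * ?B = Z'"
   unfolding times_divide_eq_right add_divide_distrib[symmetric] Z'_def Z_def Z1_def by (simp add: algebra_simps)
  moreover have g: "c1 * ((u - s / 2) / x) + c2 * ((v - t / 2) / x) = ((c1 * u + c2 * v) - (c1 * s + c2 * t) / 2) / x" for u v s t
   by (simp add: add_divide_distrib diff_divide_distrib distrib_left right_diff_distrib)
  ultimately show ?thesis unfolding g Z1_def by simp
 qed
 define S' where "S' = Z' - J'"
 note mv = moving_end_point[OF x D(1,2) path last int(1)[folded Z_def] int(2) \<rho>(2,1) J(3,4) J(1,2) DERIV_diff[OF dZ J(5)]]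
 have dq: "(q has_field_derivative w x * S') (at x)" unfolding S'_def by (rule mv(1))
 have dKJ: "((\<lambda>y. K y - J1 y) has_field_derivative 1 / (q x * w x) * (w x * S')) (at x)" unfolding S'_def by (rule mv(2))
 have ev: "eventually (\<lambda>y. w y = w x * csqrt (cubic y (q y) / cubic x (q x))) (nhds x)" by (rule mv(3))
 define q' where "q' = w x * S'"
 have "q x * (q x - 1) * (q x - x) = w x * w x" using w2 by (simp add: cubic_def power2_eq_square)
 note ww = this[symmetric]
 have fx: "q x \<noteq> 0" "q x - 1 \<noteq> 0" "q x - x \<noteq> 0" "w x \<noteq> 0" "x - 1 \<noteq> 0" using nz x by auto
 have J'v: "J' = (K x - Z x) / (2 * (x - 1)) + 1 / (x * (x - 1)) * (w x / q x - w x / (q x - x))"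
  by (simp add: J'_def last[OF D(2)])
 have S'v: "S' = - T x / (2 * (x - 1)) - 1 / (x * (x - 1)) * (w x / q x - w x / (q x - x))"
  unfolding S'_def Z'_def J'v TZ by (simp add: diff_divide_distrib)
 define r where "r = T x / w x"
 have pr: "p x = 1 / q x + x / 2 * r" by (simp add: p_def r_def T_def)
 have Tr: "T x = r * w x" using fx by (simp add: r_def)
 have q'v: "q' = q x * (q x - 1) * (1 - (q x - x) * p x) / (x * (x - 1))"
 proof -
  have "w x * (w x / q x - w x / (q x - x)) = (w x * w x) * (1 / q x - 1 / (q x - x))"
   by (simp add: right_diff_distrib)
  also have "1 / q x - 1 / (q x - x) = - x / (q x * (q x - x))" using fx by (simp add: divide_simps)
  also have "(w x * w x) * (- x / (q x * (q x - x))) = - x * (q x - 1)" unfolding ww using fx by simp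
  finally have e: "w x * (w x / q x - w x / (q x - x)) = - x * (q x - 1)" .
  have "q' = - (r * (w x * w x)) / (2 * (x - 1)) - 1 / (x * (x - 1)) * (w x * (w x / q x - w x / (q x - x)))"
   unfolding q'_def S'v Tr by (simp add: right_diff_distrib mult_ac)
  also have "\<dots> = (- (x / 2 * r * (w x * w x)) + x * (q x - 1)) / (x * (x - 1))"
   unfolding e using fx x by (simp add: divide_simps) (simp add: algebra_simps)
  also have "- (x / 2 * r * (w x * w x)) + x * (q x - 1) = q x * (q x - 1) * (1 - (q x - x) * p x)"
   unfolding pr ww using fx by (simp add: field_simps)
  finally show ?thesis .
 qed
 show "(q has_field_derivative q x * (q x - 1) * (1 - (q x - x) * p x) / (x * (x - 1))) (at x)"
  using dq by (simp only: q'v[symmetric] q'_def[symmetric])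
 have dq': "(q has_field_derivative q') (at x)" using dq by (simp only: q'_def)
 define T' where "T' = q' / (q x * w x) - q' / (x * w x) - T x / (2 * x)"
 have dT: "(T has_field_derivative T') (at x)"
 proof -
  have "((\<lambda>y. (K y - J1 y) + J1 y - Z1 y) has_field_derivative 1 / (q x * w x) * (w x * S') + (J' - K x / 2) / x - (Z' - Z1 x / 2) / x) (at x)"
   by (intro DERIV_diff DERIV_add dKJ J(6) dZ1)
  moreover have "1 / (q x * w x) * (w x * S') + (J' - K x / 2) / x - (Z' - Z1 x / 2) / x = T'"
  proof -
   have "(J' - K x / 2) / x - (Z' - Z1 x / 2) / x = - S' / x - T x / (2 * x)"
    unfolding S'_def TZ by (simp add: diff_divide_distrib)
   moreover have "S' = q' / w x" using fx by (simp add: q'_def)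
   ultimately show ?thesis unfolding T'_def q'_def[symmetric] by (simp add: mult.commute)
  qed
  ultimately show ?thesis by (simp add: TZ[abs_def])
 qed
 define c' where "c' = q' * ((q x - 1) * (q x - x) + q x * (q x - x) + q x * (q x - 1)) - q x * (q x - 1)"
 have dc: "((\<lambda>y. cubic y (q y)) has_field_derivative c') (at x)"
  unfolding cubic_def c'_def by (auto intro!: derivative_eq_intros dq' simp: algebra_simps)
 have c0: "cubic x (q x) \<noteq> 0" using fx by (simp add: cubic_def)
 \<comment> \<open>For each \<open>y\<close> the value \<open>w y\<close> is one of two roots. By
   \<open>moving_end_point\<close> it is near \<open>x\<close> the branch continuous in
   \<open>y\<close>, and so it is differentiable.\<close>
 have dw: "(w has_field_derivative c' / (2 * w x)) (at x)"
 proof -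
  have "((\<lambda>y. cubic y (q y) / cubic x (q x)) has_field_derivative c' / cubic x (q x)) (at x)" by (rule DERIV_cdivide[OF dc])
  from DERIV_cmult[OF has_field_derivative_csqrt'[OF this], of "w x"] c0
  have "((\<lambda>y. w x * csqrt (cubic y (q y) / cubic x (q x))) has_field_derivative w x * (c' / cubic x (q x) / 2)) (at x)" by simp
  moreover have "w x * (c' / cubic x (q x) / 2) = c' / (2 * w x)" unfolding w2[symmetric] using fx by (simp add: power2_eq_square)
  ultimately show ?thesis using DERIV_cong_ev[OF refl ev refl] by simp
 qed
 define p' where "p' = - q' / q x ^ 2 + (p x - 1 / q x) / (2 * x) - q' / (2 * (q x)\<^sup>2 * (q x - 1)) -
   (p x - 1 / q x) / 2 * (q' / q x + q' / (q x - 1) + (q' - 1) / (q x - x))"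
 have "(p has_field_derivative p') (at x)"
 proof -
  have "((\<lambda>y. T y / w y) has_field_derivative (T' * w x - T x * (c' / (2 * w x))) / (w x * w x)) (at x)"
   by (rule DERIV_divide[OF dT dw fx(4)])
  moreover have "((\<lambda>y. y / 2) has_field_derivative 1 / 2) (at x)" by (rule DERIV_cdivide[OF DERIV_ident])
  ultimately have m: "((\<lambda>y. y / 2 * (T y / w y)) has_field_derivative
    1 / 2 * (T x / w x) + (T' * w x - T x * (c' / (2 * w x))) / (w x * w x) * (x / 2)) (at x)" by (intro DERIV_mult)
  have "((\<lambda>y. 1 / q y) has_field_derivative (0 * q x - 1 * q') / (q x * q x)) (at x)"
   by (rule DERIV_divide[OF DERIV_const dq' fx(1)])
  from DERIV_add[OF this m] have "(p has_field_derivative (0 * q x - 1 * q') / (q x * q x) +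
    (1 / 2 * (T x / w x) + (T' * w x - T x * (c' / (2 * w x))) / (w x * w x) * (x / 2))) (at x)"
   by (simp add: p_def T_def)
  moreover have "(0 * q x - 1 * q') / (q x * q x) +
    (1 / 2 * (T x / w x) + (T' * w x - T x * (c' / (2 * w x))) / (w x * w x) * (x / 2)) = p'"
  proof -
   have "(T' * w x - T x * (c' / (2 * w x))) / (w x * w x) = T' / w x - r * (c' / (2 * (w x * w x)))"
    using fx by (simp add: r_def diff_divide_distrib)
   also have "c' / (2 * (w x * w x)) = (q' / q x + q' / (q x - 1) + (q' - 1) / (q x - x)) / 2"
    unfolding ww c'_def using fx by (simp add: divide_simps) (simp add: algebra_simps)
   also have "T' / w x = q' * ((1 / q x - 1 / x) / (w x * w x)) - r / (2 * x)"
    unfolding T'_def using fx x by (simp add: r_def diff_divide_distrib right_diff_distrib mult_ac)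
   also have "(1 / q x - 1 / x) / (w x * w x) = - 1 / (x * (q x)\<^sup>2 * (q x - 1))"
    unfolding ww using fx x by (simp add: divide_simps power2_eq_square)
   finally have e: "(T' * w x - T x * (c' / (2 * w x))) / (w x * w x) =
     q' * (- 1 / (x * (q x)\<^sup>2 * (q x - 1))) - r / (2 * x) - r * ((q' / q x + q' / (q x - 1) + (q' - 1) / (q x - x)) / 2)" .
   define k where "k = q' / q x + q' / (q x - 1) + (q' - 1) / (q x - x)"
   have z: "(q' * (- 1 / (x * (q x)\<^sup>2 * (q x - 1))) - r / (2 * x) - r * (k / 2)) * (x / 2) =
     - (q' / (2 * (q x)\<^sup>2 * (q x - 1))) - r / 4 - x / 2 * r * k / 2"
    using x by (simp add: left_diff_distrib)
   have pk: "(1 / q x + x / 2 * r - 1 / q x) / (2 * x) = r / 4" "(1 / q x + x / 2 * r - 1 / q x) / 2 * k = x / 2 * r * k / 2"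
    using x by simp_all
   have aux: "(0 * s - 1 * t) / (s * s) + (1 / 2 * r + (- d - r / 4 - m)) = - t / s\<^sup>2 + r / 4 - d - m" for s t d m
    by (simp add: power2_eq_square)
   show ?thesis
    unfolding e unfolding k_def[symmetric] p'_def pr r_def[symmetric] unfolding z pk by (rule aux)
  qed
  ultimately show ?thesis by simp
 qed
 then show "(p has_field_derivative ((3 * (p x * q x - 1)\<^sup>2 - 2 * (x + 1) * (p x * (p x * q x - 1)) + x * (p x)\<^sup>2) / 2 +
   p x * q x - 1 - x * p x) / (x * (x - 1))) (at x)"
  unfolding pole_system[OF x nz(2-4) q'v p'_def] .
qed

section \<open>From the normalised data to the zeros\<close>

lemma line_int_divide: "line_int (\<lambda>P. h P / c) \<gamma> r s = line_int h \<gamma> r s / c"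
 by (simp add: line_int_def)

lemma has_int_from_infty_of_normalized:
 assumes path: "path_from_infty x \<gamma>" and A: "A \<noteq> 0" and \<omega>: "\<And>P. P \<in> unram x ==> \<omega> P = inv_v P / A"
  and I: "has_int_from_infty \<omega> \<gamma> I"
 shows "has_int_from_infty inv_v \<gamma> (A * I)"
proof -
 have "((\<lambda>e. A * line_int \<omega> \<gamma> e 1) \<longlongrightarrow> A * I) (at_right 0)"
  using I unfolding has_int_from_infty_def by (intro tendsto_intros)
 moreover have "eventually (\<lambda>e. A * line_int \<omega> \<gamma> e 1 = line_int inv_v \<gamma> e 1) (at_right 0)"
  unfolding eventually_at_right_field
 proof (intro exI[of _ 1] conjI allI impI)
  fix e :: real assume e: "0 < e" "e < 1"
  have "line_int \<omega> \<gamma> e 1 = line_int (\<lambda>P. inv_v P / A) \<gamma> e 1"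
   by (rule line_int_cong) (use \<omega> curve_path_in[OF path_from_infty_curve_path[OF path e(1)]] in simp_all)
  then show "A * line_int \<omega> \<gamma> e 1 = line_int inv_v \<gamma> e 1" unfolding line_int_divide using A by simp
 qed simp
 ultimately show ?thesis unfolding has_int_from_infty_def by (rule Lim_transform_eventually)
qed

text \<open>Convergence of the second integral is not among the data; inversion of the first
  integral supplies it, together with a value that depends only on the first.\<close>

lemma ex_has_int_inv_uv:
 assumes "x \<noteq> 0" "x \<noteq> 1" "path_from_infty x \<gamma>" "has_int_from_infty inv_v \<gamma> \<zeta>"
 shows "\<exists>J. has_int_from_infty inv_uv \<gamma> J"
proof -
 obtain N D where ND: "uniformized x N D"
  "\<And>\<gamma> \<zeta>. path_from_infty x \<gamma> ==> has_int_from_infty inv_v \<gamma> \<zeta> ==> uniformized.at_pt N D \<zeta> (\<gamma> 1)"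
  "\<And>\<gamma> \<zeta>. path_from_infty x \<gamma> ==> has_int_from_infty inv_v \<gamma> \<zeta> ==>
    has_int_from_infty inv_uv \<gamma> (2 / x * uniformized.L N \<zeta>)"
  by (rule abel_inversion[OF assms(1,2)]) (rule that)
 show ?thesis by (rule exI, rule ND(3)[OF assms(3,4)])
qed

theorem theorem1:
  fixes D :: "complex set"
    and a b \<Gamma> :: "complex \<Rightarrow> real \<Rightarrow> pt"
    and \<omega> \<Omega>\<^sub>Q \<Omega> :: "complex \<Rightarrow> pt \<Rightarrow> complex"
    and W :: "complex \<Rightarrow> pt \<Rightarrow> pt \<Rightarrow> complex"
    and \<mu> :: "complex \<Rightarrow> complex"
    and c1 c2 :: complex
  assumes "open D" and "D \<subseteq> UNIV - {0, 1}"
    and "cycle_family D a" and "cycle_family D b"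
    and "\<And>x. x \<in> D \<Longrightarrow> transversal (a x) (b x)"
    and "\<And>x. x \<in> D \<Longrightarrow> intersection_index (a x) (b x) = 1"
    and "\<And>x. x \<in> D \<Longrightarrow> normalized_holomorphic x (a x) (\<omega> x)"
    and "\<And>x. x \<in> D \<Longrightarrow> \<mu> x = period (\<omega> x) (b x)"
    and "\<not> (\<exists>m n :: int. c1 = of_int m / 2 \<and> c2 = of_int n / 2)"
    and "\<And>x. x \<in> D \<Longrightarrow> path_from_infty x (\<Gamma> x)"
    and "\<And>x. x \<in> D \<Longrightarrow> has_int_from_infty (\<omega> x) (\<Gamma> x) (c1 + c2 * \<mu> x)"
    and "\<And>x. x \<in> D \<Longrightarrow> canonical_bidifferential x (a x) (W x)"
    and "\<And>x. x \<in> D \<Longrightarrow> third_kind x (a x) (W x) (\<Gamma> x) (\<Omega>\<^sub>Q x)"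
    and "\<And>x P. x \<in> D \<Longrightarrow> \<Omega> x P = \<Omega>\<^sub>Q x P - 4 * of_real pi * \<i> * c2 * \<omega> x P"
  shows "(\<forall>x\<in>D. \<exists>P. diff_zeros x (\<Omega> x) = {P, star P} \<and> u_proj P = u_proj (star P)) \<and>
    (\<forall>y. (\<forall>x\<in>D. \<forall>P\<in>diff_zeros x (\<Omega> x). P \<noteq> Infty \<longrightarrow> y x = u_of P) \<longrightarrow>
       (\<forall>x\<in>D. Infty \<notin> diff_zeros x (\<Omega> x) \<and> y x \<notin> {0, 1, x} \<longrightarrow>
          y analytic_on {x} \<and> painleve_VI_at (1 / 8) (- 1 / 8) (1 / 8) (3 / 8) y x))"
proof -
 note D = assms(1,2) and ab = assms(3,4) and path = assms(10)
 have x01: "x \<noteq> 0" "x \<noteq> 1" if "x \<in> D" for x using D(2) that by auto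
 have cyc: "cycle_on x (a x)" "cycle_on x (b x)" if "x \<in> D" for x using ab that by (auto simp: cycle_family_def)
 define A B A1 B1 where "A x = period inv_v (a x)" and "B x = period inv_v (b x)"
  and "A1 x = period inv_uv (a x)" and "B1 x = period inv_uv (b x)" for x
 define q w where "q x = u_of (\<Gamma> x 1)" and "w x = v_of (\<Gamma> x 1)" for x
 have Qun: "\<Gamma> x 1 \<in> unram x" if "x \<in> D" for x using path[OF that] by (auto simp: path_from_infty_def)
 have last: "\<Gamma> x 1 = Aff (q x) (w x)" if "x \<in> D" for x
  using unram_not_Infty[OF Qun[OF that]] by (cases "\<Gamma> x 1") (simp_all add: q_def w_def)
 have nzw: "w x \<noteq> 0" "(w x)\<^sup>2 = cubic x (q x)" if "x \<in> D" for x
  using unram_nonzero(1)[OF Qun[OF that]] v_of_square[OF Qun[OF that]] by (simp_all add: q_def w_def)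
 have A: "A x \<noteq> 0" "\<And>P. P \<in> unram x ==> \<omega> x P = inv_v P / A x" if "x \<in> D" for x
  using normalized_holomorphic_form[OF x01[OF that] cyc(1)[OF that] assms(7)[OF that]] by (simp_all add: A_def)
 have mu: "\<mu> x = B x / A x" if "x \<in> D" for x
 proof -
  have "period (\<omega> x) (b x) = line_int (\<lambda>P. inv_v P / A x) (b x) 0 1"
   unfolding period_def
   by (rule line_int_cong) (use A(2)[OF that] curve_path_in[OF cycle_on_curve_path[OF cyc(2)[OF that]]] in simp_all)
  then show ?thesis unfolding assms(8)[OF that] line_int_divide B_def period_def .
 qed
 have int0: "has_int_from_infty inv_v (\<Gamma> x) (c1 * A x + c2 * B x)" if "x \<in> D" for x
 proof -
  have "A x * (c1 + c2 * \<mu> x) = c1 * A x + c2 * B x" using A(1)[OF that] mu[OF that] by (simp add: distrib_left)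
  with has_int_from_infty_of_normalized[OF path[OF that] A[OF that] assms(11)[OF that]] show ?thesis by simp
 qed
 \<comment> \<open>The value is unique as a limit, so the choice is harmless; existence is obtained
   in each fibre separately.\<close>
 define K where "K x = (SOME J. has_int_from_infty inv_uv (\<Gamma> x) J)" for x
 have int1: "has_int_from_infty inv_uv (\<Gamma> x) (K x)" if "x \<in> D" for x
  unfolding K_def by (rule someI_ex[OF ex_has_int_inv_uv[OF x01[OF that] path[OF that] int0[OF that]]])
 define p where "p x = 1 / q x + x / 2 * ((K x - c1 * A1 x - c2 * B1 x) / w x)" for x
 have form: "\<Omega> x (Aff u v) = (w x / (u - q x) + w x * p x) / v"
  if x: "x \<in> D" and uv: "v\<^sup>2 = cubic x u" "v \<noteq> 0" "u \<noteq> q x" for x u v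
 proof -
  have un: "Aff u v \<in> unram x" using uv(1,2) by (auto simp: Aff_in_unram)
  define g where "g = A1 x / A x"
  have A1: "A1 x = g * A x" using A(1)[OF x] by (simp add: g_def)
  have o1: "\<Omega>\<^sub>Q x (Aff u v) = (w x / (u - q x) + (w x / q x + x / 2 * K x - x / 2 * g * (c1 * A x + c2 * B x))) / v"
   unfolding g_def A1_def using third_kind_form[OF x01[OF x] cyc(1)[OF x] A(1)[OF x, unfolded A_def] assms(12,13)[OF x] path[OF x] last[OF x]
    int0[OF x] int1[OF x] uv] by (simp only: A_def)
  have o2: "\<omega> x (Aff u v) = 1 / A x / v" using A(2)[OF x un] by simp
  \<comment> \<open>The Legendre relation expresses \<open>4 pi i / A\<close> by periods. It turns
    the subtraction of the multiple of \<open>\<omega>\<close> into the reduction of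
    \<open>K\<close> by \<open>c2\<close> times the \<open>b\<close>-period, parallel to the
    reduction by \<open>c1\<close> times the \<open>a\<close>-period.\<close>
  have o3: "4 * of_real pi * \<i> * (1 / A x) = x / 2 * (B1 x - B x * g)"
  proof -
   have "A x * B1 x - B x * A1 x = 8 * pi * \<i> / x"
    unfolding A_def B_def A1_def B1_def
    by (rule legendre_relation[OF x01(1)[OF x] cyc[OF x] assms(5,6)[OF x]])
   then have "x / 2 * (A x * B1 x - B x * A1 x) = 4 * of_real pi * \<i>" using x01(1)[OF x] by simp
   then have "4 * of_real pi * \<i> * (1 / A x) = x / 2 * (A x * B1 x - B x * A1 x) * (1 / A x)" by simp
   also have "\<dots> = x / 2 * (B1 x - B x * g)" unfolding A1 using A(1)[OF x] by (simp add: field_simps)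
   finally show ?thesis .
  qed
  have aux: "k * c * (t / m) = c * (k * t) / m" for k c t m :: complex by (simp add: mult_ac)
  have "\<Omega> x (Aff u v) = (w x / (u - q x) + (w x / q x + x / 2 * K x - x / 2 * g * (c1 * A x + c2 * B x))) / v -
    c2 * (x / 2 * (B1 x - B x * g)) / v"
   unfolding assms(14)[OF x] o1 o2 aux[of "4 * of_real pi * \<i>" c2 "1 / A x" v] o3 ..
  also have "\<dots> = (w x / (u - q x) + (w x / q x + x / 2 * (K x - c1 * A1 x - c2 * B1 x))) / v"
   unfolding A1 diff_divide_distrib[symmetric] by (simp add: algebra_simps)
  also have "w x / q x + x / 2 * (K x - c1 * A1 x - c2 * B1 x) = w x * p x"
   unfolding p_def using nzw(1)[OF x] by (simp add: distrib_left)
  finally show ?thesis .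
 qed
 have zInfty: "Infty \<in> diff_zeros x (\<Omega> x) \<longleftrightarrow> p x = 0" if "x \<in> D" for x
  using diff_zeros_form(1)[OF x01[OF that] nzw(2,1)[OF that] form[OF that]] nzw(1)[OF that]
  by (simp add: diff_zeros_def curve_def)
 have zAff: "Aff u v \<in> diff_zeros x (\<Omega> x) \<longleftrightarrow> v\<^sup>2 = cubic x u \<and> p x \<noteq> 0 \<and> u = q x - 1 / p x" if "x \<in> D" for x u v
 proof -
  have "u \<noteq> q x \<and> w x / (u - q x) + w x * p x = 0 \<longleftrightarrow> p x \<noteq> 0 \<and> u = q x - 1 / p x"
  proof -
   have "w x / (u - q x) + w x * p x = w x * (1 / (u - q x) + p x)" by (simp add: distrib_left)
   then have "w x / (u - q x) + w x * p x = 0 \<longleftrightarrow> 1 / (u - q x) + p x = 0" using nzw(1)[OF that] by simp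
   moreover have "u \<noteq> q x \<and> 1 / (u - q x) + p x = 0 \<longleftrightarrow> p x \<noteq> 0 \<and> u = q x - 1 / p x"
   proof
    assume *: "u \<noteq> q x \<and> 1 / (u - q x) + p x = 0"
    then have p: "p x = - (1 / (u - q x))" by (metis add_eq_0_iff)
    show "p x \<noteq> 0 \<and> u = q x - 1 / p x" unfolding p using * by simp
   qed auto
   ultimately show ?thesis by simp
  qed
  then show ?thesis
   using diff_zeros_form(2)[OF x01[OF that] nzw(2,1)[OF that] form[OF that], of v u]
   by (auto simp: diff_zeros_def Aff_in_curve)
 qed
 have sys: "(q has_field_derivative q x * (q x - 1) * (1 - (q x - x) * p x) / (x * (x - 1))) (at x)"
  "(p has_field_derivative ((3 * (p x * q x - 1)\<^sup>2 - 2 * (x + 1) * (p x * (p x * q x - 1)) + x * (p x)\<^sup>2) / 2 +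
   p x * q x - 1 - x * p x) / (x * (x - 1))) (at x)" if "x \<in> D" for x
  using end_point_system[OF D(1) that D(2) ab path last int0[unfolded A_def B_def] int1]
  unfolding p_def[abs_def] A1_def B1_def by blast+
 show ?thesis
 proof (intro conjI ballI allI impI)
  fix x assume x: "x \<in> D"
  show "\<exists>P. diff_zeros x (\<Omega> x) = {P, star P} \<and> u_proj P = u_proj (star P)"
  proof (cases "p x = 0")
   case True
   have "diff_zeros x (\<Omega> x) = {Infty, star Infty}"
   proof (rule set_eqI)
    fix P show "P \<in> diff_zeros x (\<Omega> x) \<longleftrightarrow> P \<in> {Infty, star Infty}"
     using zInfty[OF x] zAff[OF x] True by (cases P) simp_all
   qed
   then show ?thesis by (intro exI[of _ Infty]) simp
  next
   case False
   define u where "u = q x - 1 / p x"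
   \<comment> \<open>Either root will do. If the zeros lie at a finite ramification point then
     \<open>v = 0\<close> and the two points coincide.\<close>
   define v where "v = csqrt (cubic x u)"
   have v2: "v\<^sup>2 = cubic x u" by (simp add: v_def)
   have "diff_zeros x (\<Omega> x) = {Aff u v, star (Aff u v)}"
   proof (rule set_eqI)
    fix P show "P \<in> diff_zeros x (\<Omega> x) \<longleftrightarrow> P \<in> {Aff u v, star (Aff u v)}"
     using zInfty[OF x] zAff[OF x] False v2 by (cases P) (auto simp: u_def[symmetric] power2_eq_iff v2[symmetric])
   qed
   then show ?thesis by (intro exI[of _ "Aff u v"]) simp
  qed
 next
  fix y x assume y: "\<forall>x\<in>D. \<forall>P\<in>diff_zeros x (\<Omega> x). P \<noteq> Infty \<longrightarrow> y x = u_of P"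
   and x: "x \<in> D" and nx: "Infty \<notin> diff_zeros x (\<Omega> x) \<and> y x \<notin> {0, 1, x}"
  \<comment> \<open>The set where the zeros are finite. It is open because \<open>p\<close> is
    continuous, and on it \<open>y\<close> is given by a formula in \<open>q\<close> and
    \<open>p\<close>; second derivatives at \<open>x\<close> involve a whole neighbourhood.\<close>
  define U where "U = {z \<in> D. p z \<noteq> 0}"
  have "continuous_on D p" by (rule continuous_at_imp_continuous_on) (blast intro: DERIV_isCont sys(2))
  then have "open (D \<inter> p -` (- {0}))" by (rule continuous_open_preimage[OF _ D(1)]) (rule open_Compl, simp)
  moreover have "D \<inter> p -` (- {0}) = U" by (auto simp: U_def)
  ultimately have U: "open U" by simp
  have xU: "x \<in> U" using nx zInfty[OF x] x by (simp add: U_def)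
  have yU: "y z = q z - 1 / p z" if "z \<in> U" for z
  proof -
   have z: "z \<in> D" "p z \<noteq> 0" using that by (auto simp: U_def)
   have "Aff (q z - 1 / p z) (csqrt (cubic z (q z - 1 / p z))) \<in> diff_zeros z (\<Omega> z)"
    using zAff[OF z(1)] z(2) by simp
   with y z(1) show ?thesis by fastforce
  qed
  have M: "z * (z - 1) \<noteq> 0" "z \<in> D" "p z \<noteq> 0" if "z \<in> U" for z using that x01 by (auto simp: U_def)
  have dy: "(y has_field_derivative ((2 * z * y z - z - (y z)\<^sup>2) / 2 - y z * (y z - 1) * (y z - z) * p z) / (z * (z - 1))) (at z)"
   if z: "z \<in> U" for z
  proof -
   define q' where "q' = q z * (q z - 1) * (1 - (q z - z) * p z) / (z * (z - 1))"
   define p' where "p' = ((3 * (p z * q z - 1)\<^sup>2 - 2 * (z + 1) * (p z * (p z * q z - 1)) + z * (p z)\<^sup>2) / 2 + p z * q z - 1 - z * p z) / (z * (z - 1))"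
   have "((\<lambda>z. q z - 1 / p z) has_field_derivative q' - (0 * p z - 1 * p') / (p z * p z)) (at z)"
    unfolding q'_def p'_def by (intro DERIV_diff DERIV_divide DERIV_const sys M(2,3) z)
   then have "(y has_field_derivative q' - (0 * p z - 1 * p') / (p z * p z)) (at z)"
    by (rule has_field_derivative_transform_within_open[OF _ U z]) (simp add: yU)
   moreover have "q' - (0 * p z - 1 * p') / (p z * p z) = q' + p' / (p z)\<^sup>2" by (simp add: power2_eq_square)
   ultimately have "(y has_field_derivative q' + p' / (p z)\<^sup>2) (at z)" by (simp only:)
   then show ?thesis unfolding zero_system(2)[OF M(3)[OF z] yU[OF z] M(1)[OF z] q'_def p'_def, symmetric] .
  qed
  have dp: "(p has_field_derivative ((p x)\<^sup>2 * (3 * (y x)\<^sup>2 - 2 * x * y x - 2 * y x + x) / 2 + p x * (y x - x)) / (x * (x - 1))) (at x)"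
   using sys(2)[OF x] unfolding zero_system(1)[OF M(3)[OF xU] yU[OF xU] M(1)[OF xU] refl refl] .
  show "painleve_VI_at (1 / 8) (- 1 / 8) (1 / 8) (3 / 8) y x"
   by (rule painleve_VI_of_system[OF U xU x01[OF x] dy dp]) (use nx in auto)
  have "y holomorphic_on U" unfolding holomorphic_on_open[OF U] using dy by blast
  then have "y analytic_on U" using analytic_on_open[OF U] by simp
  then show "y analytic_on {x}" by (rule analytic_on_subset) (use xU in simp)
 qed
qed

end
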